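(* Let $X$ be a smooth proper complex curve, $D$ a finite set of points of $X$ such that $U=X\setminus D$ is hyperbolic, and let $ds^2$ be a good conformal metric on $X$ (relative to $D$). Set $\mathcal L=T_X(-D)$ and $\bar{\mathcal L}=(\mathcal L,ds^2)$, let $\log\|\langle\bar{\mathcal L},\bar{\mathcal L}\rangle\|$ be the integral of the $2$-form determined by the cup square $[\bar{\mathcal L}]\,\hat\cup\,[\bar{\mathcal L}]$ in Hermitian-holomorphic Deligne cohomology (defined in the context), and put $$S(ds^2)=\log\|\langle\bar{\mathcal L},\bar{\mathcal L}\rangle\|+\frac1{2\pi}A_\rho(X),$$ where $A_\rho(X)$ is the area of $ds^2$. Then $ds^2$ satisfies $$c_1(\rho)=\sqrt{-1}\,\omega_\rho$$ (that is, $ds^2=ds^2_{\mathsf{hyp}}$ is the hyperbolic metric of constant curvature $-1$) if and only if $$\frac{d}{dt}\Big|_{t=0}S(e^{t\sigma}ds^2)=0$$ for every smooth function $\sigma\colon X\to\mathbb R$.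
   Context: Notation. $d=\partial+\bar\partial$, $d^c=\partial-\bar\partial$; $\mathbb Z(k)=(2\pi\sqrt{-1})^k\mathbb Z$; $\pi_1(z)=\frac12(z-\bar z)$. Good conformal metrics. A good conformal metric on $X$ is a conformal metric $ds^2=\rho|dz|^2$ on $U$ ($\rho$ smooth and positive), such that near each $p\in D$, in a coordinate $z$ with $z(p)=0$, $$\log\rho(z)=-\log(|z|^2\log^2|z|)+\alpha(z),\qquad |\partial\alpha|^2\le C\,\frac{|dz|^2}{|z|^2\log^4|z|},$$ with $\alpha$ continuous near $p$ and smooth on the punctured disk, and such that the metric is good in Mumford's sense as a metric on $\mathcal L=T_X(-D)$: writing $\|s\|^2=ds^2(s,s)$ for the local frame $s=z\,\partial/\partial z$, the forms $\partial\log\|s\|$ and $\bar\partial\partial\log\|s\|$, together with their exterior differentials, have Poincaré growth (norm bounded with respect to $|dz|^2/(|z|\log|z|)^2$). $\omega_\rho=\frac{\sqrt{-1}}2\rho\,dz\wedge d\bar z$ is the Kähler form, $A_\rho(X)=\int_X\omega_\rho$, and $c_1(\rho)=\bar\partial\partial\log\rho$. The equation $c_1(\rho)=\sqrt{-1}\,\omega_\rho$ is in coordinates the Liouville equation $\partial^2\log\rho/\partial z\,\partial\bar z=\frac12\rho$. The term $\log\|\langle\bar{\mathcal L},\bar{\mathcal L}\rangle\|$. Take a finite cover $\{V_i\}$ of $X$ by coordinate disks, with all nonempty finite intersections contractible, such that each $V_i$ contains at most one point of $D$ and each point of $D$ lies in exactly one $V_i$. On $V_i$ with coordinate $z_i$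 use the frame $s_i=z_i\,\partial/\partial z_i$ of $\mathcal L$ if $V_i$ contains a point of $D$ (at which $z_i=0$), and $s_i=\partial/\partial z_i$ otherwise; let $s_j=s_ig_{ij}$, choose logarithms $\log g_{ij}$ on $V_i\cap V_j$, and let $2\pi\sqrt{-1}\,c_{ijk}=\log g_{jk}-\log g_{ik}+\log g_{ij}$, $\tilde\rho_i=\|s_i\|^2$. The cup square is represented by $$\omega^0_i=\tfrac12\log\tilde\rho_i\;\bar\partial\partial\log\tilde\rho_i,\qquad \omega^1_{ij}=-\log|g_{ij}|\,\tfrac12d^c\log\tilde\rho_j+d^c\log|g_{ij}|\,\tfrac12\log\tilde\rho_j,$$ $$\omega^2_{ijk}=-\pi_1(L_{ijk})-\pi_1(\log g_{ij})\log|g_{jk}|,$$ where $L_{ijk}$ are holomorphic functions on $V_i\cap V_j\cap V_k$, chosen once and for all independently of the metric, with $dL_{ijk}=-\log g_{ij}\,d\log g_{jk}$ and with Čech coboundary $(\delta L)_{ijkl}\in-2\pi\sqrt{-1}\,c_{ijk}\log g_{kl}+\mathbb Z(2)$ (such $L$ exist; a different choice changes $S$ by an additive constant independent of $ds^2$). These satisfy $d\omega^1_{ij}=-(\omega^0_j-\omega^0_i)$, $d\omega^2=\delta\omega^1$, $\delta\omega^2=0$. Choosing smooth imaginary functions $h_{ij}$ with $\delta h=\omega^2$ and smooth imaginary $1$-forms $\eta_i$ on $V_i$ with $\eta_j-\eta_i=\omega^1_{ij}-dh_{ij}$, one obtains a global $2$-form $\omega$ on $U$ with $\omega|_{V_i}=\omega^0_i+d\eta_i$,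 representing the class, and $$\log\|\langle\bar{\mathcal L},\bar{\mathcal L}\rangle\|=\frac{\sqrt{-1}}{2\pi}\lim_{\varepsilon\to0}\int_{X_\varepsilon}\omega,$$ with $X_\varepsilon$ the complement of the disks of radius $\varepsilon$ around the points of $D$; this does not depend on the choice of $h$ and $\eta$. *)

theory Defs
  imports "HOL-Complex_Analysis.Complex_Analysis"
begin

section \<open>Riemann surfaces\<close>

text \<open>A coordinate is a pair of its domain and its coordinate function; only the values of the
  function on the domain matter. A Riemann surface is a Hausdorff type with a holomorphic atlas.\<close>

type_synonym 'a coord = "'a set \<times> ('a \<Rightarrow> complex)"

definition chart_inv :: "'a coord \<Rightarrow> complex \<Rightarrow> 'a" where
  "chart_inv \<phi> = inv_into (fst \<phi>) (snd \<phi>)"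

definition complex_chart :: "('a::topological_space) coord \<Rightarrow> bool" where
  "complex_chart \<phi> \<longleftrightarrow> open (fst \<phi>) \<and> open (snd \<phi> ` fst \<phi>) \<and>
     homeomorphism (fst \<phi>) (snd \<phi> ` fst \<phi>) (snd \<phi>) (chart_inv \<phi>)"

definition compatible :: "('a::topological_space) coord \<Rightarrow> 'a coord \<Rightarrow> bool" where
  "compatible \<phi> \<psi> \<longleftrightarrow>
     (snd \<psi> \<circ> chart_inv \<phi>) holomorphic_on (snd \<phi> ` (fst \<phi> \<inter> fst \<psi>)) \<and>
     (snd \<phi> \<circ> chart_inv \<psi>) holomorphic_on (snd \<psi> ` (fst \<phi> \<inter> fst \<psi>))"

definition holomorphic_atlas :: "('a::topological_space) coord set \<Rightarrow> bool" where
  "holomorphic_atlas \<A> \<longleftrightarrow> (\<forall>\<phi>\<in>\<A>. complex_chart \<phi>) \<and> (\<forall>\<phi>\<in>\<A>. \<forall>\<psi>\<in>\<A>. compatible \<phi> \<psi>) \<and>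
     (\<Union>\<phi>\<in>\<A>. fst \<phi>) = UNIV"

text \<open>Smooth proper complex curves are rendered analytically, as compact connected Riemann surfaces.\<close>

definition compact_riemann_surface :: "('a::t2_space) coord set \<Rightarrow> bool" where
  "compact_riemann_surface \<A> \<longleftrightarrow>
     holomorphic_atlas \<A> \<and> compact (UNIV :: 'a set) \<and> connected (UNIV :: 'a set)"

text \<open>The maximal atlas: all holomorphic coordinates of the surface.\<close>

definition coords :: "('a::topological_space) coord set \<Rightarrow> 'a coord set" where
  "coords \<A> = {\<phi>. complex_chart \<phi> \<and> (\<forall>\<psi>\<in>\<A>. compatible \<phi> \<psi>)}"

definition in_coord :: "'a coord \<Rightarrow> ('a \<Rightarrow> 'b) \<Rightarrow> complex \<Rightarrow> 'b" where
  "in_coord \<phi> f = f \<circ> chart_inv \<phi>"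

text \<open>\<open>jac \<phi> \<psi> x\<close> is $d\varphi/d\psi$ at $x$.\<close>

definition jac :: "'a coord \<Rightarrow> 'a coord \<Rightarrow> 'a \<Rightarrow> complex" where
  "jac \<phi> \<psi> x = deriv (in_coord \<psi> (snd \<phi>)) (snd \<psi> x)"

text \<open>$U$ is hyperbolic if its universal cover is the disk, that is, if $U$ has a holomorphic
  covering by the unit disk (which is simply connected).\<close>

definition hyperbolic_surface :: "('a::topological_space) coord set \<Rightarrow> 'a set \<Rightarrow> bool" where
  "hyperbolic_surface \<A> U \<longleftrightarrow>
     (\<exists>\<pi>. covering_space (ball (0::complex) 1) \<pi> U \<and>
          (\<forall>\<phi>\<in>coords \<A>. (snd \<phi> \<circ> \<pi>) holomorphic_on (ball 0 1 \<inter> \<pi> -` fst \<phi>)))"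


section \<open>Smooth functions and differential forms\<close>

text \<open>\<open>cont_diff_on k S f\<close> says that $f$ is of class $C^k$ on the open set $S$.\<close>

primrec cont_diff_on :: "nat \<Rightarrow> complex set \<Rightarrow> (complex \<Rightarrow> 'b::real_normed_vector) \<Rightarrow> bool" where
  "cont_diff_on 0 S f \<longleftrightarrow> continuous_on S f"
| "cont_diff_on (Suc k) S f \<longleftrightarrow> (\<forall>p\<in>S. f differentiable (at p)) \<and>
     (\<forall>v. cont_diff_on k S (\<lambda>p. frechet_derivative f (at p) v))"

definition smooth_fun ::
    "('a::topological_space) coord set \<Rightarrow> 'a set \<Rightarrow> ('a \<Rightarrow> 'b::real_normed_vector) \<Rightarrow> bool" where
  "smooth_fun \<A> W f \<longleftrightarrow>
     (\<forall>\<phi>\<in>coords \<A>. \<forall>k. cont_diff_on k (snd \<phi> ` (fst \<phi> \<inter> W)) (in_coord \<phi> f))"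

definition holo_fun :: "('a::topological_space) coord set \<Rightarrow> 'a set \<Rightarrow> ('a \<Rightarrow> complex) \<Rightarrow> bool" where
  "holo_fun \<A> W f \<longleftrightarrow>
     (\<forall>\<phi>\<in>coords \<A>. in_coord \<phi> f holomorphic_on (snd \<phi> ` (fst \<phi> \<inter> W)))"

text \<open>Wirtinger derivatives $\partial f/\partial z$ and $\partial f/\partial\bar z$ in a coordinate.\<close>

definition pd_z :: "'a coord \<Rightarrow> ('a \<Rightarrow> complex) \<Rightarrow> 'a \<Rightarrow> complex" where
  "pd_z \<phi> f x = (let D = frechet_derivative (in_coord \<phi> f) (at (snd \<phi> x))
                 in (D 1 - \<i> * D \<i>) / 2)"

definition pd_zbar :: "'a coord \<Rightarrow> ('a \<Rightarrow> complex) \<Rightarrow> 'a \<Rightarrow> complex" where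
  "pd_zbar \<phi> f x = (let D = frechet_derivative (in_coord \<phi> f) (at (snd \<phi> x))
                    in (D 1 + \<i> * D \<i>) / 2)"

text \<open>A form assigns coefficients to every coordinate: a 1-form $a\,dz+b\,d\bar z$ the pair
  $(a,b)$, a 2-form $f\,dz\wedge d\bar z$ the function $f$. The coefficients are functions of points
  of the surface.\<close>

type_synonym 'a form1 = "'a coord \<Rightarrow> 'a \<Rightarrow> complex \<times> complex"
type_synonym 'a form2 = "'a coord \<Rightarrow> 'a \<Rightarrow> complex"

definition smooth_form1 :: "('a::topological_space) coord set \<Rightarrow> 'a set \<Rightarrow> 'a form1 \<Rightarrow> bool" where
  "smooth_form1 \<A> W \<eta> \<longleftrightarrow>
     (\<forall>\<phi>\<in>coords \<A>. \<forall>\<psi>\<in>coords \<A>. \<forall>x\<in>fst \<phi> \<inter> fst \<psi> \<inter> W.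
        \<eta> \<psi> x = (fst (\<eta> \<phi> x) * jac \<phi> \<psi> x, snd (\<eta> \<phi> x) * cnj (jac \<phi> \<psi> x))) \<and>
     (\<forall>\<phi>\<in>coords \<A>. smooth_fun \<A> (fst \<phi> \<inter> W) (\<eta> \<phi>))"

definition smooth_form2 :: "('a::topological_space) coord set \<Rightarrow> 'a set \<Rightarrow> 'a form2 \<Rightarrow> bool" where
  "smooth_form2 \<A> W \<omega> \<longleftrightarrow>
     (\<forall>\<phi>\<in>coords \<A>. \<forall>\<psi>\<in>coords \<A>. \<forall>x\<in>fst \<phi> \<inter> fst \<psi> \<inter> W.
        \<omega> \<psi> x = \<omega> \<phi> x * of_real ((cmod (jac \<phi> \<psi> x))\<^sup>2)) \<and>
     (\<forall>\<phi>\<in>coords \<A>. smooth_fun \<A> (fst \<phi> \<inter> W) (\<omega> \<phi>))"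

text \<open>$\overline{a\,dz+b\,d\bar z}=\bar b\,dz+\bar a\,d\bar z$, so the form is imaginary
  if and only if $a=-\bar b$.\<close>

definition imaginary_form1 :: "('a::topological_space) coord set \<Rightarrow> 'a set \<Rightarrow> 'a form1 \<Rightarrow> bool" where
  "imaginary_form1 \<A> W \<eta> \<longleftrightarrow>
     (\<forall>\<phi>\<in>coords \<A>. \<forall>x\<in>fst \<phi> \<inter> W. fst (\<eta> \<phi> x) = - cnj (snd (\<eta> \<phi> x)))"

definition csmul :: "complex \<Rightarrow> complex \<times> complex \<Rightarrow> complex \<times> complex" where
  "csmul c v = (c * fst v, c * snd v)"

text \<open>The operators $\partial$, $d=\partial+\bar\partial$ and $d^c=\partial-\bar\partial$ on functions,
  $d$ on 1-forms and $\bar\partial\partial$ on functions. Since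
  $d\bar z\wedge dz=-dz\wedge d\bar z$,
  $\bar\partial\partial f=-f_{z\bar z}\,dz\wedge d\bar z$.\<close>

definition del :: "('a \<Rightarrow> complex) \<Rightarrow> 'a form1" where
  "del f \<phi> x = (pd_z \<phi> f x, 0)"

definition d0 :: "('a \<Rightarrow> complex) \<Rightarrow> 'a form1" where
  "d0 f \<phi> x = (pd_z \<phi> f x, pd_zbar \<phi> f x)"

definition dc :: "('a \<Rightarrow> complex) \<Rightarrow> 'a form1" where
  "dc f \<phi> x = (pd_z \<phi> f x, - pd_zbar \<phi> f x)"

definition d1 :: "'a form1 \<Rightarrow> 'a form2" where
  "d1 \<eta> \<phi> x = pd_z \<phi> (\<lambda>y. snd (\<eta> \<phi> y)) x - pd_zbar \<phi> (\<lambda>y. fst (\<eta> \<phi> y)) x"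

definition dbar_del :: "('a \<Rightarrow> complex) \<Rightarrow> 'a form2" where
  "dbar_del f \<phi> x = - pd_zbar \<phi> (pd_z \<phi> f) x"


section \<open>Good conformal metrics\<close>

text \<open>A conformal metric $\rho|dz|^2$ is given by its density $\rho$ in every coordinate.\<close>

type_synonym 'a conf_metric = "'a coord \<Rightarrow> 'a \<Rightarrow> real"

definition conformal_metric ::
    "('a::topological_space) coord set \<Rightarrow> 'a set \<Rightarrow> 'a conf_metric \<Rightarrow> bool" where
  "conformal_metric \<A> U \<rho> \<longleftrightarrow>
     (\<forall>\<phi>\<in>coords \<A>. \<forall>x\<in>fst \<phi> \<inter> U. \<rho> \<phi> x > 0) \<and>
     (\<forall>\<phi>\<in>coords \<A>. \<forall>\<psi>\<in>coords \<A>. \<forall>x\<in>fst \<phi> \<inter> fst \<psi> \<inter> U.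
        \<rho> \<psi> x = \<rho> \<phi> x * (cmod (jac \<phi> \<psi> x))\<^sup>2) \<and>
     (\<forall>\<phi>\<in>coords \<A>. smooth_fun \<A> (fst \<phi> \<inter> U) (\<rho> \<phi>))"

text \<open>\<open>norm_sq \<rho> \<phi> e\<close> is $\|s\|^2=ds^2(s,s)$ for the vector field $s=e\,\partial/\partial z$, where $z$ is
  the coordinate \<open>\<phi>\<close>.\<close>

definition norm_sq :: "'a conf_metric \<Rightarrow> 'a coord \<Rightarrow> ('a \<Rightarrow> complex) \<Rightarrow> 'a \<Rightarrow> real" where
  "norm_sq \<rho> \<phi> e x = \<rho> \<phi> x * (cmod (e x))\<^sup>2"

definition poincare_growth1 :: "'a coord \<Rightarrow> 'a set \<Rightarrow> 'a form1 \<Rightarrow> bool" where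
  "poincare_growth1 \<phi> W \<eta> \<longleftrightarrow> (\<exists>C. \<forall>x\<in>W.
     cmod (fst (\<eta> \<phi> x)) \<le> C / (cmod (snd \<phi> x) * \<bar>ln (cmod (snd \<phi> x))\<bar>) \<and>
     cmod (snd (\<eta> \<phi> x)) \<le> C / (cmod (snd \<phi> x) * \<bar>ln (cmod (snd \<phi> x))\<bar>))"

definition poincare_growth2 :: "'a coord \<Rightarrow> 'a set \<Rightarrow> 'a form2 \<Rightarrow> bool" where
  "poincare_growth2 \<phi> W \<omega> \<longleftrightarrow> (\<exists>C. \<forall>x\<in>W.
     cmod (\<omega> \<phi> x) \<le> C / ((cmod (snd \<phi> x))\<^sup>2 * (ln (cmod (snd \<phi> x)))\<^sup>2))"

text \<open>The exterior differential of the 2-form $\bar\partial\partial\log\|s\|$ vanishes for dimension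
  reasons and carries no condition.\<close>

definition good_conformal_metric ::
    "('a::topological_space) coord set \<Rightarrow> 'a set \<Rightarrow> 'a conf_metric \<Rightarrow> bool" where
  "good_conformal_metric \<A> D \<rho> \<longleftrightarrow> conformal_metric \<A> (UNIV - D) \<rho> \<and>
     (\<forall>p\<in>D. \<exists>\<phi>\<in>coords \<A>. \<exists>r \<alpha> C. p \<in> fst \<phi> \<and> snd \<phi> p = 0 \<and> fst \<phi> \<inter> D = {p} \<and>
        0 < r \<and> r < 1 \<and> ball 0 r \<subseteq> snd \<phi> ` fst \<phi> \<and>
        (let N = {x \<in> fst \<phi>. cmod (snd \<phi> x) < r}; z = snd \<phi>;
             lognorm = (\<lambda>x. complex_of_real (ln (sqrt (norm_sq \<rho> \<phi> z x))))
         in continuous_on N \<alpha> \<and> smooth_fun \<A> (N - {p}) \<alpha> \<and>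
            (\<forall>x\<in>N - {p}.
               ln (\<rho> \<phi> x) = - ln ((cmod (z x))\<^sup>2 * (ln (cmod (z x)))\<^sup>2) + \<alpha> x) \<and>
            (\<forall>x\<in>N - {p}.
               (cmod (pd_z \<phi> (complex_of_real \<circ> \<alpha>) x))\<^sup>2
                 \<le> C / ((cmod (z x))\<^sup>2 * (ln (cmod (z x))) ^ 4)) \<and>
            poincare_growth1 \<phi> (N - {p}) (del lognorm) \<and>
            poincare_growth2 \<phi> (N - {p}) (d1 (del lognorm)) \<and>
            poincare_growth2 \<phi> (N - {p}) (dbar_del lognorm)))"

definition conf_change :: "('a \<Rightarrow> real) \<Rightarrow> 'a conf_metric \<Rightarrow> 'a conf_metric" where
  "conf_change \<sigma> \<rho> \<phi> x = exp (\<sigma> x) * \<rho> \<phi> x"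

definition kahler_form :: "'a conf_metric \<Rightarrow> 'a form2" where
  "kahler_form \<rho> \<phi> x = \<i> / 2 * of_real (\<rho> \<phi> x)"

definition c1_form :: "'a conf_metric \<Rightarrow> 'a form2" where
  "c1_form \<rho> \<phi> = dbar_del (\<lambda>y. complex_of_real (ln (\<rho> \<phi> y))) \<phi>"


section \<open>The cup square\<close>

text \<open>The choices entering the construction: a finite cover $V_0,\dots,V_{n-1}$ with coordinates
  $z_i$, the transition functions $g_{ij}$ of $T_X(-D)$, their logarithms $\log g_{ij}$, and the
  functions $L_{ijk}$. Cech cochains are indexed by all tuples of indices, repetitions included.\<close>

record 'a cech_choice =
  cover_size :: nat
  chart :: "nat \<Rightarrow> 'a coord"
  transition :: "nat \<Rightarrow> nat \<Rightarrow> 'a \<Rightarrow> complex"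
  log_transition :: "nat \<Rightarrow> nat \<Rightarrow> 'a \<Rightarrow> complex"
  Lfun :: "nat \<Rightarrow> nat \<Rightarrow> nat \<Rightarrow> 'a \<Rightarrow> complex"

definition cover_dom :: "'a cech_choice \<Rightarrow> nat \<Rightarrow> 'a set" where
  "cover_dom K i = fst (chart K i)"

definition coordinate :: "'a cech_choice \<Rightarrow> nat \<Rightarrow> 'a \<Rightarrow> complex" where
  "coordinate K i = snd (chart K i)"

text \<open>The frame $s_i$ of $T_X(-D)$ is \<open>frame_coeff D K i\<close> times $\partial/\partial z_i$.\<close>

definition frame_coeff :: "'a set \<Rightarrow> 'a cech_choice \<Rightarrow> nat \<Rightarrow> 'a \<Rightarrow> complex" where
  "frame_coeff D K i x = (if cover_dom K i \<inter> D \<noteq> {} then coordinate K i x else 1)"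

definition good_cover :: "('a::topological_space) coord set \<Rightarrow> 'a set \<Rightarrow> 'a cech_choice \<Rightarrow> bool" where
  "good_cover \<A> D K \<longleftrightarrow>
     (\<forall>i<cover_size K. chart K i \<in> coords \<A> \<and>
        (\<exists>c r. r > 0 \<and> coordinate K i ` cover_dom K i = ball c r)) \<and>
     (\<Union>i<cover_size K. cover_dom K i) = UNIV \<and>
     (\<forall>J\<subseteq>{..<cover_size K}. J \<noteq> {} \<and> (\<Inter>i\<in>J. cover_dom K i) \<noteq> {} \<longrightarrow> contractible (\<Inter>i\<in>J. cover_dom K i)) \<and>
     (\<forall>i<cover_size K. \<forall>p\<in>cover_dom K i \<inter> D. \<forall>q\<in>cover_dom K i \<inter> D. p = q) \<and>
     (\<forall>p\<in>D. \<exists>!i. i < cover_size K \<and> p \<in> cover_dom K i) \<and>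
     (\<forall>i<cover_size K. \<forall>p\<in>cover_dom K i \<inter> D. coordinate K i p = 0)"

text \<open>The relation $s_j=s_ig_{ij}$ in coordinates, using
  $\partial/\partial z_j=(dz_i/dz_j)\,\partial/\partial z_i$. The quotient is not used to define
  $g_{ij}$ because for $i=j$ the frame coefficient vanishes at a point of $D$ in $V_i$; there
  $g_{ii}=1$ follows from holomorphy.\<close>

definition transition_data ::
    "('a::topological_space) coord set \<Rightarrow> 'a set \<Rightarrow> 'a cech_choice \<Rightarrow> bool" where
  "transition_data \<A> D K \<longleftrightarrow>
     (\<forall>i<cover_size K. \<forall>j<cover_size K.
        holo_fun \<A> (cover_dom K i \<inter> cover_dom K j) (transition K i j) \<and>
        holo_fun \<A> (cover_dom K i \<inter> cover_dom K j) (log_transition K i j) \<and>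
        (\<forall>x\<in>cover_dom K i \<inter> cover_dom K j.
           frame_coeff D K j x * jac (chart K i) (chart K j) x
             = frame_coeff D K i x * transition K i j x \<and>
           exp (log_transition K i j x) = transition K i j x))"

definition cech_c :: "'a cech_choice \<Rightarrow> nat \<Rightarrow> nat \<Rightarrow> nat \<Rightarrow> 'a \<Rightarrow> complex" where
  "cech_c K i j k x =
     (log_transition K j k x - log_transition K i k x + log_transition K i j x) / (2 * pi * \<i>)"

definition Zgrp :: "nat \<Rightarrow> complex set" where
  "Zgrp k = range (\<lambda>m::int. (2 * pi * \<i>) ^ k * of_int m)"

definition L_data :: "('a::topological_space) coord set \<Rightarrow> 'a cech_choice \<Rightarrow> bool" where
  "L_data \<A> K \<longleftrightarrow>
     (\<forall>i<cover_size K. \<forall>j<cover_size K. \<forall>k<cover_size K.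
        let W = cover_dom K i \<inter> cover_dom K j \<inter> cover_dom K k in
        holo_fun \<A> W (Lfun K i j k) \<and>
        (\<forall>\<phi>\<in>coords \<A>. \<forall>x\<in>fst \<phi> \<inter> W.
           d0 (Lfun K i j k) \<phi> x = csmul (- log_transition K i j x) (d0 (log_transition K j k) \<phi> x))) \<and>
     (\<forall>i<cover_size K. \<forall>j<cover_size K. \<forall>k<cover_size K. \<forall>l<cover_size K.
        \<forall>x\<in>cover_dom K i \<inter> cover_dom K j \<inter> cover_dom K k \<inter> cover_dom K l.
           (Lfun K j k l x - Lfun K i k l x + Lfun K i j l x - Lfun K i j k x)
             - (- (2 * pi * \<i>) * cech_c K i j k x * log_transition K k l x) \<in> Zgrp 2)"

definition cup_square_choice ::
    "('a::topological_space) coord set \<Rightarrow> 'a set \<Rightarrow> 'a cech_choice \<Rightarrow> bool" where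
  "cup_square_choice \<A> D K \<longleftrightarrow> good_cover \<A> D K \<and> transition_data \<A> D K \<and> L_data \<A> K"

definition pi1 :: "complex \<Rightarrow> complex" where
  "pi1 z = (z - cnj z) / 2"

definition log_frame :: "'a set \<Rightarrow> 'a cech_choice \<Rightarrow> 'a conf_metric \<Rightarrow> nat \<Rightarrow> 'a \<Rightarrow> real" where
  "log_frame D K \<rho> i x = ln (norm_sq \<rho> (chart K i) (frame_coeff D K i) x)"

definition log_abs_g :: "'a cech_choice \<Rightarrow> nat \<Rightarrow> nat \<Rightarrow> 'a \<Rightarrow> real" where
  "log_abs_g K i j x = ln (cmod (transition K i j x))"

definition omega0 :: "'a set \<Rightarrow> 'a cech_choice \<Rightarrow> 'a conf_metric \<Rightarrow> nat \<Rightarrow> 'a form2" where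
  "omega0 D K \<rho> i \<phi> x =
     of_real (log_frame D K \<rho> i x / 2) * dbar_del (complex_of_real \<circ> log_frame D K \<rho> i) \<phi> x"

definition omega1 :: "'a set \<Rightarrow> 'a cech_choice \<Rightarrow> 'a conf_metric \<Rightarrow> nat \<Rightarrow> nat \<Rightarrow> 'a form1" where
  "omega1 D K \<rho> i j \<phi> x =
     (- log_abs_g K i j x) *\<^sub>R ((1/2) *\<^sub>R dc (complex_of_real \<circ> log_frame D K \<rho> j) \<phi> x)
     + (log_frame D K \<rho> j x / 2) *\<^sub>R dc (complex_of_real \<circ> log_abs_g K i j) \<phi> x"

definition omega2 :: "'a cech_choice \<Rightarrow> nat \<Rightarrow> nat \<Rightarrow> nat \<Rightarrow> 'a \<Rightarrow> complex" where
  "omega2 K i j k x =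
     - pi1 (Lfun K i j k x) - pi1 (log_transition K i j x) * of_real (log_abs_g K j k x)"

text \<open>\<open>descent\<close> relates the metric to the auxiliary cochains $h$, $\eta$ and the resulting global
  2-form $\omega$ on $U$.\<close>

definition descent ::
    "('a::topological_space) coord set \<Rightarrow> 'a set \<Rightarrow> 'a cech_choice \<Rightarrow> 'a conf_metric \<Rightarrow>
     (nat \<Rightarrow> nat \<Rightarrow> 'a \<Rightarrow> complex) \<Rightarrow> (nat \<Rightarrow> 'a form1) \<Rightarrow> 'a form2 \<Rightarrow> bool" where
  "descent \<A> D K \<rho> h \<eta> \<omega> \<longleftrightarrow>
     (\<forall>i<cover_size K. \<forall>j<cover_size K.
        smooth_fun \<A> (cover_dom K i \<inter> cover_dom K j) (h i j) \<and>
        (\<forall>x\<in>cover_dom K i \<inter> cover_dom K j. Re (h i j x) = 0)) \<and>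
     (\<forall>i<cover_size K. \<forall>j<cover_size K. \<forall>k<cover_size K. \<forall>x\<in>cover_dom K i \<inter> cover_dom K j \<inter> cover_dom K k.
        h j k x - h i k x + h i j x = omega2 K i j k x) \<and>
     (\<forall>i<cover_size K. smooth_form1 \<A> (cover_dom K i) (\<eta> i) \<and> imaginary_form1 \<A> (cover_dom K i) (\<eta> i)) \<and>
     (\<forall>i<cover_size K. \<forall>j<cover_size K. \<forall>\<phi>\<in>coords \<A>. \<forall>x\<in>fst \<phi> \<inter> cover_dom K i \<inter> cover_dom K j.
        \<eta> j \<phi> x - \<eta> i \<phi> x = omega1 D K \<rho> i j \<phi> x - d0 (h i j) \<phi> x) \<and>
     smooth_form2 \<A> (UNIV - D) \<omega> \<and>
     (\<forall>i<cover_size K. \<forall>\<phi>\<in>coords \<A>. \<forall>x\<in>fst \<phi> \<inter> cover_dom K i - D.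
        \<omega> \<phi> x = omega0 D K \<rho> i \<phi> x + d1 (\<eta> i) \<phi> x)"

text \<open>The integral of a 2-form over a Borel set $A$: cut $A$ into the pieces
  $A\cap(V_i\setminus\bigcup_{j<i}V_j)$ and integrate each one in the coordinate $z_i$, where
  $dz\wedge d\bar z=-2\sqrt{-1}\,dx\,dy$. By change of variables the value does not depend on the
  cover or on the order of its members.\<close>

definition integral_form2 :: "'a cech_choice \<Rightarrow> 'a form2 \<Rightarrow> 'a set \<Rightarrow> complex" where
  "integral_form2 K \<omega> A =
     (\<Sum>i<cover_size K. - 2 * \<i> *
        set_lebesgue_integral lborel
          (coordinate K i ` (A \<inter> (cover_dom K i - (\<Union>j<i. cover_dom K j))))
          (in_coord (chart K i) (\<omega> (chart K i))))"

definition X_eps :: "'a set \<Rightarrow> 'a cech_choice \<Rightarrow> real \<Rightarrow> 'a set" where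
  "X_eps D K \<epsilon> = UNIV - {x. \<exists>i<cover_size K. cover_dom K i \<inter> D \<noteq> {} \<and> x \<in> cover_dom K i \<and>
                                  cmod (coordinate K i x) < \<epsilon>}"

text \<open>$\log\|\langle\bar{\mathcal L},\bar{\mathcal L}\rangle\|$: the value does not depend on the
  choice of $h$ and $\eta$, hence the definite description.\<close>

definition log_cup_norm ::
    "('a::topological_space) coord set \<Rightarrow> 'a set \<Rightarrow> 'a cech_choice \<Rightarrow> 'a conf_metric \<Rightarrow> real" where
  "log_cup_norm \<A> D K \<rho> =
     (THE v. \<exists>h \<eta> \<omega>. descent \<A> D K \<rho> h \<eta> \<omega> \<and>
        ((\<lambda>\<epsilon>. \<i> / (2 * pi) * integral_form2 K \<omega> (X_eps D K \<epsilon>)) \<longlongrightarrow> complex_of_real v) (at_right 0))"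

text \<open>The area is real: $\omega_\rho=\frac{\sqrt{-1}}2\rho\,dz\wedge d\bar z=\rho\,dx\wedge dy$. The metric
  is only defined on $U$, whose complement is a null set.\<close>

definition area :: "'a set \<Rightarrow> 'a cech_choice \<Rightarrow> 'a conf_metric \<Rightarrow> real" where
  "area D K \<rho> = Re (integral_form2 K (kahler_form \<rho>) (UNIV - D))"

definition S_functional ::
    "('a::topological_space) coord set \<Rightarrow> 'a set \<Rightarrow> 'a cech_choice \<Rightarrow> 'a conf_metric \<Rightarrow> real" where
  "S_functional \<A> D K \<rho> = log_cup_norm \<A> D K \<rho> + 1 / (2 * pi) * area D K \<rho>"

end

theory Submission
  imports Defs
begin

text \<open>
  Write $r_i=\log\tilde\rho_i$ and $b_{ij}=\log|g_{ij}|$, so that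
  $\omega^1_{ij}=\frac12(r_j\,d^cb_{ij}-b_{ij}\,d^cr_j)$. Replacing $ds^2$ by $e^{t\sigma}ds^2$ replaces
  $r_i$ by $r_i+t\sigma$ and leaves $\omega^2$, hence $h$, unchanged; the global 2-form changes by
  $t\sigma\,c_1(\rho)+\frac{t^2}2\sigma\,\bar\partial\partial\sigma-t\,d\xi$, where $\xi$ is a 1-form on $U$ that near
  a point of $D$ equals $\frac14(\sigma\,d^cr_i-r_i\,d^c\sigma)$ up to a smooth form. Goodness of the metric bounds
  $r_i$ by a power of $|\log|z||$ and the coefficients of $\xi$ by $O(1/(|z||\log|z||))$, which is just enough for all
  integrals to converge absolutely and for the integral of $d\xi$ to vanish. Together with the
  area term the derivative of $S$ at $t=0$ is $\frac1{2\pi}\int\sigma\,(2c+\rho)\,dx\,dy$, where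
  $c_1(\rho)=c\,dz\wedge d\bar z$. The
  fundamental lemma of the calculus of variations turns its vanishing for all $\sigma$ into the
  Liouville equation.
\<close>

section \<open>Smooth functions in the plane\<close>

text \<open>The functional is given by a definite description, so for every metric of the family a
  descent must exist, its integrals over X_eps must converge, and all descents must give one limit.
  The punctures are kept out of the cochains: a point of D lies in one member of the cover only, so
  overlaps of distinct members miss D, and the diagonal terms of omega^1 vanish. Hence h and \<eta>
  are smooth across D, averaging over a partition of unity makes sense there, and the singularity
  sits in omega^0 alone. It is r_i c_1 / 2, a Poincare density times a double logarithm; bounding
  the latter by |log|z||^(1/2) leaves |z|^(-2) |log|z||^(-3/2), which is still integrable and
  majorises all other forms as well. Along the family the cup norm is exactly a quadratic polynomial
  in t whose coefficients are absolutely convergent integrals; only the area has to be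
  differentiated under the integral sign. Integrals are taken against an auxiliary measure on the
  surface, so that limits follow from dominated convergence and Stokes' theorem reduces to
  translation invariance of Lebesgue measure in a chart.\<close>

definition planar_smooth :: "complex set \<Rightarrow> (complex \<Rightarrow> 'b::real_normed_vector) \<Rightarrow> bool" where
  "planar_smooth S f \<longleftrightarrow> (\<forall>k. cont_diff_on k S f)"

lemma frechet_derivative_eqI:
  "(f has_derivative f') (at x) \<Longrightarrow> frechet_derivative f (at x) = f'"
  using frechet_derivative_at by metis

text \<open>Holds for arbitrary functions: germs that agree have the same derivatives, so the choice
  inside \<open>frechet_derivative\<close> returns the same map even where no derivative
  exists.\<close>

lemma frechet_derivative_cong_open:
  assumes "open S" "p \<in> S" "\<And>q. q \<in> S \<Longrightarrow> f q = g q"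
  shows "frechet_derivative f (at p) = frechet_derivative g (at p)"
proof -
  have "(f has_derivative D) (at p) \<longleftrightarrow> (g has_derivative D) (at p)" for D
    by (rule iffI; erule has_derivative_transform_within_open[OF _ assms(1,2)]; simp add: assms(3))
  then show ?thesis unfolding frechet_derivative_def by simp
qed

lemma differentiable_cong_open:
  assumes "open S" "p \<in> S" "\<And>q. q \<in> S \<Longrightarrow> f q = g q"
  shows "f differentiable at p \<longleftrightarrow> g differentiable at p"
proof -
  have "(f has_derivative D) (at p) \<longleftrightarrow> (g has_derivative D) (at p)" for D
    by (rule iffI; erule has_derivative_transform_within_open[OF _ assms(1,2)]; simp add: assms(3))
  then show ?thesis by (simp only: differentiable_def)
qed

section \<open>Closure properties of the class C^k\<close>

lemma cont_diff_on_cong: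
  assumes "open S" "\<And>p. p \<in> S \<Longrightarrow> f p = g p"
  shows "cont_diff_on k S f \<longleftrightarrow> cont_diff_on k S g"
  using assms(2)
proof (induction k arbitrary: f g)
  case 0
  then show ?case by (simp cong: continuous_on_cong)
next
  case (Suc k)
  have fr: "frechet_derivative f (at p) = frechet_derivative g (at p)" if "p \<in> S" for p
    by (rule frechet_derivative_cong_open[OF assms(1) that Suc.prems])
  have "cont_diff_on k S (\<lambda>p. frechet_derivative f (at p) v)
      \<longleftrightarrow> cont_diff_on k S (\<lambda>p. frechet_derivative g (at p) v)" for v
    by (rule Suc.IH) (simp add: fr)
  moreover have "f differentiable at p \<longleftrightarrow> g differentiable at p" if "p \<in> S" for p
    using differentiable_cong_open[OF assms(1) that Suc.prems] .
  ultimately show ?case by simp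
qed

lemma cont_diff_on_subset: "cont_diff_on k S f \<Longrightarrow> T \<subseteq> S \<Longrightarrow> cont_diff_on k T f"
  by (induction k arbitrary: f) (auto intro: continuous_on_subset)

lemma cont_diff_on_SucD: "cont_diff_on (Suc k) S f \<Longrightarrow> cont_diff_on k S f"
proof (induction k arbitrary: f)
  case 0
  then have "f differentiable_on S"
    by (auto simp: differentiable_on_def intro: differentiable_at_withinI)
  then show ?case by (simp add: differentiable_imp_continuous_on)
next
  case (Suc k)
  then show ?case by (metis cont_diff_on.simps(2))
qed

lemma cont_diff_on_Union:
  assumes "\<And>T. T \<in> F \<Longrightarrow> open T" "\<And>T. T \<in> F \<Longrightarrow> cont_diff_on k T f"
  shows "cont_diff_on k (\<Union>F) f"
  using assms(2)
proof (induction k arbitrary: f)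
  case 0
  then show ?case using assms(1) by (auto intro: continuous_on_open_Union)
qed auto

lemma cont_diff_on_const: "cont_diff_on k S (\<lambda>p. c)"
  by (induction k arbitrary: c) (auto simp: frechet_derivative_const)

text \<open>Lets an explicit formula stand in for \<open>frechet_derivative\<close>; the rules for
  products, compositions and quotients below all go through it.\<close>

lemma cont_diff_on_SucI:
  assumes "open S" "\<And>p. p \<in> S \<Longrightarrow> (f has_derivative f' p) (at p)"
    and "\<And>v. cont_diff_on k S (\<lambda>p. f' p v)"
  shows "cont_diff_on (Suc k) S f"
proof -
  have "cont_diff_on k S (\<lambda>p. frechet_derivative f (at p) v) \<longleftrightarrow> cont_diff_on k S (\<lambda>p. f' p v)" for v
    by (rule cont_diff_on_cong[OF assms(1)]) (simp add: frechet_derivative_eqI[OF assms(2)])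
  then show ?thesis using assms(2,3) unfolding cont_diff_on.simps differentiable_def by blast
qed

lemma cont_diff_on_SucE:
  assumes "cont_diff_on (Suc k) S f" "p \<in> S"
  shows "(f has_derivative frechet_derivative f (at p)) (at p)"
  using assms frechet_derivative_works by auto

lemma cont_diff_on_linear:
  assumes "open S" "bounded_linear L" "cont_diff_on k S f"
  shows "cont_diff_on k S (\<lambda>p. L (f p))"
  using assms(3)
proof (induction k arbitrary: f)
  case 0
  then show ?case using bounded_linear.continuous_on[OF assms(2)] by auto
next
  case (Suc k)
  show ?case
  proof (rule cont_diff_on_SucI[OF assms(1)])
    fix p assume "p \<in> S"
    show "((\<lambda>p. L (f p)) has_derivative (\<lambda>v. L (frechet_derivative f (at p) v))) (at p)"
      by (rule bounded_linear.has_derivative[OF assms(2) cont_diff_on_SucE[OF Suc.prems \<open>p \<in> S\<close>]])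
  next
    fix v show "cont_diff_on k S (\<lambda>p. L (frechet_derivative f (at p) v))"
      using Suc by auto
  qed
qed

lemma cont_diff_on_add:
  assumes "open S" "cont_diff_on k S f" "cont_diff_on k S g"
  shows "cont_diff_on k S (\<lambda>p. f p + g p)"
  using assms(2,3)
proof (induction k arbitrary: f g)
  case 0
  then show ?case by (auto intro: continuous_intros)
next
  case (Suc k)
  show ?case
  proof (rule cont_diff_on_SucI[OF assms(1)])
    fix p assume "p \<in> S"
    then show "((\<lambda>p. f p + g p) has_derivative
        (\<lambda>v. frechet_derivative f (at p) v + frechet_derivative g (at p) v)) (at p)"
      by (intro has_derivative_add cont_diff_on_SucE[OF Suc.prems(1)] cont_diff_on_SucE[OF Suc.prems(2)])
  next
    fix v show "cont_diff_on k S (\<lambda>p. frechet_derivative f (at p) v + frechet_derivative g (at p) v)"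
      using Suc by auto
  qed
qed

lemma cont_diff_on_bilinear:
  assumes "open S" "bounded_bilinear B" "cont_diff_on k S f" "cont_diff_on k S g"
  shows "cont_diff_on k S (\<lambda>p. B (f p) (g p))"
  using assms(3,4)
proof (induction k arbitrary: f g)
  case 0
  then show ?case using bounded_bilinear.continuous_on[OF assms(2)] by auto
next
  case (Suc k)
  show ?case
  proof (rule cont_diff_on_SucI[OF assms(1)])
    fix p assume "p \<in> S"
    then show "((\<lambda>p. B (f p) (g p)) has_derivative
        (\<lambda>v. B (f p) (frechet_derivative g (at p) v) + B (frechet_derivative f (at p) v) (g p))) (at p)"
      by (intro bounded_bilinear.FDERIV[OF assms(2)] cont_diff_on_SucE[OF Suc.prems(1)]
            cont_diff_on_SucE[OF Suc.prems(2)])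
  next
    fix v
    show "cont_diff_on k S
        (\<lambda>p. B (f p) (frechet_derivative g (at p) v) + B (frechet_derivative f (at p) v) (g p))"
      using Suc.prems cont_diff_on_SucD[OF Suc.prems(1)] cont_diff_on_SucD[OF Suc.prems(2)]
      by (intro cont_diff_on_add assms(1) Suc.IH) auto
  qed
qed

text \<open>The derivative in direction \<open>v\<close> is \<open>deriv f p * v\<close>, again
  holomorphic in \<open>p\<close>, so the induction reproduces its own hypothesis.\<close>

lemma cont_diff_on_holomorphic:
  assumes "open S" "f holomorphic_on S"
  shows "cont_diff_on k S f"
  using assms(2)
proof (induction k arbitrary: f)
  case 0
  then show ?case by (simp add: holomorphic_on_imp_continuous_on)
next
  case (Suc k)
  show ?case
  proof (rule cont_diff_on_SucI[OF assms(1)])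
    fix p assume "p \<in> S"
    then have "(f has_field_derivative deriv f p) (at p)"
      using holomorphic_derivI[OF Suc.prems assms(1)] by auto
    then show "(f has_derivative (*) (deriv f p)) (at p)"
      by (simp add: has_field_derivative_def)
  next
    fix v
    show "cont_diff_on k S (\<lambda>p. deriv f p * v)"
      using Suc.prems assms(1) by (intro Suc.IH holomorphic_intros) auto
  qed
qed

text \<open>In the chain rule the outer derivative is taken in a direction that varies with the
  point. Splitting it along 1 and \<i> leaves derivatives in fixed directions, to which the
  induction hypothesis of \<open>cont_diff_on_compose\<close> applies.\<close>

lemma frechet_derivative_Re_Im:
  assumes "f differentiable at p"
  shows "frechet_derivative f (at p) v =
     Re v *\<^sub>R frechet_derivative f (at p) 1 + Im v *\<^sub>R frechet_derivative f (at p) \<i>"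
proof -
  interpret linear "frechet_derivative f (at p)"
    using assms frechet_derivative_works has_derivative_linear by blast
  have "v = Re v *\<^sub>R 1 + Im v *\<^sub>R \<i>" by (simp add: complex_eq_iff)
  then show ?thesis by (metis add scaleR)
qed

lemma cont_diff_on_compose:
  fixes g :: "complex \<Rightarrow> complex" and f :: "complex \<Rightarrow> 'b::real_normed_vector"
  assumes "open S" "open T" "g ` S \<subseteq> T" "cont_diff_on k T f" "cont_diff_on k S g"
  shows "cont_diff_on k S (\<lambda>p. f (g p))"
  using assms(4,5)
proof (induction k arbitrary: f)
  case 0
  then show ?case using assms(3) by (auto intro: continuous_on_compose2)
next
  case (Suc k)
  have df: "f differentiable at (g p)" if "p \<in> S" for p
    using Suc.prems(1) that assms(3) by auto
  show ?case
  proof (rule cont_diff_on_SucI[OF assms(1)])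
    fix p assume p: "p \<in> S"
    have "((f \<circ> g) has_derivative
       (frechet_derivative f (at (g p)) \<circ> frechet_derivative g (at p))) (at p)"
      by (rule diff_chain_at[OF cont_diff_on_SucE[OF Suc.prems(2) p]])
         (use df[OF p] frechet_derivative_works in blast)
    moreover have "frechet_derivative f (at (g p)) \<circ> frechet_derivative g (at p) =
      (\<lambda>v. Re (frechet_derivative g (at p) v) *\<^sub>R frechet_derivative f (at (g p)) 1
         + Im (frechet_derivative g (at p) v) *\<^sub>R frechet_derivative f (at (g p)) \<i>)"
      unfolding o_def by (rule ext) (rule frechet_derivative_Re_Im[OF df[OF p]])
    ultimately show "((\<lambda>p. f (g p)) has_derivative
      (\<lambda>v. Re (frechet_derivative g (at p) v) *\<^sub>R frechet_derivative f (at (g p)) 1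
         + Im (frechet_derivative g (at p) v) *\<^sub>R frechet_derivative f (at (g p)) \<i>)) (at p)"
      by (simp add: o_def)
  next
    fix v
    have g: "cont_diff_on k S g" using Suc.prems(2) cont_diff_on_SucD by blast
    have *: "cont_diff_on k S (\<lambda>p. frechet_derivative f (at (g p)) w)" for w
      using Suc.IH[of "\<lambda>q. frechet_derivative f (at q) w"] Suc.prems(1) g by auto
    have **: "cont_diff_on k S (\<lambda>p. frechet_derivative g (at p) v)"
      using Suc.prems(2) by auto
    show "cont_diff_on k S (\<lambda>p. Re (frechet_derivative g (at p) v) *\<^sub>R frechet_derivative f (at (g p)) 1
         + Im (frechet_derivative g (at p) v) *\<^sub>R frechet_derivative f (at (g p)) \<i>)"
      by (intro cont_diff_on_add cont_diff_on_bilinear[OF _ bounded_bilinear_scaleR] assms(1) *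
            cont_diff_on_linear[OF _ bounded_linear_Re **] cont_diff_on_linear[OF _ bounded_linear_Im **])
  qed
qed

lemma cont_diff_on_mult:
  fixes f :: "complex \<Rightarrow> 'b::real_normed_algebra"
  shows "open S \<Longrightarrow> cont_diff_on k S f \<Longrightarrow> cont_diff_on k S g \<Longrightarrow> cont_diff_on k S (\<lambda>p. f p * g p)"
  by (rule cont_diff_on_bilinear[OF _ bounded_bilinear_mult])

text \<open>The derivative is - (1/f) f' (1/f), so the induction hypothesis covers the factors
  1/f.\<close>

lemma cont_diff_on_inverse:
  fixes f :: "complex \<Rightarrow> real"
  assumes "open S" "cont_diff_on k S f" "\<And>p. p \<in> S \<Longrightarrow> f p \<noteq> 0"
  shows "cont_diff_on k S (\<lambda>p. inverse (f p))"
  using assms(2)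
proof (induction k)
  case 0
  then show ?case using assms(3) by (auto intro: continuous_intros)
next
  case (Suc k)
  show ?case
  proof (rule cont_diff_on_SucI[OF assms(1)])
    fix p assume "p \<in> S"
    then show "((\<lambda>p. inverse (f p)) has_derivative
      (\<lambda>v. - (inverse (f p) * frechet_derivative f (at p) v * inverse (f p)))) (at p)"
      using assms(3) by (intro Deriv.has_derivative_inverse cont_diff_on_SucE[OF Suc.prems]) auto
  next
    fix v
    have "cont_diff_on k S (\<lambda>p. inverse (f p) * frechet_derivative f (at p) v * inverse (f p))"
      using Suc cont_diff_on_SucD[OF Suc.prems] by (intro cont_diff_on_mult assms(1)) auto
    from cont_diff_on_linear[OF assms(1) bounded_linear_minus[OF bounded_linear_ident] this]
    show "cont_diff_on k S (\<lambda>p. - (inverse (f p) * frechet_derivative f (at p) v * inverse (f p)))" .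
  qed
qed

text \<open>After one differentiation the logarithm is gone, so a case distinction on
  \<open>k\<close> replaces induction.\<close>

lemma cont_diff_on_ln:
  fixes f :: "complex \<Rightarrow> real"
  assumes "open S" "cont_diff_on k S f" "\<And>p. p \<in> S \<Longrightarrow> f p > 0"
  shows "cont_diff_on k S (\<lambda>p. ln (f p))"
proof (cases k)
  case 0
  then show ?thesis using assms by (force intro!: continuous_intros)
next
  case (Suc j)
  show ?thesis unfolding Suc
  proof (rule cont_diff_on_SucI[OF assms(1)])
    fix p assume "p \<in> S"
    then show "((\<lambda>p. ln (f p)) has_derivative
      (\<lambda>v. frechet_derivative f (at p) v * inverse (f p))) (at p)"
      using assms(3) by (intro has_derivative_ln cont_diff_on_SucE[OF assms(2)[unfolded Suc]]) auto
  next
    fix v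
    show "cont_diff_on j S (\<lambda>p. frechet_derivative f (at p) v * inverse (f p))"
      using assms(1,2) cont_diff_on_SucD[OF assms(2)[unfolded Suc]] less_imp_neq[OF assms(3)]
      by (intro cont_diff_on_mult cont_diff_on_inverse) (auto simp: Suc)
  qed
qed

section \<open>The flat function exp(-1/x) and smooth cut-offs\<close>

definition flat :: "nat \<Rightarrow> real \<Rightarrow> real" where
  "flat n x = (if x > 0 then exp (- 1 / x) / x ^ n else 0)"

text \<open>This is the difference quotient at 0. From the right, the substitution y = 1/x turns it
  into \<open>y ^ Suc n / exp y\<close>, which tends to 0 as y grows.\<close>

lemma flat_div_tendsto_0: "(\<lambda>x. flat n x / x) \<midarrow>0\<rightarrow> 0"
proof (rule filterlim_split_at)
  show "((\<lambda>x. flat n x / x) \<longlongrightarrow> 0) (at_left 0)"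
    by (rule tendsto_eventually) (auto simp: flat_def eventually_at_left_field intro: exI[of _ "-1"])
  have "((\<lambda>x. inverse x ^ Suc n / exp (inverse x)) \<longlongrightarrow> (0::real)) (at_right 0)"
    by (rule filterlim_compose[OF tendsto_power_div_exp_0 filterlim_inverse_at_top_right])
  then show "((\<lambda>x. flat n x / x) \<longlongrightarrow> 0) (at_right 0)"
  proof (rule Lim_transform_eventually)
    show "\<forall>\<^sub>F x in at_right 0. inverse x ^ Suc n / exp (inverse x) = flat n x / x"
      unfolding eventually_at_right_field
      by (rule exI[of _ 1]) (auto simp: flat_def field_simps exp_minus power_inverse)
  qed
qed

text \<open>The powers of x in the denominator make the family closed under differentiation up to
  linear combinations, which is what the induction in \<open>cont_diff_on_flat\<close>
  needs.\<close>

lemma flat_has_derivative: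
  "(flat n has_real_derivative (flat (n + 2) x - n * flat (n + 1) x)) (at x)"
proof -
  consider "x > 0" | "x < 0" | "x = 0" by linarith
  then show ?thesis
  proof cases
    case 1
    have n: "real n * x ^ (n - 1) = real n * x ^ n / x" using 1 by (cases n) auto
    have "((\<lambda>x. exp (- 1 / x) / x ^ n) has_real_derivative
        (exp (- 1 / x) * (1 / x\<^sup>2) * x ^ n - exp (- 1 / x) * (real n * x ^ (n - 1))) / (x ^ n * x ^ n)) (at x)"
      using 1 by (auto intro!: derivative_eq_intros simp: power2_eq_square)
    moreover have "(exp (- 1 / x) * (1 / x\<^sup>2) * x ^ n - exp (- 1 / x) * (real n * x ^ (n - 1))) / (x ^ n * x ^ n)
       = flat (n + 2) x - n * flat (n + 1) x"
      unfolding n using 1 by (simp add: flat_def field_simps power2_eq_square)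
    ultimately have "((\<lambda>x. exp (- 1 / x) / x ^ n) has_real_derivative (flat (n + 2) x - n * flat (n + 1) x)) (at x)"
      by simp
    then show ?thesis
      by (rule has_field_derivative_transform_within_open[of _ _ _ "{0<..}"]) (auto simp: flat_def 1)
  next
    case 2
    have "((\<lambda>x. 0) has_real_derivative (flat (n + 2) x - n * flat (n + 1) x)) (at x)"
      using 2 by (auto simp: flat_def)
    then show ?thesis
      by (rule has_field_derivative_transform_within_open[of _ _ _ "{..<0}"]) (auto simp: flat_def 2)
  next
    case 3
    then show ?thesis using flat_div_tendsto_0[of n]
      by (simp add: has_field_derivative_iff flat_def)
  qed
qed

lemma cont_diff_on_flat:
  fixes f :: "complex \<Rightarrow> real"
  assumes "open S" "cont_diff_on k S f"
  shows "cont_diff_on k S (\<lambda>p. flat n (f p))"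
  using assms(2)
proof (induction k arbitrary: n)
  case 0
  have "continuous_on UNIV (flat n)"
    using flat_has_derivative by (intro DERIV_continuous_on) auto
  then show ?case using 0 by (auto intro: continuous_on_compose2)
next
  case (Suc k)
  show ?case
  proof (rule cont_diff_on_SucI[OF assms(1)])
    fix p assume p: "p \<in> S"
    have "(flat n has_derivative (*) (flat (n + 2) (f p) - n * flat (n + 1) (f p))) (at (f p))"
      using flat_has_derivative unfolding has_field_derivative_def .
    from has_derivative_compose[OF cont_diff_on_SucE[OF Suc.prems p] this]
    show "((\<lambda>p. flat n (f p)) has_derivative
      (\<lambda>v. (flat (n + 2) (f p) + (- real n) * flat (n + 1) (f p)) * frechet_derivative f (at p) v)) (at p)"
      by (simp add: algebra_simps)
  next
    fix v
    show "cont_diff_on k S (\<lambda>p. (flat (n + 2) (f p) + (- real n) * flat (n + 1) (f p)) * frechet_derivative f (at p) v)"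
      using Suc cont_diff_on_SucD[OF Suc.prems]
      by (intro cont_diff_on_mult cont_diff_on_add assms(1) cont_diff_on_const) auto
  qed
qed

text \<open>The quotient u / (u + w) of flat functions of b^2 - |p - c|^2 and |p - c|^2 - a^2. The
  denominator is positive because a < b leaves no point where both arguments are
  nonpositive.\<close>

lemma planar_bump_exists:
  assumes "0 < a" "a < b"
  obtains \<beta> :: "complex \<Rightarrow> real" where "planar_smooth UNIV \<beta>" "\<And>p. 0 \<le> \<beta> p" "\<And>p. \<beta> p \<le> 1"
    "\<And>p. dist c p \<le> a \<Longrightarrow> \<beta> p = 1" "\<And>p. dist c p \<ge> b \<Longrightarrow> \<beta> p = 0"
proof -
  define N where "N p = (norm (p - c))\<^sup>2" for p :: complex
  define u where "u p = flat 0 (b\<^sup>2 - N p)" for p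
  define w where "w p = flat 0 (N p - a\<^sup>2)" for p
  have pos: "u p + w p > 0" for p
  proof -
    have "b\<^sup>2 - N p > 0 \<or> N p - a\<^sup>2 > 0"
      using assms power_strict_mono[of a b 2] by linarith
    then show ?thesis by (auto simp: u_def w_def flat_def add_pos_nonneg add_nonneg_pos)
  qed
  have ge0: "u p \<ge> 0" "w p \<ge> 0" for p by (auto simp: u_def w_def flat_def)
  have id: "cont_diff_on k UNIV (\<lambda>p. p - c)" for k
    by (rule cont_diff_on_holomorphic) (auto intro: holomorphic_intros)
  have N: "cont_diff_on k UNIV N" for k
    unfolding N_def power2_norm_eq_inner
    by (rule cont_diff_on_bilinear[OF _ bounded_bilinear_inner id id]) auto
  have N': "cont_diff_on k UNIV (\<lambda>p. - N p)" for k
    using cont_diff_on_linear[OF _ bounded_linear_minus[OF bounded_linear_ident] N] by auto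
  have "cont_diff_on k UNIV (\<lambda>p. b\<^sup>2 + (- N p))" "cont_diff_on k UNIV (\<lambda>p. N p + (- a\<^sup>2))" for k
    by (intro cont_diff_on_add N N' cont_diff_on_const; simp)+
  then have uw: "cont_diff_on k UNIV u" "cont_diff_on k UNIV w" for k
    unfolding u_def w_def by (auto intro!: cont_diff_on_flat)
  define \<beta> where "\<beta> p = u p * inverse (u p + w p)" for p
  have "cont_diff_on k UNIV \<beta>" for k
    unfolding \<beta>_def using pos less_imp_neq by (intro cont_diff_on_mult cont_diff_on_inverse cont_diff_on_add uw) (auto simp: less_imp_neq[symmetric])
  then have "planar_smooth UNIV \<beta>" by (simp add: planar_smooth_def)
  moreover have "0 \<le> \<beta> p" "\<beta> p \<le> 1" for p
    using pos[of p] ge0[of p] by (auto simp: \<beta>_def field_simps)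
  moreover have "\<beta> p = 1" if "dist c p \<le> a" for p
  proof -
    have "N p \<le> a\<^sup>2" using that unfolding N_def
      by (metis dist_commute dist_norm norm_ge_zero power_mono)
    then have "w p = 0" by (simp add: w_def flat_def)
    then show ?thesis using pos[of p] by (simp add: \<beta>_def)
  qed
  moreover have "\<beta> p = 0" if "dist c p \<ge> b" for p
  proof -
    have "N p \<ge> b\<^sup>2" using that assms unfolding N_def
      by (metis dist_commute dist_norm less_eq_real_def less_trans power_mono)
    then show ?thesis by (simp add: \<beta>_def u_def flat_def)
  qed
  ultimately show ?thesis using that by blast
qed

text \<open>Integrate the v-derivative along the segment from p to p + s v and differentiate the
  result in direction w under the integral sign: D_w f(p + s v) - D_w f(p) is the integral of D_w
  D_v f. Differentiating in s at 0 exchanges the order.\<close>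

lemma frechet_derivative_symmetric:
  fixes f :: "complex \<Rightarrow> 'b::banach"
  assumes "open S" "cont_diff_on 2 S f" "p \<in> S"
  shows "frechet_derivative (\<lambda>q. frechet_derivative f (at q) v) (at p) w =
         frechet_derivative (\<lambda>q. frechet_derivative f (at q) w) (at p) v"
proof -
  define D where "D u q = frechet_derivative f (at q) u" for u q
  define DD where "DD u u' q = frechet_derivative (D u) (at q) u'" for u u' q
  have S1: "cont_diff_on (Suc (Suc 0)) S f" using assms(2) by (simp add: numeral_2_eq_2)
  have f1: "(f has_derivative (\<lambda>u. D u q)) (at q)" if "q \<in> S" for q
    using cont_diff_on_SucE[OF S1 that] by (simp add: D_def)
  have S2: "cont_diff_on (Suc 0) S (D u)" for u
    using S1 unfolding D_def[abs_def] cont_diff_on.simps(2)[of "Suc 0"] by blast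
  have f2: "(D u has_derivative (\<lambda>u'. DD u u' q)) (at q)" if "q \<in> S" for q u
    using cont_diff_on_SucE[OF S2 that] by (simp add: DD_def)
  have c1: "continuous_on S (D u)" for u using cont_diff_on_SucD[OF S2] by auto
  have c2: "continuous_on S (DD u u')" for u u' using S2 by (auto simp: DD_def[abs_def])
  have line: "((\<lambda>t. F (a + t *\<^sub>R u)) has_vector_derivative F' u (a + t *\<^sub>R u)) (at t within T)"
    if "a + t *\<^sub>R u \<in> S" "\<And>q. q \<in> S \<Longrightarrow> (F has_derivative (\<lambda>u. F' u q)) (at q)"
    for F :: "complex \<Rightarrow> 'b" and F' a t u T
  proof -
    have "((\<lambda>t. a + t *\<^sub>R u) has_derivative (\<lambda>t. t *\<^sub>R u)) (at t within T)"
      by (auto intro!: derivative_eq_intros)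
    from has_derivative_compose[OF this that(2)[OF that(1)]]
    have "((\<lambda>t. F (a + t *\<^sub>R u)) has_derivative (\<lambda>s. F' (s *\<^sub>R u) (a + t *\<^sub>R u))) (at t within T)" .
    moreover have "F' (s *\<^sub>R u) (a + t *\<^sub>R u) = s *\<^sub>R F' u (a + t *\<^sub>R u)" for s
      using has_derivative_linear[OF that(2)[OF that(1)]] by (simp add: linear_iff)
    ultimately show ?thesis by (simp add: has_vector_derivative_def)
  qed
  obtain r where r: "r > 0" "ball p r \<subseteq> S" using assms(1,3) openE by blast
  \<comment> \<open>Small enough for the points p + t v + y w with |t|, |y| \<le> \<delta> to stay
    in the ball; the summand 1 covers v = w = 0.\<close>
  define \<delta> where "\<delta> = r / (2 * (norm v + norm w + 1))"
  have \<delta>: "\<delta> > 0" using r by (auto simp: \<delta>_def intro!: divide_pos_pos add_nonneg_pos)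
  have inS: "p + t *\<^sub>R v + y *\<^sub>R w \<in> S" if "\<bar>t\<bar> \<le> \<delta>" "\<bar>y\<bar> \<le> \<delta>" for t y
  proof -
    have "norm (t *\<^sub>R v + y *\<^sub>R w) \<le> \<delta> * norm v + \<delta> * norm w"
      using that by (intro order_trans[OF norm_triangle_ineq] add_mono) (auto intro!: mult_right_mono)
    also have "\<dots> \<le> \<delta> * (norm v + norm w + 1)" using \<delta> by (simp add: algebra_simps)
    also have "\<dots> < r" using r by (simp add: \<delta>_def field_simps add_pos_nonneg)
    finally show ?thesis
      by (intro subsetD[OF r(2)]) (metis add.assoc add_diff_cancel_left' dist_commute dist_norm mem_ball)
  qed
  have key: "D w (p + s *\<^sub>R v) - D w p = integral {0..s} (\<lambda>t. DD v w (p + t *\<^sub>R v))"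
    if s: "0 \<le> s" "s \<le> \<delta>" for s
  proof -
    have F: "((\<lambda>t. D v (p + t *\<^sub>R v + y *\<^sub>R w)) has_integral
        f (p + s *\<^sub>R v + y *\<^sub>R w) - f (p + y *\<^sub>R w)) {0..s}" if "\<bar>y\<bar> \<le> \<delta>" for y
    proof -
      have "((\<lambda>t. f ((p + y *\<^sub>R w) + t *\<^sub>R v)) has_vector_derivative D v ((p + y *\<^sub>R w) + t *\<^sub>R v))
          (at t within {0..s})" if "t \<in> {0..s}" for t
        using inS[of t y] that s \<open>\<bar>y\<bar> \<le> \<delta>\<close> by (intro line f1) (auto simp: algebra_simps)
      from fundamental_theorem_of_calculus[OF s(1) this]
      show ?thesis by (simp add: algebra_simps)
    qed
    \<comment> \<open>The identity \<open>F\<close> is differentiated in y at 0 twice over: on the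
      left under the integral sign, and then through its right side, where only derivatives of f
      itself occur.\<close>
    have "((\<lambda>y. integral (cbox 0 s) (\<lambda>t. D v (p + t *\<^sub>R v + y *\<^sub>R w))) has_vector_derivative
       integral (cbox 0 s) (\<lambda>t. DD v w (p + t *\<^sub>R v + 0 *\<^sub>R w))) (at 0 within {-\<delta>..\<delta>})"
    proof (rule leibniz_rule_vector_derivative[where U="{-\<delta>..\<delta>}"
        and f="\<lambda>y t. D v (p + t *\<^sub>R v + y *\<^sub>R w)" and fx="\<lambda>y t. DD v w (p + t *\<^sub>R v + y *\<^sub>R w)"])
      fix y t assume "y \<in> {-\<delta>..\<delta>}" "t \<in> cbox 0 s"
      then show "((\<lambda>y. D v (p + t *\<^sub>R v + y *\<^sub>R w)) has_vector_derivative
           DD v w (p + t *\<^sub>R v + y *\<^sub>R w)) (at y within {-\<delta>..\<delta>})"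
        using inS s by (intro line[where F="D v" and F'="DD v"] f2) auto
    next
      fix y assume "y \<in> {-\<delta>..\<delta>}"
      then show "(\<lambda>t. D v (p + t *\<^sub>R v + y *\<^sub>R w)) integrable_on cbox 0 s"
        using has_integral_integrable[OF F[of y]] by (simp add: abs_le_iff)
    next
      show "continuous_on ({-\<delta>..\<delta>} \<times> cbox 0 s) (\<lambda>(y, t). DD v w (p + t *\<^sub>R v + y *\<^sub>R w))"
        unfolding split_beta using inS s
        by (intro continuous_on_compose2[OF c2[of v w]] continuous_intros) auto
    qed (use \<delta> in auto)
    moreover have "((\<lambda>y. integral (cbox 0 s) (\<lambda>t. D v (p + t *\<^sub>R v + y *\<^sub>R w))) has_vector_derivative
       D w (p + s *\<^sub>R v) - D w p) (at 0 within {-\<delta>..\<delta>})"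
    proof (rule has_vector_derivative_transform[where f="\<lambda>y. f (p + s *\<^sub>R v + y *\<^sub>R w) - f (p + y *\<^sub>R w)"])
      show "0 \<in> {-\<delta>..\<delta>}" using \<delta> by auto
      show "integral (cbox 0 s) (\<lambda>t. D v (p + t *\<^sub>R v + y *\<^sub>R w)) =
         f (p + s *\<^sub>R v + y *\<^sub>R w) - f (p + y *\<^sub>R w)" if "y \<in> {-\<delta>..\<delta>}" for y
        using F[of y] that by (auto intro!: integral_unique)
      show "((\<lambda>y. f (p + s *\<^sub>R v + y *\<^sub>R w) - f (p + y *\<^sub>R w)) has_vector_derivative
        D w (p + s *\<^sub>R v) - D w p) (at 0 within {-\<delta>..\<delta>})"
        using line[of "p + s *\<^sub>R v" 0 w f D] line[of p 0 w f D] f1 inS[of s 0] s assms(3) \<delta>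
        by (intro has_vector_derivative_diff) auto
    qed
    ultimately have "D w (p + s *\<^sub>R v) - D w p = integral (cbox 0 s) (\<lambda>t. DD v w (p + t *\<^sub>R v + 0 *\<^sub>R w))"
      using \<delta> by (intro vector_derivative_unique_within[of 0 "{-\<delta>..\<delta>}"])
        (auto simp: trivial_limit_within islimpt_Icc)
    then show ?thesis by simp
  qed
  \<comment> \<open>Two derivatives of one integral at s = 0: by the fundamental theorem of
    calculus, and through \<open>key\<close> as the derivative of D_w f along v.\<close>
  have "((\<lambda>s. integral {0..s} (\<lambda>t. DD v w (p + t *\<^sub>R v))) has_vector_derivative
      DD v w (p + 0 *\<^sub>R v)) (at 0 within {0..\<delta>})"
    using inS[of _ 0] \<delta> by (intro integral_has_vector_derivative continuous_on_compose2[OF c2[of v w]]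
        continuous_intros) auto
  moreover have "((\<lambda>s. integral {0..s} (\<lambda>t. DD v w (p + t *\<^sub>R v))) has_vector_derivative
      DD w v (p + 0 *\<^sub>R v)) (at 0 within {0..\<delta>})"
  proof (rule has_vector_derivative_transform[where f="\<lambda>s. D w (p + s *\<^sub>R v) - D w p"])
    show "0 \<in> {0..\<delta>}" using \<delta> by auto
    show "integral {0..s} (\<lambda>t. DD v w (p + t *\<^sub>R v)) = D w (p + s *\<^sub>R v) - D w p" if "s \<in> {0..\<delta>}" for s
      using key[of s] that by auto
    show "((\<lambda>s. D w (p + s *\<^sub>R v) - D w p) has_vector_derivative DD w v (p + 0 *\<^sub>R v)) (at 0 within {0..\<delta>})"
      unfolding has_vector_derivative_diff_const
      using line[of p 0 v "D w" "DD w"] f2 assms(3) by auto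
  qed
  ultimately have "DD v w (p + 0 *\<^sub>R v) = DD w v (p + 0 *\<^sub>R v)"
    using \<delta> by (intro vector_derivative_unique_within[of 0 "{0..\<delta>}"])
      (auto simp: trivial_limit_within islimpt_Icc)
  then show ?thesis by (simp add: DD_def D_def[abs_def])
qed

section \<open>Coordinates and smooth functions on the surface\<close>

definition wirt :: "(complex \<Rightarrow> complex) \<Rightarrow> complex" where
  "wirt L = (L 1 - \<i> * L \<i>) / 2"

definition wirt_bar :: "(complex \<Rightarrow> complex) \<Rightarrow> complex" where
  "wirt_bar L = (L 1 + \<i> * L \<i>) / 2"

lemma pd_z_wirt: "pd_z \<phi> f x = wirt (frechet_derivative (in_coord \<phi> f) (at (snd \<phi> x)))"
  by (simp add: pd_z_def wirt_def Let_def)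

lemma pd_zbar_wirt: "pd_zbar \<phi> f x = wirt_bar (frechet_derivative (in_coord \<phi> f) (at (snd \<phi> x)))"
  by (simp add: pd_zbar_def wirt_bar_def Let_def)

text \<open>Turns the chain rule for \<open>pd_z\<close> and \<open>pd_zbar\<close> into algebra: a
  holomorphic change of coordinate multiplies the complex linear part by the Jacobian and the
  antilinear part by its conjugate.\<close>

lemma linear_wirt:
  assumes "linear L"
  shows "L v = wirt L * v + wirt_bar L * cnj v"
proof -
  interpret linear L by fact
  have "v = Re v *\<^sub>R 1 + Im v *\<^sub>R \<i>" by (simp add: complex_eq_iff)
  then have "L v = Re v *\<^sub>R L 1 + Im v *\<^sub>R L \<i>" by (metis add scaleR)
  also have "\<dots> = wirt L * v + wirt_bar L * cnj v"
    by (simp add: wirt_def wirt_bar_def complex_eq_iff algebra_simps add_divide_distrib diff_divide_distrib)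
  finally show ?thesis .
qed

locale complex_surface =
  fixes \<A> :: "('a::t2_space) coord set"
  assumes surface: "compact_riemann_surface \<A>"
begin

section \<open>Charts of the maximal atlas and their transition maps\<close>

lemma atlas_subset_coords: "\<A> \<subseteq> coords \<A>"
  using surface by (auto simp: compact_riemann_surface_def holomorphic_atlas_def coords_def)

lemma atlas_cover: obtains \<phi> where "\<phi> \<in> \<A>" "x \<in> fst \<phi>"
  using surface unfolding compact_riemann_surface_def holomorphic_atlas_def by blast

lemma coords_cover: obtains \<phi> where "\<phi> \<in> coords \<A>" "x \<in> fst \<phi>"
  using atlas_cover atlas_subset_coords by blast

lemma compact_UNIV: "compact (UNIV :: 'a set)"
  using surface by (simp add: compact_riemann_surface_def)

lemma coord_chart: "\<phi> \<in> coords \<A> \<Longrightarrow> complex_chart \<phi>"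
  by (simp add: coords_def)

lemma coord_open: "\<phi> \<in> coords \<A> \<Longrightarrow> open (fst \<phi>)"
  using coord_chart by (simp add: complex_chart_def)

lemma coord_inv [simp]: "\<phi> \<in> coords \<A> \<Longrightarrow> x \<in> fst \<phi> \<Longrightarrow> chart_inv \<phi> (snd \<phi> x) = x"
  using coord_chart[of \<phi>] by (simp add: complex_chart_def homeomorphism_def)

lemma coord_inv_image [simp]:
  "\<phi> \<in> coords \<A> \<Longrightarrow> p \<in> snd \<phi> ` fst \<phi> \<Longrightarrow> snd \<phi> (chart_inv \<phi> p) = p"
  by (metis coord_inv imageE)

lemma coord_inv_mem: "\<phi> \<in> coords \<A> \<Longrightarrow> p \<in> snd \<phi> ` fst \<phi> \<Longrightarrow> chart_inv \<phi> p \<in> fst \<phi>"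
  using coord_chart[of \<phi>] by (auto simp: complex_chart_def homeomorphism_def)

lemma coord_continuous: "\<phi> \<in> coords \<A> \<Longrightarrow> continuous_on (fst \<phi>) (snd \<phi>)"
  using coord_chart[of \<phi>] by (simp add: complex_chart_def homeomorphism_def)

lemma coord_inv_continuous: "\<phi> \<in> coords \<A> \<Longrightarrow> continuous_on (snd \<phi> ` fst \<phi>) (chart_inv \<phi>)"
  using coord_chart[of \<phi>] by (simp add: complex_chart_def homeomorphism_def)

lemma coord_inj: "\<phi> \<in> coords \<A> \<Longrightarrow> inj_on (snd \<phi>) (fst \<phi>)"
  by (rule inj_on_inverseI[of _ "chart_inv \<phi>"]) simp

lemma coord_image_eq:
  "\<phi> \<in> coords \<A> \<Longrightarrow> snd \<phi> ` (fst \<phi> \<inter> W) = snd \<phi> ` fst \<phi> \<inter> chart_inv \<phi> -` W"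
proof (intro equalityI subsetI)
  fix p assume \<phi>: "\<phi> \<in> coords \<A>" and p: "p \<in> snd \<phi> ` fst \<phi> \<inter> chart_inv \<phi> -` W"
  then show "p \<in> snd \<phi> ` (fst \<phi> \<inter> W)"
    by (intro image_eqI[of _ _ "chart_inv \<phi> p"]) (simp_all add: coord_inv_mem)
qed auto

lemma coord_open_image:
  assumes "\<phi> \<in> coords \<A>" "open W"
  shows "open (snd \<phi> ` (fst \<phi> \<inter> W))"
  unfolding coord_image_eq[OF assms(1)]
  using coord_chart[OF assms(1)] continuous_open_preimage[OF coord_inv_continuous[OF assms(1)] _ assms(2)]
  by (simp add: complex_chart_def)

lemma coord_open_range: "\<phi> \<in> coords \<A> \<Longrightarrow> open (snd \<phi> ` fst \<phi>)"
  using coord_chart[of \<phi>] by (simp add: complex_chart_def)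

lemma coord_open_preimage:
  assumes "\<phi> \<in> coords \<A>" "open T"
  shows "open {x \<in> fst \<phi>. snd \<phi> x \<in> T}"
  using continuous_open_preimage[OF coord_continuous[OF assms(1)] coord_open[OF assms(1)] assms(2)]
  by (simp add: vimage_def Int_def)

text \<open>Membership in \<open>coords\<close> only compares with charts of the atlas. Near each
  point the transition between two coordinates factors through one atlas chart, and holomorphy is
  local.\<close>

lemma transition_holomorphic:
  assumes "\<phi> \<in> coords \<A>" "\<psi> \<in> coords \<A>"
  shows "(snd \<psi> \<circ> chart_inv \<phi>) holomorphic_on (snd \<phi> ` (fst \<phi> \<inter> fst \<psi>))"
proof -
  have "(snd \<psi> \<circ> chart_inv \<phi>) field_differentiable (at (snd \<phi> x))" if x: "x \<in> fst \<phi> \<inter> fst \<psi>" for x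
  proof -
    obtain \<kappa> where \<kappa>: "\<kappa> \<in> \<A>" "x \<in> fst \<kappa>" by (rule atlas_cover)
    have \<kappa>': "\<kappa> \<in> coords \<A>" using \<kappa>(1) atlas_subset_coords by auto
    let ?T = "snd \<phi> ` (fst \<phi> \<inter> (fst \<psi> \<inter> fst \<kappa>))"
    have T: "open ?T" by (intro coord_open_image assms(1) open_Int coord_open assms(2) \<kappa>')
    have 1: "(snd \<kappa> \<circ> chart_inv \<phi>) holomorphic_on ?T"
      using assms(1) \<kappa>(1) unfolding coords_def compatible_def
      by (auto intro: holomorphic_on_subset)
    have 2: "(snd \<psi> \<circ> chart_inv \<kappa>) holomorphic_on (snd \<kappa> ` (fst \<psi> \<inter> fst \<kappa>))"
      using assms(2) \<kappa>(1) unfolding coords_def compatible_def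
      by auto
    have "((snd \<psi> \<circ> chart_inv \<kappa>) \<circ> (snd \<kappa> \<circ> chart_inv \<phi>)) holomorphic_on ?T"
      by (rule holomorphic_on_compose_gen[OF 1 2]) (use assms(1) in auto)
    moreover have "((snd \<psi> \<circ> chart_inv \<kappa>) \<circ> (snd \<kappa> \<circ> chart_inv \<phi>)) p = (snd \<psi> \<circ> chart_inv \<phi>) p"
      if "p \<in> ?T" for p
      using that assms(1) \<kappa>' by auto
    ultimately have "(snd \<psi> \<circ> chart_inv \<phi>) holomorphic_on ?T"
      using holomorphic_cong by blast
    moreover have "snd \<phi> x \<in> ?T" using x \<kappa> by auto
    ultimately show ?thesis using T holomorphic_on_imp_differentiable_at by blast
  qed
  then show ?thesis
    by (auto simp: holomorphic_on_def intro: field_differentiable_at_within)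
qed

lemma transition_has_derivative:
  assumes "\<phi> \<in> coords \<A>" "\<psi> \<in> coords \<A>" "x \<in> fst \<phi>" "x \<in> fst \<psi>"
  shows "((snd \<phi> \<circ> chart_inv \<psi>) has_field_derivative jac \<phi> \<psi> x) (at (snd \<psi> x))"
proof -
  have "(snd \<phi> \<circ> chart_inv \<psi>) holomorphic_on snd \<psi> ` (fst \<psi> \<inter> fst \<phi>)"
    by (rule transition_holomorphic[OF assms(2,1)])
  then show ?thesis unfolding jac_def in_coord_def
    using assms coord_open_image[OF assms(2) coord_open[OF assms(1)]]
    by (intro holomorphic_derivI) auto
qed

lemma jac_chain:
  assumes "\<phi> \<in> coords \<A>" "\<psi> \<in> coords \<A>" "\<kappa> \<in> coords \<A>" "x \<in> fst \<phi>" "x \<in> fst \<psi>" "x \<in> fst \<kappa>"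
  shows "jac \<phi> \<kappa> x = jac \<phi> \<psi> x * jac \<psi> \<kappa> x"
proof -
  have e: "(snd \<psi> \<circ> chart_inv \<kappa>) (snd \<kappa> x) = snd \<psi> x" using assms by simp
  have "((snd \<phi> \<circ> chart_inv \<psi>) \<circ> (snd \<psi> \<circ> chart_inv \<kappa>) has_field_derivative
          jac \<phi> \<psi> x * jac \<psi> \<kappa> x) (at (snd \<kappa> x))"
    by (rule DERIV_chain) (simp_all only: e transition_has_derivative assms)
  then have "((snd \<phi> \<circ> chart_inv \<kappa>) has_field_derivative jac \<phi> \<psi> x * jac \<psi> \<kappa> x) (at (snd \<kappa> x))"
    by (rule has_field_derivative_transform_within_open[of _ _ _ "snd \<kappa> ` (fst \<kappa> \<inter> fst \<psi>)"])
       (use assms coord_open_image[OF assms(3) coord_open[OF assms(2)]] in auto)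
  then show ?thesis using DERIV_unique transition_has_derivative assms by blast
qed

lemma jac_refl [simp]:
  assumes "\<phi> \<in> coords \<A>" "x \<in> fst \<phi>"
  shows "jac \<phi> \<phi> x = 1"
proof -
  have "((\<lambda>p. p) has_field_derivative 1) (at (snd \<phi> x))" by (rule DERIV_ident)
  then have "((snd \<phi> \<circ> chart_inv \<phi>) has_field_derivative 1) (at (snd \<phi> x))"
    by (rule has_field_derivative_transform_within_open[of _ _ _ "snd \<phi> ` fst \<phi>"])
       (use assms coord_open_range in auto)
  then show ?thesis using DERIV_unique transition_has_derivative assms by blast
qed

lemma jac_inverse:
  assumes "\<phi> \<in> coords \<A>" "\<psi> \<in> coords \<A>" "x \<in> fst \<phi>" "x \<in> fst \<psi>"
  shows "jac \<phi> \<psi> x * jac \<psi> \<phi> x = 1"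
  using jac_chain[of \<phi> \<psi> \<phi> x] assms by simp

lemma jac_nonzero:
  assumes "\<phi> \<in> coords \<A>" "\<psi> \<in> coords \<A>" "x \<in> fst \<phi>" "x \<in> fst \<psi>"
  shows "jac \<phi> \<psi> x \<noteq> 0"
  using jac_inverse[OF assms] by auto

lemma in_coord_change:
  assumes "\<phi> \<in> coords \<A>" "\<psi> \<in> coords \<A>" "p \<in> snd \<psi> ` (fst \<psi> \<inter> fst \<phi>)"
  shows "in_coord \<psi> f p = in_coord \<phi> f ((snd \<phi> \<circ> chart_inv \<psi>) p)"
  using assms by (auto simp: in_coord_def)

lemma in_coord_at [simp]: "\<phi> \<in> coords \<A> \<Longrightarrow> x \<in> fst \<phi> \<Longrightarrow> in_coord \<phi> f (snd \<phi> x) = f x"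
  by (simp add: in_coord_def)

lemma frechet_derivative_change:
  assumes "\<phi> \<in> coords \<A>" "\<psi> \<in> coords \<A>" "x \<in> fst \<phi>" "x \<in> fst \<psi>"
    and "in_coord \<phi> f differentiable at (snd \<phi> x)"
  shows "(in_coord \<psi> f has_derivative
     (\<lambda>v. frechet_derivative (in_coord \<phi> f) (at (snd \<phi> x)) (jac \<phi> \<psi> x * v))) (at (snd \<psi> x))"
proof -
  have e: "(snd \<phi> \<circ> chart_inv \<psi>) (snd \<psi> x) = snd \<phi> x" using assms by simp
  have "(in_coord \<phi> f \<circ> (snd \<phi> \<circ> chart_inv \<psi>) has_derivative
     frechet_derivative (in_coord \<phi> f) (at (snd \<phi> x)) \<circ> (*) (jac \<phi> \<psi> x)) (at (snd \<psi> x))"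
    by (rule diff_chain_at)
       (use transition_has_derivative[OF assms(1-4)] assms(5) e frechet_derivative_works in
        \<open>auto simp: has_field_derivative_def\<close>)
  then show ?thesis
    unfolding o_def
    by (rule has_derivative_transform_within_open[of _ _ _ _ "snd \<psi> ` (fst \<psi> \<inter> fst \<phi>)"])
       (use assms coord_open_image[OF assms(2) coord_open[OF assms(1)]] in
        \<open>auto simp: in_coord_def\<close>)
qed

lemma
  assumes "\<phi> \<in> coords \<A>" "\<psi> \<in> coords \<A>" "x \<in> fst \<phi>" "x \<in> fst \<psi>"
    and "in_coord \<phi> f differentiable at (snd \<phi> x)"
  shows pd_z_change: "pd_z \<psi> f x = pd_z \<phi> f x * jac \<phi> \<psi> x"
    and pd_zbar_change: "pd_zbar \<psi> f x = pd_zbar \<phi> f x * cnj (jac \<phi> \<psi> x)"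
proof -
  let ?L = "frechet_derivative (in_coord \<phi> f) (at (snd \<phi> x))"
  have L: "linear ?L" using assms(5) frechet_derivative_works has_derivative_linear by blast
  have *: "frechet_derivative (in_coord \<psi> f) (at (snd \<psi> x)) = (\<lambda>v. ?L (jac \<phi> \<psi> x * v))"
    by (rule frechet_derivative_eqI[OF frechet_derivative_change[OF assms]])
  show "pd_z \<psi> f x = pd_z \<phi> f x * jac \<phi> \<psi> x"
    unfolding pd_z_wirt * wirt_def[of "\<lambda>v. ?L (jac \<phi> \<psi> x * v)"]
    by (simp add: linear_wirt[OF L, of "_ * _"] linear_wirt[OF L, of "jac \<phi> \<psi> x"] algebra_simps complex_eq_iff)
  show "pd_zbar \<psi> f x = pd_zbar \<phi> f x * cnj (jac \<phi> \<psi> x)"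
    unfolding pd_zbar_wirt * wirt_bar_def[of "\<lambda>v. ?L (jac \<phi> \<psi> x * v)"]
    by (simp add: linear_wirt[OF L, of "_ * _"] linear_wirt[OF L, of "jac \<phi> \<psi> x"] algebra_simps complex_eq_iff)
qed

section \<open>The algebra of smooth functions on the surface\<close>

lemma smooth_fun_subset: "smooth_fun \<A> W f \<Longrightarrow> W' \<subseteq> W \<Longrightarrow> smooth_fun \<A> W' f"
  unfolding smooth_fun_def by (meson Int_mono cont_diff_on_subset image_mono subset_refl)

text \<open>Passing to another coordinate composes with a holomorphic, hence C^k, transition map; so
  one coordinate near each point decides.\<close>

lemma smooth_fun_local:
  assumes "\<And>x. x \<in> W \<Longrightarrow> \<exists>\<phi>\<in>coords \<A>. \<exists>W'. open W' \<and> x \<in> W' \<and> x \<in> fst \<phi> \<and>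
      (\<forall>k. cont_diff_on k (snd \<phi> ` (fst \<phi> \<inter> W')) (in_coord \<phi> f))"
  shows "smooth_fun \<A> W f"
  unfolding smooth_fun_def
proof (intro ballI allI)
  fix \<psi> k assume \<psi>: "\<psi> \<in> coords \<A>"
  define F where "F = {T. open T \<and> cont_diff_on k T (in_coord \<psi> f)}"
  have "snd \<psi> x \<in> \<Union>F" if x: "x \<in> fst \<psi>" "x \<in> W" for x
  proof -
    obtain \<phi> W' where \<phi>: "\<phi> \<in> coords \<A>" "open W'" "x \<in> W'" "x \<in> fst \<phi>"
      "\<And>k. cont_diff_on k (snd \<phi> ` (fst \<phi> \<inter> W')) (in_coord \<phi> f)"
      using assms[OF x(2)] by blast
    let ?T = "snd \<psi> ` (fst \<psi> \<inter> (fst \<phi> \<inter> W'))"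
    have T: "open ?T" by (intro coord_open_image \<psi> open_Int coord_open \<phi>)
    have "(snd \<phi> \<circ> chart_inv \<psi>) holomorphic_on ?T"
      by (rule holomorphic_on_subset[OF transition_holomorphic[OF \<psi> \<phi>(1)]]) auto
    then have "cont_diff_on k ?T (snd \<phi> \<circ> chart_inv \<psi>)"
      by (rule cont_diff_on_holomorphic[OF T])
    then have "cont_diff_on k ?T (\<lambda>p. in_coord \<phi> f ((snd \<phi> \<circ> chart_inv \<psi>) p))"
      by (intro cont_diff_on_compose[OF T coord_open_image[OF \<phi>(1,2)] _ \<phi>(5)]) (use \<psi> in \<open>auto simp: o_def\<close>)
    then have "cont_diff_on k ?T (in_coord \<psi> f)"
      by (subst cont_diff_on_cong[OF T]) (use in_coord_change[OF \<phi>(1) \<psi>] in auto)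
    then show ?thesis using T x \<phi> by (auto simp: F_def)
  qed
  then have "snd \<psi> ` (fst \<psi> \<inter> W) \<subseteq> \<Union>F" by auto
  moreover have "cont_diff_on k (\<Union>F) (in_coord \<psi> f)"
    by (rule cont_diff_on_Union) (auto simp: F_def)
  ultimately show "cont_diff_on k (snd \<psi> ` (fst \<psi> \<inter> W)) (in_coord \<psi> f)"
    using cont_diff_on_subset by blast
qed

lemma smooth_fun_Un:
  assumes "smooth_fun \<A> V f" "smooth_fun \<A> W f" "open V" "open W"
  shows "smooth_fun \<A> (V \<union> W) f"
proof (rule smooth_fun_local)
  fix x assume x: "x \<in> V \<union> W"
  obtain \<phi> where \<phi>: "\<phi> \<in> coords \<A>" "x \<in> fst \<phi>" by (rule coords_cover)
  show "\<exists>\<phi>\<in>coords \<A>. \<exists>W'. open W' \<and> x \<in> W' \<and> x \<in> fst \<phi> \<and>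
      (\<forall>k. cont_diff_on k (snd \<phi> ` (fst \<phi> \<inter> W')) (in_coord \<phi> f))"
    using x \<phi> assms unfolding smooth_fun_def by blast
qed

lemma smooth_fun_cong:
  assumes "open W" "\<And>x. x \<in> W \<Longrightarrow> f x = g x"
  shows "smooth_fun \<A> W f \<longleftrightarrow> smooth_fun \<A> W g"
proof -
  have "cont_diff_on k (snd \<phi> ` (fst \<phi> \<inter> W)) (in_coord \<phi> f) \<longleftrightarrow>
        cont_diff_on k (snd \<phi> ` (fst \<phi> \<inter> W)) (in_coord \<phi> g)" if "\<phi> \<in> coords \<A>" for \<phi> k
    by (rule cont_diff_on_cong[OF coord_open_image[OF that assms(1)]])
       (use that assms(2) in \<open>auto simp: in_coord_def\<close>)
  then show ?thesis by (simp add: smooth_fun_def)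
qed

lemma smooth_fun_const: "smooth_fun \<A> W (\<lambda>x. c)"
  by (simp add: smooth_fun_def in_coord_def o_def cont_diff_on_const)

lemma smooth_fun_linear:
  assumes "open W" "bounded_linear L" "smooth_fun \<A> W f"
  shows "smooth_fun \<A> W (\<lambda>x. L (f x))"
  using assms cont_diff_on_linear[OF coord_open_image assms(2)]
  by (simp add: smooth_fun_def in_coord_def o_def)

lemma smooth_fun_bilinear:
  assumes "open W" "bounded_bilinear B" "smooth_fun \<A> W f" "smooth_fun \<A> W g"
  shows "smooth_fun \<A> W (\<lambda>x. B (f x) (g x))"
  using assms cont_diff_on_bilinear[OF coord_open_image assms(2)]
  by (simp add: smooth_fun_def in_coord_def o_def)

lemma smooth_fun_add:
  assumes "open W" "smooth_fun \<A> W f" "smooth_fun \<A> W g"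
  shows "smooth_fun \<A> W (\<lambda>x. f x + g x)"
  unfolding smooth_fun_def in_coord_def o_def
proof (intro ballI allI)
  fix \<phi> k assume \<phi>: "\<phi> \<in> coords \<A>"
  show "cont_diff_on k (snd \<phi> ` (fst \<phi> \<inter> W)) (\<lambda>x. f (chart_inv \<phi> x) + g (chart_inv \<phi> x))"
    by (rule cont_diff_on_add[OF coord_open_image[OF \<phi> assms(1)]])
       (use assms \<phi> in \<open>auto simp: smooth_fun_def in_coord_def o_def\<close>)
qed

lemma smooth_fun_minus:
  "open W \<Longrightarrow> smooth_fun \<A> W f \<Longrightarrow> smooth_fun \<A> W (\<lambda>x. - f x)"
  by (rule smooth_fun_linear[OF _ bounded_linear_minus[OF bounded_linear_ident]])

lemma smooth_fun_diff:
  "open W \<Longrightarrow> smooth_fun \<A> W f \<Longrightarrow> smooth_fun \<A> W g \<Longrightarrow> smooth_fun \<A> W (\<lambda>x. f x - g x)"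
  using smooth_fun_add[OF _ _ smooth_fun_minus] by simp

lemma smooth_fun_mult:
  fixes f :: "'a \<Rightarrow> 'b::real_normed_algebra"
  shows "open W \<Longrightarrow> smooth_fun \<A> W f \<Longrightarrow> smooth_fun \<A> W g \<Longrightarrow> smooth_fun \<A> W (\<lambda>x. f x * g x)"
  by (rule smooth_fun_bilinear[OF _ bounded_bilinear_mult])

lemma smooth_fun_scaleR:
  "open W \<Longrightarrow> smooth_fun \<A> W f \<Longrightarrow> smooth_fun \<A> W g \<Longrightarrow> smooth_fun \<A> W (\<lambda>x. f x *\<^sub>R g x)"
  by (rule smooth_fun_bilinear[OF _ bounded_bilinear_scaleR])

lemma smooth_fun_of_real:
  "open W \<Longrightarrow> smooth_fun \<A> W f \<Longrightarrow> smooth_fun \<A> W (\<lambda>x. complex_of_real (f x))"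
  by (rule smooth_fun_linear[OF _ bounded_linear_of_real])

lemma smooth_fun_cnj:
  "open W \<Longrightarrow> smooth_fun \<A> W f \<Longrightarrow> smooth_fun \<A> W (\<lambda>x. cnj (f x))"
  by (rule smooth_fun_linear[OF _ bounded_linear_cnj])

lemma smooth_fun_sum:
  "open W \<Longrightarrow> (\<And>i. i \<in> I \<Longrightarrow> smooth_fun \<A> W (f i)) \<Longrightarrow> smooth_fun \<A> W (\<lambda>x. \<Sum>i\<in>I. f i x)"
  by (induction I rule: infinite_finite_induct) (auto simp: smooth_fun_const intro: smooth_fun_add)

lemma smooth_fun_inverse:
  fixes f :: "'a \<Rightarrow> real"
  assumes "open W" "smooth_fun \<A> W f" "\<And>x. x \<in> W \<Longrightarrow> f x \<noteq> 0"
  shows "smooth_fun \<A> W (\<lambda>x. inverse (f x))"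
  unfolding smooth_fun_def in_coord_def o_def
proof (intro ballI allI)
  fix \<phi> k assume \<phi>: "\<phi> \<in> coords \<A>"
  show "cont_diff_on k (snd \<phi> ` (fst \<phi> \<inter> W)) (\<lambda>x. inverse (f (chart_inv \<phi> x)))"
    by (rule cont_diff_on_inverse[OF coord_open_image[OF \<phi> assms(1)]])
       (use assms \<phi> in \<open>auto simp: smooth_fun_def in_coord_def o_def\<close>)
qed

lemma smooth_fun_ln:
  fixes f :: "'a \<Rightarrow> real"
  assumes "open W" "smooth_fun \<A> W f" "\<And>x. x \<in> W \<Longrightarrow> f x > 0"
  shows "smooth_fun \<A> W (\<lambda>x. ln (f x))"
  unfolding smooth_fun_def in_coord_def o_def
proof (intro ballI allI)
  fix \<phi> k assume \<phi>: "\<phi> \<in> coords \<A>"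
  show "cont_diff_on k (snd \<phi> ` (fst \<phi> \<inter> W)) (\<lambda>x. ln (f (chart_inv \<phi> x)))"
    by (rule cont_diff_on_ln[OF coord_open_image[OF \<phi> assms(1)]])
       (use assms \<phi> in \<open>auto simp: smooth_fun_def in_coord_def o_def\<close>)
qed

lemma smooth_fun_differentiable:
  assumes "smooth_fun \<A> W f" "\<phi> \<in> coords \<A>" "x \<in> fst \<phi>" "x \<in> W"
  shows "in_coord \<phi> f differentiable at (snd \<phi> x)"
proof -
  have "cont_diff_on (Suc 0) (snd \<phi> ` (fst \<phi> \<inter> W)) (in_coord \<phi> f)"
    using assms(1,2) unfolding smooth_fun_def by blast
  then show ?thesis using assms(3,4) by auto
qed

lemma smooth_fun_continuous:
  assumes "smooth_fun \<A> W f" "open W"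
  shows "continuous_on W f"
proof -
  have "isCont f x" if x: "x \<in> W" for x
  proof -
    obtain \<phi> where \<phi>: "\<phi> \<in> coords \<A>" "x \<in> fst \<phi>" by (rule coords_cover)
    have "cont_diff_on 0 (snd \<phi> ` (fst \<phi> \<inter> W)) (in_coord \<phi> f)"
      using assms(1) \<phi>(1) unfolding smooth_fun_def by blast
    then have "continuous_on (fst \<phi> \<inter> W) (\<lambda>y. in_coord \<phi> f (snd \<phi> y))"
      using continuous_on_compose2[OF _ continuous_on_subset[OF coord_continuous[OF \<phi>(1)]],
          of "snd \<phi> ` (fst \<phi> \<inter> W)" "in_coord \<phi> f" "fst \<phi> \<inter> W"] by auto
    then have "continuous_on (fst \<phi> \<inter> W) f"
      by (rule continuous_on_eq) (use \<phi> in auto)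
    then show ?thesis
      using x \<phi> by (simp add: continuous_on_eq_continuous_at[OF open_Int[OF coord_open[OF \<phi>(1)] assms(2)]])
  qed
  then show ?thesis by (simp add: continuous_at_imp_continuous_on)
qed

lemma holo_fun_smooth:
  assumes "open W" "holo_fun \<A> W f"
  shows "smooth_fun \<A> W f"
  using assms cont_diff_on_holomorphic[OF coord_open_image] by (simp add: smooth_fun_def holo_fun_def)

lemma holo_fun_subset: "holo_fun \<A> W f \<Longrightarrow> W' \<subseteq> W \<Longrightarrow> holo_fun \<A> W' f"
  unfolding holo_fun_def by (meson Int_mono holomorphic_on_subset image_mono subset_refl)

lemma holo_fun_coord: "\<phi> \<in> coords \<A> \<Longrightarrow> holo_fun \<A> (fst \<phi>) (snd \<phi>)"
  using transition_holomorphic unfolding holo_fun_def in_coord_def by blast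

section \<open>Wirtinger derivatives on the surface\<close>

lemma frechet_in_coord_cong:
  assumes "open W" "\<And>y. y \<in> W \<Longrightarrow> f y = g y" "\<phi> \<in> coords \<A>" "x \<in> fst \<phi>" "x \<in> W"
  shows "frechet_derivative (in_coord \<phi> f) (at (snd \<phi> x)) = frechet_derivative (in_coord \<phi> g) (at (snd \<phi> x))"
  by (rule frechet_derivative_cong_open[OF coord_open_image[OF assms(3,1)]])
     (use assms in \<open>auto simp: in_coord_def\<close>)

lemma pd_z_cong:
  assumes "open W" "\<And>y. y \<in> W \<Longrightarrow> f y = g y" "\<phi> \<in> coords \<A>" "x \<in> fst \<phi>" "x \<in> W"
  shows "pd_z \<phi> f x = pd_z \<phi> g x"
  using frechet_in_coord_cong[OF assms] by (simp add: pd_z_wirt)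

lemma pd_zbar_cong:
  assumes "open W" "\<And>y. y \<in> W \<Longrightarrow> f y = g y" "\<phi> \<in> coords \<A>" "x \<in> fst \<phi>" "x \<in> W"
  shows "pd_zbar \<phi> f x = pd_zbar \<phi> g x"
  using frechet_in_coord_cong[OF assms] by (simp add: pd_zbar_wirt)

lemma pd_const [simp]: "pd_z \<phi> (\<lambda>x. c) x = 0" "pd_zbar \<phi> (\<lambda>x. c) x = 0"
  by (simp_all add: pd_z_wirt pd_zbar_wirt in_coord_def o_def wirt_def wirt_bar_def)

lemma frechet_works:
  assumes "smooth_fun \<A> W f" "\<phi> \<in> coords \<A>" "x \<in> fst \<phi>" "x \<in> W"
  shows "((\<lambda>p. f (chart_inv \<phi> p)) has_derivative frechet_derivative (in_coord \<phi> f) (at (snd \<phi> x))) (at (snd \<phi> x))"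
  using smooth_fun_differentiable[OF assms] frechet_derivative_works
  by (fastforce simp: in_coord_def o_def)

lemma
  assumes "smooth_fun \<A> W f" "smooth_fun \<A> W g" "\<phi> \<in> coords \<A>" "x \<in> fst \<phi>" "x \<in> W"
  shows pd_z_add: "pd_z \<phi> (\<lambda>x. f x + g x) x = pd_z \<phi> f x + pd_z \<phi> g x"
    and pd_zbar_add: "pd_zbar \<phi> (\<lambda>x. f x + g x) x = pd_zbar \<phi> f x + pd_zbar \<phi> g x"
  using frechet_derivative_eqI[OF has_derivative_add[OF frechet_works[OF assms(1,3-5)] frechet_works[OF assms(2,3-5)]]]
  by (simp_all add: pd_z_wirt pd_zbar_wirt in_coord_def o_def wirt_def wirt_bar_def field_simps)

lemma
  assumes "smooth_fun \<A> W f" "smooth_fun \<A> W g" "\<phi> \<in> coords \<A>" "x \<in> fst \<phi>" "x \<in> W"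
  shows pd_z_mult: "pd_z \<phi> (\<lambda>x. f x * g x) x = f x * pd_z \<phi> g x + pd_z \<phi> f x * g x"
    and pd_zbar_mult: "pd_zbar \<phi> (\<lambda>x. f x * g x) x = f x * pd_zbar \<phi> g x + pd_zbar \<phi> f x * g x"
  using frechet_derivative_eqI[OF has_derivative_mult[OF frechet_works[OF assms(1,3-5)] frechet_works[OF assms(2,3-5)]]] assms(3,4)
  by (simp_all add: pd_z_wirt pd_zbar_wirt in_coord_def o_def wirt_def wirt_bar_def field_simps)

lemma
  assumes "smooth_fun \<A> W f" "\<phi> \<in> coords \<A>" "x \<in> fst \<phi>" "x \<in> W"
  shows pd_z_minus: "pd_z \<phi> (\<lambda>x. - f x) x = - pd_z \<phi> f x"
    and pd_zbar_minus: "pd_zbar \<phi> (\<lambda>x. - f x) x = - pd_zbar \<phi> f x"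
  using frechet_derivative_eqI[OF has_derivative_minus[OF frechet_works[OF assms]]]
  by (simp_all add: pd_z_wirt pd_zbar_wirt in_coord_def o_def wirt_def wirt_bar_def field_simps)

lemma
  assumes "smooth_fun \<A> W f" "\<phi> \<in> coords \<A>" "x \<in> fst \<phi>" "x \<in> W"
  shows pd_z_cnj: "pd_z \<phi> (\<lambda>x. cnj (f x)) x = cnj (pd_zbar \<phi> f x)"
    and pd_zbar_cnj: "pd_zbar \<phi> (\<lambda>x. cnj (f x)) x = cnj (pd_z \<phi> f x)"
  using frechet_derivative_eqI[OF bounded_linear.has_derivative[OF bounded_linear_cnj frechet_works[OF assms]]]
  by (simp_all add: pd_z_wirt pd_zbar_wirt in_coord_def o_def wirt_def wirt_bar_def field_simps)

lemma
  assumes "smooth_fun \<A> W f" "\<phi> \<in> coords \<A>" "x \<in> fst \<phi>" "x \<in> W"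
  shows pd_z_cmult: "pd_z \<phi> (\<lambda>x. c * f x) x = c * pd_z \<phi> f x"
    and pd_zbar_cmult: "pd_zbar \<phi> (\<lambda>x. c * f x) x = c * pd_zbar \<phi> f x"
  using pd_z_mult[OF smooth_fun_const assms] pd_zbar_mult[OF smooth_fun_const assms] by simp_all

lemma
  assumes "smooth_fun \<A> W f" "smooth_fun \<A> W g" "\<phi> \<in> coords \<A>" "x \<in> fst \<phi>" "x \<in> W" "open W"
  shows pd_z_diff: "pd_z \<phi> (\<lambda>x. f x - g x) x = pd_z \<phi> f x - pd_z \<phi> g x"
    and pd_zbar_diff: "pd_zbar \<phi> (\<lambda>x. f x - g x) x = pd_zbar \<phi> f x - pd_zbar \<phi> g x"
  using pd_z_add[OF assms(1) smooth_fun_minus[OF assms(6,2)] assms(3-5)] pd_z_minus[OF assms(2-5)]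
    pd_zbar_add[OF assms(1) smooth_fun_minus[OF assms(6,2)] assms(3-5)] pd_zbar_minus[OF assms(2-5)]
  by simp_all

text \<open>Directional derivatives are used only as functions on the chart in which they are taken;
  the Wirtinger derivatives are combinations of those in the directions 1 and \<i>.\<close>

lemma frechet_smooth:
  assumes "smooth_fun \<A> W f" "\<phi> \<in> coords \<A>" "open W"
  shows "smooth_fun \<A> (fst \<phi> \<inter> W) (\<lambda>x. frechet_derivative (in_coord \<phi> f) (at (snd \<phi> x)) v)"
proof (rule smooth_fun_local)
  fix x assume x: "x \<in> fst \<phi> \<inter> W"
  let ?S = "snd \<phi> ` (fst \<phi> \<inter> W)"
  have "cont_diff_on k ?S (\<lambda>p. frechet_derivative (in_coord \<phi> f) (at p) v)" for k
  proof -
    have "cont_diff_on (Suc k) ?S (in_coord \<phi> f)" using assms unfolding smooth_fun_def by blast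
    then show ?thesis by simp
  qed
  moreover have "cont_diff_on k ?S (in_coord \<phi> (\<lambda>x. frechet_derivative (in_coord \<phi> f) (at (snd \<phi> x)) v))
      \<longleftrightarrow> cont_diff_on k ?S (\<lambda>p. frechet_derivative (in_coord \<phi> f) (at p) v)" for k
    by (rule cont_diff_on_cong[OF coord_open_image[OF assms(2,3)]]) (use assms(2) in \<open>auto simp: in_coord_def\<close>)
  ultimately have "cont_diff_on k ?S (in_coord \<phi> (\<lambda>x. frechet_derivative (in_coord \<phi> f) (at (snd \<phi> x)) v))" for k
    by simp
  then show "\<exists>\<phi>'\<in>coords \<A>. \<exists>W'. open W' \<and> x \<in> W' \<and> x \<in> fst \<phi>' \<and>
      (\<forall>k. cont_diff_on k (snd \<phi>' ` (fst \<phi>' \<inter> W')) (in_coord \<phi>' (\<lambda>x. frechet_derivative (in_coord \<phi> f) (at (snd \<phi> x)) v)))"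
    using assms x by blast
qed

lemma
  assumes "smooth_fun \<A> W f" "\<phi> \<in> coords \<A>" "open W"
  shows smooth_fun_pd_z: "smooth_fun \<A> (fst \<phi> \<inter> W) (pd_z \<phi> f)"
    and smooth_fun_pd_zbar: "smooth_fun \<A> (fst \<phi> \<inter> W) (pd_zbar \<phi> f)"
proof -
  have o: "open (fst \<phi> \<inter> W)" using coord_open[OF assms(2)] assms(3) by auto
  note s = frechet_smooth[OF assms]
  have half: "bounded_linear (\<lambda>z::complex. z / 2)" by (rule bounded_linear_divide)
  show "smooth_fun \<A> (fst \<phi> \<inter> W) (pd_z \<phi> f)"
    unfolding pd_z_wirt wirt_def
    by (intro smooth_fun_linear[OF o half] smooth_fun_diff smooth_fun_mult smooth_fun_const o s)
  show "smooth_fun \<A> (fst \<phi> \<inter> W) (pd_zbar \<phi> f)"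
    unfolding pd_zbar_wirt wirt_bar_def
    by (intro smooth_fun_linear[OF o half] smooth_fun_add smooth_fun_mult smooth_fun_const o s)
qed

text \<open>Both sides equal a quarter of the sum of the pure second derivatives in the directions 1
  and \<i>; the mixed ones cancel by \<open>frechet_derivative_symmetric\<close>.\<close>

lemma pd_z_pd_zbar_commute:
  assumes "smooth_fun \<A> W f" "\<phi> \<in> coords \<A>" "open W" "x \<in> fst \<phi>" "x \<in> W"
  shows "pd_z \<phi> (pd_zbar \<phi> f) x = pd_zbar \<phi> (pd_z \<phi> f) x"
proof -
  define d where "d v x = frechet_derivative (in_coord \<phi> f) (at (snd \<phi> x)) v" for v x
  let ?S = "snd \<phi> ` (fst \<phi> \<inter> W)"
  have S: "open ?S" by (rule coord_open_image[OF assms(2,3)])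
  have o: "open (fst \<phi> \<inter> W)" using coord_open[OF assms(2)] assms(3) by auto
  have d: "smooth_fun \<A> (fst \<phi> \<inter> W) (d v)" for v
    unfolding d_def[abs_def] by (rule frechet_smooth[OF assms(1-3)])
  have "frechet_derivative (in_coord \<phi> (d v)) (at (snd \<phi> x)) =
      frechet_derivative (\<lambda>q. frechet_derivative (in_coord \<phi> f) (at q) v) (at (snd \<phi> x))" for v
    by (rule frechet_derivative_cong_open[OF S]) (use assms in \<open>auto simp: in_coord_def d_def\<close>)
  moreover have "cont_diff_on 2 ?S (in_coord \<phi> f)" using assms unfolding smooth_fun_def by blast
  ultimately have sym: "frechet_derivative (in_coord \<phi> (d v)) (at (snd \<phi> x)) w
      = frechet_derivative (in_coord \<phi> (d w)) (at (snd \<phi> x)) v" for v w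
    using frechet_derivative_symmetric[OF S, of "in_coord \<phi> f" "snd \<phi> x" v w] assms by auto
  have x: "x \<in> fst \<phi> \<inter> W" using assms by auto
  have eqs: "pd_z \<phi> f = (\<lambda>x. (1/2) * d 1 x + (-\<i>/2) * d \<i> x)" "pd_zbar \<phi> f = (\<lambda>x. (1/2) * d 1 x + (\<i>/2) * d \<i> x)"
    by (auto simp: pd_z_wirt pd_zbar_wirt wirt_def wirt_bar_def d_def field_simps)
  have c: "smooth_fun \<A> (fst \<phi> \<inter> W) (\<lambda>x. c * d v x)" for c v
    by (intro smooth_fun_mult smooth_fun_const o d)
  have "pd_zbar \<phi> (pd_z \<phi> f) x = (1/2) * pd_zbar \<phi> (d 1) x + (-\<i>/2) * pd_zbar \<phi> (d \<i>) x"
    unfolding eqs pd_zbar_add[OF c c assms(2,4) x] pd_zbar_cmult[OF d assms(2,4) x] ..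
  moreover have "pd_z \<phi> (pd_zbar \<phi> f) x = (1/2) * pd_z \<phi> (d 1) x + (\<i>/2) * pd_z \<phi> (d \<i>) x"
    unfolding eqs pd_z_add[OF c c assms(2,4) x] pd_z_cmult[OF d assms(2,4) x] ..
  moreover have "(1/2) * pd_zbar \<phi> (d 1) x + (-\<i>/2) * pd_zbar \<phi> (d \<i>) x
      = (1/2) * pd_z \<phi> (d 1) x + (\<i>/2) * pd_z \<phi> (d \<i>) x"
    by (simp add: pd_z_wirt pd_zbar_wirt wirt_def wirt_bar_def sym[of \<i> 1] field_simps)
  ultimately show ?thesis by (simp only:)
qed

lemma holo_fun_pd:
  assumes "holo_fun \<A> W f" "\<phi> \<in> coords \<A>" "open W" "x \<in> fst \<phi>" "x \<in> W"
  shows "pd_zbar \<phi> f x = 0" "pd_z \<phi> f x = deriv (in_coord \<phi> f) (snd \<phi> x)"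
proof -
  have "in_coord \<phi> f holomorphic_on (snd \<phi> ` (fst \<phi> \<inter> W))" using assms by (simp add: holo_fun_def)
  then have "(in_coord \<phi> f has_field_derivative deriv (in_coord \<phi> f) (snd \<phi> x)) (at (snd \<phi> x))"
    using coord_open_image[OF assms(2,3)] assms(4,5) holomorphic_derivI by blast
  then have "frechet_derivative (in_coord \<phi> f) (at (snd \<phi> x)) = (*) (deriv (in_coord \<phi> f) (snd \<phi> x))"
    by (intro frechet_derivative_eqI) (simp add: has_field_derivative_def)
  moreover have "\<i> * (z * \<i>) = - z" for z by (simp add: complex_eq_iff)
  ultimately show "pd_zbar \<phi> f x = 0" "pd_z \<phi> f x = deriv (in_coord \<phi> f) (snd \<phi> x)"
    by (simp_all add: pd_z_wirt pd_zbar_wirt wirt_def wirt_bar_def)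
qed

section \<open>Bump functions and partitions of unity\<close>

lemma smooth_fun_cutoff:
  fixes \<kappa> :: "'a \<Rightarrow> real"
  assumes "smooth_fun \<A> UNIV \<kappa>" "closed C" "C \<subseteq> V" "\<And>x. x \<notin> C \<Longrightarrow> \<kappa> x = 0"
    and "open V" "open W" "smooth_fun \<A> (V \<inter> W) f"
  shows "smooth_fun \<A> W (\<lambda>x. \<kappa> x *\<^sub>R f x)"
proof -
  have "smooth_fun \<A> (V \<inter> W) (\<lambda>x. \<kappa> x *\<^sub>R f x)"
    using assms by (intro smooth_fun_scaleR smooth_fun_subset[OF assms(1)]) auto
  \<comment> \<open>Off the support the product is the zero function, whatever values
    \<open>f\<close> takes outside \<open>V\<close>.\<close>
  moreover have "smooth_fun \<A> (W - C) (\<lambda>x. \<kappa> x *\<^sub>R f x)"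
    by (subst smooth_fun_cong[of _ _ "\<lambda>x. 0"]) (use assms in \<open>auto intro: smooth_fun_const\<close>)
  ultimately have "smooth_fun \<A> (V \<inter> W \<union> (W - C)) (\<lambda>x. \<kappa> x *\<^sub>R f x)"
    by (rule smooth_fun_Un) (use assms in auto)
  then show ?thesis by (rule smooth_fun_subset) (use assms in auto)
qed

lemma coord_cball_compact:
  assumes "\<phi> \<in> coords \<A>" "cball c b \<subseteq> snd \<phi> ` fst \<phi>"
  shows "compact (chart_inv \<phi> ` cball c b)" "chart_inv \<phi> ` cball c b \<subseteq> fst \<phi>"
    "chart_inv \<phi> ` cball c b = {x \<in> fst \<phi>. dist c (snd \<phi> x) \<le> b}"
proof -
  show "compact (chart_inv \<phi> ` cball c b)"
    by (intro compact_continuous_image continuous_on_subset[OF coord_inv_continuous[OF assms(1)] assms(2)]) auto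
  show "chart_inv \<phi> ` cball c b \<subseteq> fst \<phi>" using assms coord_inv_mem by blast
  show "chart_inv \<phi> ` cball c b = {x \<in> fst \<phi>. dist c (snd \<phi> x) \<le> b}" (is "?L = ?R")
  proof
    show "?L \<subseteq> ?R" using assms coord_inv_mem coord_inv_image by (auto simp: subset_iff)
    show "?R \<subseteq> ?L" using assms(1) by (auto intro!: image_eqI[of _ _ "snd \<phi> _"])
  qed
qed

text \<open>A planar bump pulled back by the coordinate. Extension by 0 stays smooth because the
  preimage of the closed ball is compact, hence closed in the Hausdorff surface.\<close>

lemma bump_exists:
  assumes "\<phi> \<in> coords \<A>" "0 < a" "a < b" "cball c b \<subseteq> snd \<phi> ` fst \<phi>"
  obtains \<kappa> :: "'a \<Rightarrow> real" where "smooth_fun \<A> UNIV \<kappa>" "\<And>x. 0 \<le> \<kappa> x" "\<And>x. \<kappa> x \<le> 1"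
    "\<And>x. x \<in> fst \<phi> \<Longrightarrow> dist c (snd \<phi> x) \<le> a \<Longrightarrow> \<kappa> x = 1"
    "\<And>x. x \<notin> {x \<in> fst \<phi>. dist c (snd \<phi> x) < b} \<Longrightarrow> \<kappa> x = 0"
proof -
  obtain \<beta> :: "complex \<Rightarrow> real" where \<beta>: "planar_smooth UNIV \<beta>" "\<And>p. 0 \<le> \<beta> p" "\<And>p. \<beta> p \<le> 1"
    "\<And>p. dist c p \<le> a \<Longrightarrow> \<beta> p = 1" "\<And>p. dist c p \<ge> b \<Longrightarrow> \<beta> p = 0"
    using planar_bump_exists[OF assms(2,3)] by blast
  let ?C = "chart_inv \<phi> ` cball c b"
  note C = coord_cball_compact[OF assms(1,4)]
  define \<kappa> where "\<kappa> x = (if x \<in> fst \<phi> then \<beta> (snd \<phi> x) else 0)" for x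
  have 0: "\<kappa> x = 0" if "x \<notin> {x \<in> fst \<phi>. dist c (snd \<phi> x) < b}" for x
    using that \<beta>(5) by (auto simp: \<kappa>_def)
  have "smooth_fun \<A> (fst \<phi>) \<kappa>"
  proof (rule smooth_fun_local)
    fix x assume x: "x \<in> fst \<phi>"
    have "cont_diff_on k (snd \<phi> ` (fst \<phi> \<inter> UNIV)) (in_coord \<phi> \<kappa>) \<longleftrightarrow> cont_diff_on k (snd \<phi> ` (fst \<phi> \<inter> UNIV)) \<beta>" for k
      using assms(1) coord_inv_mem by (intro cont_diff_on_cong coord_open_image) (auto simp: in_coord_def \<kappa>_def)
    then show "\<exists>\<phi>\<in>coords \<A>. \<exists>W'. open W' \<and> x \<in> W' \<and> x \<in> fst \<phi> \<and>
      (\<forall>k. cont_diff_on k (snd \<phi> ` (fst \<phi> \<inter> W')) (in_coord \<phi> \<kappa>))"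
      using \<beta>(1) x assms(1) cont_diff_on_subset[of _ UNIV \<beta>] unfolding planar_smooth_def
      by (intro bexI[of _ \<phi>] exI[of _ UNIV]) auto
  qed
  moreover have "smooth_fun \<A> (- ?C) \<kappa>"
    using compact_imp_closed[OF C(1)] 0
    by (subst smooth_fun_cong[of _ _ "\<lambda>x. 0"]) (auto intro: smooth_fun_const simp: C(3))
  ultimately have "smooth_fun \<A> (fst \<phi> \<union> - ?C) \<kappa>"
    using compact_imp_closed[OF C(1)] coord_open[OF assms(1)] by (intro smooth_fun_Un) auto
  then have "smooth_fun \<A> UNIV \<kappa>" by (rule smooth_fun_subset) (use C(2) in auto)
  then show ?thesis by (rule that) (use \<beta> 0 in \<open>auto simp: \<kappa>_def\<close>)
qed

lemma bump_at_exists: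
  assumes "open V" "x \<in> V"
  obtains \<kappa> :: "'a \<Rightarrow> real" and N C where "smooth_fun \<A> UNIV \<kappa>" "\<And>y. 0 \<le> \<kappa> y" "\<And>y. \<kappa> y \<le> 1"
    "open N" "x \<in> N" "\<And>y. y \<in> N \<Longrightarrow> \<kappa> y = 1" "compact C" "C \<subseteq> V" "\<And>y. y \<notin> C \<Longrightarrow> \<kappa> y = 0"
proof -
  obtain \<phi> where \<phi>: "\<phi> \<in> coords \<A>" "x \<in> fst \<phi>" by (rule coords_cover)
  have "open (snd \<phi> ` (fst \<phi> \<inter> V))" by (rule coord_open_image[OF \<phi>(1) assms(1)])
  then obtain b where b: "b > 0" "cball (snd \<phi> x) b \<subseteq> snd \<phi> ` (fst \<phi> \<inter> V)"
    using \<phi> assms(2) open_contains_cball by blast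
  then have b': "cball (snd \<phi> x) b \<subseteq> snd \<phi> ` fst \<phi>" by auto
  obtain \<kappa> :: "'a \<Rightarrow> real" where \<kappa>: "smooth_fun \<A> UNIV \<kappa>" "\<And>y. 0 \<le> \<kappa> y" "\<And>y. \<kappa> y \<le> 1"
    "\<And>y. y \<in> fst \<phi> \<Longrightarrow> dist (snd \<phi> x) (snd \<phi> y) \<le> b/2 \<Longrightarrow> \<kappa> y = 1"
    "\<And>y. y \<notin> {y \<in> fst \<phi>. dist (snd \<phi> x) (snd \<phi> y) < b} \<Longrightarrow> \<kappa> y = 0"
    using bump_exists[OF \<phi>(1) _ _ b', of "b/2"] b(1) by auto
  note C = coord_cball_compact[OF \<phi>(1) b']
  have "chart_inv \<phi> ` cball (snd \<phi> x) b \<subseteq> V"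
    using b(2) \<phi>(1) by (force simp: subset_iff)
  moreover have "open {y \<in> fst \<phi>. snd \<phi> y \<in> ball (snd \<phi> x) (b/2)}"
    by (rule coord_open_preimage[OF \<phi>(1)]) auto
  ultimately show ?thesis
    using \<phi> b(1) C by (intro that[of \<kappa> "{y \<in> fst \<phi>. snd \<phi> y \<in> ball (snd \<phi> x) (b/2)}" "chart_inv \<phi> ` cball (snd \<phi> x) b"] \<kappa>)
      auto
qed

lemma partition_of_unity:
  fixes V :: "nat \<Rightarrow> 'a set"
  assumes "\<And>i. i < n \<Longrightarrow> open (V i)" "(\<Union>i<n. V i) = UNIV"
  obtains \<kappa> :: "nat \<Rightarrow> 'a \<Rightarrow> real" and C where
    "\<And>i. smooth_fun \<A> UNIV (\<kappa> i)" "\<And>x. (\<Sum>i<n. \<kappa> i x) = 1"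
    "\<And>i. i < n \<Longrightarrow> compact (C i)" "\<And>i. i < n \<Longrightarrow> C i \<subseteq> V i"
    "\<And>i x. i < n \<Longrightarrow> x \<notin> C i \<Longrightarrow> \<kappa> i x = 0"
proof -
  have "\<exists>i<n. x \<in> V i" for x using assms(2) by blast
  then obtain idx where idx: "\<And>x. idx x < n" "\<And>x. x \<in> V (idx x)" by metis
  have "\<exists>\<tau> N C. smooth_fun \<A> UNIV \<tau> \<and> (\<forall>y. 0 \<le> \<tau> y) \<and> open N \<and> x \<in> N \<and> (\<forall>y\<in>N. \<tau> y = (1::real)) \<and>
      compact C \<and> C \<subseteq> V (idx x) \<and> (\<forall>y. y \<notin> C \<longrightarrow> \<tau> y = 0)" for x
    by (rule bump_at_exists[OF assms(1)[OF idx(1)] idx(2), of x]) blast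
  then obtain \<tau> :: "'a \<Rightarrow> 'a \<Rightarrow> real" and N C where
    \<tau>: "\<And>x. smooth_fun \<A> UNIV (\<tau> x)" "\<And>x y. 0 \<le> \<tau> x y" "\<And>x. open (N x)" "\<And>x. x \<in> N x"
      "\<And>x y. y \<in> N x \<Longrightarrow> \<tau> x y = 1" "\<And>x. compact (C x)" "\<And>x. C x \<subseteq> V (idx x)"
      "\<And>x y. y \<notin> C x \<Longrightarrow> \<tau> x y = 0"
    by metis
  \<comment> \<open>Compactness leaves finitely many bumps. Every point lies where one of them
    equals 1, so their sum is positive and can be divided by.\<close>
  obtain F where F: "finite F" "UNIV \<subseteq> (\<Union>x\<in>F. N x)"
    by (rule compactE_image[OF compact_UNIV, of UNIV N]) (use \<tau>(3,4) in auto)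
  define B where "B y = (\<Sum>x\<in>F. \<tau> x y)" for y
  have B: "B y > 0" for y
  proof -
    obtain x where "x \<in> F" "y \<in> N x" using F(2) by auto
    then show ?thesis unfolding B_def using F(1) \<tau>(2,5) by (intro sum_pos2[of F x]) auto
  qed
  have Bs: "smooth_fun \<A> UNIV B" unfolding B_def[abs_def] by (intro smooth_fun_sum \<tau>) auto
  \<comment> \<open>The bumps are grouped by the member of the cover assigned to their centre, which
    gives one function per index; an index assigned to no centre gets the zero function.\<close>
  define \<kappa> where "\<kappa> i y = (\<Sum>x\<in>{x\<in>F. idx x = i}. \<tau> x y) * inverse (B y)" for i y
  have "smooth_fun \<A> UNIV (\<kappa> i)" for i
    unfolding \<kappa>_def[abs_def] using B by (intro smooth_fun_mult smooth_fun_sum smooth_fun_inverse \<tau> Bs) (auto simp: less_imp_neq[symmetric])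
  moreover have "(\<Sum>i<n. \<kappa> i y) = 1" for y
  proof -
    have "(\<Sum>i<n. \<Sum>x\<in>{x\<in>F. idx x = i}. \<tau> x y) = B y"
      unfolding B_def using F(1) idx(1) by (intro sum.group) auto
    then show ?thesis using B[of y] by (simp add: \<kappa>_def sum_distrib_right[symmetric])
  qed
  moreover have "compact (\<Union>x\<in>{x\<in>F. idx x = i}. C x)" for i
    using F(1) \<tau>(6) by (intro compact_UN) auto
  moreover have "(\<Union>x\<in>{x\<in>F. idx x = i}. C x) \<subseteq> V i" for i using \<tau>(7) by auto
  moreover have "\<kappa> i y = 0" if "y \<notin> (\<Union>x\<in>{x\<in>F. idx x = i}. C x)" for i y
    using that \<tau>(8) by (auto simp: \<kappa>_def intro!: sum.neutral)
  ultimately show ?thesis by (intro that[of \<kappa> "\<lambda>i. \<Union>x\<in>{x\<in>F. idx x = i}. C x"]) auto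
qed

end

section \<open>Differential forms\<close>

text \<open>The coefficient of the product with respect to dz \<and> dzbar.\<close>

definition wedge :: "complex \<times> complex \<Rightarrow> complex \<times> complex \<Rightarrow> complex" where
  "wedge u v = fst u * snd v - snd u * fst v"

context complex_surface
begin

lemma smooth_fun_Pair:
  assumes "open W" "smooth_fun \<A> W f" "smooth_fun \<A> W g"
  shows "smooth_fun \<A> W (\<lambda>x. (f x, g x))"
proof -
  have "bounded_linear (\<lambda>x::'b. (x, 0::'c))" "bounded_linear (\<lambda>x::'c. (0::'b, x))"
    by (intro bounded_linear_Pair bounded_linear_ident bounded_linear_zero)+
  then have "smooth_fun \<A> W (\<lambda>x. (f x, 0) + (0, g x))"
    by (intro smooth_fun_add assms(1) smooth_fun_linear[OF assms(1) _ assms(2), of "\<lambda>x. (x, 0)"]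
          smooth_fun_linear[OF assms(1) _ assms(3), of "\<lambda>x. (0, x)"])
  then show ?thesis by simp
qed

section \<open>Transformation laws and gluing of smooth forms\<close>

lemma smooth_form1_change:
  assumes "smooth_form1 \<A> W \<eta>" "\<phi> \<in> coords \<A>" "\<psi> \<in> coords \<A>" "x \<in> fst \<phi>" "x \<in> fst \<psi>" "x \<in> W"
  shows "\<eta> \<psi> x = (fst (\<eta> \<phi> x) * jac \<phi> \<psi> x, snd (\<eta> \<phi> x) * cnj (jac \<phi> \<psi> x))"
proof -
  note H = conjunct1[OF assms(1)[unfolded smooth_form1_def], rule_format, OF assms(2,3)]
  show ?thesis by (rule H) (simp add: assms)
qed

lemma smooth_form1_smooth:
  "smooth_form1 \<A> W \<eta> \<Longrightarrow> \<phi> \<in> coords \<A> \<Longrightarrow> smooth_fun \<A> (fst \<phi> \<inter> W) (\<eta> \<phi>)"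
  unfolding smooth_form1_def by blast

lemma smooth_form1_fst_snd:
  assumes "smooth_form1 \<A> W \<eta>" "\<phi> \<in> coords \<A>" "open W"
  shows "smooth_fun \<A> (fst \<phi> \<inter> W) (\<lambda>x. fst (\<eta> \<phi> x))" "smooth_fun \<A> (fst \<phi> \<inter> W) (\<lambda>x. snd (\<eta> \<phi> x))"
proof -
  have o: "open (fst \<phi> \<inter> W)" using coord_open[OF assms(2)] assms(3) by auto
  note s = smooth_form1_smooth[OF assms(1,2)]
  show "smooth_fun \<A> (fst \<phi> \<inter> W) (\<lambda>x. fst (\<eta> \<phi> x))" "smooth_fun \<A> (fst \<phi> \<inter> W) (\<lambda>x. snd (\<eta> \<phi> x))"
    by (rule smooth_fun_linear[OF o bounded_linear_fst s], rule smooth_fun_linear[OF o bounded_linear_snd s])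
qed

lemma smooth_form1_subset:
  assumes "smooth_form1 \<A> W \<eta>" "W' \<subseteq> W"
  shows "smooth_form1 \<A> W' \<eta>"
proof -
  have "smooth_fun \<A> (fst \<phi> \<inter> W') (\<eta> \<phi>)" if "\<phi> \<in> coords \<A>" for \<phi>
    using smooth_fun_subset[OF smooth_form1_smooth[OF assms(1) that], of "fst \<phi> \<inter> W'"] assms(2) by auto
  then show ?thesis using assms unfolding smooth_form1_def by blast
qed

lemma smooth_form1_local:
  assumes "\<And>x. x \<in> W \<Longrightarrow> \<exists>W'. open W' \<and> x \<in> W' \<and> smooth_form1 \<A> W' \<eta>"
  shows "smooth_form1 \<A> W \<eta>"
proof -
  have "smooth_fun \<A> (fst \<phi> \<inter> W) (\<eta> \<phi>)" if \<phi>: "\<phi> \<in> coords \<A>" for \<phi>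
  proof (rule smooth_fun_local)
    fix x assume x: "x \<in> fst \<phi> \<inter> W"
    then obtain W' where "open W'" "x \<in> W'" "smooth_form1 \<A> W' \<eta>" using assms by blast
    then have W': "open W'" "x \<in> W'" "smooth_fun \<A> (fst \<phi> \<inter> W') (\<eta> \<phi>)"
      using \<phi> smooth_form1_smooth by auto
    have "\<forall>k. cont_diff_on k (snd \<phi> ` (fst \<phi> \<inter> (fst \<phi> \<inter> W'))) (in_coord \<phi> (\<eta> \<phi>))"
      using W'(3) \<phi> unfolding smooth_fun_def by blast
    then show "\<exists>\<phi>'\<in>coords \<A>. \<exists>W'. open W' \<and> x \<in> W' \<and> x \<in> fst \<phi>' \<and>
      (\<forall>k. cont_diff_on k (snd \<phi>' ` (fst \<phi>' \<inter> W')) (in_coord \<phi>' (\<eta> \<phi>)))"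
      using \<phi> x W' by (intro bexI[of _ \<phi>] exI[of _ W']) (auto simp: Int_absorb)
  qed
  then show ?thesis using assms unfolding smooth_form1_def by blast
qed

lemma smooth_form1_cong:
  assumes "open W" "\<And>\<phi> x. \<phi> \<in> coords \<A> \<Longrightarrow> x \<in> fst \<phi> \<Longrightarrow> x \<in> W \<Longrightarrow> \<eta> \<phi> x = \<zeta> \<phi> x"
  shows "smooth_form1 \<A> W \<eta> \<longleftrightarrow> smooth_form1 \<A> W \<zeta>"
proof -
  have "smooth_fun \<A> (fst \<phi> \<inter> W) (\<eta> \<phi>) \<longleftrightarrow> smooth_fun \<A> (fst \<phi> \<inter> W) (\<zeta> \<phi>)" if "\<phi> \<in> coords \<A>" for \<phi>
    using assms that coord_open[OF that] by (intro smooth_fun_cong) auto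
  then show ?thesis using assms(2) unfolding smooth_form1_def by auto
qed

lemma smooth_form1_zero: "smooth_form1 \<A> W (\<lambda>\<phi> x. 0)"
  by (simp add: smooth_form1_def smooth_fun_const zero_prod_def)

lemma smooth_form1_add:
  assumes "open W" "smooth_form1 \<A> W \<eta>" "smooth_form1 \<A> W \<zeta>"
  shows "smooth_form1 \<A> W (\<lambda>\<phi> x. \<eta> \<phi> x + \<zeta> \<phi> x)"
  unfolding smooth_form1_def
proof (intro conjI ballI)
  fix \<phi> \<psi> x assume *: "\<phi> \<in> coords \<A>" "\<psi> \<in> coords \<A>" "x \<in> fst \<phi> \<inter> fst \<psi> \<inter> W"
  show "\<eta> \<psi> x + \<zeta> \<psi> x = (fst (\<eta> \<phi> x + \<zeta> \<phi> x) * jac \<phi> \<psi> x, snd (\<eta> \<phi> x + \<zeta> \<phi> x) * cnj (jac \<phi> \<psi> x))"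
    using smooth_form1_change[OF assms(2) *(1,2)] smooth_form1_change[OF assms(3) *(1,2)] *(3)
    by (auto simp: algebra_simps)
next
  fix \<phi> assume \<phi>: "\<phi> \<in> coords \<A>"
  show "smooth_fun \<A> (fst \<phi> \<inter> W) (\<lambda>x. \<eta> \<phi> x + \<zeta> \<phi> x)"
    using coord_open[OF \<phi>] assms(1)
    by (intro smooth_fun_add smooth_form1_smooth[OF assms(2) \<phi>] smooth_form1_smooth[OF assms(3) \<phi>]) auto
qed

lemma smooth_form1_scaleR:
  assumes "open W" "smooth_fun \<A> W c" "smooth_form1 \<A> W \<eta>"
  shows "smooth_form1 \<A> W (\<lambda>\<phi> x. c x *\<^sub>R \<eta> \<phi> x)"
  unfolding smooth_form1_def
proof (intro conjI ballI)
  fix \<phi> \<psi> x assume *: "\<phi> \<in> coords \<A>" "\<psi> \<in> coords \<A>" "x \<in> fst \<phi> \<inter> fst \<psi> \<inter> W"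
  show "c x *\<^sub>R \<eta> \<psi> x = (fst (c x *\<^sub>R \<eta> \<phi> x) * jac \<phi> \<psi> x, snd (c x *\<^sub>R \<eta> \<phi> x) * cnj (jac \<phi> \<psi> x))"
    using smooth_form1_change[OF assms(3) *(1,2)] *(3) by auto
next
  fix \<phi> assume \<phi>: "\<phi> \<in> coords \<A>"
  show "smooth_fun \<A> (fst \<phi> \<inter> W) (\<lambda>x. c x *\<^sub>R \<eta> \<phi> x)"
    using coord_open[OF \<phi>] assms(1)
    by (intro smooth_fun_scaleR smooth_form1_smooth[OF assms(3) \<phi>] smooth_fun_subset[OF assms(2)]) auto
qed

lemma smooth_form1_diff:
  assumes "open W" "smooth_form1 \<A> W \<eta>" "smooth_form1 \<A> W \<zeta>"
  shows "smooth_form1 \<A> W (\<lambda>\<phi> x. \<eta> \<phi> x - \<zeta> \<phi> x)"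
  using smooth_form1_add[OF assms(1,2) smooth_form1_scaleR[OF assms(1) smooth_fun_const[of W "-1"] assms(3)]]
  by simp

lemma smooth_form1_sum:
  "open W \<Longrightarrow> (\<And>i. i \<in> I \<Longrightarrow> smooth_form1 \<A> W (\<eta> i)) \<Longrightarrow> smooth_form1 \<A> W (\<lambda>\<phi> x. \<Sum>i\<in>I. \<eta> i \<phi> x)"
  by (induction I rule: infinite_finite_induct) (auto simp: smooth_form1_zero intro: smooth_form1_add)

lemma smooth_form1_cutoff:
  fixes \<kappa> :: "'a \<Rightarrow> real"
  assumes "smooth_fun \<A> UNIV \<kappa>" "closed C" "C \<subseteq> V" "\<And>x. x \<notin> C \<Longrightarrow> \<kappa> x = 0"
    and "open V" "open W" "smooth_form1 \<A> (V \<inter> W) \<eta>"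
  shows "smooth_form1 \<A> W (\<lambda>\<phi> x. \<kappa> x *\<^sub>R \<eta> \<phi> x)"
proof (rule smooth_form1_local)
  fix x assume x: "x \<in> W"
  show "\<exists>W'. open W' \<and> x \<in> W' \<and> smooth_form1 \<A> W' (\<lambda>\<phi> x. \<kappa> x *\<^sub>R \<eta> \<phi> x)"
  proof (cases "x \<in> C")
    case True
    then show ?thesis using assms x
      by (intro exI[of _ "V \<inter> W"] conjI smooth_form1_scaleR smooth_fun_subset[OF assms(1)]) auto
  next
    case False
    have "smooth_form1 \<A> (- C) (\<lambda>\<phi> x. \<kappa> x *\<^sub>R \<eta> \<phi> x)"
      by (subst smooth_form1_cong[of _ _ "\<lambda>\<phi> x. 0"]) (use assms in \<open>auto simp: smooth_form1_zero\<close>)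
    then show ?thesis using False assms(2) by (intro exI[of _ "- C"]) auto
  qed
qed

lemma
  assumes "open W" "smooth_fun \<A> W f"
  shows smooth_form1_d0: "smooth_form1 \<A> W (d0 f)"
    and smooth_form1_dc: "smooth_form1 \<A> W (dc f)"
    and smooth_form1_del: "smooth_form1 \<A> W (del f)"
proof -
  have o: "open (fst \<phi> \<inter> W)" if "\<phi> \<in> coords \<A>" for \<phi> using coord_open[OF that] assms(1) by auto
  have c: "pd_z \<psi> f x = pd_z \<phi> f x * jac \<phi> \<psi> x" "pd_zbar \<psi> f x = pd_zbar \<phi> f x * cnj (jac \<phi> \<psi> x)"
    if "\<phi> \<in> coords \<A>" "\<psi> \<in> coords \<A>" "x \<in> fst \<phi> \<inter> fst \<psi> \<inter> W" for \<phi> \<psi> x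
    using pd_z_change[OF that(1,2) _ _ smooth_fun_differentiable[OF assms(2) that(1)]]
      pd_zbar_change[OF that(1,2) _ _ smooth_fun_differentiable[OF assms(2) that(1)]] that(3) by auto
  have s: "smooth_fun \<A> (fst \<phi> \<inter> W) (\<lambda>x. (pd_z \<phi> f x, pd_zbar \<phi> f x))"
    "smooth_fun \<A> (fst \<phi> \<inter> W) (\<lambda>x. (pd_z \<phi> f x, - pd_zbar \<phi> f x))"
    "smooth_fun \<A> (fst \<phi> \<inter> W) (\<lambda>x. (pd_z \<phi> f x, 0 :: complex))" if "\<phi> \<in> coords \<A>" for \<phi>
    by (intro smooth_fun_Pair smooth_fun_minus smooth_fun_const o that smooth_fun_pd_z[OF assms(2) _ assms(1)]
            smooth_fun_pd_zbar[OF assms(2) _ assms(1)])+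
  show "smooth_form1 \<A> W (d0 f)"
    unfolding smooth_form1_def d0_def[abs_def]
  proof (intro conjI ballI, goal_cases)
    case (1 \<phi> \<psi> x)
    then show ?case using c[of \<phi> \<psi> x] by simp
  qed (rule s(1))
  show "smooth_form1 \<A> W (dc f)"
    unfolding smooth_form1_def dc_def[abs_def]
  proof (intro conjI ballI, goal_cases)
    case (1 \<phi> \<psi> x)
    then show ?case using c[of \<phi> \<psi> x] by simp
  qed (rule s(2))
  show "smooth_form1 \<A> W (del f)"
    unfolding smooth_form1_def del_def[abs_def]
  proof (intro conjI ballI, goal_cases)
    case (1 \<phi> \<psi> x)
    then show ?case using c[of \<phi> \<psi> x] by simp
  qed (rule s(3))
qed

lemma smooth_form2_change:
  assumes "smooth_form2 \<A> W \<omega>" "\<phi> \<in> coords \<A>" "\<psi> \<in> coords \<A>" "x \<in> fst \<phi>" "x \<in> fst \<psi>" "x \<in> W"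
  shows "\<omega> \<psi> x = \<omega> \<phi> x * of_real ((cmod (jac \<phi> \<psi> x))\<^sup>2)"
proof -
  note H = conjunct1[OF assms(1)[unfolded smooth_form2_def], rule_format, OF assms(2,3)]
  show ?thesis by (rule H) (simp add: assms)
qed

lemma smooth_form2_smooth:
  "smooth_form2 \<A> W \<omega> \<Longrightarrow> \<phi> \<in> coords \<A> \<Longrightarrow> smooth_fun \<A> (fst \<phi> \<inter> W) (\<omega> \<phi>)"
  unfolding smooth_form2_def by blast

lemma smooth_form2_subset:
  assumes "smooth_form2 \<A> W \<eta>" "W' \<subseteq> W"
  shows "smooth_form2 \<A> W' \<eta>"
proof -
  have "smooth_fun \<A> (fst \<phi> \<inter> W') (\<eta> \<phi>)" if "\<phi> \<in> coords \<A>" for \<phi>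
    using smooth_fun_subset[OF smooth_form2_smooth[OF assms(1) that], of "fst \<phi> \<inter> W'"] assms(2) by auto
  then show ?thesis using assms unfolding smooth_form2_def by blast
qed

lemma smooth_form2_local:
  assumes "\<And>x. x \<in> W \<Longrightarrow> \<exists>W'. open W' \<and> x \<in> W' \<and> smooth_form2 \<A> W' \<eta>"
  shows "smooth_form2 \<A> W \<eta>"
proof -
  have "smooth_fun \<A> (fst \<phi> \<inter> W) (\<eta> \<phi>)" if \<phi>: "\<phi> \<in> coords \<A>" for \<phi>
  proof (rule smooth_fun_local)
    fix x assume x: "x \<in> fst \<phi> \<inter> W"
    then obtain W' where "open W'" "x \<in> W'" "smooth_form2 \<A> W' \<eta>" using assms by blast
    then have W': "open W'" "x \<in> W'" "smooth_fun \<A> (fst \<phi> \<inter> W') (\<eta> \<phi>)"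
      using \<phi> smooth_form2_smooth by auto
    have "\<forall>k. cont_diff_on k (snd \<phi> ` (fst \<phi> \<inter> (fst \<phi> \<inter> W'))) (in_coord \<phi> (\<eta> \<phi>))"
      using W'(3) \<phi> unfolding smooth_fun_def by blast
    then show "\<exists>\<phi>'\<in>coords \<A>. \<exists>W'. open W' \<and> x \<in> W' \<and> x \<in> fst \<phi>' \<and>
      (\<forall>k. cont_diff_on k (snd \<phi>' ` (fst \<phi>' \<inter> W')) (in_coord \<phi>' (\<eta> \<phi>)))"
      using \<phi> x W' by (intro bexI[of _ \<phi>] exI[of _ W']) (auto simp: Int_absorb)
  qed
  then show ?thesis using assms unfolding smooth_form2_def by blast
qed

lemma smooth_form2_cong:
  assumes "open W" "\<And>\<phi> x. \<phi> \<in> coords \<A> \<Longrightarrow> x \<in> fst \<phi> \<Longrightarrow> x \<in> W \<Longrightarrow> \<eta> \<phi> x = \<zeta> \<phi> x"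
  shows "smooth_form2 \<A> W \<eta> \<longleftrightarrow> smooth_form2 \<A> W \<zeta>"
proof -
  have "smooth_fun \<A> (fst \<phi> \<inter> W) (\<eta> \<phi>) \<longleftrightarrow> smooth_fun \<A> (fst \<phi> \<inter> W) (\<zeta> \<phi>)" if "\<phi> \<in> coords \<A>" for \<phi>
    using assms that coord_open[OF that] by (intro smooth_fun_cong) auto
  then show ?thesis using assms(2) unfolding smooth_form2_def by auto
qed

lemma smooth_form2_add:
  assumes "open W" "smooth_form2 \<A> W \<eta>" "smooth_form2 \<A> W \<zeta>"
  shows "smooth_form2 \<A> W (\<lambda>\<phi> x. \<eta> \<phi> x + \<zeta> \<phi> x)"
  unfolding smooth_form2_def
proof (intro conjI ballI)
  fix \<phi> \<psi> x assume *: "\<phi> \<in> coords \<A>" "\<psi> \<in> coords \<A>" "x \<in> fst \<phi> \<inter> fst \<psi> \<inter> W"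
  show "\<eta> \<psi> x + \<zeta> \<psi> x = (\<eta> \<phi> x + \<zeta> \<phi> x) * of_real ((cmod (jac \<phi> \<psi> x))\<^sup>2)"
    using smooth_form2_change[OF assms(2) *(1,2)] smooth_form2_change[OF assms(3) *(1,2)] *(3)
    by (auto simp: algebra_simps)
next
  fix \<phi> assume \<phi>: "\<phi> \<in> coords \<A>"
  show "smooth_fun \<A> (fst \<phi> \<inter> W) (\<lambda>x. \<eta> \<phi> x + \<zeta> \<phi> x)"
    using coord_open[OF \<phi>] assms(1)
    by (intro smooth_fun_add smooth_form2_smooth[OF assms(2) \<phi>] smooth_form2_smooth[OF assms(3) \<phi>]) auto
qed

lemma smooth_form2_mult:
  assumes "open W" "smooth_fun \<A> W c" "smooth_form2 \<A> W \<eta>"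
  shows "smooth_form2 \<A> W (\<lambda>\<phi> x. c x * \<eta> \<phi> x)"
  unfolding smooth_form2_def
proof (intro conjI ballI)
  fix \<phi> \<psi> x assume *: "\<phi> \<in> coords \<A>" "\<psi> \<in> coords \<A>" "x \<in> fst \<phi> \<inter> fst \<psi> \<inter> W"
  show "c x * \<eta> \<psi> x = (c x * \<eta> \<phi> x) * of_real ((cmod (jac \<phi> \<psi> x))\<^sup>2)"
    using smooth_form2_change[OF assms(3) *(1,2)] *(3) by auto
next
  fix \<phi> assume \<phi>: "\<phi> \<in> coords \<A>"
  show "smooth_fun \<A> (fst \<phi> \<inter> W) (\<lambda>x. c x * \<eta> \<phi> x)"
    using coord_open[OF \<phi>] assms(1)
    by (intro smooth_fun_mult smooth_form2_smooth[OF assms(3) \<phi>] smooth_fun_subset[OF assms(2)]) auto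
qed

lemma holo_fun_jac:
  assumes "\<phi> \<in> coords \<A>" "\<psi> \<in> coords \<A>"
  shows "holo_fun \<A> (fst \<phi> \<inter> fst \<psi>) (jac \<phi> \<psi>)"
  unfolding holo_fun_def
proof
  fix \<xi> assume \<xi>: "\<xi> \<in> coords \<A>"
  let ?h = "deriv (in_coord \<psi> (snd \<phi>))"
  have h: "?h holomorphic_on (snd \<psi> ` (fst \<psi> \<inter> fst \<phi>))"
    using transition_holomorphic[OF assms(2,1)] coord_open_image[OF assms(2) coord_open[OF assms(1)]]
    unfolding in_coord_def by (rule holomorphic_deriv)
  have 1: "(snd \<psi> \<circ> chart_inv \<xi>) holomorphic_on (snd \<xi> ` (fst \<xi> \<inter> (fst \<phi> \<inter> fst \<psi>)))"
    by (rule holomorphic_on_subset[OF transition_holomorphic[OF \<xi> assms(2)]]) auto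
  have "(?h \<circ> (snd \<psi> \<circ> chart_inv \<xi>)) holomorphic_on (snd \<xi> ` (fst \<xi> \<inter> (fst \<phi> \<inter> fst \<psi>)))"
    by (rule holomorphic_on_compose_gen[OF 1 h]) (use \<xi> in auto)
  then show "in_coord \<xi> (jac \<phi> \<psi>) holomorphic_on (snd \<xi> ` (fst \<xi> \<inter> (fst \<phi> \<inter> fst \<psi>)))"
    by (simp add: in_coord_def jac_def[abs_def] o_def)
qed

section \<open>The exterior derivative and its product rules\<close>

lemma d1_cong:
  assumes "open W" "\<And>\<phi> x. \<phi> \<in> coords \<A> \<Longrightarrow> x \<in> fst \<phi> \<Longrightarrow> x \<in> W \<Longrightarrow> \<eta> \<phi> x = \<zeta> \<phi> x"
    "\<phi> \<in> coords \<A>" "x \<in> fst \<phi>" "x \<in> W"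
  shows "d1 \<eta> \<phi> x = d1 \<zeta> \<phi> x"
proof -
  have o: "open (fst \<phi> \<inter> W)" using coord_open[OF assms(3)] assms(1) by auto
  have "pd_z \<phi> (\<lambda>y. snd (\<eta> \<phi> y)) x = pd_z \<phi> (\<lambda>y. snd (\<zeta> \<phi> y)) x"
    "pd_zbar \<phi> (\<lambda>y. fst (\<eta> \<phi> y)) x = pd_zbar \<phi> (\<lambda>y. fst (\<zeta> \<phi> y)) x"
    using assms(3-5) by (auto simp: assms(2) intro!: pd_z_cong[OF o] pd_zbar_cong[OF o])
  then show ?thesis by (simp add: d1_def)
qed

lemma
  assumes "open W" "\<And>y. y \<in> W \<Longrightarrow> f y = g y" "\<phi> \<in> coords \<A>" "x \<in> fst \<phi>" "x \<in> W"
  shows d0_cong: "d0 f \<phi> x = d0 g \<phi> x" and dc_cong: "dc f \<phi> x = dc g \<phi> x"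
    and dbar_del_cong: "dbar_del f \<phi> x = dbar_del g \<phi> x"
proof -
  have c: "pd_z \<phi> f y = pd_z \<phi> g y" "pd_zbar \<phi> f y = pd_zbar \<phi> g y" if "y \<in> fst \<phi>" "y \<in> W" for y
    by (rule pd_z_cong[OF assms(1) _ assms(3) that], rule assms(2), assumption)
       (rule pd_zbar_cong[OF assms(1) _ assms(3) that], rule assms(2), assumption)
  show "d0 f \<phi> x = d0 g \<phi> x" "dc f \<phi> x = dc g \<phi> x"
    using c[OF assms(4-5)] by (auto simp: d0_def dc_def)
  have o: "open (fst \<phi> \<inter> W)" using coord_open[OF assms(3)] assms(1) by auto
  show "dbar_del f \<phi> x = dbar_del g \<phi> x"
    unfolding dbar_del_def using pd_zbar_cong[OF o, of "pd_z \<phi> f" "pd_z \<phi> g"] c(1) assms(3-5) by auto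
qed

text \<open>The Jacobian enters the coefficients as J and as its conjugate. It is holomorphic, so
  the terms in which it is differentiated drop out, and both remaining terms acquire the factor
  |J|^2.\<close>

lemma d1_change:
  assumes "open W" "smooth_form1 \<A> W \<eta>" "\<phi> \<in> coords \<A>" "\<psi> \<in> coords \<A>" "x \<in> fst \<phi>" "x \<in> fst \<psi>" "x \<in> W"
  shows "d1 \<eta> \<psi> x = d1 \<eta> \<phi> x * of_real ((cmod (jac \<phi> \<psi> x))\<^sup>2)"
proof -
  let ?W = "fst \<phi> \<inter> fst \<psi> \<inter> W" and ?J = "jac \<phi> \<psi>"
  have W: "open ?W" using coord_open[OF assms(3)] coord_open[OF assms(4)] assms(1) by auto
  have x: "x \<in> ?W" using assms by auto
  have s: "smooth_fun \<A> ?W (\<lambda>y. fst (\<eta> \<phi> y))" "smooth_fun \<A> ?W (\<lambda>y. snd (\<eta> \<phi> y))"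
    by (rule smooth_fun_subset[OF smooth_form1_fst_snd(1)[OF assms(2,3,1)]], blast)
       (rule smooth_fun_subset[OF smooth_form1_fst_snd(2)[OF assms(2,3,1)]], blast)
  have J: "holo_fun \<A> ?W ?J" by (rule holo_fun_subset[OF holo_fun_jac[OF assms(3,4)]]) auto
  note Js = holo_fun_smooth[OF W J]
  have J0: "pd_zbar \<psi> ?J x = 0" by (rule holo_fun_pd(1)[OF J assms(4) W assms(6) x])
  have "pd_zbar \<psi> (\<lambda>y. fst (\<eta> \<psi> y)) x = pd_zbar \<psi> (\<lambda>y. fst (\<eta> \<phi> y) * ?J y) x"
    using smooth_form1_change[OF assms(2-4)] assms x by (intro pd_zbar_cong[OF W]) auto
  also have "\<dots> = pd_zbar \<phi> (\<lambda>y. fst (\<eta> \<phi> y)) x * cnj (?J x) * ?J x"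
    using pd_zbar_mult[OF s(1) Js assms(4,6) x]
      pd_zbar_change[OF assms(3-6) smooth_fun_differentiable[OF s(1) assms(3,5) x]] J0 by simp
  finally have 1: "pd_zbar \<psi> (\<lambda>y. fst (\<eta> \<psi> y)) x = pd_zbar \<phi> (\<lambda>y. fst (\<eta> \<phi> y)) x * cnj (?J x) * ?J x" .
  have "pd_z \<psi> (\<lambda>y. snd (\<eta> \<psi> y)) x = pd_z \<psi> (\<lambda>y. snd (\<eta> \<phi> y) * cnj (?J y)) x"
    using smooth_form1_change[OF assms(2-4)] assms x by (intro pd_z_cong[OF W]) auto
  also have "\<dots> = pd_z \<phi> (\<lambda>y. snd (\<eta> \<phi> y)) x * cnj (?J x) * ?J x"
    using pd_z_mult[OF s(2) smooth_fun_cnj[OF W Js] assms(4,6) x] pd_z_cnj[OF Js assms(4,6) x]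
      pd_z_change[OF assms(3-6) smooth_fun_differentiable[OF s(2) assms(3,5) x]] J0 by simp
  finally have 2: "pd_z \<psi> (\<lambda>y. snd (\<eta> \<psi> y)) x = pd_z \<phi> (\<lambda>y. snd (\<eta> \<phi> y)) x * cnj (?J x) * ?J x" .
  have 3: "complex_of_real ((cmod (?J x))\<^sup>2) = cnj (?J x) * ?J x"
    by (simp only: complex_norm_square mult.commute)
  show ?thesis unfolding d1_def 1 2 3 by (simp add: algebra_simps)
qed

lemma smooth_form2_d1:
  assumes "open W" "smooth_form1 \<A> W \<eta>"
  shows "smooth_form2 \<A> W (d1 \<eta>)"
  unfolding smooth_form2_def
proof (intro conjI ballI)
  fix \<phi> \<psi> x assume *: "\<phi> \<in> coords \<A>" "\<psi> \<in> coords \<A>" "x \<in> fst \<phi> \<inter> fst \<psi> \<inter> W"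
  then show "d1 \<eta> \<psi> x = d1 \<eta> \<phi> x * of_real ((cmod (jac \<phi> \<psi> x))\<^sup>2)"
    by (intro d1_change[OF assms]) auto
next
  fix \<phi> assume \<phi>: "\<phi> \<in> coords \<A>"
  have o: "open (fst \<phi> \<inter> W)" using coord_open[OF \<phi>] assms(1) by auto
  have "smooth_fun \<A> (fst \<phi> \<inter> (fst \<phi> \<inter> W)) (\<lambda>x. pd_z \<phi> (\<lambda>y. snd (\<eta> \<phi> y)) x - pd_zbar \<phi> (\<lambda>y. fst (\<eta> \<phi> y)) x)"
    using smooth_form1_fst_snd[OF assms(2) \<phi> assms(1)] o \<phi> coord_open[OF \<phi>]
    by (intro smooth_fun_diff smooth_fun_pd_z smooth_fun_pd_zbar) auto
  then show "smooth_fun \<A> (fst \<phi> \<inter> W) (d1 \<eta> \<phi>)"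
    by (simp add: d1_def[abs_def] Int_absorb)
qed

text \<open>The second coefficient of \<open>del f\<close> is the constant 0, so the identity holds
  for every \<open>f\<close>. Through it \<open>dbar_del\<close> inherits smoothness and the
  transformation law from \<open>d1\<close>.\<close>

lemma d1_del: "d1 (del f) = dbar_del f"
proof -
  have "pd_z \<phi> (\<lambda>y. 0) x = 0" for \<phi> :: "'a coord" and x by (rule pd_const)
  then show ?thesis by (intro ext) (simp add: d1_def del_def dbar_del_def)
qed

lemma smooth_form2_dbar_del:
  "open W \<Longrightarrow> smooth_fun \<A> W f \<Longrightarrow> smooth_form2 \<A> W (dbar_del f)"
  using smooth_form2_d1[OF _ smooth_form1_del] d1_del by metis

lemma d1_add:
  assumes "open W" "smooth_form1 \<A> W \<eta>" "smooth_form1 \<A> W \<zeta>" "\<phi> \<in> coords \<A>" "x \<in> fst \<phi>" "x \<in> W"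
  shows "d1 (\<lambda>\<phi> x. \<eta> \<phi> x + \<zeta> \<phi> x) \<phi> x = d1 \<eta> \<phi> x + d1 \<zeta> \<phi> x"
proof -
  have x: "x \<in> fst \<phi> \<inter> W" using assms by auto
  show ?thesis
  using pd_z_add[OF smooth_form1_fst_snd(2)[OF assms(2,4,1)] smooth_form1_fst_snd(2)[OF assms(3,4,1)] assms(4,5) x]
    pd_zbar_add[OF smooth_form1_fst_snd(1)[OF assms(2,4,1)] smooth_form1_fst_snd(1)[OF assms(3,4,1)] assms(4,5) x]
  by (simp add: d1_def)
qed

lemma d1_scaleR:
  assumes "open W" "smooth_fun \<A> W c" "smooth_form1 \<A> W \<eta>" "\<phi> \<in> coords \<A>" "x \<in> fst \<phi>" "x \<in> W"
  shows "d1 (\<lambda>\<phi> x. c x *\<^sub>R \<eta> \<phi> x) \<phi> x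
     = wedge (d0 (\<lambda>x. complex_of_real (c x)) \<phi> x) (\<eta> \<phi> x) + of_real (c x) * d1 \<eta> \<phi> x"
proof -
  have x: "x \<in> fst \<phi> \<inter> W" using assms by auto
  have o: "open (fst \<phi> \<inter> W)" using coord_open[OF assms(4)] assms(1) by auto
  have c: "smooth_fun \<A> (fst \<phi> \<inter> W) (\<lambda>x. complex_of_real (c x))"
    by (rule smooth_fun_of_real[OF o smooth_fun_subset[OF assms(2)]]) auto
  show ?thesis
    using pd_z_mult[OF c smooth_form1_fst_snd(2)[OF assms(3,4,1)] assms(4,5) x]
      pd_zbar_mult[OF c smooth_form1_fst_snd(1)[OF assms(3,4,1)] assms(4,5) x]
    by (simp add: d1_def wedge_def d0_def scaleR_conv_of_real algebra_simps)
qed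

lemma d1_cmult:
  assumes "open W" "smooth_form1 \<A> W \<eta>" "\<phi> \<in> coords \<A>" "x \<in> fst \<phi>" "x \<in> W"
  shows "d1 (\<lambda>\<phi> x. c *\<^sub>R \<eta> \<phi> x) \<phi> x = of_real c * d1 \<eta> \<phi> x"
  using d1_scaleR[OF assms(1) smooth_fun_const assms(2-5)] by (simp add: wedge_def d0_def)

lemma d1_diff:
  assumes "open W" "smooth_form1 \<A> W \<eta>" "smooth_form1 \<A> W \<zeta>" "\<phi> \<in> coords \<A>" "x \<in> fst \<phi>" "x \<in> W"
  shows "d1 (\<lambda>\<phi> x. \<eta> \<phi> x - \<zeta> \<phi> x) \<phi> x = d1 \<eta> \<phi> x - d1 \<zeta> \<phi> x"
  using d1_add[OF assms(1,2) smooth_form1_scaleR[OF assms(1) smooth_fun_const[of W "-1"] assms(3)] assms(4-6)]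
    d1_cmult[OF assms(1,3-6), of "-1"] by simp

lemma d1_d0:
  assumes "open W" "smooth_fun \<A> W f" "\<phi> \<in> coords \<A>" "x \<in> fst \<phi>" "x \<in> W"
  shows "d1 (d0 f) \<phi> x = 0"
  using pd_z_pd_zbar_commute[OF assms(2,3,1,4,5)] by (simp add: d1_def d0_def)

lemma d1_dc:
  assumes "open W" "smooth_fun \<A> W f" "\<phi> \<in> coords \<A>" "x \<in> fst \<phi>" "x \<in> W"
  shows "d1 (dc f) \<phi> x = 2 * dbar_del f \<phi> x"
  using pd_z_pd_zbar_commute[OF assms(2,3,1,4,5)]
    pd_z_minus[OF smooth_fun_pd_zbar[OF assms(2,3,1)] assms(3,4)] assms(4,5)
  by (simp add: d1_def dc_def dbar_del_def)

text \<open>Both sides are - f_z g_zbar - f_zbar g_z. This symmetry removes the first-order terms in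
  \<open>d1_theta\<close>.\<close>

lemma wedge_d0_dc: "wedge (d0 f \<phi> x) (dc g \<phi> x) = wedge (d0 g \<phi> x) (dc f \<phi> x)"
  by (simp add: wedge_def d0_def dc_def algebra_simps)

lemma
  assumes "open W" "smooth_fun \<A> W f" "smooth_fun \<A> W g" "\<phi> \<in> coords \<A>" "x \<in> fst \<phi>" "x \<in> W"
  shows d0_add: "d0 (\<lambda>x. f x + g x) \<phi> x = d0 f \<phi> x + d0 g \<phi> x"
    and d0_diff: "d0 (\<lambda>x. f x - g x) \<phi> x = d0 f \<phi> x - d0 g \<phi> x"
    and dc_add: "dc (\<lambda>x. f x + g x) \<phi> x = dc f \<phi> x + dc g \<phi> x"
    and dc_diff: "dc (\<lambda>x. f x - g x) \<phi> x = dc f \<phi> x - dc g \<phi> x"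
  using pd_z_add[OF assms(2-6)] pd_zbar_add[OF assms(2-6)] pd_z_diff[OF assms(2-6,1)] pd_zbar_diff[OF assms(2-6,1)]
  by (simp_all add: d0_def dc_def)

lemma
  assumes "open W" "smooth_fun \<A> W f" "\<phi> \<in> coords \<A>" "x \<in> fst \<phi>" "x \<in> W"
  shows dc_cmult: "dc (\<lambda>x. complex_of_real c * f x) \<phi> x = c *\<^sub>R dc f \<phi> x"
    and dbar_del_cmult: "dbar_del (\<lambda>x. k * f x) \<phi> x = k * dbar_del f \<phi> x"
proof -
  show "dc (\<lambda>x. complex_of_real c * f x) \<phi> x = c *\<^sub>R dc f \<phi> x"
    using pd_z_cmult[OF assms(2-5)] pd_zbar_cmult[OF assms(2-5)]
    by (simp add: dc_def scaleR_conv_of_real)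
  have o: "open (fst \<phi> \<inter> W)" using coord_open[OF assms(3)] assms(1) by auto
  have "pd_zbar \<phi> (pd_z \<phi> (\<lambda>x. k * f x)) x = pd_zbar \<phi> (\<lambda>x. k * pd_z \<phi> f x) x"
    using pd_z_cmult[OF assms(2,3)] assms by (intro pd_zbar_cong[OF o]) auto
  then show "dbar_del (\<lambda>x. k * f x) \<phi> x = k * dbar_del f \<phi> x"
    using pd_zbar_cmult[OF smooth_fun_pd_z[OF assms(2,3,1)] assms(3,4)] assms by (simp add: dbar_del_def)
qed

lemma dbar_del_add:
  assumes "open W" "smooth_fun \<A> W f" "smooth_fun \<A> W g" "\<phi> \<in> coords \<A>" "x \<in> fst \<phi>" "x \<in> W"
  shows "dbar_del (\<lambda>x. f x + g x) \<phi> x = dbar_del f \<phi> x + dbar_del g \<phi> x"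
proof -
  have o: "open (fst \<phi> \<inter> W)" using coord_open[OF assms(4)] assms(1) by auto
  have "pd_zbar \<phi> (pd_z \<phi> (\<lambda>x. f x + g x)) x = pd_zbar \<phi> (\<lambda>x. pd_z \<phi> f x + pd_z \<phi> g x) x"
    using pd_z_add[OF assms(2-4)] assms by (intro pd_zbar_cong[OF o]) auto
  then show ?thesis
    using pd_zbar_add[OF smooth_fun_pd_z[OF assms(2,4,1)] smooth_fun_pd_z[OF assms(3,4,1)] assms(4,5)] assms
    by (simp add: dbar_del_def)
qed

text \<open>A real function equals its conjugate, so conjugation exchanges its two Wirtinger
  derivatives; for the mixed second derivative their commutation is used as well.\<close>

lemma
  fixes f :: "'a \<Rightarrow> real"
  assumes "open W" "smooth_fun \<A> W f" "\<phi> \<in> coords \<A>" "x \<in> fst \<phi>" "x \<in> W"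
  shows pd_zbar_real: "pd_zbar \<phi> (\<lambda>x. complex_of_real (f x)) x = cnj (pd_z \<phi> (\<lambda>x. complex_of_real (f x)) x)"
    and dbar_del_real: "Im (dbar_del (\<lambda>x. complex_of_real (f x)) \<phi> x) = 0"
proof -
  let ?f = "\<lambda>x. complex_of_real (f x)"
  note s = smooth_fun_of_real[OF assms(1,2)]
  have r: "pd_zbar \<phi> ?f x = cnj (pd_z \<phi> ?f x)" if "x \<in> fst \<phi>" "x \<in> W" for x
    using pd_zbar_cnj[OF s assms(3) that] by simp
  show "pd_zbar \<phi> ?f x = cnj (pd_z \<phi> ?f x)" by (rule r[OF assms(4,5)])
  have o: "open (fst \<phi> \<inter> W)" using coord_open[OF assms(3)] assms(1) by auto
  have "pd_z \<phi> (pd_zbar \<phi> ?f) x = pd_z \<phi> (\<lambda>y. cnj (pd_z \<phi> ?f y)) x"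
    using r assms by (intro pd_z_cong[OF o]) auto
  also have "\<dots> = cnj (pd_zbar \<phi> (pd_z \<phi> ?f) x)"
    using pd_z_cnj[OF smooth_fun_pd_z[OF s assms(3,1)] assms(3,4)] assms by auto
  finally have "pd_zbar \<phi> (pd_z \<phi> ?f) x = cnj (pd_zbar \<phi> (pd_z \<phi> ?f) x)"
    using pd_z_pd_zbar_commute[OF s assms(3,1,4,5)] by simp
  then show "Im (dbar_del ?f \<phi> x) = 0"
    by (metis dbar_del_def complex_cnj_minus Reals_cnj_iff complex_is_Real_iff)
qed

text \<open>log |f|^2 is harmonic for a nowhere vanishing holomorphic f. Changes of frame or
  coordinate alter the logarithm of a norm by such a function, hence are invisible to
  \<open>dbar_del\<close>.\<close>

lemma ln_holo_fun:
  assumes "open W" "holo_fun \<A> W f" "\<And>x. x \<in> W \<Longrightarrow> f x \<noteq> 0"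
  defines "u \<equiv> \<lambda>x. ln ((cmod (f x))\<^sup>2)"
  shows smooth_fun_ln_holo: "smooth_fun \<A> W u"
    and pd_z_ln_holo: "\<And>\<phi> x. \<phi> \<in> coords \<A> \<Longrightarrow> x \<in> fst \<phi> \<Longrightarrow> x \<in> W \<Longrightarrow>
      pd_z \<phi> (\<lambda>x. complex_of_real (u x)) x = pd_z \<phi> f x / f x"
    and dbar_del_ln_holo: "\<And>\<phi> x. \<phi> \<in> coords \<A> \<Longrightarrow> x \<in> fst \<phi> \<Longrightarrow> x \<in> W \<Longrightarrow>
      dbar_del (\<lambda>x. complex_of_real (u x)) \<phi> x = 0"
proof -
  note fs = holo_fun_smooth[OF assms(1,2)]
  have "smooth_fun \<A> W (\<lambda>x. f x \<bullet> f x)"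
    by (intro smooth_fun_bilinear[OF _ bounded_bilinear_inner] assms(1) fs)
  then have "smooth_fun \<A> W (\<lambda>x. (cmod (f x))\<^sup>2)" by (simp add: power2_norm_eq_inner)
  then show us: "smooth_fun \<A> W u"
    unfolding u_def using assms by (intro smooth_fun_ln) auto
  note us' = smooth_fun_of_real[OF assms(1) us]
  show uz: "pd_z \<phi> (\<lambda>x. complex_of_real (u x)) x = pd_z \<phi> f x / f x"
    if \<phi>: "\<phi> \<in> coords \<A>" "x \<in> fst \<phi>" "x \<in> W" for \<phi> x
  proof -
    let ?F = "\<lambda>p. f (chart_inv \<phi> p)"
    define d where "d = deriv (in_coord \<phi> f) (snd \<phi> x)"
    have "((\<lambda>p. f (chart_inv \<phi> p)) has_derivative frechet_derivative (in_coord \<phi> f) (at (snd \<phi> x))) (at (snd \<phi> x))"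
      by (rule frechet_works[OF fs \<phi>])
    moreover have "frechet_derivative (in_coord \<phi> f) (at (snd \<phi> x)) = (\<lambda>v. d * v)"
    proof -
      have "in_coord \<phi> f holomorphic_on (snd \<phi> ` (fst \<phi> \<inter> W))" using assms \<phi> by (simp add: holo_fun_def)
      then have "(in_coord \<phi> f has_field_derivative deriv (in_coord \<phi> f) (snd \<phi> x)) (at (snd \<phi> x))"
        using coord_open_image[OF \<phi>(1) assms(1)] \<phi>(2,3) holomorphic_derivI by blast
      then show ?thesis by (intro frechet_derivative_eqI) (simp add: has_field_derivative_def d_def)
    qed
    ultimately have F: "(?F has_derivative (\<lambda>v. d * v)) (at (snd \<phi> x))" by simp
    have "((\<lambda>p. ln (?F p \<bullet> ?F p)) has_derivative (\<lambda>v. (f x \<bullet> (d * v) + (d * v) \<bullet> f x) * inverse (f x \<bullet> f x))) (at (snd \<phi> x))"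
      using has_derivative_ln[OF _ has_derivative_inner[OF F F]] assms(3) \<phi> by simp
    from bounded_linear.has_derivative[OF bounded_linear_of_real this]
    have "((\<lambda>p. complex_of_real (ln (?F p \<bullet> ?F p))) has_derivative
      (\<lambda>v. complex_of_real ((f x \<bullet> (d * v) + (d * v) \<bullet> f x) * inverse (f x \<bullet> f x)))) (at (snd \<phi> x))" .
    then have "frechet_derivative (in_coord \<phi> (\<lambda>x. complex_of_real (u x))) (at (snd \<phi> x)) =
      (\<lambda>v. complex_of_real ((f x \<bullet> (d * v) + (d * v) \<bullet> f x) * inverse (f x \<bullet> f x)))"
      unfolding u_def in_coord_def o_def power2_norm_eq_inner by (rule frechet_derivative_eqI)
    moreover have "(f x \<bullet> (d * v) + (d * v) \<bullet> f x) * inverse (f x \<bullet> f x) = 2 * (f x \<bullet> (d * v)) / (f x \<bullet> f x)" for v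
      using inner_commute[of "d * v" "f x"] by (simp add: divide_inverse)
    ultimately have e: "frechet_derivative (in_coord \<phi> (\<lambda>x. complex_of_real (u x))) (at (snd \<phi> x)) =
      (\<lambda>v. complex_of_real (2 * (f x \<bullet> (d * v)) / (f x \<bullet> f x)))"
      by simp
    have "pd_z \<phi> (\<lambda>x. complex_of_real (u x)) x = (complex_of_real (2 * (f x \<bullet> d)) - \<i> * complex_of_real (2 * (f x \<bullet> (d * \<i>)))) / 2 / complex_of_real (f x \<bullet> f x)"
      unfolding pd_z_wirt e wirt_def by (simp add: diff_divide_distrib)
    also have "complex_of_real (2 * (f x \<bullet> d)) - \<i> * complex_of_real (2 * (f x \<bullet> (d * \<i>))) = 2 * (cnj (f x) * d)"
      by (simp add: complex_eq_iff inner_complex_def algebra_simps)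
    also have "complex_of_real (f x \<bullet> f x) = f x * cnj (f x)"
      by (simp only: power2_norm_eq_inner[symmetric] complex_norm_square)
    finally show ?thesis
      using holo_fun_pd(2)[OF assms(2) \<phi>(1) assms(1) \<phi>(2,3)] assms(3)[OF \<phi>(3)] by (simp add: d_def)
  qed
  show "dbar_del (\<lambda>x. complex_of_real (u x)) \<phi> x = 0"
    if \<phi>: "\<phi> \<in> coords \<A>" "x \<in> fst \<phi>" "x \<in> W" for \<phi> x
  proof -
    have o: "open (fst \<phi> \<inter> W)" using coord_open[OF \<phi>(1)] assms(1) by auto
    have x: "x \<in> fst \<phi> \<inter> W" using \<phi> by auto
    let ?g = "pd_z \<phi> (\<lambda>x. complex_of_real (u x))"
    have gs: "smooth_fun \<A> (fst \<phi> \<inter> W) ?g" by (rule smooth_fun_pd_z[OF us' \<phi>(1) assms(1)])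
    have 0: "pd_zbar \<phi> (pd_z \<phi> f) x = 0"
    proof -
      have "pd_zbar \<phi> (pd_z \<phi> f) x = pd_z \<phi> (pd_zbar \<phi> f) x"
        using pd_z_pd_zbar_commute[OF fs \<phi>(1) assms(1) \<phi>(2,3)] by simp
      also have "\<dots> = pd_z \<phi> (\<lambda>x. 0) x"
        using holo_fun_pd(1)[OF assms(2) \<phi>(1) assms(1)] \<phi> by (intro pd_z_cong[OF o]) auto
      finally show ?thesis by simp
    qed
    \<comment> \<open>Differentiating f u_z = f_z, in place of u_z = f_z / f, avoids the quotient
      rule.\<close>
    have "pd_zbar \<phi> (pd_z \<phi> f) x = pd_zbar \<phi> (\<lambda>y. f y * ?g y) x"
      using uz[OF \<phi>(1)] assms(3) \<phi> by (intro pd_zbar_cong[OF o]) auto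
    also have "\<dots> = f x * pd_zbar \<phi> ?g x"
      using pd_zbar_mult[OF smooth_fun_subset[OF fs] gs \<phi>(1,2) x] holo_fun_pd(1)[OF assms(2) \<phi>(1) assms(1) \<phi>(2,3)]
      by simp
    finally show ?thesis using 0 assms(3)[OF \<phi>(3)] by (simp add: dbar_del_def)
  qed
qed

section \<open>Imaginary 1-forms\<close>

lemma imaginary_form1_diff:
  "imaginary_form1 \<A> W \<eta> \<Longrightarrow> imaginary_form1 \<A> W \<zeta> \<Longrightarrow> imaginary_form1 \<A> W (\<lambda>\<phi> x. \<eta> \<phi> x - \<zeta> \<phi> x)"
  "imaginary_form1 \<A> W \<eta> \<Longrightarrow> imaginary_form1 \<A> W \<zeta> \<Longrightarrow> imaginary_form1 \<A> W (\<lambda>\<phi> x. \<eta> \<phi> x + \<zeta> \<phi> x)"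
  by (auto simp: imaginary_form1_def)

lemma imaginary_form1_scaleR:
  "imaginary_form1 \<A> W \<eta> \<Longrightarrow> imaginary_form1 \<A> W (\<lambda>\<phi> x. c x *\<^sub>R \<eta> \<phi> x)"
  by (auto simp: imaginary_form1_def)

lemma imaginary_form1_sum:
  "(\<And>i. i \<in> I \<Longrightarrow> imaginary_form1 \<A> W (\<eta> i)) \<Longrightarrow> imaginary_form1 \<A> W (\<lambda>\<phi> x. \<Sum>i\<in>I. \<eta> i \<phi> x)"
  by (induction I rule: infinite_finite_induct) (auto simp: imaginary_form1_def)

lemma imaginary_form1_dc:
  fixes f :: "'a \<Rightarrow> real"
  assumes "open W" "smooth_fun \<A> W f"
  shows "imaginary_form1 \<A> W (dc (\<lambda>x. complex_of_real (f x)))"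
  using pd_zbar_real[OF assms] by (auto simp: imaginary_form1_def dc_def)

lemma imaginary_form1_d0:
  assumes "open W" "smooth_fun \<A> W f" "\<And>x. x \<in> W \<Longrightarrow> Re (f x) = 0"
  shows "imaginary_form1 \<A> W (d0 f)"
  unfolding imaginary_form1_def
proof (intro ballI)
  fix \<phi> x assume \<phi>: "\<phi> \<in> coords \<A>" and x: "x \<in> fst \<phi> \<inter> W"
  have "pd_z \<phi> (\<lambda>x. cnj (f x)) x = pd_z \<phi> (\<lambda>x. - f x) x"
    using assms(3) x by (intro pd_z_cong[OF assms(1) _ \<phi>]) (auto simp: complex_eq_iff)
  then show "fst (d0 f \<phi> x) = - cnj (snd (d0 f \<phi> x))"
    using pd_z_cnj[OF assms(2) \<phi>] pd_z_minus[OF assms(2) \<phi>] x by (simp add: d0_def)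
qed

end

section \<open>The Cech--de Rham descent\<close>

text \<open>In this notation $\omega^1_{ij}=\frac12\,\theta(\log\tilde\rho_j,\log|g_{ij}|)$.\<close>

definition theta :: "('a \<Rightarrow> real) \<Rightarrow> ('a \<Rightarrow> real) \<Rightarrow> 'a form1" where
  "theta f g \<phi> x = f x *\<^sub>R dc (\<lambda>y. complex_of_real (g y)) \<phi> x - g x *\<^sub>R dc (\<lambda>y. complex_of_real (f y)) \<phi> x"

context complex_surface
begin

lemma theta_cong:
  assumes "open W" "\<And>y. y \<in> W \<Longrightarrow> f y = f' y" "\<And>y. y \<in> W \<Longrightarrow> g y = g' y" "\<phi> \<in> coords \<A>" "x \<in> fst \<phi>" "x \<in> W"
  shows "theta f g \<phi> x = theta f' g' \<phi> x"
proof -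
  have "dc (\<lambda>y. complex_of_real (g y)) \<phi> x = dc (\<lambda>y. complex_of_real (g' y)) \<phi> x"
    by (rule dc_cong[OF assms(1) _ assms(4-6)]) (simp add: assms(3))
  moreover have "dc (\<lambda>y. complex_of_real (f y)) \<phi> x = dc (\<lambda>y. complex_of_real (f' y)) \<phi> x"
    by (rule dc_cong[OF assms(1) _ assms(4-6)]) (simp add: assms(2))
  ultimately show ?thesis using assms(2,3)[OF assms(6)] by (simp add: theta_def)
qed

lemma smooth_form1_theta:
  assumes "open W" "smooth_fun \<A> W f" "smooth_fun \<A> W g"
  shows "smooth_form1 \<A> W (theta f g)"
  unfolding theta_def[abs_def]
  by (intro smooth_form1_diff smooth_form1_scaleR smooth_form1_dc smooth_fun_of_real assms)

lemma imaginary_form1_theta: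
  assumes "open W" "smooth_fun \<A> W f" "smooth_fun \<A> W g"
  shows "imaginary_form1 \<A> W (theta f g)"
  unfolding theta_def[abs_def]
  by (intro imaginary_form1_diff imaginary_form1_scaleR imaginary_form1_dc assms)

lemma theta_swap: "theta f g \<phi> x = - theta g f \<phi> x"
  by (simp add: theta_def)

lemma theta_add:
  assumes "open W" "smooth_fun \<A> W f" "smooth_fun \<A> W g" "smooth_fun \<A> W h" "\<phi> \<in> coords \<A>" "x \<in> fst \<phi>" "x \<in> W"
  shows "theta f (\<lambda>x. g x + c * h x) \<phi> x = theta f g \<phi> x + c *\<^sub>R theta f h \<phi> x"
    and "theta (\<lambda>x. g x + c * h x) f \<phi> x = theta g f \<phi> x + c *\<^sub>R theta h f \<phi> x"
proof -
  note s = smooth_fun_of_real[OF assms(1,3)] smooth_fun_of_real[OF assms(1,4)]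
  have sc: "smooth_fun \<A> W (\<lambda>x. complex_of_real c * complex_of_real (h x))"
    by (intro smooth_fun_mult smooth_fun_const s assms(1))
  have "dc (\<lambda>x. complex_of_real (g x) + complex_of_real c * complex_of_real (h x)) \<phi> x
     = dc (\<lambda>x. complex_of_real (g x)) \<phi> x + c *\<^sub>R dc (\<lambda>x. complex_of_real (h x)) \<phi> x"
    unfolding dc_add[OF assms(1) s(1) sc assms(5-7)] dc_cmult[OF assms(1) s(2) assms(5-7)] ..
  then show 1: "theta f (\<lambda>x. g x + c * h x) \<phi> x = theta f g \<phi> x + c *\<^sub>R theta f h \<phi> x"
    by (simp add: theta_def algebra_simps)
  then show "theta (\<lambda>x. g x + c * h x) f \<phi> x = theta g f \<phi> x + c *\<^sub>R theta h f \<phi> x"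
    using theta_swap[of "\<lambda>x. g x + c * h x" f \<phi> x] theta_swap[of g f \<phi> x] theta_swap[of h f \<phi> x] by simp
qed

lemma theta_zero: 
  assumes "open W" "\<And>y. y \<in> W \<Longrightarrow> g y = 0" "\<phi> \<in> coords \<A>" "x \<in> fst \<phi>" "x \<in> W"
  shows "theta f g \<phi> x = 0" "theta g f \<phi> x = 0"
proof -
  have "theta f g \<phi> x = theta f (\<lambda>y. 0) \<phi> x"
    by (rule theta_cong[OF assms(1) _ _ assms(3-5)]) (simp_all add: assms(2))
  also have "\<dots> = 0" by (simp add: theta_def dc_def zero_prod_def)
  finally show "theta f g \<phi> x = 0" .
  then show "theta g f \<phi> x = 0" using theta_swap[of g f \<phi> x] by simp
qed

text \<open>Green's identity in terms of forms: the products of first derivatives cancel by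
  \<open>wedge_d0_dc\<close>, and d d^c equals 2 dbar del.\<close>

lemma d1_theta:
  assumes "open W" "smooth_fun \<A> W f" "smooth_fun \<A> W g" "\<phi> \<in> coords \<A>" "x \<in> fst \<phi>" "x \<in> W"
  shows "d1 (theta f g) \<phi> x = 2 * (of_real (f x) * dbar_del (\<lambda>y. complex_of_real (g y)) \<phi> x
     - of_real (g x) * dbar_del (\<lambda>y. complex_of_real (f y)) \<phi> x)"
proof -
  note f = smooth_fun_of_real[OF assms(1,2)] and g = smooth_fun_of_real[OF assms(1,3)]
  note sf = smooth_form1_dc[OF assms(1) f] and sg = smooth_form1_dc[OF assms(1) g]
  have "d1 (theta f g) \<phi> x = d1 (\<lambda>\<phi> x. f x *\<^sub>R dc (\<lambda>y. complex_of_real (g y)) \<phi> x) \<phi> x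
      - d1 (\<lambda>\<phi> x. g x *\<^sub>R dc (\<lambda>y. complex_of_real (f y)) \<phi> x) \<phi> x"
    unfolding theta_def[abs_def]
    by (intro d1_diff[OF assms(1) _ _ assms(4-6)] smooth_form1_scaleR assms sf sg)
  then show ?thesis
    unfolding d1_scaleR[OF assms(1,2) sg assms(4-6)] d1_scaleR[OF assms(1,3) sf assms(4-6)]
      d1_dc[OF assms(1) f assms(4-6)] d1_dc[OF assms(1) g assms(4-6)]
      wedge_d0_dc[of "\<lambda>x. complex_of_real (f x)"]
    by (simp add: algebra_simps)
qed

end

locale cech_surface = complex_surface \<A> for \<A> :: "('a::t2_space) coord set" +
  fixes D :: "'a set" and K :: "'a cech_choice"
  assumes finite_D: "finite D" and choice: "cup_square_choice \<A> D K"
begin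

abbreviation "V \<equiv> cover_dom K"
abbreviation "n \<equiv> cover_size K"
abbreviation "b \<equiv> log_abs_g K"
abbreviation "lg \<equiv> log_transition K"

section \<open>The cover, the frames and the transition functions\<close>

lemma good: "good_cover \<A> D K" and trans: "transition_data \<A> D K" and Ldata: "L_data \<A> K"
  using choice by (auto simp: cup_square_choice_def)

lemma good_facts:
  "\<forall>i<n. chart K i \<in> coords \<A> \<and> (\<exists>c r. r > 0 \<and> coordinate K i ` V i = ball c r)"
  "(\<Union>i<n. V i) = UNIV"
  "\<forall>i<n. \<forall>p\<in>V i \<inter> D. \<forall>q\<in>V i \<inter> D. p = q"
  "\<forall>p\<in>D. \<exists>!i. i < n \<and> p \<in> V i"
  "\<forall>i<n. \<forall>p\<in>V i \<inter> D. coordinate K i p = 0"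
  using good unfolding good_cover_def by - (elim conjE, assumption)+

lemma chart_coords: "i < n \<Longrightarrow> chart K i \<in> coords \<A>"
  using good_facts(1) by simp

lemma V_open: "i < n \<Longrightarrow> open (V i)"
  unfolding cover_dom_def by (rule coord_open[OF chart_coords])

lemma V_cover: obtains i where "i < n" "x \<in> V i"
  using good_facts(2) by blast

text \<open>The reason why the punctures do not disturb the cochains: over D every overlap is a
  diagonal one.\<close>

lemma V_int_D:
  assumes "i < n" "j < n" "x \<in> V i" "x \<in> V j" "x \<in> D"
  shows "i = j"
proof -
  have "\<exists>!i. i < n \<and> x \<in> V i" using good_facts(4) assms(5) by simp
  then show ?thesis using assms by auto
qed

lemma V_D_unique: "i < n \<Longrightarrow> p \<in> V i \<Longrightarrow> p \<in> D \<Longrightarrow> q \<in> V i \<Longrightarrow> q \<in> D \<Longrightarrow> p = q"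
  using good_facts(3) by simp

lemma coordinate_D: "i < n \<Longrightarrow> p \<in> V i \<Longrightarrow> p \<in> D \<Longrightarrow> coordinate K i p = 0"
  using good_facts(5) by simp

lemma closed_D: "closed D"
  using finite_D finite_imp_closed by auto

lemma open_U: "open (UNIV - D)" using closed_D by auto

lemma coordinate_nonzero:
  assumes "i < n" "V i \<inter> D \<noteq> {}" "x \<in> V i" "x \<notin> D"
  shows "coordinate K i x \<noteq> 0"
proof
  assume 0: "coordinate K i x = 0"
  obtain p where p: "p \<in> V i" "p \<in> D" using assms(2) by auto
  have "coordinate K i p = 0" by (rule coordinate_D[OF assms(1) p])
  then have "x = p"
    using inj_onD[OF coord_inj[OF chart_coords[OF assms(1)]], of x p] 0 assms(3) p(1)
    by (simp add: cover_dom_def coordinate_def)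
  then show False using p assms by auto
qed

lemma frame_nonzero: "i < n \<Longrightarrow> x \<in> V i \<Longrightarrow> x \<notin> D \<Longrightarrow> frame_coeff D K i x \<noteq> 0"
  using coordinate_nonzero by (auto simp: frame_coeff_def)

lemma holo_fun_const: "holo_fun \<A> W (\<lambda>x. c)"
  by (simp add: holo_fun_def in_coord_def o_def)

lemma frame_holo:
  assumes "i < n"
  shows "holo_fun \<A> (V i) (frame_coeff D K i)"
proof (cases "V i \<inter> D = {}")
  case True
  then show ?thesis by (simp add: frame_coeff_def[abs_def] holo_fun_const)
next
  case False
  then have "frame_coeff D K i = snd (chart K i)" by (intro ext) (simp add: frame_coeff_def coordinate_def)
  then show ?thesis using holo_fun_coord[OF chart_coords[OF assms]] by (simp add: cover_dom_def)
qed

lemma trans_holo: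
  assumes "i < n" "j < n"
  shows "holo_fun \<A> (V i \<inter> V j) (transition K i j)" "holo_fun \<A> (V i \<inter> V j) (lg i j)"
  using trans assms unfolding transition_data_def by blast+

lemma trans_eq:
  assumes "i < n" "j < n" "x \<in> V i" "x \<in> V j"
  shows "frame_coeff D K j x * jac (chart K i) (chart K j) x = frame_coeff D K i x * transition K i j x"
    "exp (lg i j x) = transition K i j x"
  using trans assms unfolding transition_data_def by blast+

lemma trans_nonzero: "i < n \<Longrightarrow> j < n \<Longrightarrow> x \<in> V i \<Longrightarrow> x \<in> V j \<Longrightarrow> transition K i j x \<noteq> 0"
  using trans_eq(2) exp_not_eq_zero by metis

lemma b_Re: "i < n \<Longrightarrow> j < n \<Longrightarrow> x \<in> V i \<Longrightarrow> x \<in> V j \<Longrightarrow> b i j x = Re (lg i j x)"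
  unfolding log_abs_g_def trans_eq(2)[symmetric] by simp

lemma VV_open: "i < n \<Longrightarrow> j < n \<Longrightarrow> open (V i \<inter> V j)"
  using V_open by auto

lemma VVV_open: "i < n \<Longrightarrow> j < n \<Longrightarrow> m < n \<Longrightarrow> open (V m \<inter> (V i \<inter> V j))"
  using V_open by auto

lemma lg_smooth: "i < n \<Longrightarrow> j < n \<Longrightarrow> smooth_fun \<A> (V i \<inter> V j) (lg i j)"
  by (rule holo_fun_smooth[OF VV_open trans_holo(2)])

lemma b_smooth:
  assumes "i < n" "j < n"
  shows "smooth_fun \<A> (V i \<inter> V j) (b i j)"
proof -
  have "smooth_fun \<A> (V i \<inter> V j) (\<lambda>x. Re (lg i j x))"
    by (rule smooth_fun_linear[OF VV_open[OF assms] bounded_linear_Re lg_smooth[OF assms]])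
  then show ?thesis
    by (subst smooth_fun_cong[OF VV_open[OF assms], of _ "\<lambda>x. Re (lg i j x)"]) (use b_Re assms in auto)
qed

text \<open>At a puncture the frame coefficient vanishes and the relation s_i = s_i g_ii carries no
  information. The value there comes by continuity from the punctured neighbourhood.\<close>

lemma trans_self:
  assumes i: "i < n" and x: "x \<in> V i"
  shows "transition K i i x = 1"
proof (cases "x \<in> D")
  case False
  have "jac (chart K i) (chart K i) x = 1"
    using x by (intro jac_refl[OF chart_coords[OF i]]) (simp add: cover_dom_def)
  then show ?thesis using trans_eq(1)[OF i i x x] frame_nonzero[OF i x False] by simp
next
  case True
  let ?\<phi> = "chart K i" and ?f = "in_coord (chart K i) (transition K i i)"
  note \<phi> = chart_coords[OF i]
  have f1: "fst ?\<phi> = V i" by (simp add: cover_dom_def)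
  let ?S = "snd ?\<phi> ` V i" and ?p = "snd ?\<phi> x"
  have S: "open ?S" using coord_open_range[OF \<phi>] by (simp add: f1)
  have p: "?p \<in> ?S" using x by auto
  have "?f holomorphic_on ?S"
    using trans_holo(1)[OF i i] \<phi> unfolding holo_fun_def by (metis f1 inf.idem)
  then have c: "continuous_on ?S ?f" by (rule holomorphic_on_imp_continuous_on)
  then have "?f \<midarrow>?p\<rightarrow> ?f ?p" using S p continuous_on_eq_continuous_at[OF S] isContD by blast
  moreover have "?f \<midarrow>?p\<rightarrow> 1"
  proof (rule Lim_transform_within_open[OF tendsto_const[of 1] S p])
    fix q assume q: "q \<in> ?S" "q \<noteq> ?p"
    then obtain y where y: "y \<in> V i" "q = snd ?\<phi> y" by auto
    have yD: "y \<notin> D" using V_D_unique[OF i x True y(1)] q y by auto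
    have "jac ?\<phi> ?\<phi> y = 1" using y by (intro jac_refl[OF \<phi>]) (simp add: f1)
    then have "transition K i i y = 1" using trans_eq(1)[OF i i y(1) y(1)] frame_nonzero[OF i y(1) yD] by simp
    then show "1 = ?f q" using y \<phi> by (simp add: f1)
  qed
  ultimately have "?f ?p = 1" using LIM_unique by blast
  then show ?thesis using \<phi> x by (simp add: f1)
qed

lemma b_self: "i < n \<Longrightarrow> x \<in> V i \<Longrightarrow> b i i x = 0"
  by (simp add: log_abs_g_def trans_self)

text \<open>Off D this is the chain rule for the Jacobians after cancelling the frame coefficient.
  Over D, where the coefficient vanishes, the three indices coincide.\<close>

lemma trans_cocycle:
  assumes "i < n" "j < n" "k < n" "x \<in> V i" "x \<in> V j" "x \<in> V k"
  shows "transition K i j x * transition K j k x = transition K i k x"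
proof (cases "x \<in> D")
  case True
  then have "i = j" "j = k" using V_int_D assms by blast+
  then show ?thesis using trans_self assms by simp
next
  case False
  have J: "jac (chart K i) (chart K k) x = jac (chart K i) (chart K j) x * jac (chart K j) (chart K k) x"
    using assms chart_coords by (intro jac_chain) (auto simp: cover_dom_def)
  have "frame_coeff D K i x * transition K i k x = frame_coeff D K k x * (jac (chart K i) (chart K j) x * jac (chart K j) (chart K k) x)"
    using trans_eq(1)[of i k x] assms J by simp
  also have "\<dots> = frame_coeff D K j x * transition K j k x * jac (chart K i) (chart K j) x"
    using trans_eq(1)[of j k x] assms by (simp add: algebra_simps)
  also have "\<dots> = frame_coeff D K i x * (transition K i j x * transition K j k x)"
    using trans_eq(1)[of i j x] assms by (simp add: algebra_simps)
  finally show ?thesis using frame_nonzero[OF assms(1,4) False] by simp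
qed

lemma b_cocycle:
  assumes "i < n" "j < n" "k < n" "x \<in> V i" "x \<in> V j" "x \<in> V k"
  shows "b i k x = b i j x + b j k x"
  unfolding log_abs_g_def trans_cocycle[OF assms, symmetric]
  using trans_nonzero assms by (simp add: norm_mult ln_mult)

lemma omega2_eq:
  assumes "i < n" "j < n" "k < n" "x \<in> V j" "x \<in> V k"
  shows "omega2 K i j k x = - \<i> * of_real (Im (Lfun K i j k x) + Im (lg i j x) * Re (lg j k x))"
  using b_Re[OF assms(2-5)] by (simp add: omega2_def pi1_def complex_eq_iff)

text \<open>The integrality condition on L enters through its imaginary part: \<open>Zgrp 2\<close>
  consists of real numbers, because (2 pi i)^2 is real. The factor multiplying log g_kl is
  imaginary, since the real parts of the logarithms form a cocycle; so only Re log g_kl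
  survives.\<close>

lemma omega2_cocycle:
  assumes "i < n" "j < n" "k < n" "l < n" "x \<in> V i" "x \<in> V j" "x \<in> V k" "x \<in> V l"
  shows "omega2 K j k l x - omega2 K i k l x + omega2 K i j l x - omega2 K i j k x = 0"
proof -
  have "(Lfun K j k l x - Lfun K i k l x + Lfun K i j l x - Lfun K i j k x)
             - (- (2 * pi * \<i>) * cech_c K i j k x * lg k l x) \<in> Zgrp 2"
    using Ldata assms unfolding L_data_def by blast
  then obtain m :: int where m: "(Lfun K j k l x - Lfun K i k l x + Lfun K i j l x - Lfun K i j k x)
             - (- (2 * pi * \<i>) * cech_c K i j k x * lg k l x) = (2 * pi * \<i>)\<^sup>2 * of_int m"
    by (auto simp: Zgrp_def)
  have c: "2 * pi * \<i> * cech_c K i j k x = lg j k x - lg i k x + lg i j x"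
    by (simp add: cech_c_def)
  have Re0: "Re (lg j k x - lg i k x + lg i j x) = 0"
    using b_cocycle[of i j k x] b_Re assms by simp
  have "Im ((Lfun K j k l x - Lfun K i k l x + Lfun K i j l x - Lfun K i j k x)
     + (lg j k x - lg i k x + lg i j x) * lg k l x) = 0"
    using m[unfolded mult.assoc[symmetric] minus_mult_left[symmetric] c] by (simp add: power2_eq_square)
  moreover have "Im (X + s * t) = Im X + Im s * Re t" if "Re s = 0" for X s t by (simp add: that)
  ultimately have "Im (Lfun K j k l x) - Im (Lfun K i k l x) + Im (Lfun K i j l x) - Im (Lfun K i j k x)
     + (Im (lg j k x) - Im (lg i k x) + Im (lg i j x)) * Re (lg k l x) = 0"
    using Re0 by simp
  moreover have "Re (lg j l x) = Re (lg j k x) + Re (lg k l x)"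
    using b_cocycle[of j k l x] b_Re assms by simp
  ultimately have "Im (Lfun K j k l x) - Im (Lfun K i k l x) + Im (Lfun K i j l x) - Im (Lfun K i j k x)
     + Im (lg j k x) * Re (lg k l x) - Im (lg i k x) * Re (lg k l x)
     + Im (lg i j x) * Re (lg j l x) - Im (lg i j x) * Re (lg j k x) = 0"
    by (simp add: algebra_simps)
  then show ?thesis
    using assms by (simp add: omega2_eq complex_eq_iff)
qed

section \<open>Smoothness and differential of omega^2\<close>

lemma L_holo:
  assumes "m < n" "i < n" "j < n"
  shows "holo_fun \<A> (V m \<inter> V i \<inter> V j) (Lfun K m i j)"
  using Ldata assms unfolding L_data_def Let_def by blast

lemma L_d0:
  assumes "m < n" "i < n" "j < n" "\<phi> \<in> coords \<A>" "x \<in> fst \<phi>" "x \<in> V m" "x \<in> V i" "x \<in> V j"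
  shows "d0 (Lfun K m i j) \<phi> x = csmul (- lg m i x) (d0 (lg i j) \<phi> x)"
  using Ldata assms unfolding L_data_def Let_def by blast

text \<open>A polynomial in holomorphic functions and their conjugates, so that the Wirtinger rules
  apply term by term.\<close>

lemma omega2_form:
  assumes "m < n" "i < n" "j < n" "x \<in> V m \<inter> (V i \<inter> V j)"
  shows "omega2 K m i j x = (-1/2) * Lfun K m i j x + (1/2) * cnj (Lfun K m i j x)
     + (-1/4) * ((lg m i x - cnj (lg m i x)) * (lg i j x + cnj (lg i j x)))"
  using omega2_eq[of m i j x] assms by (simp add: complex_eq_iff)

text \<open>One half of the relation d omega^2 = \<delta> omega^1. The right side contains no
  metric; \<open>omega1_cocycle\<close> shows that \<delta> omega^1 reduces to the same
  form.\<close>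

lemma
  assumes "m < n" "i < n" "j < n"
  shows omega2_smooth: "smooth_fun \<A> (V m \<inter> (V i \<inter> V j)) (omega2 K m i j)"
    and omega2_d0: "\<And>\<phi> x. \<phi> \<in> coords \<A> \<Longrightarrow> x \<in> fst \<phi> \<Longrightarrow> x \<in> V m \<inter> (V i \<inter> V j) \<Longrightarrow>
       d0 (omega2 K m i j) \<phi> x = theta (b m i) (b i j) \<phi> x"
proof -
  let ?W = "V m \<inter> (V i \<inter> V j)"
  let ?L = "Lfun K m i j" and ?l = "lg m i" and ?l' = "lg i j"
  have W: "open ?W" by (rule VVV_open[OF assms(2,3,1)])
  have L: "holo_fun \<A> ?W ?L" using L_holo[OF assms] by (simp add: Int_assoc)
  have l: "holo_fun \<A> ?W ?l" by (rule holo_fun_subset[OF trans_holo(2)[OF assms(1,2)]]) auto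
  have l': "holo_fun \<A> ?W ?l'" by (rule holo_fun_subset[OF trans_holo(2)[OF assms(2,3)]]) auto
  note Ls = holo_fun_smooth[OF W L] and ls = holo_fun_smooth[OF W l] and ls' = holo_fun_smooth[OF W l']
  note cs = Ls[THEN smooth_fun_cnj[OF W]] ls[THEN smooth_fun_cnj[OF W]] ls'[THEN smooth_fun_cnj[OF W]]
  define F where "F x = (-1/2) * ?L x + (1/2) * cnj (?L x) + (-1/4) * ((?l x - cnj (?l x)) * (?l' x + cnj (?l' x)))" for x
  have F: "omega2 K m i j x = F x" if "x \<in> ?W" for x
    using omega2_form[OF assms that] by (simp add: F_def)
  have Fs: "smooth_fun \<A> ?W F" unfolding F_def[abs_def]
    by (intro smooth_fun_add smooth_fun_mult smooth_fun_diff smooth_fun_const W Ls ls ls' cs)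
  then show "smooth_fun \<A> ?W (omega2 K m i j)"
    using smooth_fun_cong[OF W, of "omega2 K m i j" F] F by blast
  fix \<phi> x assume \<phi>: "\<phi> \<in> coords \<A>" "x \<in> fst \<phi>" and x: "x \<in> ?W"
  note h = holo_fun_pd(1)[OF _ \<phi>(1) W \<phi>(2) x]
  note c = pd_z_cnj[OF _ \<phi> x, of ?L] pd_z_cnj[OF _ \<phi> x, of ?l] pd_z_cnj[OF _ \<phi> x, of ?l']
    pd_zbar_cnj[OF _ \<phi> x, of ?L] pd_zbar_cnj[OF _ \<phi> x, of ?l] pd_zbar_cnj[OF _ \<phi> x, of ?l']
  \<comment> \<open>The prescribed differential of L turns the imaginary part of log g_mi in the
    second term of omega^2 into its real part, which is log |g_mi|.\<close>
  have Lz: "pd_z \<phi> ?L x = - ?l x * pd_z \<phi> ?l' x"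
    using L_d0[OF assms \<phi>] x by (auto simp: d0_def csmul_def)
  have s1: "smooth_fun \<A> ?W (\<lambda>x. (-1/2) * ?L x)" "smooth_fun \<A> ?W (\<lambda>x. (1/2) * cnj (?L x))"
    "smooth_fun \<A> ?W (\<lambda>x. (-1/2) * ?L x + (1/2) * cnj (?L x))"
    "smooth_fun \<A> ?W (\<lambda>x. ?l x - cnj (?l x))" "smooth_fun \<A> ?W (\<lambda>x. ?l' x + cnj (?l' x))"
    "smooth_fun \<A> ?W (\<lambda>x. (?l x - cnj (?l x)) * (?l' x + cnj (?l' x)))"
    "smooth_fun \<A> ?W (\<lambda>x. (-1/4) * ((?l x - cnj (?l x)) * (?l' x + cnj (?l' x))))"
    by (intro smooth_fun_add smooth_fun_mult smooth_fun_diff smooth_fun_const W Ls ls ls' cs)+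
  have "pd_z \<phi> (omega2 K m i j) x = pd_z \<phi> F x" by (rule pd_z_cong[OF W _ \<phi> x]) (rule F)
  also have "\<dots> = (-1/2) * pd_z \<phi> ?L x + (-1/4) * ((?l x - cnj (?l x)) * pd_z \<phi> ?l' x + pd_z \<phi> ?l x * (?l' x + cnj (?l' x)))"
    unfolding F_def[abs_def] pd_z_add[OF s1(3,7) \<phi> x] pd_z_add[OF s1(1,2) \<phi> x] pd_z_cmult[OF Ls \<phi> x]
      pd_z_cmult[OF cs(1) \<phi> x] pd_z_cmult[OF s1(6) \<phi> x] pd_z_mult[OF s1(4,5) \<phi> x]
      pd_z_diff[OF ls cs(2) \<phi> x W] pd_z_add[OF ls' cs(3) \<phi> x] c(1)[OF Ls] c(2)[OF ls] c(3)[OF ls'] h[OF L] h[OF l] h[OF l']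
    by simp
  also have "\<dots> = (1/2) * (of_real (Re (?l x)) * pd_z \<phi> ?l' x - of_real (Re (?l' x)) * pd_z \<phi> ?l x)"
    unfolding Lz by (simp add: complex_eq_iff field_simps)
  finally have 1: "pd_z \<phi> (omega2 K m i j) x = (1/2) * (of_real (Re (?l x)) * pd_z \<phi> ?l' x - of_real (Re (?l' x)) * pd_z \<phi> ?l x)" .
  have "pd_zbar \<phi> (omega2 K m i j) x = pd_zbar \<phi> F x" by (rule pd_zbar_cong[OF W _ \<phi> x]) (rule F)
  also have "\<dots> = (1/2) * cnj (pd_z \<phi> ?L x) + (-1/4) * ((?l x - cnj (?l x)) * cnj (pd_z \<phi> ?l' x) - cnj (pd_z \<phi> ?l x) * (?l' x + cnj (?l' x)))"
    unfolding F_def[abs_def] pd_zbar_add[OF s1(3,7) \<phi> x] pd_zbar_add[OF s1(1,2) \<phi> x] pd_zbar_cmult[OF Ls \<phi> x]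
      pd_zbar_cmult[OF cs(1) \<phi> x] pd_zbar_cmult[OF s1(6) \<phi> x] pd_zbar_mult[OF s1(4,5) \<phi> x]
      pd_zbar_diff[OF ls cs(2) \<phi> x W] pd_zbar_add[OF ls' cs(3) \<phi> x] c(4)[OF Ls] c(5)[OF ls] c(6)[OF ls'] h[OF L] h[OF l] h[OF l']
    by simp
  also have "\<dots> = - (1/2) * (of_real (Re (?l x)) * cnj (pd_z \<phi> ?l' x) - of_real (Re (?l' x)) * cnj (pd_z \<phi> ?l x))"
    unfolding Lz by (simp add: complex_eq_iff field_simps)
  finally have 2: "pd_zbar \<phi> (omega2 K m i j) x = - (1/2) * (of_real (Re (?l x)) * cnj (pd_z \<phi> ?l' x) - of_real (Re (?l' x)) * cnj (pd_z \<phi> ?l x))" .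
  have dcb: "dc (\<lambda>y. complex_of_real (Re (l y))) \<phi> x = ((1/2) * pd_z \<phi> l x, - (1/2) * cnj (pd_z \<phi> l x))"
    if "holo_fun \<A> ?W l" for l
  proof -
    note ls = holo_fun_smooth[OF W that]
    note lc = smooth_fun_cnj[OF W ls]
    have e: "(\<lambda>y. complex_of_real (Re (l y))) = (\<lambda>y. (1/2) * (l y + cnj (l y)))" by (auto simp: complex_eq_iff)
    have s: "smooth_fun \<A> ?W (\<lambda>y. l y + cnj (l y))" by (intro smooth_fun_add W ls lc)
    show ?thesis
      unfolding dc_def e pd_z_cmult[OF s \<phi> x] pd_zbar_cmult[OF s \<phi> x] pd_z_add[OF ls lc \<phi> x] pd_zbar_add[OF ls lc \<phi> x]
        pd_z_cnj[OF ls \<phi> x] pd_zbar_cnj[OF ls \<phi> x] h[OF that] by simp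
  qed
  have "theta (b m i) (b i j) \<phi> x = theta (\<lambda>y. Re (?l y)) (\<lambda>y. Re (?l' y)) \<phi> x"
    by (rule theta_cong[OF W _ _ \<phi> x]) (use b_Re assms in auto)
  then show "d0 (omega2 K m i j) \<phi> x = theta (b m i) (b i j) \<phi> x"
    unfolding d0_def 1 2 by (simp add: theta_def dcb[OF l] dcb[OF l'] scaleR_conv_of_real algebra_simps)
qed

lemma dbar_del_b:
  assumes "i < n" "j < n" "\<phi> \<in> coords \<A>" "x \<in> fst \<phi>" "x \<in> V i" "x \<in> V j"
  shows "dbar_del (\<lambda>y. complex_of_real (b i j y)) \<phi> x = 0"
proof -
  let ?W = "V i \<inter> V j" and ?u = "\<lambda>y. ln ((cmod (transition K i j y))\<^sup>2)"
  note W = VV_open[OF assms(1,2)]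
  have x: "x \<in> ?W" using assms by auto
  have nz: "\<And>y. y \<in> ?W \<Longrightarrow> transition K i j y \<noteq> 0" using trans_nonzero assms by auto
  have u: "smooth_fun \<A> ?W ?u"
    by (rule smooth_fun_ln_holo[OF W trans_holo(1)[OF assms(1,2)]]) (rule nz)
  have u0: "dbar_del (\<lambda>y. complex_of_real (?u y)) \<phi> x = 0"
    by (rule dbar_del_ln_holo[OF W trans_holo(1)[OF assms(1,2)] _ assms(3,4) x]) (rule nz)
  have "dbar_del (\<lambda>y. complex_of_real (b i j y)) \<phi> x = dbar_del (\<lambda>y. (1/2) * complex_of_real (?u y)) \<phi> x"
    by (rule dbar_del_cong[OF W _ assms(3,4) x]) (use nz in \<open>auto simp: log_abs_g_def ln_realpow\<close>)
  also have "\<dots> = (1/2) * dbar_del (\<lambda>y. complex_of_real (?u y)) \<phi> x"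
    by (rule dbar_del_cmult[OF W smooth_fun_of_real[OF W u] assms(3,4) x])
  finally show ?thesis using u0 by simp
qed

text \<open>The least index is the one whose piece V_i - \<Union>(V_j, j < i) contains the point, so
  \<open>idx\<close> also tells in which chart \<open>integral_form2\<close> works there.\<close>

definition idx :: "'a \<Rightarrow> nat" where "idx x = (LEAST i. i < n \<and> x \<in> V i)"

lemma idx: "idx x < n" "x \<in> V (idx x)"
proof -
  have "\<exists>i. i < n \<and> x \<in> V i" using V_cover by metis
  then have "idx x < n \<and> x \<in> V (idx x)" unfolding idx_def by (rule LeastI_ex)
  then show "idx x < n" "x \<in> V (idx x)" by auto
qed

section \<open>Gluing local forms and comparing frame norms\<close>

lemma glue_form1:
  assumes "open W" "\<And>i. i < n \<Longrightarrow> smooth_form1 \<A> (V i \<inter> W) (\<xi> i)"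
    and "\<And>i j \<phi> x. i < n \<Longrightarrow> j < n \<Longrightarrow> \<phi> \<in> coords \<A> \<Longrightarrow> x \<in> fst \<phi> \<Longrightarrow> x \<in> V i \<Longrightarrow> x \<in> V j \<Longrightarrow> x \<in> W \<Longrightarrow> \<xi> i \<phi> x = \<xi> j \<phi> x"
  obtains \<zeta> where "smooth_form1 \<A> W \<zeta>"
    "\<And>i \<phi> x. i < n \<Longrightarrow> \<phi> \<in> coords \<A> \<Longrightarrow> x \<in> fst \<phi> \<Longrightarrow> x \<in> V i \<Longrightarrow> x \<in> W \<Longrightarrow> \<zeta> \<phi> x = \<xi> i \<phi> x"
proof
  show e: "(\<lambda>\<phi> x. \<xi> (idx x) \<phi> x) \<phi> x = \<xi> i \<phi> x" if "i < n" "\<phi> \<in> coords \<A>" "x \<in> fst \<phi>" "x \<in> V i" "x \<in> W" for i \<phi> x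
    using assms(3)[OF idx(1) that(1-3) idx(2) that(4,5)] .
  show "smooth_form1 \<A> W (\<lambda>\<phi> x. \<xi> (idx x) \<phi> x)"
  proof (rule smooth_form1_local)
    fix x assume x: "x \<in> W"
    obtain i where i: "i < n" "x \<in> V i" by (rule V_cover)
    have o: "open (V i \<inter> W)" using V_open[OF i(1)] assms(1) by auto
    have "smooth_form1 \<A> (V i \<inter> W) (\<lambda>\<phi> x. \<xi> (idx x) \<phi> x)"
      using smooth_form1_cong[OF o, of "\<lambda>\<phi> x. \<xi> (idx x) \<phi> x" "\<xi> i"] e[OF i(1)] assms(2)[OF i(1)] by blast
    then show "\<exists>W'. open W' \<and> x \<in> W' \<and> smooth_form1 \<A> W' (\<lambda>\<phi> x. \<xi> (idx x) \<phi> x)"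
      using o i x by blast
  qed
qed

lemma glue_form2:
  assumes "open W" "\<And>i. i < n \<Longrightarrow> smooth_form2 \<A> (V i \<inter> W) (\<xi> i)"
    and "\<And>i j \<phi> x. i < n \<Longrightarrow> j < n \<Longrightarrow> \<phi> \<in> coords \<A> \<Longrightarrow> x \<in> fst \<phi> \<Longrightarrow> x \<in> V i \<Longrightarrow> x \<in> V j \<Longrightarrow> x \<in> W \<Longrightarrow> \<xi> i \<phi> x = \<xi> j \<phi> x"
  obtains \<zeta> where "smooth_form2 \<A> W \<zeta>"
    "\<And>i \<phi> x. i < n \<Longrightarrow> \<phi> \<in> coords \<A> \<Longrightarrow> x \<in> fst \<phi> \<Longrightarrow> x \<in> V i \<Longrightarrow> x \<in> W \<Longrightarrow> \<zeta> \<phi> x = \<xi> i \<phi> x"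
proof
  show e: "(\<lambda>\<phi> x. \<xi> (idx x) \<phi> x) \<phi> x = \<xi> i \<phi> x" if "i < n" "\<phi> \<in> coords \<A>" "x \<in> fst \<phi>" "x \<in> V i" "x \<in> W" for i \<phi> x
    using assms(3)[OF idx(1) that(1-3) idx(2) that(4,5)] .
  show "smooth_form2 \<A> W (\<lambda>\<phi> x. \<xi> (idx x) \<phi> x)"
  proof (rule smooth_form2_local)
    fix x assume x: "x \<in> W"
    obtain i where i: "i < n" "x \<in> V i" by (rule V_cover)
    have o: "open (V i \<inter> W)" using V_open[OF i(1)] assms(1) by auto
    have "smooth_form2 \<A> (V i \<inter> W) (\<lambda>\<phi> x. \<xi> (idx x) \<phi> x)"
      using smooth_form2_cong[OF o, of "\<lambda>\<phi> x. \<xi> (idx x) \<phi> x" "\<xi> i"] e[OF i(1)] assms(2)[OF i(1)] by blast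
    then show "\<exists>W'. open W' \<and> x \<in> W' \<and> smooth_form2 \<A> W' (\<lambda>\<phi> x. \<xi> (idx x) \<phi> x)"
      using o i x by blast
  qed
qed

text \<open>The data of a metric on which the algebra of the descent rests: smooth logarithms of the
  frame norms off D, related on overlaps by |g_ij|^2.\<close>

definition frame_log :: "'a conf_metric \<Rightarrow> bool" where
  "frame_log \<rho> \<longleftrightarrow> (\<forall>i<n. smooth_fun \<A> (V i - D) (log_frame D K \<rho> i)) \<and>
     (\<forall>i<n. \<forall>j<n. \<forall>x\<in>V i \<inter> V j - D. log_frame D K \<rho> j x = log_frame D K \<rho> i x + 2 * b i j x)"

text \<open>The defining relation of g_ij turns the transformation law of the density into
  multiplication of ||s_i||^2 by |g_ij|^2.\<close>

lemma conformal_frame_log: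
  assumes "conformal_metric \<A> (UNIV - D) \<rho>"
  shows "frame_log \<rho>"
  unfolding frame_log_def
proof (intro conjI allI impI ballI)
  have pos: "\<rho> (chart K i) x > 0" if "i < n" "x \<in> V i" "x \<notin> D" for i x
    using assms chart_coords[OF that(1)] that unfolding conformal_metric_def cover_dom_def by blast
  have pos': "norm_sq \<rho> (chart K i) (frame_coeff D K i) x > 0" if "i < n" "x \<in> V i" "x \<notin> D" for i x
    using pos[OF that] frame_nonzero[OF that] by (simp add: norm_sq_def)
  {
    fix i assume i: "i < n"
    have o: "open (V i - D)" using V_open[OF i] closed_D by auto
    have "smooth_fun \<A> (fst (chart K i) \<inter> (UNIV - D)) (\<rho> (chart K i))"
      using assms chart_coords[OF i] unfolding conformal_metric_def by blast
    then have r: "smooth_fun \<A> (V i - D) (\<rho> (chart K i))" by (simp add: cover_dom_def Diff_eq)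
    have "smooth_fun \<A> (V i) (frame_coeff D K i)" by (rule holo_fun_smooth[OF V_open[OF i] frame_holo[OF i]])
    then have e: "smooth_fun \<A> (V i - D) (frame_coeff D K i)" by (rule smooth_fun_subset) auto
    have "smooth_fun \<A> (V i - D) (\<lambda>x. frame_coeff D K i x \<bullet> frame_coeff D K i x)"
      by (rule smooth_fun_bilinear[OF o bounded_bilinear_inner e e])
    then have "smooth_fun \<A> (V i - D) (\<lambda>x. \<rho> (chart K i) x * (frame_coeff D K i x \<bullet> frame_coeff D K i x))"
      by (intro smooth_fun_mult r o)
    then have "smooth_fun \<A> (V i - D) (\<lambda>x. norm_sq \<rho> (chart K i) (frame_coeff D K i) x)"
      by (simp add: norm_sq_def power2_norm_eq_inner)
    then show "smooth_fun \<A> (V i - D) (log_frame D K \<rho> i)"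
      unfolding log_frame_def[abs_def] using pos'[OF i] by (intro smooth_fun_ln o) auto
  next
    fix i j x assume i: "i < n" and j: "j < n" and x: "x \<in> V i \<inter> V j - D"
    have "\<rho> (chart K j) x = \<rho> (chart K i) x * (cmod (jac (chart K i) (chart K j) x))\<^sup>2"
      using assms chart_coords[OF i] chart_coords[OF j] x unfolding conformal_metric_def cover_dom_def by blast
    then have "norm_sq \<rho> (chart K j) (frame_coeff D K j) x
       = \<rho> (chart K i) x * (cmod (frame_coeff D K j x * jac (chart K i) (chart K j) x))\<^sup>2"
      by (simp add: norm_sq_def norm_mult power_mult_distrib algebra_simps)
    also have "\<dots> = norm_sq \<rho> (chart K i) (frame_coeff D K i) x * (cmod (transition K i j x))\<^sup>2"
      using trans_eq(1)[OF i j, of x] x by (simp add: norm_sq_def norm_mult power_mult_distrib algebra_simps)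
    finally have "norm_sq \<rho> (chart K j) (frame_coeff D K j) x = \<dots>" .
    then show "log_frame D K \<rho> j x = log_frame D K \<rho> i x + 2 * b i j x"
      using pos'[OF i, of x] trans_nonzero[OF i j, of x] x
      by (simp add: log_frame_def log_abs_g_def ln_mult ln_realpow)
  }
qed

lemma log_frame_smooth: "frame_log \<rho> \<Longrightarrow> i < n \<Longrightarrow> smooth_fun \<A> (V i - D) (log_frame D K \<rho> i)"
  by (simp add: frame_log_def)

lemma log_frame_change_frame:
  assumes "frame_log \<rho>" "i < n" "j < n" "x \<in> V i" "x \<in> V j" "x \<notin> D"
  shows "log_frame D K \<rho> j x = log_frame D K \<rho> i x + 2 * b i j x"
proof -
  note H = conjunct2[OF assms(1)[unfolded frame_log_def], rule_format, OF assms(2,3)]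
  show ?thesis by (rule H) (simp add: assms)
qed

lemma VD_open: "i < n \<Longrightarrow> open (V i - D)"
  using V_open closed_D by auto

section \<open>Averaging over a partition of unity\<close>

lemma pu_exists: "\<exists>\<kappa> :: nat \<Rightarrow> 'a \<Rightarrow> real. (\<forall>i. smooth_fun \<A> UNIV (\<kappa> i)) \<and> (\<forall>x. (\<Sum>i<n. \<kappa> i x) = 1) \<and>
    (\<forall>i<n. \<exists>C. compact C \<and> C \<subseteq> V i \<and> (\<forall>x. x \<notin> C \<longrightarrow> \<kappa> i x = 0))"
proof (rule partition_of_unity[of n V])
  fix \<kappa> :: "nat \<Rightarrow> 'a \<Rightarrow> real" and C
  assume \<kappa>: "\<And>i. smooth_fun \<A> UNIV (\<kappa> i)" "\<And>x. (\<Sum>i<n. \<kappa> i x) = 1"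
    and C: "\<And>i. i < n \<Longrightarrow> compact (C i)" "\<And>i. i < n \<Longrightarrow> C i \<subseteq> V i" "\<And>i x. i < n \<Longrightarrow> x \<notin> C i \<Longrightarrow> \<kappa> i x = 0"
  have "\<exists>C. compact C \<and> C \<subseteq> V i \<and> (\<forall>x. x \<notin> C \<longrightarrow> \<kappa> i x = 0)" if "i < n" for i
    using C[OF that] by (intro exI[of _ "C i"]) simp
  with \<kappa> show ?thesis by (intro exI[of _ \<kappa>]) simp
qed (auto intro: V_open simp: good_facts(2))

definition pu :: "nat \<Rightarrow> 'a \<Rightarrow> real" where
  "pu = (SOME \<kappa>. (\<forall>i. smooth_fun \<A> UNIV (\<kappa> i)) \<and> (\<forall>x. (\<Sum>i<n. \<kappa> i x) = 1) \<and>
    (\<forall>i<n. \<exists>C. compact C \<and> C \<subseteq> V i \<and> (\<forall>x. x \<notin> C \<longrightarrow> \<kappa> i x = 0)))"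

lemma pu_props: "(\<forall>i. smooth_fun \<A> UNIV (pu i)) \<and> (\<forall>x. (\<Sum>i<n. pu i x) = 1) \<and>
    (\<forall>i<n. \<exists>C. compact C \<and> C \<subseteq> V i \<and> (\<forall>x. x \<notin> C \<longrightarrow> pu i x = 0))"
  unfolding pu_def by (rule someI_ex[OF pu_exists])

lemma pu_smooth: "smooth_fun \<A> UNIV (pu i)" and pu_sum1: "(\<Sum>i<n. pu i x) = 1"
  using pu_props by auto

lemma pu_support:
  assumes "m < n"
  obtains C where "compact C" "C \<subseteq> V m" "\<And>x. x \<notin> C \<Longrightarrow> pu m x = 0"
  using pu_props assms by metis

lemma pu_outside: "m < n \<Longrightarrow> x \<notin> V m \<Longrightarrow> pu m x = 0"
  by (rule pu_support[of m]) auto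

text \<open>The averaging principle behind all Cech arguments below: members that miss
  \<open>x\<close> have weight 0, so the values of \<open>f\<close> for them may be
  arbitrary.\<close>

lemma pu_sum:
  assumes "\<And>m. m < n \<Longrightarrow> x \<in> V m \<Longrightarrow> f m = (g :: 'b :: real_normed_vector)"
  shows "(\<Sum>m<n. pu m x *\<^sub>R f m) = g"
proof -
  have "(\<Sum>m<n. pu m x *\<^sub>R f m) = (\<Sum>m<n. pu m x *\<^sub>R g)"
    using assms pu_outside by (intro sum.cong) force+
  then show ?thesis by (simp add: scaleR_left.sum[symmetric] pu_sum1)
qed

lemma pu_cut_fun:
  assumes "m < n" "open W" "smooth_fun \<A> (V m \<inter> W) f"
  shows "smooth_fun \<A> W (\<lambda>x. pu m x *\<^sub>R f x)"
proof -
  obtain C where C: "compact C" "C \<subseteq> V m" "\<And>x. x \<notin> C \<Longrightarrow> pu m x = 0" by (rule pu_support[OF assms(1)]) blast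
  show ?thesis
    by (rule smooth_fun_cutoff[OF pu_smooth compact_imp_closed[OF C(1)] C(2,3) V_open[OF assms(1)] assms(2,3)])
qed

lemma pu_cut_form1:
  assumes "m < n" "open W" "smooth_form1 \<A> (V m \<inter> W) \<eta>"
  shows "smooth_form1 \<A> W (\<lambda>\<phi> x. pu m x *\<^sub>R \<eta> \<phi> x)"
proof -
  obtain C where C: "compact C" "C \<subseteq> V m" "\<And>x. x \<notin> C \<Longrightarrow> pu m x = 0" by (rule pu_support[OF assms(1)]) blast
  show ?thesis
    by (rule smooth_form1_cutoff[OF pu_smooth compact_imp_closed[OF C(1)] C(2,3) V_open[OF assms(1)] assms(2,3)])
qed

lemma pu_cut_imaginary:
  assumes "m < n" "imaginary_form1 \<A> (V m \<inter> W) \<eta>"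
  shows "imaginary_form1 \<A> W (\<lambda>\<phi> x. pu m x *\<^sub>R \<eta> \<phi> x)"
  unfolding imaginary_form1_def
proof (intro ballI)
  fix \<phi> x assume \<phi>: "\<phi> \<in> coords \<A>" "x \<in> fst \<phi> \<inter> W"
  show "fst (pu m x *\<^sub>R \<eta> \<phi> x) = - cnj (snd (pu m x *\<^sub>R \<eta> \<phi> x))"
  proof (cases "x \<in> V m")
    case True
    then have "fst (\<eta> \<phi> x) = - cnj (snd (\<eta> \<phi> x))"
      using assms(2) \<phi> unfolding imaginary_form1_def by auto
    then show ?thesis by simp
  qed (simp add: pu_outside[OF assms(1)])
qed

section \<open>The cochain omega^1 and its coboundary\<close>

lemma omega1_theta: "omega1 D K \<rho> i j \<phi> x = (1/2) *\<^sub>R theta (log_frame D K \<rho> j) (b i j) \<phi> x"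
  by (simp add: omega1_def theta_def o_def scaleR_diff_right)

lemma theta_b_self: "i < n \<Longrightarrow> \<phi> \<in> coords \<A> \<Longrightarrow> x \<in> fst \<phi> \<Longrightarrow> x \<in> V i \<Longrightarrow> theta f (b i i) \<phi> x = 0"
  by (rule theta_zero(1)[OF V_open b_self])

lemma VV_diff: "i < n \<Longrightarrow> j < n \<Longrightarrow> i \<noteq> j \<Longrightarrow> V i \<inter> V j \<subseteq> V j - D"
  using V_int_D by blast

text \<open>Smooth across D although the logarithm of the norm is singular there: omega^1_ii
  vanishes because log |g_ii| = 0, and overlaps of distinct members avoid D.\<close>

lemma
  assumes \<rho>: "frame_log \<rho>" and i: "i < n" and j: "j < n"
  shows omega1_smooth: "smooth_form1 \<A> (V i \<inter> V j) (omega1 D K \<rho> i j)"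
    and omega1_imaginary: "imaginary_form1 \<A> (V i \<inter> V j) (omega1 D K \<rho> i j)"
proof (atomize(full), cases "i = j")
  case True
  have "omega1 D K \<rho> i j \<phi> x = 0" if "\<phi> \<in> coords \<A>" "x \<in> fst \<phi>" "x \<in> V i \<inter> V j" for \<phi> x
    using theta_b_self[OF i that(1,2)] that(3) True by (simp add: omega1_theta)
  then show "smooth_form1 \<A> (V i \<inter> V j) (omega1 D K \<rho> i j) \<and> imaginary_form1 \<A> (V i \<inter> V j) (omega1 D K \<rho> i j)"
    using smooth_form1_cong[OF VV_open[OF i j], of "omega1 D K \<rho> i j" "\<lambda>\<phi> x. 0"] smooth_form1_zero
    by (auto simp: imaginary_form1_def)
next
  case False
  have r: "smooth_fun \<A> (V i \<inter> V j) (log_frame D K \<rho> j)"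
    by (rule smooth_fun_subset[OF log_frame_smooth[OF \<rho> j] VV_diff[OF i j False]])
  show "smooth_form1 \<A> (V i \<inter> V j) (omega1 D K \<rho> i j) \<and> imaginary_form1 \<A> (V i \<inter> V j) (omega1 D K \<rho> i j)"
    unfolding omega1_theta[abs_def]
    by (intro conjI smooth_form1_scaleR imaginary_form1_scaleR smooth_fun_const smooth_form1_theta
        imaginary_form1_theta VV_open i j r b_smooth)
qed

text \<open>Both cocycle rules enter. Expanding b_mj = b_mi + b_ij cancels \<theta>(r_j, b_ij), and
  then r_j = r_i + 2 b_ij cancels \<theta>(r_i, b_mi). What remains involves only the logarithms of
  the |g|.\<close>

lemma omega1_cocycle:
  assumes \<rho>: "frame_log \<rho>" and m: "m < n" and i: "i < n" and j: "j < n"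
    and \<phi>: "\<phi> \<in> coords \<A>" "x \<in> fst \<phi>" and x: "x \<in> V m" "x \<in> V i" "x \<in> V j"
  shows "omega1 D K \<rho> i j \<phi> x - omega1 D K \<rho> m j \<phi> x + omega1 D K \<rho> m i \<phi> x = theta (b m i) (b i j) \<phi> x"
proof (cases "x \<in> D")
  case True
  then have "m = i" "i = j" using V_int_D m i j x by blast+
  then show ?thesis using theta_b_self[OF i \<phi> x(2)] by (simp add: omega1_theta)
next
  case False
  let ?W = "V m \<inter> (V i \<inter> V j) - D"
  have W: "open ?W" using VVV_open[OF i j m] closed_D by auto
  have xW: "x \<in> ?W" using x False by auto
  let ?r = "log_frame D K \<rho>"
  have s: "smooth_fun \<A> ?W (?r i)" "smooth_fun \<A> ?W (?r j)" "smooth_fun \<A> ?W (b m i)" "smooth_fun \<A> ?W (b i j)"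
    by (rule smooth_fun_subset[OF log_frame_smooth[OF \<rho> i]], blast)
       (rule smooth_fun_subset[OF log_frame_smooth[OF \<rho> j]], blast,
        rule smooth_fun_subset[OF b_smooth[OF m i]], blast, rule smooth_fun_subset[OF b_smooth[OF i j]], blast)
  have 1: "theta (?r j) (b m j) \<phi> x = theta (?r j) (\<lambda>y. b m i y + 1 * b i j y) \<phi> x"
    by (rule theta_cong[OF W _ _ \<phi> xW]) (use b_cocycle[OF m i j] in auto)
  have 2: "theta (?r j) (b m i) \<phi> x = theta (\<lambda>y. ?r i y + 2 * b i j y) (b m i) \<phi> x"
    by (rule theta_cong[OF W _ _ \<phi> xW]) (use log_frame_change_frame[OF \<rho> i j] in auto)
  have e1: "theta (?r j) (b m j) \<phi> x = theta (?r j) (b m i) \<phi> x + theta (?r j) (b i j) \<phi> x"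
    unfolding 1 theta_add(1)[OF W s(2,3,4) \<phi> xW] by simp
  have e2: "theta (?r j) (b m i) \<phi> x = theta (?r i) (b m i) \<phi> x + 2 *\<^sub>R theta (b i j) (b m i) \<phi> x"
    unfolding 2 theta_add(2)[OF W s(3,1,4) \<phi> xW] ..
  show ?thesis
    unfolding omega1_theta e1 e2 theta_swap[of "b i j" "b m i" \<phi> x]
    by (simp add: scaleR_add_right scaleR_diff_right)
qed

lemma dbar_del_frame_change:
  assumes "frame_log \<rho>" "i < n" "j < n" "\<phi> \<in> coords \<A>" "x \<in> fst \<phi>" "x \<in> V i" "x \<in> V j" "x \<notin> D"
  shows "dbar_del (\<lambda>y. complex_of_real (log_frame D K \<rho> j y)) \<phi> x = dbar_del (\<lambda>y. complex_of_real (log_frame D K \<rho> i y)) \<phi> x"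
proof -
  let ?W = "V i \<inter> V j - D" and ?r = "log_frame D K \<rho>"
  have W: "open ?W" using VV_open[OF assms(2,3)] closed_D by auto
  have x: "x \<in> ?W" using assms by auto
  have r: "smooth_fun \<A> ?W (\<lambda>y. complex_of_real (?r i y))"
    by (rule smooth_fun_of_real[OF W smooth_fun_subset[OF log_frame_smooth[OF assms(1,2)]]]) auto
  have b': "smooth_fun \<A> ?W (\<lambda>y. complex_of_real (b i j y))"
    by (rule smooth_fun_of_real[OF W smooth_fun_subset[OF b_smooth[OF assms(2,3)]]]) auto
  have b: "smooth_fun \<A> ?W (\<lambda>y. 2 * complex_of_real (b i j y))"
    by (intro smooth_fun_mult smooth_fun_const W b')
  have "dbar_del (\<lambda>y. complex_of_real (?r j y)) \<phi> x = dbar_del (\<lambda>y. complex_of_real (?r i y) + 2 * complex_of_real (b i j y)) \<phi> x"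
    by (rule dbar_del_cong[OF W _ assms(4,5) x]) (use log_frame_change_frame[OF assms(1-3)] in auto)
  also have "\<dots> = dbar_del (\<lambda>y. complex_of_real (?r i y)) \<phi> x"
    unfolding dbar_del_add[OF W r b assms(4,5) x] dbar_del_cmult[OF W b' assms(4,5) x]
    using dbar_del_b[OF assms(2-5,6,7)] by simp
  finally show ?thesis .
qed

text \<open>As log |g_ij| is harmonic, only - b_ij dbar del r_j survives in d omega^1. Here b_ij is
  half of r_j - r_i, and dbar del r_j = dbar del r_i.\<close>

lemma d1_omega1:
  assumes "frame_log \<rho>" "i < n" "j < n" "\<phi> \<in> coords \<A>" "x \<in> fst \<phi>" "x \<in> V i" "x \<in> V j" "x \<notin> D"
  shows "d1 (omega1 D K \<rho> i j) \<phi> x = omega0 D K \<rho> i \<phi> x - omega0 D K \<rho> j \<phi> x"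
proof -
  let ?W = "V i \<inter> V j - D" and ?r = "log_frame D K \<rho>"
  have W: "open ?W" using VV_open[OF assms(2,3)] closed_D by auto
  have x: "x \<in> ?W" using assms by auto
  have r: "smooth_fun \<A> ?W (?r j)"
    by (rule smooth_fun_subset[OF log_frame_smooth[OF assms(1,3)]]) auto
  have b: "smooth_fun \<A> ?W (b i j)" by (rule smooth_fun_subset[OF b_smooth[OF assms(2,3)]]) auto
  have "d1 (omega1 D K \<rho> i j) \<phi> x = (1/2) * d1 (theta (?r j) (b i j)) \<phi> x"
    unfolding omega1_theta[abs_def]
    by (subst d1_cmult[OF W smooth_form1_theta[OF W r b] assms(4,5) x]) simp
  also have "\<dots> = - (of_real (b i j x) * dbar_del (\<lambda>y. complex_of_real (?r j y)) \<phi> x)"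
    unfolding d1_theta[OF W r b assms(4,5) x] dbar_del_b[OF assms(2-7)] by simp
  finally show ?thesis
    using log_frame_change_frame[OF assms(1-3,6-8)] dbar_del_frame_change[OF assms]
    by (simp add: omega0_def o_def algebra_simps)
qed

lemma omega0_smooth:
  assumes "frame_log \<rho>" "i < n"
  shows "smooth_form2 \<A> (V i - D) (omega0 D K \<rho> i)"
proof -
  note r = log_frame_smooth[OF assms] and W = VD_open[OF assms(2)]
  have "smooth_fun \<A> (V i - D) (\<lambda>x. complex_of_real (log_frame D K \<rho> i x * (1/2)))"
    by (intro smooth_fun_of_real smooth_fun_mult smooth_fun_const W r)
  from smooth_form2_mult[OF W this smooth_form2_dbar_del[OF W smooth_fun_of_real[OF W r]]]
  have "smooth_form2 \<A> (V i - D) (\<lambda>\<phi> x. complex_of_real (log_frame D K \<rho> i x * (1/2)) *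
     dbar_del (\<lambda>y. complex_of_real (log_frame D K \<rho> i y)) \<phi> x)" .
  then show ?thesis by (simp add: omega0_def[abs_def] o_def)
qed

section \<open>Existence and comparison of descents\<close>

lemma d1_descent:
  assumes "frame_log \<rho>" "i < n" "j < n" "smooth_fun \<A> (V i \<inter> V j) (h i j)"
    and "smooth_form1 \<A> (V i) (\<eta> i)" "smooth_form1 \<A> (V j) (\<eta> j)"
    and eta: "\<And>\<phi> x. \<phi> \<in> coords \<A> \<Longrightarrow> x \<in> fst \<phi> \<Longrightarrow> x \<in> V i \<Longrightarrow> x \<in> V j \<Longrightarrow> \<eta> j \<phi> x - \<eta> i \<phi> x = omega1 D K \<rho> i j \<phi> x - d0 (h i j) \<phi> x"
    and "\<phi> \<in> coords \<A>" "x \<in> fst \<phi>" "x \<in> V i" "x \<in> V j" "x \<notin> D"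
  shows "omega0 D K \<rho> i \<phi> x + d1 (\<eta> i) \<phi> x = omega0 D K \<rho> j \<phi> x + d1 (\<eta> j) \<phi> x"
proof -
  let ?W = "V i \<inter> V j"
  note W = VV_open[OF assms(2,3)]
  have x: "x \<in> ?W" using assms by auto
  have s: "smooth_form1 \<A> ?W (\<eta> i)" "smooth_form1 \<A> ?W (\<eta> j)"
    by (rule smooth_form1_subset[OF assms(5)], blast) (rule smooth_form1_subset[OF assms(6)], blast)
  have "d1 (\<eta> j) \<phi> x - d1 (\<eta> i) \<phi> x = d1 (\<lambda>\<phi> x. \<eta> j \<phi> x - \<eta> i \<phi> x) \<phi> x"
    using d1_diff[OF W s(2,1) assms(8,9) x] by simp
  also have "\<dots> = d1 (\<lambda>\<phi> x. omega1 D K \<rho> i j \<phi> x - d0 (h i j) \<phi> x) \<phi> x"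
    by (rule d1_cong[OF W _ assms(8,9) x]) (simp add: eta)
  also have "\<dots> = d1 (omega1 D K \<rho> i j) \<phi> x - d1 (d0 (h i j)) \<phi> x"
    by (rule d1_diff[OF W omega1_smooth[OF assms(1-3)] smooth_form1_d0[OF W assms(4)] assms(8,9) x])
  also have "\<dots> = omega0 D K \<rho> i \<phi> x - omega0 D K \<rho> j \<phi> x"
    using d1_omega1[OF assms(1-3,8-12)] d1_d0[OF W assms(4,8,9) x] by simp
  finally show ?thesis by (simp add: algebra_simps)
qed

text \<open>The contracting homotopy of the Cech complex: h_ij is the average over m of omega^2_mij,
  and \<eta>_i that of omega^1_mi - dh_mi. The cocycle identities make their coboundaries the
  required cochains, and all terms are smooth across D.\<close>

lemma descent_exists:
  assumes \<rho>: "frame_log \<rho>"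
  shows "\<exists>h \<eta> \<omega>. descent \<A> D K \<rho> h \<eta> \<omega>"
proof -
  define h where "h i j x = (\<Sum>m<n. pu m x *\<^sub>R omega2 K m i j x)" for i j x
  have hs: "smooth_fun \<A> (V i \<inter> V j) (h i j)" if "i < n" "j < n" for i j
    unfolding h_def[abs_def]
    by (intro smooth_fun_sum VV_open that pu_cut_fun omega2_smooth) auto
  have hRe: "Re (h i j x) = 0" if "i < n" "j < n" "x \<in> V i" "x \<in> V j" for i j x
    using that by (simp add: h_def omega2_eq)
  have hd: "h j k x - h i k x + h i j x = omega2 K i j k x"
    if "i < n" "j < n" "k < n" "x \<in> V i" "x \<in> V j" "x \<in> V k" for i j k x
  proof -
    have "h j k x - h i k x + h i j x = (\<Sum>m<n. pu m x *\<^sub>R (omega2 K m j k x - omega2 K m i k x + omega2 K m i j x))"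
      by (simp add: h_def sum.distrib sum_subtractf scaleR_add_right scaleR_diff_right)
    also have "\<dots> = omega2 K i j k x"
      by (rule pu_sum) (use omega2_cocycle[of _ i j k x] that in \<open>simp add: algebra_simps\<close>)
    finally show ?thesis .
  qed
  \<comment> \<open>Obtained by differentiating \<delta>h = omega^2, so that no derivative of the
    partition of unity appears.\<close>
  have dh: "d0 (h i j) \<phi> x - d0 (h m j) \<phi> x + d0 (h m i) \<phi> x = theta (b m i) (b i j) \<phi> x"
    if i: "i < n" and j: "j < n" and m: "m < n" and \<phi>: "\<phi> \<in> coords \<A>" "x \<in> fst \<phi>" and x: "x \<in> V m" "x \<in> V i" "x \<in> V j"
    for i j m \<phi> x
  proof -
    let ?W = "V m \<inter> (V i \<inter> V j)"
    note W = VVV_open[OF i j m]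
    have xW: "x \<in> ?W" using x by auto
    have s: "smooth_fun \<A> ?W (h i j)" "smooth_fun \<A> ?W (h m j)" "smooth_fun \<A> ?W (h m i)"
      by (rule smooth_fun_subset[OF hs[OF i j]], blast)
         (rule smooth_fun_subset[OF hs[OF m j]], blast, rule smooth_fun_subset[OF hs[OF m i]], blast)
    have "d0 (omega2 K m i j) \<phi> x = d0 (\<lambda>x. (h i j x - h m j x) + h m i x) \<phi> x"
      by (rule d0_cong[OF W _ \<phi> xW]) (use hd[OF m i j] in auto)
    also have "\<dots> = d0 (h i j) \<phi> x - d0 (h m j) \<phi> x + d0 (h m i) \<phi> x"
      unfolding d0_add[OF W smooth_fun_diff[OF W s(1,2)] s(3) \<phi> xW] d0_diff[OF W s(1,2) \<phi> xW] ..
    finally show ?thesis using omega2_d0[OF m i j \<phi> xW] by simp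
  qed
  define \<eta> where "\<eta> i \<phi> x = (\<Sum>m<n. pu m x *\<^sub>R (omega1 D K \<rho> m i \<phi> x - d0 (h m i) \<phi> x))" for i \<phi> x
  have \<eta>s: "smooth_form1 \<A> (V i) (\<eta> i)" if "i < n" for i
    unfolding \<eta>_def[abs_def]
    by (intro smooth_form1_sum V_open that pu_cut_form1 smooth_form1_diff VV_open omega1_smooth \<rho> smooth_form1_d0 hs) auto
  have \<eta>i: "imaginary_form1 \<A> (V i) (\<eta> i)" if "i < n" for i
    unfolding \<eta>_def[abs_def]
    by (intro imaginary_form1_sum pu_cut_imaginary imaginary_form1_diff omega1_imaginary \<rho> that imaginary_form1_d0[OF VV_open] hs)
       (auto intro: hRe that)
  have \<eta>d: "\<eta> j \<phi> x - \<eta> i \<phi> x = omega1 D K \<rho> i j \<phi> x - d0 (h i j) \<phi> x"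
    if "i < n" "j < n" "\<phi> \<in> coords \<A>" "x \<in> fst \<phi>" "x \<in> V i" "x \<in> V j" for i j \<phi> x
  proof -
    have "\<eta> j \<phi> x - \<eta> i \<phi> x = (\<Sum>m<n. pu m x *\<^sub>R ((omega1 D K \<rho> m j \<phi> x - d0 (h m j) \<phi> x) - (omega1 D K \<rho> m i \<phi> x - d0 (h m i) \<phi> x)))"
      by (simp add: \<eta>_def sum_subtractf[symmetric] scaleR_diff_right)
    also have "\<dots> = omega1 D K \<rho> i j \<phi> x - d0 (h i j) \<phi> x"
    proof (rule pu_sum)
      fix m assume m: "m < n" "x \<in> V m"
      show "(omega1 D K \<rho> m j \<phi> x - d0 (h m j) \<phi> x) - (omega1 D K \<rho> m i \<phi> x - d0 (h m i) \<phi> x) = omega1 D K \<rho> i j \<phi> x - d0 (h i j) \<phi> x"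
        using omega1_cocycle[OF \<rho> m(1) that(1-4) m(2) that(5,6)] dh[OF that(1,2) m(1) that(3,4) m(2) that(5,6)]
        by (simp add: algebra_simps)
    qed
    finally show ?thesis .
  qed
  obtain \<omega> where \<omega>: "smooth_form2 \<A> (UNIV - D) \<omega>"
    "\<And>i \<phi> x. i < n \<Longrightarrow> \<phi> \<in> coords \<A> \<Longrightarrow> x \<in> fst \<phi> \<Longrightarrow> x \<in> V i \<Longrightarrow> x \<in> UNIV - D \<Longrightarrow> \<omega> \<phi> x = omega0 D K \<rho> i \<phi> x + d1 (\<eta> i) \<phi> x"
  proof (rule glue_form2[of "UNIV - D" "\<lambda>i \<phi> x. omega0 D K \<rho> i \<phi> x + d1 (\<eta> i) \<phi> x"])
    show "open (UNIV - D)" by (rule open_U)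
    show "smooth_form2 \<A> (V i \<inter> (UNIV - D)) (\<lambda>\<phi> x. omega0 D K \<rho> i \<phi> x + d1 (\<eta> i) \<phi> x)" if i: "i < n" for i
    proof -
      have "V i \<inter> (UNIV - D) = V i - D" by auto
      moreover have "smooth_form1 \<A> (V i - D) (\<eta> i)" by (rule smooth_form1_subset[OF \<eta>s[OF i]]) auto
      ultimately show ?thesis
        using smooth_form2_add[OF VD_open[OF i] omega0_smooth[OF \<rho> i] smooth_form2_d1[OF VD_open[OF i]]] by simp
    qed
    show "omega0 D K \<rho> i \<phi> x + d1 (\<eta> i) \<phi> x = omega0 D K \<rho> j \<phi> x + d1 (\<eta> j) \<phi> x"
      if "i < n" "j < n" "\<phi> \<in> coords \<A>" "x \<in> fst \<phi>" "x \<in> V i" "x \<in> V j" "x \<in> UNIV - D" for i j \<phi> x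
      by (rule d1_descent[where h = h and \<eta> = \<eta>, OF \<rho> that(1,2) hs[OF that(1,2)] \<eta>s[OF that(1)] \<eta>s[OF that(2)] \<eta>d[OF that(1,2)] that(3-6)])
         (use that in auto)
  qed blast
  have "descent \<A> D K \<rho> h \<eta> \<omega>"
    unfolding descent_def using hs hRe hd \<eta>s \<eta>i \<eta>d \<omega> by auto
  then show ?thesis by blast
qed

lemma descentD:
  assumes "descent \<A> D K \<rho> h \<eta> \<omega>"
  shows "\<And>i j. i < n \<Longrightarrow> j < n \<Longrightarrow> smooth_fun \<A> (V i \<inter> V j) (h i j)"
    "\<And>i j k x. i < n \<Longrightarrow> j < n \<Longrightarrow> k < n \<Longrightarrow> x \<in> V i \<Longrightarrow> x \<in> V j \<Longrightarrow> x \<in> V k \<Longrightarrow> h j k x - h i k x + h i j x = omega2 K i j k x"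
    "\<And>i. i < n \<Longrightarrow> smooth_form1 \<A> (V i) (\<eta> i)"
    "\<And>i. i < n \<Longrightarrow> imaginary_form1 \<A> (V i) (\<eta> i)"
    "\<And>i j \<phi> x. i < n \<Longrightarrow> j < n \<Longrightarrow> \<phi> \<in> coords \<A> \<Longrightarrow> x \<in> fst \<phi> \<Longrightarrow> x \<in> V i \<Longrightarrow> x \<in> V j \<Longrightarrow>
      \<eta> j \<phi> x - \<eta> i \<phi> x = omega1 D K \<rho> i j \<phi> x - d0 (h i j) \<phi> x"
    "smooth_form2 \<A> (UNIV - D) \<omega>"
    "\<And>i \<phi> x. i < n \<Longrightarrow> \<phi> \<in> coords \<A> \<Longrightarrow> x \<in> fst \<phi> \<Longrightarrow> x \<in> V i \<Longrightarrow> x \<notin> D \<Longrightarrow> \<omega> \<phi> x = omega0 D K \<rho> i \<phi> x + d1 (\<eta> i) \<phi> x"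
    "\<And>i j x. i < n \<Longrightarrow> j < n \<Longrightarrow> x \<in> V i \<Longrightarrow> x \<in> V j \<Longrightarrow> Re (h i j x) = 0"
proof -
  note P = assms[unfolded descent_def]
  note P1 = conjunct1[OF P] and P2 = conjunct1[OF conjunct2[OF P]]
    and P3 = conjunct1[OF conjunct2[OF conjunct2[OF P]]]
    and P4 = conjunct1[OF conjunct2[OF conjunct2[OF conjunct2[OF P]]]]
    and P5 = conjunct1[OF conjunct2[OF conjunct2[OF conjunct2[OF conjunct2[OF P]]]]]
    and P6 = conjunct2[OF conjunct2[OF conjunct2[OF conjunct2[OF conjunct2[OF P]]]]]
  show "\<And>i j. i < n \<Longrightarrow> j < n \<Longrightarrow> smooth_fun \<A> (V i \<inter> V j) (h i j)" using P1 by simp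
  show "\<And>i j x. i < n \<Longrightarrow> j < n \<Longrightarrow> x \<in> V i \<Longrightarrow> x \<in> V j \<Longrightarrow> Re (h i j x) = 0" using P1 by simp
  show "\<And>i j k x. i < n \<Longrightarrow> j < n \<Longrightarrow> k < n \<Longrightarrow> x \<in> V i \<Longrightarrow> x \<in> V j \<Longrightarrow> x \<in> V k \<Longrightarrow> h j k x - h i k x + h i j x = omega2 K i j k x"
    by (rule P2[rule_format]) auto
  show "\<And>i. i < n \<Longrightarrow> smooth_form1 \<A> (V i) (\<eta> i)" using P3 by simp
  show "\<And>i. i < n \<Longrightarrow> imaginary_form1 \<A> (V i) (\<eta> i)" using P3 by simp
  show "\<And>i j \<phi> x. i < n \<Longrightarrow> j < n \<Longrightarrow> \<phi> \<in> coords \<A> \<Longrightarrow> x \<in> fst \<phi> \<Longrightarrow> x \<in> V i \<Longrightarrow> x \<in> V j \<Longrightarrow>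
      \<eta> j \<phi> x - \<eta> i \<phi> x = omega1 D K \<rho> i j \<phi> x - d0 (h i j) \<phi> x"
    by (rule P4[rule_format]) auto
  show "smooth_form2 \<A> (UNIV - D) \<omega>" by (rule P5)
  show "\<And>i \<phi> x. i < n \<Longrightarrow> \<phi> \<in> coords \<A> \<Longrightarrow> x \<in> fst \<phi> \<Longrightarrow> x \<in> V i \<Longrightarrow> x \<notin> D \<Longrightarrow> \<omega> \<phi> x = omega0 D K \<rho> i \<phi> x + d1 (\<eta> i) \<phi> x"
    by (rule P6[rule_format]) auto
qed

text \<open>The difference k of the two choices of h is a cocycle, hence k = \<delta>f with f an
  average of k. Adding df to the difference of the two \<eta> makes it agree on overlaps, while
  omega^0 cancels. The glued form is smooth on the whole surface, D included.\<close>

lemma descent_unique_mod_exact: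
  assumes d: "descent \<A> D K \<rho> h \<eta> \<omega>" and d': "descent \<A> D K \<rho> h' \<eta>' \<omega>'"
  obtains \<xi> where "smooth_form1 \<A> UNIV \<xi>"
    "\<And>\<phi> x. \<phi> \<in> coords \<A> \<Longrightarrow> x \<in> fst \<phi> \<Longrightarrow> x \<notin> D \<Longrightarrow> \<omega>' \<phi> x = \<omega> \<phi> x + d1 \<xi> \<phi> x"
proof -
  note d = descentD[OF d] and d' = descentD[OF d']
  define k where "k i j x = h' i j x - h i j x" for i j x
  have ks: "smooth_fun \<A> (V i \<inter> V j) (k i j)" if "i < n" "j < n" for i j
    unfolding k_def[abs_def] by (intro smooth_fun_diff VV_open d(1) d'(1) that)
  have kd: "k m j x - k m i x = k i j x" if "m < n" "i < n" "j < n" "x \<in> V m" "x \<in> V i" "x \<in> V j" for m i j x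
    using d(2)[OF that] d'(2)[OF that] by (simp add: k_def algebra_simps)
  define f where "f i x = (\<Sum>m<n. pu m x *\<^sub>R k m i x)" for i x
  have fs: "smooth_fun \<A> (V i) (f i)" if "i < n" for i
    unfolding f_def[abs_def] by (intro smooth_fun_sum V_open that pu_cut_fun ks) auto
  have fd: "f j x - f i x = k i j x" if "i < n" "j < n" "x \<in> V i" "x \<in> V j" for i j x
  proof -
    have "f j x - f i x = (\<Sum>m<n. pu m x *\<^sub>R (k m j x - k m i x))"
      by (simp add: f_def sum_subtractf[symmetric] scaleR_diff_right)
    also have "\<dots> = k i j x" by (rule pu_sum) (use kd that in auto)
    finally show ?thesis .
  qed
  define \<xi> where "\<xi> i \<phi> x = (\<eta>' i \<phi> x - \<eta> i \<phi> x) + d0 (f i) \<phi> x" for i \<phi> x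
  have e: "\<xi> i \<phi> x = \<xi> j \<phi> x"
    if "i < n" "j < n" "\<phi> \<in> coords \<A>" "x \<in> fst \<phi>" "x \<in> V i" "x \<in> V j" for i j \<phi> x
  proof -
    note W = VV_open[OF that(1,2)]
    have x: "x \<in> V i \<inter> V j" using that by auto
    have "d0 (\<lambda>x. f j x - f i x) \<phi> x = d0 (\<lambda>x. h' i j x - h i j x) \<phi> x"
      by (rule d0_cong[OF W _ that(3,4) x]) (use fd[OF that(1,2)] in \<open>auto simp: k_def\<close>)
    moreover have "d0 (\<lambda>x. f j x - f i x) \<phi> x = d0 (f j) \<phi> x - d0 (f i) \<phi> x"
      by (rule d0_diff[OF W smooth_fun_subset[OF fs[OF that(2)]] smooth_fun_subset[OF fs[OF that(1)]] that(3,4) x]) auto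
    moreover have "d0 (\<lambda>x. h' i j x - h i j x) \<phi> x = d0 (h' i j) \<phi> x - d0 (h i j) \<phi> x"
      by (rule d0_diff[OF W d'(1)[OF that(1,2)] d(1)[OF that(1,2)] that(3,4) x])
    ultimately have E: "d0 (f j) \<phi> x - d0 (f i) \<phi> x = d0 (h' i j) \<phi> x - d0 (h i j) \<phi> x"
      by simp
    have "\<xi> j \<phi> x - \<xi> i \<phi> x = ((\<eta>' j \<phi> x - \<eta>' i \<phi> x) - (\<eta> j \<phi> x - \<eta> i \<phi> x)) + (d0 (f j) \<phi> x - d0 (f i) \<phi> x)"
      by (simp add: \<xi>_def)
    also have "\<dots> = 0" unfolding d(5)[OF that] d'(5)[OF that] E by simp
    finally show ?thesis by simp
  qed
  obtain \<zeta> where \<zeta>: "smooth_form1 \<A> UNIV \<zeta>"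
    "\<And>i \<phi> x. i < n \<Longrightarrow> \<phi> \<in> coords \<A> \<Longrightarrow> x \<in> fst \<phi> \<Longrightarrow> x \<in> V i \<Longrightarrow> x \<in> UNIV \<Longrightarrow> \<zeta> \<phi> x = \<xi> i \<phi> x"
  proof (rule glue_form1[of UNIV \<xi>])
    show "smooth_form1 \<A> (V i \<inter> UNIV) (\<xi> i)" if "i < n" for i
      unfolding \<xi>_def[abs_def] Int_UNIV_right
      by (intro smooth_form1_add smooth_form1_diff V_open that d(3) d'(3) smooth_form1_d0 fs)
    show "\<xi> i \<phi> x = \<xi> j \<phi> x"
      if "i < n" "j < n" "\<phi> \<in> coords \<A>" "x \<in> fst \<phi>" "x \<in> V i" "x \<in> V j" for i j \<phi> x
      by (rule e[OF that])
  qed (rule open_UNIV | blast)+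
  have "\<omega>' \<phi> x = \<omega> \<phi> x + d1 \<zeta> \<phi> x" if \<phi>: "\<phi> \<in> coords \<A>" "x \<in> fst \<phi>" and x: "x \<notin> D" for \<phi> x
  proof -
    obtain i where i: "i < n" "x \<in> V i" by (rule V_cover)
    note W = V_open[OF i(1)]
    have "d1 \<zeta> \<phi> x = d1 (\<lambda>\<phi> x. (\<eta>' i \<phi> x - \<eta> i \<phi> x) + d0 (f i) \<phi> x) \<phi> x"
      by (rule d1_cong[OF W _ \<phi> i(2)]) (use \<zeta>(2)[OF i(1)] in \<open>auto simp: \<xi>_def\<close>)
    also have "\<dots> = d1 (\<eta>' i) \<phi> x - d1 (\<eta> i) \<phi> x"
      unfolding d1_add[OF W smooth_form1_diff[OF W d'(3)[OF i(1)] d(3)[OF i(1)]] smooth_form1_d0[OF W fs[OF i(1)]] \<phi> i(2)]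
        d1_diff[OF W d'(3)[OF i(1)] d(3)[OF i(1)] \<phi> i(2)] d1_d0[OF W fs[OF i(1)] \<phi> i(2)] by simp
    finally show ?thesis using d(7)[OF i(1) \<phi> i(2) x] d'(7)[OF i(1) \<phi> i(2) x] by simp
  qed
  then show ?thesis using that \<zeta>(1) by blast
qed

lemma holo_fun_mult:
  "holo_fun \<A> W f \<Longrightarrow> holo_fun \<A> W g \<Longrightarrow> holo_fun \<A> W (\<lambda>x. f x * g x)"
  by (simp add: holo_fun_def in_coord_def o_def holomorphic_on_mult)

text \<open>Compared with log \<rho> in the coordinate \<phi>, \<open>log_frame\<close> has the
  extra term log |f|^2 with f = \<open>jac \<phi> (chart K i)\<close> times the frame coefficient.
  This f is holomorphic and has no zeros off D.\<close>

lemma c1_frame: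
  assumes "conformal_metric \<A> (UNIV - D) \<rho>" "i < n" "\<phi> \<in> coords \<A>" "x \<in> fst \<phi>" "x \<in> V i" "x \<notin> D"
  shows "dbar_del (\<lambda>y. complex_of_real (log_frame D K \<rho> i y)) \<phi> x = c1_form \<rho> \<phi> x"
proof -
  let ?W = "fst \<phi> \<inter> V i - D" and ?\<psi> = "chart K i"
  note \<psi> = chart_coords[OF assms(2)]
  have W: "open ?W" using coord_open[OF assms(3)] V_open[OF assms(2)] closed_D by auto
  have x: "x \<in> ?W" using assms by auto
  have pos: "\<rho> \<phi> y > 0" if "y \<in> ?W" for y
    using assms(1,3) that unfolding conformal_metric_def by blast
  have tr: "\<rho> ?\<psi> y = \<rho> \<phi> y * (cmod (jac \<phi> ?\<psi> y))\<^sup>2" if "y \<in> ?W" for y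
    using assms(1,3) \<psi> that unfolding conformal_metric_def cover_dom_def by blast
  let ?f = "\<lambda>y. jac \<phi> ?\<psi> y * frame_coeff D K i y"
  have fh: "holo_fun \<A> ?W ?f"
    by (intro holo_fun_mult holo_fun_subset[OF holo_fun_jac[OF assms(3) \<psi>]] holo_fun_subset[OF frame_holo[OF assms(2)]])
       (auto simp: cover_dom_def)
  have fnz: "?f y \<noteq> 0" if "y \<in> ?W" for y
    using that jac_nonzero[OF assms(3) \<psi>, of y] frame_nonzero[OF assms(2), of y] by (auto simp: cover_dom_def)
  let ?u = "\<lambda>y. ln ((cmod (?f y))\<^sup>2)"
  have us: "smooth_fun \<A> ?W (\<lambda>y. complex_of_real (?u y))"
    by (rule smooth_fun_of_real[OF W smooth_fun_ln_holo[OF W fh]]) (rule fnz)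
  have u0: "dbar_del (\<lambda>y. complex_of_real (?u y)) \<phi> x = 0"
    by (rule dbar_del_ln_holo[OF W fh _ assms(3,4) x]) (rule fnz)
  have "smooth_fun \<A> (fst \<phi> \<inter> (UNIV - D)) (\<rho> \<phi>)"
    using assms(1,3) unfolding conformal_metric_def by blast
  then have "smooth_fun \<A> ?W (\<rho> \<phi>)" by (rule smooth_fun_subset) auto
  then have r: "smooth_fun \<A> ?W (\<lambda>y. complex_of_real (ln (\<rho> \<phi> y)))"
    by (intro smooth_fun_of_real smooth_fun_ln W pos)
  have "dbar_del (\<lambda>y. complex_of_real (log_frame D K \<rho> i y)) \<phi> x
      = dbar_del (\<lambda>y. complex_of_real (ln (\<rho> \<phi> y)) + complex_of_real (?u y)) \<phi> x"
  proof (rule dbar_del_cong[OF W _ assms(3,4) x])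
    fix y assume y: "y \<in> ?W"
    have "log_frame D K \<rho> i y = ln (\<rho> \<phi> y * (cmod (?f y))\<^sup>2)"
      by (simp add: log_frame_def norm_sq_def tr[OF y] norm_mult power_mult_distrib mult.assoc)
    also have "\<dots> = ln (\<rho> \<phi> y) + ?u y" using pos[OF y] fnz[OF y] by (subst ln_mult) auto
    finally show "complex_of_real (log_frame D K \<rho> i y) = complex_of_real (ln (\<rho> \<phi> y)) + complex_of_real (?u y)" by simp
  qed
  also have "\<dots> = dbar_del (\<lambda>y. complex_of_real (ln (\<rho> \<phi> y))) \<phi> x"
    unfolding dbar_del_add[OF W r us assms(3,4) x] u0 by simp
  finally show ?thesis by (simp add: c1_form_def)
qed

lemma c1_form_smooth:
  assumes "conformal_metric \<A> (UNIV - D) \<rho>"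
  shows "smooth_form2 \<A> (UNIV - D) (c1_form \<rho>)"
proof (rule smooth_form2_local)
  fix x assume x: "x \<in> UNIV - D"
  obtain i where i: "i < n" "x \<in> V i" by (rule V_cover)
  note W = VD_open[OF i(1)]
  have "smooth_form2 \<A> (V i - D) (dbar_del (\<lambda>y. complex_of_real (log_frame D K \<rho> i y)))"
    by (intro smooth_form2_dbar_del W smooth_fun_of_real log_frame_smooth conformal_frame_log assms i)
  moreover have "dbar_del (\<lambda>y. complex_of_real (log_frame D K \<rho> i y)) \<phi> y = c1_form \<rho> \<phi> y"
    if "\<phi> \<in> coords \<A>" "y \<in> fst \<phi>" "y \<in> V i - D" for \<phi> y
    using c1_frame[OF assms i(1) that(1,2)] that(3) by auto
  ultimately have "smooth_form2 \<A> (V i - D) (c1_form \<rho>)"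
    using smooth_form2_cong[OF W, of "dbar_del (\<lambda>y. complex_of_real (log_frame D K \<rho> i y))" "c1_form \<rho>"] by blast
  then show "\<exists>W'. open W' \<and> x \<in> W' \<and> smooth_form2 \<A> W' (c1_form \<rho>)" using W i x by blast
qed

section \<open>Conformal change of the metric\<close>

lemma log_frame_conf_change:
  assumes "conformal_metric \<A> (UNIV - D) \<rho>" "i < n" "x \<in> V i" "x \<notin> D"
  shows "log_frame D K (conf_change \<tau> \<rho>) i x = log_frame D K \<rho> i x + \<tau> x"
proof -
  have pos: "\<rho> (chart K i) x > 0"
    using assms chart_coords[OF assms(2)] unfolding conformal_metric_def cover_dom_def by blast
  then show ?thesis
    using frame_nonzero[OF assms(2-4)] by (simp add: log_frame_def norm_sq_def conf_change_def mult.assoc ln_mult)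
qed

lemma frame_log_conf_change:
  assumes "conformal_metric \<A> (UNIV - D) \<rho>" "smooth_fun \<A> UNIV \<tau>"
  shows "frame_log (conf_change \<tau> \<rho>)"
  unfolding frame_log_def
proof (intro conjI allI impI ballI)
  note \<rho> = conformal_frame_log[OF assms(1)]
  fix i assume i: "i < n"
  have "smooth_fun \<A> (V i - D) (\<lambda>x. log_frame D K \<rho> i x + \<tau> x)"
    by (intro smooth_fun_add VD_open i log_frame_smooth \<rho> smooth_fun_subset[OF assms(2)]) auto
  then show "smooth_fun \<A> (V i - D) (log_frame D K (conf_change \<tau> \<rho>) i)"
    using smooth_fun_cong[OF VD_open[OF i], of "log_frame D K (conf_change \<tau> \<rho>) i" "\<lambda>x. log_frame D K \<rho> i x + \<tau> x"]
      log_frame_conf_change[OF assms(1) i] by auto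
  fix j x assume j: "j < n" and x: "x \<in> V i \<inter> V j - D"
  then show "log_frame D K (conf_change \<tau> \<rho>) j x = log_frame D K (conf_change \<tau> \<rho>) i x + 2 * b i j x"
    using log_frame_conf_change[OF assms(1) i, of x] log_frame_conf_change[OF assms(1) j, of x]
      log_frame_change_frame[OF \<rho> i j, of x] by auto
qed

text \<open>With h fixed, \<eta> has to absorb t/2 \<theta>(\<sigma>, b_ij), for which a cochain
  \<zeta> is found by averaging. The new omega^0 has the linear term t/2 (\<sigma> c_1 + r_i dbar
  del \<sigma>); replacing it by t \<sigma> c_1 costs an exact form, with primitive 1/4
  \<theta>(\<sigma>, r_i) by \<open>d1_theta\<close>.\<close>

lemma descent_variation:
  assumes \<rho>: "conformal_metric \<A> (UNIV - D) \<rho>" and d: "descent \<A> D K \<rho> h \<eta> \<omega>" and \<sigma>: "smooth_fun \<A> UNIV \<sigma>"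
  obtains \<xi> where "smooth_form1 \<A> (UNIV - D) \<xi>"
    "\<And>i. i < n \<Longrightarrow> \<exists>\<zeta>. smooth_form1 \<A> (V i) \<zeta> \<and> (\<forall>\<phi>\<in>coords \<A>. \<forall>x\<in>fst \<phi> \<inter> V i - D.
        \<xi> \<phi> x = (1/4) *\<^sub>R theta \<sigma> (log_frame D K \<rho> i) \<phi> x - \<zeta> \<phi> x)"
    "\<And>t. \<exists>\<eta>'. descent \<A> D K (conf_change (\<lambda>x. t * \<sigma> x) \<rho>) h \<eta>'
        (\<lambda>\<phi> x. \<omega> \<phi> x + (of_real (t * \<sigma> x) * c1_form \<rho> \<phi> x
           + (of_real (t\<^sup>2 / 2 * \<sigma> x) * dbar_del (\<lambda>y. complex_of_real (\<sigma> y)) \<phi> x + of_real (- t) * d1 \<xi> \<phi> x)))"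
proof -
  note f\<rho> = conformal_frame_log[OF \<rho>]
  note D = descentD[OF d]
  let ?r = "log_frame D K \<rho>"
  have \<sigma>W: "smooth_fun \<A> W \<sigma>" for W by (rule smooth_fun_subset[OF \<sigma>]) auto
  define \<zeta> where "\<zeta> i \<phi> x = (\<Sum>m<n. pu m x *\<^sub>R ((1/2) *\<^sub>R theta \<sigma> (b m i) \<phi> x))" for i \<phi> x
  have \<zeta>s: "smooth_form1 \<A> (V i) (\<zeta> i)" if "i < n" for i
    unfolding \<zeta>_def[abs_def]
    by (intro smooth_form1_sum V_open that pu_cut_form1 smooth_form1_scaleR smooth_fun_const smooth_form1_theta VV_open \<sigma>W b_smooth) auto
  have \<zeta>i: "imaginary_form1 \<A> (V i) (\<zeta> i)" if "i < n" for i
    unfolding \<zeta>_def[abs_def]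
    by (intro imaginary_form1_sum V_open that pu_cut_imaginary imaginary_form1_scaleR imaginary_form1_theta VV_open \<sigma>W b_smooth) auto
  have \<zeta>d: "\<zeta> j \<phi> x - \<zeta> i \<phi> x = (1/2) *\<^sub>R theta \<sigma> (b i j) \<phi> x"
    if "i < n" "j < n" "\<phi> \<in> coords \<A>" "x \<in> fst \<phi>" "x \<in> V i" "x \<in> V j" for i j \<phi> x
  proof -
    have "\<zeta> j \<phi> x - \<zeta> i \<phi> x = (\<Sum>m<n. pu m x *\<^sub>R ((1/2) *\<^sub>R theta \<sigma> (b m j) \<phi> x - (1/2) *\<^sub>R theta \<sigma> (b m i) \<phi> x))"
      by (simp add: \<zeta>_def sum_subtractf[symmetric] scaleR_diff_right)
    also have "\<dots> = (1/2) *\<^sub>R theta \<sigma> (b i j) \<phi> x"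
    proof (rule pu_sum)
      fix m assume m: "m < n" "x \<in> V m"
      let ?W = "V m \<inter> (V i \<inter> V j)"
      note W = VVV_open[OF that(1,2) m(1)]
      have xW: "x \<in> ?W" using m that by auto
      have "theta \<sigma> (b m j) \<phi> x = theta \<sigma> (\<lambda>y. b m i y + 1 * b i j y) \<phi> x"
        by (rule theta_cong[OF W _ _ that(3,4) xW]) (use b_cocycle[OF m(1) that(1,2)] in auto)
      also have "\<dots> = theta \<sigma> (b m i) \<phi> x + 1 *\<^sub>R theta \<sigma> (b i j) \<phi> x"
        by (rule theta_add(1)[OF W \<sigma>W smooth_fun_subset[OF b_smooth[OF m(1) that(1)]] smooth_fun_subset[OF b_smooth[OF that(1,2)]] that(3,4) xW]) auto
      finally show "(1/2) *\<^sub>R theta \<sigma> (b m j) \<phi> x - (1/2) *\<^sub>R theta \<sigma> (b m i) \<phi> x = (1/2) *\<^sub>R theta \<sigma> (b i j) \<phi> x"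
        by (simp add: scaleR_add_right)
    qed
    finally show ?thesis .
  qed
  \<comment> \<open>On overlaps \<theta>(\<sigma>, r_i) / 4 jumps by \<theta>(\<sigma>, b_ij) / 2,
    because r_j = r_i + 2 b_ij, and \<zeta> jumps by the same amount; so the difference is a form on
    U.\<close>
  define \<xi>0 where "\<xi>0 i \<phi> x = (1/4) *\<^sub>R theta \<sigma> (?r i) \<phi> x - \<zeta> i \<phi> x" for i \<phi> x
  have th: "smooth_form1 \<A> (V i - D) (theta \<sigma> (?r i))" if "i < n" for i
    by (intro smooth_form1_theta VD_open that \<sigma>W log_frame_smooth f\<rho>)
  have \<zeta>s': "smooth_form1 \<A> (V i - D) (\<zeta> i)" if "i < n" for i
    by (rule smooth_form1_subset[OF \<zeta>s[OF that]]) auto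
  have th4: "smooth_form1 \<A> (V i - D) (\<lambda>\<phi> x. (1/4) *\<^sub>R theta \<sigma> (?r i) \<phi> x)" if "i < n" for i
    by (intro smooth_form1_scaleR smooth_fun_const th that VD_open)
  have \<xi>s: "smooth_form1 \<A> (V i \<inter> (UNIV - D)) (\<xi>0 i)" if "i < n" for i
  proof -
    have "smooth_form1 \<A> (V i - D) (\<xi>0 i)"
      unfolding \<xi>0_def[abs_def] by (intro smooth_form1_diff th4 \<zeta>s' that VD_open)
    then show ?thesis by (rule smooth_form1_subset) auto
  qed
  have \<xi>e: "\<xi>0 i \<phi> x = \<xi>0 j \<phi> x"
    if "i < n" "j < n" "\<phi> \<in> coords \<A>" "x \<in> fst \<phi>" "x \<in> V i" "x \<in> V j" "x \<in> UNIV - D" for i j \<phi> x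
  proof -
    let ?W = "V i \<inter> V j - D"
    have W: "open ?W" using VV_open[OF that(1,2)] closed_D by auto
    have xW: "x \<in> ?W" using that by auto
    have "theta \<sigma> (?r j) \<phi> x = theta \<sigma> (\<lambda>y. ?r i y + 2 * b i j y) \<phi> x"
      by (rule theta_cong[OF W _ _ that(3,4) xW]) (use log_frame_change_frame[OF f\<rho> that(1,2)] in auto)
    also have "\<dots> = theta \<sigma> (?r i) \<phi> x + 2 *\<^sub>R theta \<sigma> (b i j) \<phi> x"
      by (rule theta_add(1)[OF W \<sigma>W smooth_fun_subset[OF log_frame_smooth[OF f\<rho> that(1)]] smooth_fun_subset[OF b_smooth[OF that(1,2)]] that(3,4) xW]) auto
    finally show ?thesis using \<zeta>d[OF that(1-6)] by (simp add: \<xi>0_def scaleR_add_right algebra_simps)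
  qed
  obtain \<xi> where \<xi>: "smooth_form1 \<A> (UNIV - D) \<xi>"
    "\<And>i \<phi> x. i < n \<Longrightarrow> \<phi> \<in> coords \<A> \<Longrightarrow> x \<in> fst \<phi> \<Longrightarrow> x \<in> V i \<Longrightarrow> x \<in> UNIV - D \<Longrightarrow> \<xi> \<phi> x = \<xi>0 i \<phi> x"
    by (rule glue_form1[OF open_U \<xi>s \<xi>e]) blast+
  let ?s = "\<lambda>y. complex_of_real (\<sigma> y)"
  have d\<xi>: "d1 \<xi> \<phi> x = (1/2) * (of_real (\<sigma> x) * c1_form \<rho> \<phi> x - of_real (?r i x) * dbar_del ?s \<phi> x) - d1 (\<zeta> i) \<phi> x"
    if i: "i < n" and \<phi>: "\<phi> \<in> coords \<A>" "x \<in> fst \<phi>" and x: "x \<in> V i" "x \<notin> D" for i \<phi> x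
  proof -
    note W = VD_open[OF i]
    have xW: "x \<in> V i - D" using x by auto
    have "d1 \<xi> \<phi> x = d1 (\<lambda>\<phi> x. (1/4) *\<^sub>R theta \<sigma> (?r i) \<phi> x - \<zeta> i \<phi> x) \<phi> x"
      by (rule d1_cong[OF W _ \<phi> xW]) (use \<xi>(2)[OF i] in \<open>auto simp: \<xi>0_def\<close>)
    also have "\<dots> = of_real (1/4) * d1 (theta \<sigma> (?r i)) \<phi> x - d1 (\<zeta> i) \<phi> x"
      unfolding d1_diff[OF W th4[OF i] \<zeta>s'[OF i] \<phi> xW] d1_cmult[OF W th[OF i] \<phi> xW] ..
    finally show ?thesis
      unfolding d1_theta[OF W \<sigma>W log_frame_smooth[OF f\<rho> i] \<phi> xW] c1_frame[OF \<rho> i \<phi> x] by simp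
  qed
  have "\<exists>\<eta>'. descent \<A> D K (conf_change (\<lambda>x. t * \<sigma> x) \<rho>) h \<eta>'
        (\<lambda>\<phi> x. \<omega> \<phi> x + (of_real (t * \<sigma> x) * c1_form \<rho> \<phi> x
           + (of_real (t\<^sup>2 / 2 * \<sigma> x) * dbar_del ?s \<phi> x + of_real (- t) * d1 \<xi> \<phi> x)))" for t
  proof -
    let ?\<rho> = "conf_change (\<lambda>x. t * \<sigma> x) \<rho>"
    let ?\<omega> = "\<lambda>\<phi> x. \<omega> \<phi> x + (of_real (t * \<sigma> x) * c1_form \<rho> \<phi> x
           + (of_real (t\<^sup>2 / 2 * \<sigma> x) * dbar_del ?s \<phi> x + of_real (- t) * d1 \<xi> \<phi> x))"
    have lf: "log_frame D K ?\<rho> i x = ?r i x + t * \<sigma> x" if "i < n" "x \<in> V i" "x \<notin> D" for i x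
      by (rule log_frame_conf_change[OF \<rho> that])
    define \<eta>' where "\<eta>' i \<phi> x = \<eta> i \<phi> x + t *\<^sub>R \<zeta> i \<phi> x" for i \<phi> x
    have t\<zeta>: "smooth_form1 \<A> (V i) (\<lambda>\<phi> x. t *\<^sub>R \<zeta> i \<phi> x)" if "i < n" for i
      by (intro smooth_form1_scaleR smooth_fun_const \<zeta>s that V_open)
    have \<eta>s: "smooth_form1 \<A> (V i) (\<eta>' i)" if "i < n" for i
      unfolding \<eta>'_def[abs_def] by (intro smooth_form1_add V_open that D(3) t\<zeta>)
    have \<eta>i: "imaginary_form1 \<A> (V i) (\<eta>' i)" if "i < n" for i
      unfolding \<eta>'_def[abs_def] by (intro imaginary_form1_diff imaginary_form1_scaleR D(4) \<zeta>i that)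
    have o1: "omega1 D K ?\<rho> i j \<phi> x = omega1 D K \<rho> i j \<phi> x + (t/2) *\<^sub>R theta \<sigma> (b i j) \<phi> x"
      if "i < n" "j < n" "\<phi> \<in> coords \<A>" "x \<in> fst \<phi>" "x \<in> V i" "x \<in> V j" for i j \<phi> x
    proof (cases "x \<in> D")
      case True
      then have "i = j" using V_int_D that by blast
      then show ?thesis using theta_b_self[OF that(1,3,4,5)] by (simp add: omega1_theta)
    next
      case False
      let ?W = "V i \<inter> V j - D"
      have W: "open ?W" using VV_open[OF that(1,2)] closed_D by auto
      have xW: "x \<in> ?W" using that False by auto
      have "theta (log_frame D K ?\<rho> j) (b i j) \<phi> x = theta (\<lambda>y. ?r j y + t * \<sigma> y) (b i j) \<phi> x"
        by (rule theta_cong[OF W _ _ that(3,4) xW]) (use lf that in auto)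
      also have "\<dots> = theta (?r j) (b i j) \<phi> x + t *\<^sub>R theta \<sigma> (b i j) \<phi> x"
        by (rule theta_add(2)[OF W smooth_fun_subset[OF b_smooth[OF that(1,2)]] smooth_fun_subset[OF log_frame_smooth[OF f\<rho> that(2)]] \<sigma>W that(3,4) xW]) auto
      finally show ?thesis by (simp add: omega1_theta scaleR_add_right)
    qed
    have \<eta>d: "\<eta>' j \<phi> x - \<eta>' i \<phi> x = omega1 D K ?\<rho> i j \<phi> x - d0 (h i j) \<phi> x"
      if "i < n" "j < n" "\<phi> \<in> coords \<A>" "x \<in> fst \<phi>" "x \<in> V i" "x \<in> V j" for i j \<phi> x
    proof -
      have "t *\<^sub>R (\<zeta> j \<phi> x - \<zeta> i \<phi> x) = (t/2) *\<^sub>R theta \<sigma> (b i j) \<phi> x" unfolding \<zeta>d[OF that] by simp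
      then show ?thesis unfolding o1[OF that] \<eta>'_def using D(5)[OF that] by (simp add: algebra_simps)
    qed
    have \<omega>s: "smooth_form2 \<A> (UNIV - D) ?\<omega>"
      by (intro smooth_form2_add smooth_form2_mult open_U D(6) c1_form_smooth \<rho> smooth_form2_dbar_del smooth_form2_d1 \<xi>(1)
          smooth_fun_of_real smooth_fun_mult smooth_fun_const \<sigma>W)
    have \<omega>e: "?\<omega> \<phi> x = omega0 D K ?\<rho> i \<phi> x + d1 (\<eta>' i) \<phi> x"
      if i: "i < n" and \<phi>: "\<phi> \<in> coords \<A>" "x \<in> fst \<phi>" and x: "x \<in> V i" "x \<notin> D" for i \<phi> x
    proof -
      note W = VD_open[OF i]
      have xW: "x \<in> V i - D" using x by auto
      have rs: "smooth_fun \<A> (V i - D) (\<lambda>y. complex_of_real (?r i y))"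
        by (intro smooth_fun_of_real W log_frame_smooth f\<rho> i)
      have ss: "smooth_fun \<A> (V i - D) ?s" by (intro smooth_fun_of_real W \<sigma>W)
      have ts: "smooth_fun \<A> (V i - D) (\<lambda>y. of_real t * ?s y)" by (intro smooth_fun_mult smooth_fun_const W ss)
      have "dbar_del (\<lambda>y. complex_of_real (log_frame D K ?\<rho> i y)) \<phi> x
          = dbar_del (\<lambda>y. complex_of_real (?r i y) + of_real t * ?s y) \<phi> x"
        by (rule dbar_del_cong[OF W _ \<phi> xW]) (use lf i in auto)
      also have "\<dots> = c1_form \<rho> \<phi> x + of_real t * dbar_del ?s \<phi> x"
        unfolding dbar_del_add[OF W rs ts \<phi> xW] dbar_del_cmult[OF W ss \<phi> xW] c1_frame[OF \<rho> i \<phi> x] ..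
      finally have o0: "omega0 D K ?\<rho> i \<phi> x = of_real ((?r i x + t * \<sigma> x) / 2) * (c1_form \<rho> \<phi> x + of_real t * dbar_del ?s \<phi> x)"
        using lf[OF i x] by (simp add: omega0_def o_def)
      have o0': "omega0 D K \<rho> i \<phi> x = of_real (?r i x / 2) * c1_form \<rho> \<phi> x"
        using c1_frame[OF \<rho> i \<phi> x] by (simp add: omega0_def o_def)
      have dd: "d1 (\<eta>' i) \<phi> x = d1 (\<eta> i) \<phi> x + of_real t * d1 (\<zeta> i) \<phi> x"
        unfolding \<eta>'_def[abs_def] d1_add[OF V_open[OF i] D(3)[OF i] t\<zeta>[OF i] \<phi> x(1)] d1_cmult[OF V_open[OF i] \<zeta>s[OF i] \<phi> x(1)] ..
      show ?thesis
        unfolding o0 dd d\<xi>[OF i \<phi> x] D(7)[OF i \<phi> x] o0'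
        by (simp add: field_simps power2_eq_square)
    qed
    have "descent \<A> D K ?\<rho> h \<eta>' ?\<omega>"
      unfolding descent_def using D(1,2,8) \<eta>s \<eta>i \<eta>d \<omega>s \<omega>e by auto
    then show ?thesis by blast
  qed
  then show ?thesis
    using \<zeta>s \<xi> by (intro that[OF \<xi>(1)]) (auto simp: \<xi>0_def)
qed

end

section \<open>Integration in the plane\<close>

definition to_R2 :: "complex \<Rightarrow> real ^ 2" where "to_R2 z = vector [Re z, Im z]"
definition of_R2 :: "real ^ 2 \<Rightarrow> complex" where "of_R2 v = Complex (v $ 1) (v $ 2)"

lemma of_R2_to_R2 [simp]: "of_R2 (to_R2 z) = z" by (simp add: of_R2_def to_R2_def)
lemma to_R2_of_R2 [simp]: "to_R2 (of_R2 v) = v" by (simp add: of_R2_def to_R2_def vec_eq_iff forall_2)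

lemma to_R2_eq_iff [simp]: "to_R2 z = to_R2 w \<longleftrightarrow> z = w" by (metis of_R2_to_R2)

lemma bounded_linear_to_R2: "bounded_linear to_R2"
  by (intro linear_conv_bounded_linear[THEN iffD1] linearI) (simp_all add: to_R2_def vec_eq_iff forall_2)

lemma bounded_linear_of_R2: "bounded_linear of_R2"
  by (intro linear_conv_bounded_linear[THEN iffD1] linearI) (simp_all add: of_R2_def complex_eq_iff)

lemma to_R2_measurable [measurable]: "to_R2 \<in> borel_measurable borel"
  by (intro borel_measurable_continuous_onI linear_continuous_on bounded_linear_to_R2)

lemma of_R2_measurable [measurable]: "of_R2 \<in> borel_measurable borel"
  by (intro borel_measurable_continuous_onI linear_continuous_on bounded_linear_of_R2)

lemma to_R2_image: "to_R2 ` B = of_R2 -` B"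
  by (auto simp: image_iff) (metis to_R2_of_R2)

text \<open>Carries the change of variables formula, which is stated with determinants on real^2,
  over to the complex plane. A measure that agrees with volume on boxes is Lebesgue measure.\<close>

lemma lborel_to_R2: "(lborel :: (real ^ 2) measure) = distr lborel borel to_R2"
proof (rule lborel_eqI)
  fix l u :: "real ^ 2" assume lu: "\<And>b. b \<in> Basis \<Longrightarrow> l \<bullet> b \<le> u \<bullet> b"
  have "l \<bullet> axis 1 1 \<le> u \<bullet> axis 1 1" "l \<bullet> axis 2 1 \<le> u \<bullet> axis 2 1" by (intro lu; auto simp: Basis_vec_def)+
  then have le: "l $ 1 \<le> u $ 1" "l $ 2 \<le> u $ 2" by (simp_all add: inner_axis)
  have "to_R2 -` box l u = box (of_R2 l) (of_R2 u)"
    by (auto simp: box_def to_R2_def of_R2_def Basis_complex_def Basis_vec_def inner_axis forall_2)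
  then have "emeasure (distr lborel borel to_R2) (box l u) = emeasure lborel (box (of_R2 l) (of_R2 u))"
    by (simp add: emeasure_distr)
  also have "\<dots> = (\<Prod>b\<in>Basis. (of_R2 u - of_R2 l) \<bullet> b)"
    using le by (intro emeasure_lborel_box) (auto simp: Basis_complex_def of_R2_def)
  also have "(\<Prod>b\<in>Basis. (of_R2 u - of_R2 l) \<bullet> b) = (\<Prod>b\<in>Basis. (u - l) \<bullet> b)"
  proof -
    have B: "(Basis :: (real^2) set) = {axis 1 1, axis 2 1}" by (auto simp: Basis_vec_def) (metis exhaust_2)
    have "axis 1 (1::real) \<noteq> (axis 2 1 :: real ^ 2)" by (simp add: axis_eq_axis)
    then have "(\<Prod>b\<in>{axis 1 1, axis 2 1}. (u - l) \<bullet> b) = (u - l) \<bullet> axis 1 1 * ((u - l) \<bullet> axis 2 1)"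
      by simp
    then show ?thesis unfolding B by (simp add: Basis_complex_def of_R2_def inner_axis)
  qed
  finally show "emeasure (distr lborel borel to_R2) (box l u) = (\<Prod>b\<in>Basis. (u - l) \<bullet> b)" .
qed simp

lemma emeasure_to_R2: "B \<in> sets borel \<Longrightarrow> emeasure lborel (to_R2 ` B) = emeasure lborel B"
proof -
  assume B: "B \<in> sets borel"
  have "to_R2 ` B \<in> sets borel"
    unfolding to_R2_image using measurable_sets[OF of_R2_measurable B] by simp
  then have "emeasure lborel (to_R2 ` B) = emeasure lborel (to_R2 -` (to_R2 ` B))"
    by (subst lborel_to_R2) (simp add: emeasure_distr)
  also have "to_R2 -` (to_R2 ` B) = B" by (auto simp: to_R2_image)
  finally show ?thesis .
qed

lemma nn_integral_to_R2:
  assumes "f \<in> borel_measurable borel"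
  shows "(\<integral>\<^sup>+v. f (of_R2 v) \<partial>lborel) = (\<integral>\<^sup>+z. f z \<partial>lborel)"
  using assms by (subst lborel_to_R2) (simp add: nn_integral_distr)

text \<open>Multiplication by h' has real determinant |h'|^2. Formulated with the extended
  nonnegative integral, so that images of infinite measure are covered too.\<close>

lemma emeasure_holomorphic_image:
  assumes S: "open S" "h holomorphic_on S" and A: "A \<in> sets borel" "A \<subseteq> S" "inj_on h A" "h ` A \<in> sets borel"
  shows "emeasure lborel (h ` A) = (\<integral>\<^sup>+p. ennreal ((cmod (deriv h p))\<^sup>2 * indicator A p) \<partial>lborel)"
proof -
  define g where "g v = to_R2 (h (of_R2 v))" for v
  define J where "J p = (cmod (deriv h p))\<^sup>2 * indicator A p" for p
  let ?A = "to_R2 ` A"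
  have A2: "?A \<in> sets borel" unfolding to_R2_image using measurable_sets[OF of_R2_measurable A(1)] by simp
  have gA: "g ` ?A = to_R2 ` (h ` A)" by (auto simp: g_def image_iff)
  have "to_R2 ` (h ` A) \<in> sets borel"
    unfolding to_R2_image using measurable_sets[OF of_R2_measurable A(4)] by simp
  then have gA2: "g ` ?A \<in> sets borel" by (simp only: gA)
  have gAl: "g ` ?A \<in> sets lborel" using gA2 by (simp only: sets_lborel)
  have eqm: "emeasure lebesgue (g ` ?A) = emeasure lborel (g ` ?A)"
    by (simp only: emeasure_completion[OF sets_completionI_sets[OF gAl]] main_part[OF gAl])
  have ind: "indicator ?A v = (indicator A (of_R2 v) :: real)" for v
    by (auto simp: indicator_def to_R2_image)
  have "continuous_on S (\<lambda>p. (cmod (deriv h p))\<^sup>2)"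
    using S by (intro continuous_intros holomorphic_on_imp_continuous_on holomorphic_deriv)
  then have "continuous_on A (\<lambda>p. (cmod (deriv h p))\<^sup>2)" using A(2) continuous_on_subset by blast
  from borel_measurable_continuous_on_indicator[OF A(1) this]
  have J[measurable]: "J \<in> borel_measurable borel" by (simp add: J_def[abs_def] mult.commute)
  have J0: "J p \<ge> 0" for p by (simp add: J_def)
  define D where "D v w = to_R2 (deriv h (of_R2 v) * of_R2 w)" for v w
  have der: "(g has_derivative D v) (at v within ?A)" if "v \<in> ?A" for v
  proof -
    have "(h has_field_derivative deriv h (of_R2 v)) (at (of_R2 v))"
      using that A(2) by (intro holomorphic_derivI[OF S(2,1)]) auto
    then have "(h has_derivative (\<lambda>w. deriv h (of_R2 v) * w)) (at (of_R2 v))"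
      by (simp add: has_field_derivative_def)
    from has_derivative_compose[OF bounded_linear_imp_has_derivative[OF bounded_linear_of_R2] this]
    have "((\<lambda>v. h (of_R2 v)) has_derivative (\<lambda>w. deriv h (of_R2 v) * of_R2 w)) (at v within ?A)" .
    from bounded_linear.has_derivative[OF bounded_linear_to_R2 this]
    show ?thesis by (simp add: g_def[abs_def] D_def[abs_def])
  qed
  have inj: "inj_on g ?A"
    using A(3) unfolding inj_on_def g_def by auto
  have det: "\<bar>det (matrix (D v))\<bar> = (cmod (deriv h (of_R2 v)))\<^sup>2" for v
    unfolding cmod_power2 by (simp add: det_2 matrix_def D_def to_R2_def of_R2_def axis_def power2_eq_square)
  \<comment> \<open>Both directions are used below: from a finite image to its integral, and, when
    the image has infinite measure, to exclude a finite integral.\<close>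
  have key: "g ` ?A \<in> lmeasurable \<and> measure lebesgue (g ` ?A) = m \<longleftrightarrow> ((\<lambda>v. (cmod (deriv h (of_R2 v)))\<^sup>2) has_integral m) ?A" for m
    using has_measure_differentiable_image[of ?A g D m] A2 der inj by (simp add: det)
  have key': "((\<lambda>v. (cmod (deriv h (of_R2 v)))\<^sup>2) has_integral m) ?A \<longleftrightarrow> ((\<lambda>v. J (of_R2 v)) has_integral m) UNIV" for m
  proof -
    have "(\<lambda>v. J (of_R2 v)) = (\<lambda>v. if v \<in> ?A then (cmod (deriv h (of_R2 v)))\<^sup>2 else 0)"
      by (auto simp: J_def to_R2_image)
    then show ?thesis by (simp add: has_integral_restrict_UNIV)
  qed
  have JR: "(\<lambda>v. J (of_R2 v)) \<in> borel_measurable borel" by simp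
  have "emeasure lborel (g ` ?A) = (\<integral>\<^sup>+v. ennreal (J (of_R2 v)) \<partial>lborel)"
  proof (cases "emeasure lborel (g ` ?A) = \<infinity>")
    case False
    then have "emeasure lborel (g ` ?A) < \<infinity>" by (simp add: less_top)
    then have "emeasure lebesgue (g ` ?A) < \<infinity>" unfolding eqm .
    then have fin: "g ` ?A \<in> lmeasurable" by (rule fmeasurableI[OF sets_completionI_sets[OF gAl]])
    let ?m = "measure lebesgue (g ` ?A)"
    have "((\<lambda>v. J (of_R2 v)) has_integral ?m) UNIV" using key[of ?m] key'[of ?m] fin by simp
    then have "(\<integral>\<^sup>+v. ennreal (J (of_R2 v)) \<partial>lborel) = ennreal ?m"
      by (rule nn_integral_has_integral_lborel[OF JR J0])
    also have "\<dots> = emeasure lborel (g ` ?A)"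
      using False unfolding measure_completion[OF gAl] infinity_ennreal_def by (rule emeasure_eq_ennreal_measure[symmetric])
    finally show ?thesis by simp
  next
    case True
    \<comment> \<open>A finite integral would give the image finite measure by \<open>key\<close>,
      against the case assumption.\<close>
    show ?thesis
    proof (rule ccontr)
      assume "emeasure lborel (g ` ?A) \<noteq> (\<integral>\<^sup>+v. ennreal (J (of_R2 v)) \<partial>lborel)"
      then obtain r where r: "(\<integral>\<^sup>+v. ennreal (J (of_R2 v)) \<partial>lborel) = ennreal r" "0 \<le> r"
        using True by (cases "\<integral>\<^sup>+v. ennreal (J (of_R2 v)) \<partial>lborel" rule: ennreal_cases) auto
      have "((\<lambda>v. J (of_R2 v)) has_integral r) UNIV" by (rule nn_integral_has_integral[OF JR J0 r])
      then have "g ` ?A \<in> lmeasurable" using key[of r] key'[of r] by simp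
      from fmeasurableD2[OF this] have "emeasure lborel (g ` ?A) \<noteq> top" unfolding eqm .
      with True show False by simp
    qed
  qed
  also have "\<dots> = (\<integral>\<^sup>+p. ennreal (J p) \<partial>lborel)"
    by (rule nn_integral_to_R2) simp
  finally show ?thesis unfolding gA emeasure_to_R2[OF A(4)] J_def .
qed

section \<open>Integrals of derivatives with compact support\<close>

lemma compact_support_integrable:
  fixes f :: "complex \<Rightarrow> complex"
  assumes "continuous_on UNIV f" "\<And>p. norm p > R \<Longrightarrow> f p = 0"
  shows "integrable lborel f"
proof -
  have "set_integrable lborel (cball 0 R) f"
    unfolding set_integrable_def
    by (rule borel_integrable_compact) (auto intro: continuous_on_subset[OF assms(1)])
  moreover have "(\<lambda>p. indicator (cball 0 R) p *\<^sub>R f p) = f"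
    using assms(2) by (fastforce simp: indicator_def not_le)
  ultimately show ?thesis by (simp add: set_integrable_def)
qed

lemma compact_support_bounded:
  fixes f :: "complex \<Rightarrow> complex"
  assumes "continuous_on UNIV f" "\<And>p. norm p > R \<Longrightarrow> f p = 0"
  obtains M where "M > 0" "\<And>p. norm (f p) \<le> M"
proof -
  have "compact (f ` cball 0 R)"
    by (intro compact_continuous_image continuous_on_subset[OF assms(1)]) auto
  then obtain M where M: "M > 0" "\<And>y. y \<in> f ` cball 0 R \<Longrightarrow> norm y \<le> M"
    using compact_imp_bounded bounded_pos by metis
  have "norm (f p) \<le> M" for p
    using M assms(2)[of p] by (cases "norm p > R") (auto simp: not_less)
  then show ?thesis using that M(1) by blast
qed

text \<open>The difference quotients have integral 0 by translation invariance and converge to the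
  directional derivative. The mean value inequality bounds them uniformly on a fixed ball, so
  dominated convergence applies.\<close>

lemma integral_frechet_compact_support:
  fixes f :: "complex \<Rightarrow> complex"
  assumes diff: "\<And>p. f differentiable (at p)"
    and cont: "continuous_on UNIV (\<lambda>p. frechet_derivative f (at p) v)"
    and supp: "\<And>p. norm p > R \<Longrightarrow> f p = 0"
  shows "integrable lborel (\<lambda>p. frechet_derivative f (at p) v)"
    and "integral\<^sup>L lborel (\<lambda>p. frechet_derivative f (at p) v) = 0"
proof -
  define G where "G p = frechet_derivative f (at p) v" for p
  have G0: "G p = 0" if "norm p > R" for p
  proof -
    have "frechet_derivative f (at p) = frechet_derivative (\<lambda>p. 0) (at p)"
      by (rule frechet_derivative_cong_open[of "{q. norm q > R}"])
         (use that supp in \<open>auto intro: open_Collect_less continuous_intros\<close>)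
    then show ?thesis by (simp add: G_def)
  qed
  have Gc: "continuous_on UNIV G" using cont by (simp add: G_def[abs_def])
  have fc: "continuous_on UNIV f"
    using diff by (simp add: continuous_on_eq_continuous_at differentiable_imp_continuous_within)
  note Gi = compact_support_integrable[OF Gc G0] and fi = compact_support_integrable[OF fc supp]
  obtain M where M: "M > 0" "\<And>p. norm (G p) \<le> M" using compact_support_bounded[OF Gc G0] by blast
  \<comment> \<open>Step lengths at most 1, so that every quotient vanishes outside the ball of
    radius |R| + |v|.\<close>
  define e where "e n = inverse (real (Suc n))" for n
  have e: "e n > 0" "e n \<le> 1" for n by (simp_all add: e_def field_simps)
  define Q where "Q n p = (f (p + e n *\<^sub>R v) - f p) /\<^sub>R e n" for n p
  have sh: "integrable lborel (\<lambda>p. f (p + c))" "integral\<^sup>L lborel (\<lambda>p. f (p + c)) = integral\<^sup>L lborel f" for c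
  proof -
    have [measurable]: "f \<in> borel_measurable borel" using fc by (rule borel_measurable_continuous_onI)
    have d: "distr lborel borel (\<lambda>p. p + c) = (lborel :: complex measure)"
    proof -
      have "(\<lambda>p. p + c) = (+) c" by (intro ext add.commute)
      then show ?thesis using lborel_distr_plus[of c] by simp
    qed
    show "integrable lborel (\<lambda>p. f (p + c))"
      using fi integrable_distr_eq[of "\<lambda>p. p + c" lborel borel f] by (simp add: d)
    show "integral\<^sup>L lborel (\<lambda>p. f (p + c)) = integral\<^sup>L lborel f"
      using integral_distr[of "\<lambda>p. p + c" lborel borel f] by (simp add: d)
  qed
  have Q0: "integral\<^sup>L lborel (Q n) = 0" for n
    unfolding Q_def[abs_def] using sh[of "e n *\<^sub>R v"] fi by (simp add: Bochner_Integration.integral_diff)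
  have QG: "(\<lambda>n. Q n p) \<longlonglongrightarrow> G p" for p
  proof -
    have 1: "((\<lambda>t. p + t *\<^sub>R v) has_derivative (\<lambda>t. t *\<^sub>R v)) (at (0::real))"
      by (auto intro!: derivative_eq_intros)
    have 2: "(f has_derivative frechet_derivative f (at p)) (at (p + 0 *\<^sub>R v))"
      using diff[of p] frechet_derivative_works by auto
    have "frechet_derivative f (at p) (t *\<^sub>R v) = t *\<^sub>R G p" for t
      unfolding G_def using linear_frechet_derivative[OF diff] linear_cmul by blast
    with has_derivative_compose[OF 1 2]
    have "((\<lambda>t. f (p + t *\<^sub>R v)) has_derivative (\<lambda>t. t *\<^sub>R G p)) (at 0)" by simp
    then have "((\<lambda>t. ((f (p + t *\<^sub>R v) - f p) - t *\<^sub>R G p) /\<^sub>R norm t) \<longlongrightarrow> 0) (at 0)"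
      by (simp add: has_derivative_def)
    from tendsto_norm_zero[OF this]
    have "((\<lambda>t. norm ((f (p + t *\<^sub>R v) - f p) /\<^sub>R t - G p)) \<longlongrightarrow> 0) (at 0)"
    proof (rule Lim_transform_eventually)
      have "norm (((f (p + t *\<^sub>R v) - f p) - t *\<^sub>R G p) /\<^sub>R norm t) = norm ((f (p + t *\<^sub>R v) - f p) /\<^sub>R t - G p)"
        if "t \<noteq> 0" for t
      proof -
        have "(f (p + t *\<^sub>R v) - f p) /\<^sub>R t - G p = ((f (p + t *\<^sub>R v) - f p) - t *\<^sub>R G p) /\<^sub>R t"
          using that by (simp add: scaleR_diff_right)
        then show ?thesis by simp
      qed
      then show "\<forall>\<^sub>F t in at 0. norm (((f (p + t *\<^sub>R v) - f p) - t *\<^sub>R G p) /\<^sub>R norm t) = norm ((f (p + t *\<^sub>R v) - f p) /\<^sub>R t - G p)"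
        by (auto simp: eventually_at_filter)
    qed
    then have "((\<lambda>t. (f (p + t *\<^sub>R v) - f p) /\<^sub>R t) \<longlongrightarrow> G p) (at 0)"
      by (rule LIM_zero_cancel[OF tendsto_norm_zero_cancel])
    moreover have "filterlim e (at 0) sequentially"
    proof (rule filterlim_atI)
      show "e \<longlonglongrightarrow> 0" using LIMSEQ_inverse_real_of_nat by (simp add: e_def[abs_def])
      have "e n \<noteq> 0" for n using e(1)[of n] by simp
      then show "\<forall>\<^sub>F n in sequentially. e n \<noteq> 0" by simp
    qed
    ultimately show ?thesis unfolding Q_def by (rule filterlim_compose)
  qed
  have Qb: "norm (Q n p) \<le> M * indicator (cball 0 (\<bar>R\<bar> + norm v)) p" for n p
  proof (cases "p \<in> cball 0 (\<bar>R\<bar> + norm v)")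
    case True
    have "\<exists>t\<in>{0<..<e n}. norm (f (p + e n *\<^sub>R v) - f (p + 0 *\<^sub>R v)) \<le> norm ((e n - 0) *\<^sub>R G (p + t *\<^sub>R v))"
    proof (rule mvt_general[of 0 "e n" "\<lambda>t. f (p + t *\<^sub>R v)" "\<lambda>t s. s *\<^sub>R G (p + t *\<^sub>R v)"])
      show "continuous_on {0..e n} (\<lambda>t. f (p + t *\<^sub>R v))"
        by (intro continuous_on_compose2[OF fc] continuous_intros) auto
      fix t
      have 1: "((\<lambda>t. p + t *\<^sub>R v) has_derivative (\<lambda>t. t *\<^sub>R v)) (at t)"
        by (auto intro!: derivative_eq_intros)
      have 2: "(f has_derivative frechet_derivative f (at (p + t *\<^sub>R v))) (at (p + t *\<^sub>R v))"
        using diff frechet_derivative_works by auto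
      have "frechet_derivative f (at (p + t *\<^sub>R v)) (s *\<^sub>R v) = s *\<^sub>R G (p + t *\<^sub>R v)" for s
        unfolding G_def using linear_frechet_derivative[OF diff] linear_cmul by blast
      with has_derivative_compose[OF 1 2]
      show "((\<lambda>t. f (p + t *\<^sub>R v)) has_derivative (\<lambda>s. s *\<^sub>R G (p + t *\<^sub>R v))) (at t)" by simp
    qed (use e in auto)
    then obtain t where "norm (f (p + e n *\<^sub>R v) - f p) \<le> e n * norm (G (p + t *\<^sub>R v))" using e[of n] by auto
    also have "\<dots> \<le> e n * M" using M(2) e[of n] by (intro mult_left_mono) auto
    finally have *: "norm (f (p + e n *\<^sub>R v) - f p) \<le> e n * M" .
    have "norm (Q n p) = inverse (e n) * norm (f (p + e n *\<^sub>R v) - f p)"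
      unfolding Q_def norm_scaleR using e[of n] by simp
    also have "\<dots> \<le> inverse (e n) * (e n * M)" using * e[of n] by (intro mult_left_mono) auto
    also have "\<dots> = M" using e(1)[of n] by (simp add: mult.assoc[symmetric])
    finally have "norm (Q n p) \<le> M" .
    then show ?thesis using True by simp
  next
    case False
    then have p: "norm p > \<bar>R\<bar> + norm v" by simp
    have "norm p \<le> norm (p + e n *\<^sub>R v) + norm (e n *\<^sub>R v)" by (metis add_diff_cancel_right' norm_triangle_ineq4)
    moreover have "norm (e n *\<^sub>R v) \<le> norm v" using e[of n] by (simp add: mult_left_le_one_le)
    ultimately have "norm (p + e n *\<^sub>R v) > R" using p by linarith
    moreover have "norm p > R" using p norm_ge_zero[of v] by linarith
    ultimately show ?thesis using False supp by (simp add: Q_def)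
  qed
  have "(\<lambda>n. integral\<^sup>L lborel (Q n)) \<longlonglongrightarrow> integral\<^sup>L lborel G"
  proof (rule integral_dominated_convergence)
    show "G \<in> borel_measurable lborel" using Gc borel_measurable_continuous_onI by simp
    have [measurable]: "f \<in> borel_measurable borel" using fc by (rule borel_measurable_continuous_onI)
    show "Q n \<in> borel_measurable lborel" for n unfolding Q_def[abs_def] by simp
    have "emeasure lborel (cball (0::complex) (\<bar>R\<bar> + norm v)) < \<infinity>" by (rule emeasure_lborel_cball_finite)
    then show "integrable lborel (\<lambda>p::complex. M * indicator (cball 0 (\<bar>R\<bar> + norm v)) p)"
      by (intro integrable_mult_right integrable_real_indicator) auto
    show "AE p in lborel. (\<lambda>n. Q n p) \<longlonglongrightarrow> G p" using QG by simp
    show "AE p in lborel. norm (Q n p) \<le> M * indicator (cball 0 (\<bar>R\<bar> + norm v)) p" for n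
      using Qb by (intro AE_I2)
  qed
  then have "(\<lambda>n. 0) \<longlonglongrightarrow> integral\<^sup>L lborel G" by (simp only: Q0)
  then have "integral\<^sup>L lborel G = 0" using LIMSEQ_unique[OF _ tendsto_const] by blast
  then show "integrable lborel (\<lambda>p. frechet_derivative f (at p) v)" "integral\<^sup>L lborel (\<lambda>p. frechet_derivative f (at p) v) = 0"
    using Gi by (simp_all add: G_def[abs_def])
qed

section \<open>Growth rates near a puncture\<close>

definition neglog :: "complex \<Rightarrow> real" where "neglog p = - ln (norm p)"

text \<open>A majorant, integrable near the puncture, of the growth $\log|\log|z||/(|z|^2\log^2|z|)$.\<close>

definition cusp_majorant :: "complex \<Rightarrow> real" where
  "cusp_majorant p = 1 / ((norm p)\<^sup>2 * (neglog p * sqrt (neglog p)))"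

text \<open>The radius makes \<open>neglog\<close> exceed 1, so that its powers increase with the
  exponent.\<close>

definition cusp_disc :: "complex set" where "cusp_disc = {p. p \<noteq> 0 \<and> norm p < exp (- 1)}"

lemma open_cusp_disc: "open cusp_disc"
proof -
  have "cusp_disc = ball 0 (exp (- 1)) - {0}" by (auto simp: cusp_disc_def)
  moreover have "open (ball 0 (exp (- 1)) - {0::complex})" by (intro open_Diff) auto
  ultimately show ?thesis by (simp only:)
qed

lemma neglog_ge1: "p \<in> cusp_disc \<Longrightarrow> neglog p > 1"
proof -
  assume p: "p \<in> cusp_disc"
  then have "ln (norm p) < ln (exp (-1))" by (subst ln_less_cancel_iff) (auto simp: cusp_disc_def)
  then show ?thesis by (simp add: neglog_def)
qed

lemma norm_neglog_le1: "p \<in> cusp_disc \<Longrightarrow> norm p * neglog p \<le> 1"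
proof -
  assume p: "p \<in> cusp_disc"
  have "ln (1 / norm p) \<le> 1 / norm p - 1" using p by (intro ln_le_minus_one) (auto simp: cusp_disc_def)
  then have "neglog p \<le> 1 / norm p" using p by (simp add: neglog_def ln_div cusp_disc_def)
  then show ?thesis using p by (simp add: cusp_disc_def field_simps)
qed

lemma neglog_continuous: "continuous_on cusp_disc neglog"
  unfolding neglog_def[abs_def] by (intro continuous_intros) (auto simp: cusp_disc_def)

lemma cusp_majorant_continuous: "continuous_on cusp_disc cusp_majorant"
  unfolding cusp_majorant_def[abs_def]
  by (intro continuous_intros neglog_continuous) (use neglog_ge1 in \<open>force simp: cusp_disc_def\<close>)

lemma cusp_majorant_nonneg: "p \<in> cusp_disc \<Longrightarrow> cusp_majorant p \<ge> 0"
  using neglog_ge1[of p] by (simp add: cusp_majorant_def)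

text \<open>The growth rates to be majorised, in this order: bounded coefficients, the logarithm of
  a frame norm, omega^0, and the Poincare growth of c_1 and of the area form.\<close>

lemma cusp_majorant_ge:
  assumes p: "p \<in> cusp_disc"
  shows "1 \<le> cusp_majorant p" and "sqrt (neglog p) \<le> cusp_majorant p"
    and "sqrt (neglog p) / ((norm p)\<^sup>2 * (neglog p)\<^sup>2) = cusp_majorant p"
    and "1 / ((norm p)\<^sup>2 * (neglog p)\<^sup>2) \<le> cusp_majorant p"
proof -
  let ?L = "neglog p"
  have L: "?L > 1" and np: "norm p > 0" using neglog_ge1[OF p] p by (auto simp: cusp_disc_def)
  have sL: "sqrt ?L > 1" using L by simp
  have sq: "sqrt ?L * sqrt ?L = ?L" using L by simp
  have P: "(norm p)\<^sup>2 * ?L\<^sup>2 \<le> 1"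
    using norm_neglog_le1[OF p] np L by (simp add: power_mult_distrib[symmetric] power_le_one)
  have P0: "(norm p)\<^sup>2 * ?L\<^sup>2 > 0" using np L by simp
  show 3: "sqrt ?L / ((norm p)\<^sup>2 * ?L\<^sup>2) = cusp_majorant p"
  proof -
    have "?L\<^sup>2 = ?L * sqrt ?L * sqrt ?L" using sq by (simp add: power2_eq_square mult.assoc)
    then show ?thesis using L sL np by (simp add: cusp_majorant_def field_simps)
  qed
  have "sqrt ?L * 1 \<le> sqrt ?L * (1 / ((norm p)\<^sup>2 * ?L\<^sup>2))"
    using P P0 sL by (intro mult_left_mono) (auto simp: field_simps)
  then show 2: "sqrt ?L \<le> cusp_majorant p" using 3 by simp
  then show "1 \<le> cusp_majorant p" using sL by linarith
  have "1 / ((norm p)\<^sup>2 * ?L\<^sup>2) \<le> sqrt ?L / ((norm p)\<^sup>2 * ?L\<^sup>2)"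
    using sL P0 by (intro divide_right_mono) auto
  then show "1 / ((norm p)\<^sup>2 * ?L\<^sup>2) \<le> cusp_majorant p" using 3 by simp
qed

text \<open>The area of the circumscribed square; the crude constant 4 suffices wherever small discs
  are measured below.\<close>

lemma emeasure_cball_complex:
  assumes "0 \<le> s"
  shows "emeasure lborel (cball (0::complex) s) \<le> ennreal (4 * s\<^sup>2)"
proof -
  have "cball (0::complex) s \<subseteq> cbox (Complex (-s) (-s)) (Complex s s)"
    using abs_Re_le_cmod abs_Im_le_cmod
    by (fastforce simp: in_cbox_complex_iff dest: order_trans[OF abs_Re_le_cmod] order_trans[OF abs_Im_le_cmod])
  then have "emeasure lborel (cball (0::complex) s) \<le> emeasure lborel (cbox (Complex (-s) (-s)) (Complex s s))"
    by (intro emeasure_mono) auto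
  also have "\<dots> = (\<Prod>b\<in>Basis. (Complex s s - Complex (-s) (-s)) \<bullet> b)"
    using assms by (intro emeasure_lborel_cbox) (auto simp: Basis_complex_def)
  also have "\<dots> = ennreal (4 * s\<^sup>2)" by (simp add: Basis_complex_def power2_eq_square)
  finally show ?thesis .
qed

text \<open>The cusp disc is cut into the annuli k + 1 \<le> neglog < k + 2. Bounding the majorant
  by a constant on each of them and its area by that of the disc of radius exp(-(k+1)) leaves a
  multiple of the convergent series of (k+1)^(-3/2).\<close>

lemma cusp_majorant_integrable: "integrable lborel (\<lambda>p. indicator cusp_disc p *\<^sub>R cusp_majorant p)"
proof (rule integrableI_nonneg)
  have meas: "(\<lambda>p. indicator cusp_disc p *\<^sub>R cusp_majorant p) \<in> borel_measurable borel"
    using open_cusp_disc by (intro borel_measurable_continuous_on_indicator cusp_majorant_continuous) auto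
  then show "(\<lambda>p. indicator cusp_disc p *\<^sub>R cusp_majorant p) \<in> borel_measurable lborel" by simp
  show "AE p in lborel. 0 \<le> indicator cusp_disc p *\<^sub>R cusp_majorant p"
    using cusp_majorant_nonneg by (auto simp: indicator_def)
  \<comment> \<open>From |p|^(-2) = exp(2 neglog p) < exp(2k + 4) and neglog p \<ge> k + 1 on the
    k-th annulus.\<close>
  define c where "c k = exp (2 * real k + 4) / (real (Suc k) * sqrt (real (Suc k)))" for k
  have c0: "c k \<ge> 0" for k by (simp add: c_def)
  have single: "f k \<le> (\<Sum>k. f k)" for f :: "nat \<Rightarrow> ennreal" and k
    using sum_le_suminf[OF summableI, of "{k}" f] by simp
  have bound: "ennreal (indicator cusp_disc p *\<^sub>R cusp_majorant p)
     \<le> (\<Sum>k. ennreal (c k) * indicator (cball 0 (exp (- real (Suc k)))) p)" for p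
  proof (cases "p \<in> cusp_disc")
    case True
    have L: "neglog p > 1" and np: "norm p > 0" using neglog_ge1[OF True] True by (auto simp: cusp_disc_def)
    \<comment> \<open>The natural subtraction is exact: the floor is at least 1 because
      \<open>neglog p\<close> > 1.\<close>
    define k where "k = nat \<lfloor>neglog p\<rfloor> - 1"
    have k: "real (Suc k) \<le> neglog p" "neglog p < real (Suc k) + 1"
      using L unfolding k_def by linarith+
    have ne: "norm p = exp (- neglog p)" using np by (simp add: neglog_def)
    have "p \<in> cball 0 (exp (- real (Suc k)))" using k(1) by (simp add: ne)
    moreover have "cusp_majorant p \<le> c k"
    proof -
      have "(norm p)\<^sup>2 = exp (- 2 * neglog p)" unfolding ne by (simp add: exp_double[symmetric] power2_eq_square exp_add[symmetric])
      also have "\<dots> \<ge> exp (- (2 * real k + 4))" using k(2) by simp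
      finally have "exp (- (2 * real k + 4)) \<le> (norm p)\<^sup>2" .
      moreover have "real (Suc k) * sqrt (real (Suc k)) \<le> neglog p * sqrt (neglog p)"
        using k(1) L by (intro mult_mono) auto
      ultimately have "exp (- (2 * real k + 4)) * (real (Suc k) * sqrt (real (Suc k))) \<le> (norm p)\<^sup>2 * (neglog p * sqrt (neglog p))"
        by (rule mult_mono) auto
      moreover have "exp (- (2 * real k + 4)) * (real (Suc k) * sqrt (real (Suc k))) > 0" by simp
      ultimately have "1 / ((norm p)\<^sup>2 * (neglog p * sqrt (neglog p))) \<le> 1 / (exp (- (2 * real k + 4)) * (real (Suc k) * sqrt (real (Suc k))))"
        by (intro frac_le) auto
      also have "\<dots> = c k" unfolding c_def exp_minus by (simp add: divide_inverse)
      finally show ?thesis by (simp add: cusp_majorant_def)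
    qed
    ultimately have "ennreal (indicator cusp_disc p *\<^sub>R cusp_majorant p) \<le> ennreal (c k) * indicator (cball 0 (exp (- real (Suc k)))) p"
      using True by (simp add: ennreal_leI)
    also have "\<dots> \<le> (\<Sum>k. ennreal (c k) * indicator (cball 0 (exp (- real (Suc k)))) p)"
      by (rule single)
    finally show ?thesis .
  qed simp
  have "(\<integral>\<^sup>+p. ennreal (indicator cusp_disc p *\<^sub>R cusp_majorant p) \<partial>lborel)
     \<le> (\<integral>\<^sup>+p. (\<Sum>k. ennreal (c k) * indicator (cball (0::complex) (exp (- real (Suc k)))) p) \<partial>lborel)"
    by (rule nn_integral_mono) (rule bound)
  also have "\<dots> = (\<Sum>k. ennreal (c k) * emeasure lborel (cball (0::complex) (exp (- real (Suc k)))))"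
  proof -
    have cb: "cball (0::complex) s \<in> sets borel" for s by (rule borel_closed) simp
    have mm: "(\<lambda>p. ennreal (c k) * indicator (cball (0::complex) s) p) \<in> borel_measurable lborel" for k s
      using cb[of s] by measurable
    have "(\<integral>\<^sup>+p. (\<Sum>k. ennreal (c k) * indicator (cball (0::complex) (exp (- real (Suc k)))) p) \<partial>lborel)
      = (\<Sum>k. \<integral>\<^sup>+p. ennreal (c k) * indicator (cball (0::complex) (exp (- real (Suc k)))) p \<partial>lborel)"
      by (rule nn_integral_suminf) (rule mm)
    then show ?thesis using cb by (simp add: nn_integral_cmult_indicator)
  qed
  also have "\<dots> \<le> (\<Sum>k. ennreal (4 * exp 2 / (real (Suc k) * sqrt (real (Suc k)))))"
  proof (rule suminf_le)
    fix k
    have "ennreal (c k) * emeasure lborel (cball (0::complex) (exp (- real (Suc k)))) \<le> ennreal (c k) * ennreal (4 * (exp (- real (Suc k)))\<^sup>2)"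
      by (intro mult_left_mono emeasure_cball_complex) auto
    also have "\<dots> = ennreal (c k * (4 * (exp (- real (Suc k)))\<^sup>2))" using c0 by (simp add: ennreal_mult)
    also have "c k * (4 * (exp (- real (Suc k)))\<^sup>2) = 4 * exp 2 / (real (Suc k) * sqrt (real (Suc k)))"
    proof -
      have "exp (2 * real k + 4) * (exp (- real (Suc k)))\<^sup>2 = exp 2"
        by (simp add: power2_eq_square exp_add[symmetric] mult_exp_exp)
      then show ?thesis by (simp add: c_def field_simps)
    qed
    finally show "ennreal (c k) * emeasure lborel (cball (0::complex) (exp (- real (Suc k)))) \<le> ennreal (4 * exp 2 / (real (Suc k) * sqrt (real (Suc k))))" .
  qed auto
  also have "\<dots> < \<infinity>"
  proof -
    have "summable (\<lambda>k. real k powr (- (3/2)))" by (subst summable_real_powr_iff) simp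
    then have "summable (\<lambda>k. real (Suc k) powr (- (3/2)))" by (subst summable_Suc_iff)
    moreover have "real (Suc k) powr (- (3/2)) = 1 / (real (Suc k) * sqrt (real (Suc k)))" for k
    proof -
      have "x powr (- (3/2)) = 1 / (x * sqrt x)" if "x > 0" for x :: real
      proof -
        have "x powr (1 + 1/2) = x powr 1 * x powr (1/2)" by (rule powr_add)
        then have "x powr (3/2) = x * sqrt x" using that by (simp add: powr_half_sqrt)
        then show ?thesis unfolding powr_minus inverse_eq_divide by (simp only:)
      qed
      from this[of "real (Suc k)"] show ?thesis by simp
    qed
    ultimately have "summable (\<lambda>k. 4 * exp 2 * (1 / (real (Suc k) * sqrt (real (Suc k)))))"
      by (intro summable_mult) simp
    then have "summable (\<lambda>k. 4 * exp 2 / (real (Suc k) * sqrt (real (Suc k))))" by simp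
    then show ?thesis
      by (subst suminf_ennreal2) auto
  qed
  finally show "(\<integral>\<^sup>+p. ennreal (indicator cusp_disc p *\<^sub>R cusp_majorant p) \<partial>lborel) < \<infinity>" .
qed

section \<open>Stokes' theorem in the plane with one puncture\<close>

lemma frechet_zero_outside:
  assumes "\<And>q. norm q > R \<Longrightarrow> f q = 0" "norm p > R"
  shows "frechet_derivative f (at p) v = 0"
proof -
  have "frechet_derivative f (at p) = frechet_derivative (\<lambda>p. 0) (at p)"
    by (rule frechet_derivative_cong_open[of "{q. norm q > R}"])
       (use assms in \<open>auto intro: open_Collect_less continuous_intros\<close>)
  then show ?thesis by simp
qed

lemma planar_smooth_C1:
  assumes "planar_smooth UNIV f"
  shows "f differentiable at p" "continuous_on UNIV (\<lambda>p. frechet_derivative f (at p) v)"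
proof -
  have "cont_diff_on (Suc 0) UNIV f" using assms unfolding planar_smooth_def by blast
  then show "f differentiable at p" "continuous_on UNIV (\<lambda>p. frechet_derivative f (at p) v)" by auto
qed

text \<open>The cutoff at scale $\varepsilon$ has gradient $O(1/\varepsilon)$ on a set of area $O(\varepsilon^2)$,
  where the form is $O(1/(\varepsilon|\log\varepsilon|))$.\<close>

lemma cusp_stokes:
  fixes a b :: "complex \<Rightarrow> complex"
  assumes diff: "\<And>p. p \<noteq> 0 \<Longrightarrow> a differentiable (at p)" "\<And>p. p \<noteq> 0 \<Longrightarrow> b differentiable (at p)"
    and cont: "\<And>v. continuous_on (- {0}) (\<lambda>p. frechet_derivative a (at p) v)"
      "\<And>v. continuous_on (- {0}) (\<lambda>p. frechet_derivative b (at p) v)"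
    and supp: "\<And>p. norm p > R \<Longrightarrow> a p = 0" "\<And>p. norm p > R \<Longrightarrow> b p = 0"
    and C: "\<delta> > 0" "\<And>p. p \<noteq> 0 \<Longrightarrow> norm p < \<delta> \<Longrightarrow> norm (a p) \<le> C / (norm p * neglog p)"
      "\<And>p. p \<noteq> 0 \<Longrightarrow> norm p < \<delta> \<Longrightarrow> norm (b p) \<le> C / (norm p * neglog p)"
    and int: "integrable lborel (\<lambda>p. wirt (frechet_derivative b (at p)) - wirt_bar (frechet_derivative a (at p)))"
  shows "integral\<^sup>L lborel (\<lambda>p. wirt (frechet_derivative b (at p)) - wirt_bar (frechet_derivative a (at p))) = 0"
proof -
  define g where "g p = wirt (frechet_derivative b (at p)) - wirt_bar (frechet_derivative a (at p))" for p
  obtain \<beta> :: "complex \<Rightarrow> real" where \<beta>: "planar_smooth UNIV \<beta>" "\<And>p. 0 \<le> \<beta> p" "\<And>p. \<beta> p \<le> 1"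
    "\<And>p. dist 0 p \<le> 1 \<Longrightarrow> \<beta> p = 1" "\<And>p. dist 0 p \<ge> 2 \<Longrightarrow> \<beta> p = 0"
    by (rule planar_bump_exists[of 1 2 0]) auto
  define \<gamma> where "\<gamma> p = complex_of_real (\<beta> p)" for p
  have \<gamma>: "planar_smooth UNIV \<gamma>"
    unfolding planar_smooth_def \<gamma>_def[abs_def]
    using \<beta>(1) by (auto simp: planar_smooth_def intro: cont_diff_on_linear[OF _ bounded_linear_of_real])
  note \<gamma>d = planar_smooth_C1[OF \<gamma>]
  have \<gamma>0: "\<gamma> p = 0" if "norm p > 2" for p using \<beta>(5)[of p] that by (simp add: \<gamma>_def)
  define G where "G v p = frechet_derivative \<gamma> (at p) v" for v p
  have Gc: "continuous_on UNIV (G v)" for v using \<gamma>d(2) by (simp add: G_def[abs_def])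
  have G0: "G v p = 0" if "norm p > 2" for v p unfolding G_def by (rule frechet_zero_outside[OF \<gamma>0 that])
  obtain M1 where M1: "M1 > 0" "\<And>p. norm (G 1 p) \<le> M1" using compact_support_bounded[OF Gc G0] by blast
  obtain M2 where M2: "M2 > 0" "\<And>p. norm (G \<i> p) \<le> M2" using compact_support_bounded[OF Gc G0] by blast
  define M where "M = M1 + M2"
  have M: "M > 0" using M1 M2 by (simp add: M_def)
  have WM: "norm (wirt (\<lambda>v. G v p)) \<le> M" "norm (wirt_bar (\<lambda>v. G v p)) \<le> M" for p
  proof -
    have "norm (G 1 p - \<i> * G \<i> p) \<le> M" "norm (G 1 p + \<i> * G \<i> p) \<le> M"
      using M1(2)[of p] M2(2)[of p] norm_triangle_ineq4[of "G 1 p" "\<i> * G \<i> p"] norm_triangle_ineq[of "G 1 p" "\<i> * G \<i> p"]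
      by (auto simp: M_def norm_mult)
    then show "norm (wirt (\<lambda>v. G v p)) \<le> M" "norm (wirt_bar (\<lambda>v. G v p)) \<le> M"
      using M by (auto simp: wirt_def wirt_bar_def norm_divide)
  qed
  \<comment> \<open>\<open>\<psi> n\<close> vanishes for |p| \<le> 1/n and equals 1 for |p| \<ge>
    2/n.\<close>
  define \<psi> where "\<psi> n p = 1 - \<gamma> (real n *\<^sub>R p)" for n p
  have \<psi>d: "(\<psi> n has_derivative (\<lambda>v. - (real n *\<^sub>R G v (real n *\<^sub>R p)))) (at p)" for n p
  proof -
    have 1: "((\<lambda>p. real n *\<^sub>R p) has_derivative (\<lambda>v. real n *\<^sub>R v)) (at p)"
      by (auto intro!: derivative_eq_intros)
    have 2: "(\<gamma> has_derivative (\<lambda>v. G v (real n *\<^sub>R p))) (at (real n *\<^sub>R p))"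
      unfolding G_def using \<gamma>d(1) frechet_derivative_works by blast
    have "G (real n *\<^sub>R v) q = real n *\<^sub>R G v q" for v q
      unfolding G_def using linear_frechet_derivative[OF \<gamma>d(1)] linear_cmul by blast
    with has_derivative_compose[OF 1 2]
    have "((\<lambda>p. \<gamma> (real n *\<^sub>R p)) has_derivative (\<lambda>v. real n *\<^sub>R G v (real n *\<^sub>R p))) (at p)" by simp
    then show ?thesis unfolding \<psi>_def[abs_def] by (auto intro!: derivative_eq_intros)
  qed
  have \<psi>0: "\<psi> n p = 0" if "real n * norm p \<le> 1" for n p
    using \<beta>(4)[of "real n *\<^sub>R p"] that by (simp add: \<psi>_def \<gamma>_def)
  have \<psi>c: "continuous_on UNIV (\<psi> n)" for n
    by (rule continuous_at_imp_continuous_on) (intro ballI has_derivative_continuous[OF \<psi>d])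
  \<comment> \<open>The product is 0 on a neighbourhood of the origin, so multiplying by
    \<open>\<psi> n\<close> turns a function that is C^1 off the origin into one that is C^1
    everywhere.\<close>
  have cut: "(\<lambda>p. \<psi> n p * f p) differentiable at p"
    "continuous_on UNIV (\<lambda>p. frechet_derivative (\<lambda>p. \<psi> n p * f p) (at p) v)"
    "p \<noteq> 0 \<Longrightarrow> frechet_derivative (\<lambda>p. \<psi> n p * f p) (at p) v = \<psi> n p * frechet_derivative f (at p) v - real n *\<^sub>R G v (real n *\<^sub>R p) * f p"
    if f: "\<And>p. p \<noteq> 0 \<Longrightarrow> f differentiable (at p)" "\<And>v. continuous_on (- {0}) (\<lambda>p. frechet_derivative f (at p) v)"
      and n: "n > 0" for f n p v
  proof -
    have d: "((\<lambda>p. \<psi> n p * f p) has_derivative (\<lambda>v. \<psi> n p * frechet_derivative f (at p) v + - (real n *\<^sub>R G v (real n *\<^sub>R p)) * f p)) (at p)"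
      if "p \<noteq> 0" for p
      by (rule has_derivative_mult[OF \<psi>d]) (use f(1)[OF that] frechet_derivative_works in blast)
    let ?B = "ball (0::complex) (1 / real n)"
    have B: "\<psi> n p * f p = 0" if "p \<in> ?B" for p
      using \<psi>0[of n p] that n by (simp add: field_simps)
    have d0: "((\<lambda>p. \<psi> n p * f p) has_derivative (\<lambda>v. 0)) (at p)" if "p \<in> ?B" for p
      by (rule has_derivative_transform_within_open[of "\<lambda>p. 0" _ _ _ ?B]) (use that B in auto)
    show "(\<lambda>p. \<psi> n p * f p) differentiable at p"
      using d[of p] d0[of p] n unfolding differentiable_def by (cases "p = 0") auto
    show e: "frechet_derivative (\<lambda>p. \<psi> n p * f p) (at p) v = \<psi> n p * frechet_derivative f (at p) v - real n *\<^sub>R G v (real n *\<^sub>R p) * f p"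
      if "p \<noteq> 0" for p v
      using frechet_derivative_eqI[OF d[OF that]] by simp
    have fc: "continuous_on (- {0}) f"
      using f(1) by (simp add: continuous_on_eq_continuous_at differentiable_imp_continuous_within open_Compl)
    have c1: "continuous_on (- {0}) (\<lambda>p. frechet_derivative (\<lambda>p. \<psi> n p * f p) (at p) v)"
    proof (subst continuous_on_cong[OF refl e])
      show "continuous_on (- {0}) (\<lambda>p. \<psi> n p * frechet_derivative f (at p) v - real n *\<^sub>R G v (real n *\<^sub>R p) * f p)"
        by (intro continuous_intros f(2) fc continuous_on_subset[OF \<psi>c] continuous_on_compose2[OF Gc]) auto
    qed auto
    have c2: "continuous_on ?B (\<lambda>p. frechet_derivative (\<lambda>p. \<psi> n p * f p) (at p) v)"
      by (subst continuous_on_cong[OF refl, of _ _ "\<lambda>p. 0"]) (use frechet_derivative_eqI[OF d0] in auto)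
    have "continuous_on (- {0} \<union> ?B) (\<lambda>p. frechet_derivative (\<lambda>p. \<psi> n p * f p) (at p) v)"
      by (rule continuous_on_open_Un[OF _ _ c1 c2]) auto
    moreover have "- {0} \<union> ?B = UNIV" using n by auto
    ultimately show "continuous_on UNIV (\<lambda>p. frechet_derivative (\<lambda>p. \<psi> n p * f p) (at p) v)" by simp
  qed
  \<comment> \<open>Up to sign the term d\<psi>_n \<and> (a dz + b dzbar): \<psi>_n g - E_n is the
    differential of a form without singularity and therefore has integral 0.\<close>
  define E where "E n p = real n *\<^sub>R (wirt (\<lambda>v. G v (real n *\<^sub>R p)) * b p - wirt_bar (\<lambda>v. G v (real n *\<^sub>R p)) * a p)" for n p
  have z: "integrable lborel (\<lambda>p. \<psi> n p * g p - E n p) \<and> integral\<^sup>L lborel (\<lambda>p. \<psi> n p * g p - E n p) = 0" if n: "n > 0" for n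
  proof -
    have s: "norm p > R \<Longrightarrow> \<psi> n p * a p = 0" "norm p > R \<Longrightarrow> \<psi> n p * b p = 0" for p using supp by auto
    define FA where "FA v p = frechet_derivative (\<lambda>p. \<psi> n p * a p) (at p) v" for v p
    define FB where "FB v p = frechet_derivative (\<lambda>p. \<psi> n p * b p) (at p) v" for v p
    have F: "integrable lborel (FA v)" "integral\<^sup>L lborel (FA v) = 0" "integrable lborel (FB v)" "integral\<^sup>L lborel (FB v) = 0" for v
      using integral_frechet_compact_support[where f = "\<lambda>p. \<psi> n p * a p" and v = v,
          OF cut(1)[OF diff(1) cont(1) n] cut(2)[OF diff(1) cont(1) n] s(1)]
        integral_frechet_compact_support[where f = "\<lambda>p. \<psi> n p * b p" and v = v,
          OF cut(1)[OF diff(2) cont(2) n] cut(2)[OF diff(2) cont(2) n] s(2)]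
      by (simp_all add: FA_def[abs_def] FB_def[abs_def])
    let ?h = "\<lambda>p. (1/2) * (FB 1 p - \<i> * FB \<i> p) - (1/2) * (FA 1 p + \<i> * FA \<i> p)"
    have hi: "integrable lborel ?h" by (intro Bochner_Integration.integrable_diff Bochner_Integration.integrable_add integrable_mult_right F)
    have h0: "integral\<^sup>L lborel ?h = 0" by (simp add: F)
    have FAe: "FA v p = \<psi> n p * frechet_derivative a (at p) v - real n *\<^sub>R G v (real n *\<^sub>R p) * a p" if "p \<noteq> 0" for v p
      unfolding FA_def by (rule cut(3)[OF diff(1) cont(1) n that])
    have FBe: "FB v p = \<psi> n p * frechet_derivative b (at p) v - real n *\<^sub>R G v (real n *\<^sub>R p) * b p" if "p \<noteq> 0" for v p
      unfolding FB_def by (rule cut(3)[OF diff(2) cont(2) n that])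
    have eq: "\<psi> n p * g p - E n p = ?h p" if "p \<noteq> 0" for p
      unfolding FAe[OF that] FBe[OF that] g_def E_def
      by (simp add: wirt_def wirt_bar_def scaleR_conv_of_real field_simps)
    have AE: "AE p in lborel. \<psi> n p * g p - E n p = ?h p"
      by (rule AE_I'[of "{0}"]) (use eq in auto)
    \<comment> \<open>Equality off the origin alone does not give Borel measurability, so the value
      at 0 is split off explicitly.\<close>
    have m: "(\<lambda>p. \<psi> n p * g p - E n p) \<in> borel_measurable lborel"
    proof -
      have "(\<lambda>p. if p = 0 then \<psi> n 0 * g 0 - E n 0 else ?h p) \<in> borel_measurable borel"
        using borel_measurable_integrable[OF hi] by measurable
      moreover have "(\<lambda>p. if p = 0 then \<psi> n 0 * g 0 - E n 0 else ?h p) = (\<lambda>p. \<psi> n p * g p - E n p)"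
        using eq by auto
      ultimately show ?thesis by simp
    qed
    show ?thesis
      using integrable_cong_AE[OF m borel_measurable_integrable[OF hi] AE] integral_cong_AE[OF m borel_measurable_integrable[OF hi] AE] hi h0 by simp
  qed
  have gi: "integrable lborel g" using int by (simp add: g_def[abs_def])
  have \<psi>m: "\<psi> n \<in> borel_measurable borel" for n using \<psi>c by (rule borel_measurable_continuous_onI)
  have \<psi>1: "norm (\<psi> n p) \<le> 1" for n p
  proof -
    have "\<psi> n p = complex_of_real (1 - \<beta> (real n *\<^sub>R p))" by (simp add: \<psi>_def \<gamma>_def)
    then have "norm (\<psi> n p) = \<bar>1 - \<beta> (real n *\<^sub>R p)\<bar>" by (simp only: norm_of_real)
    then show ?thesis using \<beta>(2)[of "real n *\<^sub>R p"] \<beta>(3)[of "real n *\<^sub>R p"] by linarith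
  qed
  have \<psi>gm: "(\<lambda>p. \<psi> n p * g p) \<in> borel_measurable lborel" for n
    by (rule borel_measurable_times) (simp add: \<psi>m, rule borel_measurable_integrable[OF gi])
  have \<psi>gb: "norm (\<psi> n p * g p) \<le> norm (g p)" for n p
    using mult_right_mono[OF \<psi>1[of n p], of "norm (g p)"] by (simp add: norm_mult)
  have \<psi>gi: "integrable lborel (\<lambda>p. \<psi> n p * g p)" for n
    by (rule Bochner_Integration.integrable_bound[OF gi \<psi>gm]) (rule AE_I2, rule \<psi>gb)
  have lim1: "(\<lambda>n. integral\<^sup>L lborel (\<lambda>p. \<psi> n p * g p)) \<longlonglongrightarrow> integral\<^sup>L lborel g"
  proof (rule integral_dominated_convergence)
    show "integrable lborel (\<lambda>p. norm (g p))" using gi by simp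
    show "AE p in lborel. (\<lambda>n. \<psi> n p * g p) \<longlonglongrightarrow> g p"
    proof (rule AE_I'[of "{0}"])
      have "(\<lambda>n. \<psi> n p * g p) \<longlonglongrightarrow> g p" if p: "p \<noteq> 0" for p
      proof (rule tendsto_eventually)
        obtain N where N: "real N * norm p > 2" using p reals_Archimedean3[of "norm p" ] by auto
        have "\<psi> n p = 1" if "n \<ge> N" for n
        proof -
          have "real n * norm p \<ge> real N * norm p" using that by (intro mult_right_mono) auto
          then show ?thesis using N \<beta>(5)[of "real n *\<^sub>R p"] by (simp add: \<psi>_def \<gamma>_def)
        qed
        then show "\<forall>\<^sub>F n in sequentially. \<psi> n p * g p = g p" by (auto simp: eventually_sequentially)
      qed
      then show "{p \<in> space lborel. \<not> (\<lambda>n. \<psi> n p * g p) \<longlonglongrightarrow> g p} \<subseteq> {0}" by auto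
    qed auto
    show "AE p in lborel. norm (\<psi> n p * g p) \<le> norm (g p)" for n
      by (rule AE_I2) (rule \<psi>gb)
  qed (rule \<psi>gm borel_measurable_integrable[OF gi])+
  have lim2: "(\<lambda>n. integral\<^sup>L lborel (\<lambda>p. \<psi> n p * g p)) \<longlonglongrightarrow> 0"
  proof (rule Lim_null_comparison)
    \<comment> \<open>N > 3 makes ln (n / 2) positive for n \<ge> N; 2/N < \<delta> puts the support
      of d\<psi>_n where the growth bound holds.\<close>
    obtain N where N: "N > 3" "2 / real N < \<delta>"
    proof -
      obtain N0 where "real N0 > 2 / \<delta>" using reals_Archimedean2 by blast
      then have "2 / real (N0 + 4) < \<delta>" using C(1) by (simp add: field_simps)
      then show ?thesis using that[of "N0 + 4"] by simp
    qed
    show "\<forall>\<^sub>F n in sequentially. norm (integral\<^sup>L lborel (\<lambda>p. \<psi> n p * g p)) \<le> 32 * M * \<bar>C\<bar> / ln (real n / 2)"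
      unfolding eventually_sequentially
    proof (intro exI[of _ N] allI impI)
      fix n assume n: "n \<ge> N"
      then have n0: "n > 0" and n3: "real n > 3" using N by auto
      have n\<delta>: "2 / real n < \<delta>"
      proof -
        have "2 / real n \<le> 2 / real N" using n N(1) by (intro divide_left_mono) auto
        then show ?thesis using N(2) by simp
      qed
      have ln: "ln (real n / 2) > 0" using n3 by simp
      \<comment> \<open>A gradient of size n M meets two coefficients of size |C| n / ln (n/2), on a
        disc of area at most 4 (2/n)^2. The powers of n cancel, and 32 M |C| / ln (n/2) remains as a
        bound for the integral.\<close>
      have Eb: "norm (E n p) \<le> 2 * M * \<bar>C\<bar> * (real n)\<^sup>2 / ln (real n / 2) * indicator (cball 0 (2 / real n)) p" if p: "p \<noteq> 0" for p
      proof (cases "real n * norm p > 2 \<or> real n * norm p < 1")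
        case True
        have "G v (real n *\<^sub>R p) = 0" for v
        proof (cases "real n * norm p > 2")
          case True
          then show ?thesis by (intro G0) simp
        next
          case False
          then have "norm (real n *\<^sub>R p) < 1" using True by simp
          then have "frechet_derivative \<gamma> (at (real n *\<^sub>R p)) = frechet_derivative (\<lambda>p. 1) (at (real n *\<^sub>R p))"
            by (intro frechet_derivative_cong_open[of "ball 0 1"]) (use \<beta>(4) in \<open>auto simp: \<gamma>_def\<close>)
          then show ?thesis by (simp add: G_def)
        qed
        then have "E n p = 0" by (simp add: E_def wirt_def wirt_bar_def)
        then show ?thesis using M ln by simp
      next
        case False
        then have p1: "1 / real n \<le> norm p" and p2: "norm p \<le> 2 / real n" using n0 by (auto simp: field_simps not_less)
        have L: "neglog p \<ge> ln (real n / 2)"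
        proof -
          have "ln (norm p) \<le> ln (2 / real n)" using p p2 n0 by (subst ln_le_cancel_iff) auto
          also have "\<dots> = - ln (real n / 2)" using n0 by (simp add: ln_div)
          finally show ?thesis by (simp add: neglog_def)
        qed
        have nl: "neglog p > 0" using L ln by linarith
        have pd: "norm p < \<delta>" using p2 n\<delta> by linarith
        have q: "norm x \<le> \<bar>C\<bar> * real n / ln (real n / 2)" if "norm x \<le> C / (norm p * neglog p)" for x :: complex
        proof -
          have "C / (norm p * neglog p) \<le> \<bar>C\<bar> / (norm p * neglog p)" using nl by (intro divide_right_mono) auto
          also have "\<dots> \<le> \<bar>C\<bar> / (1 / real n * ln (real n / 2))"
            using p1 L ln nl n0 p by (intro divide_left_mono mult_mono mult_pos_pos) auto
          finally show ?thesis using that by simp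
        qed
        have ab: "norm (a p) \<le> \<bar>C\<bar> * real n / ln (real n / 2)" "norm (b p) \<le> \<bar>C\<bar> * real n / ln (real n / 2)"
          using q C(2,3)[OF p pd] by auto
        have "norm (E n p) \<le> real n * (norm (wirt (\<lambda>v. G v (real n *\<^sub>R p)) * b p) + norm (wirt_bar (\<lambda>v. G v (real n *\<^sub>R p)) * a p))"
          unfolding E_def using n0 by (simp add: norm_triangle_ineq4)
        also have "\<dots> \<le> real n * (M * (\<bar>C\<bar> * real n / ln (real n / 2)) + M * (\<bar>C\<bar> * real n / ln (real n / 2)))"
          unfolding norm_mult using WM ab M by (intro mult_left_mono add_mono mult_mono) auto
        also have "\<dots> = 2 * M * \<bar>C\<bar> * (real n)\<^sup>2 / ln (real n / 2)" by (simp add: power2_eq_square field_simps)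
        finally show ?thesis using p2 by simp
      qed
      have Ei: "integrable lborel (E n)"
      proof -
        have e: "(\<lambda>p. \<psi> n p * g p - (\<psi> n p * g p - E n p)) = E n" by auto
        show ?thesis
          using Bochner_Integration.integrable_diff[OF \<psi>gi[of n] conjunct1[OF z[OF n0]]] unfolding e .
      qed
      have "integral\<^sup>L lborel (\<lambda>p. \<psi> n p * g p) = integral\<^sup>L lborel (E n)"
        using z[OF n0] \<psi>gi[of n] Ei by (simp add: Bochner_Integration.integral_diff)
      then have "norm (integral\<^sup>L lborel (\<lambda>p. \<psi> n p * g p)) \<le> integral\<^sup>L lborel (\<lambda>p. norm (E n p))" by simp
      also have "\<dots> \<le> integral\<^sup>L lborel (\<lambda>p. 2 * M * \<bar>C\<bar> * (real n)\<^sup>2 / ln (real n / 2) * indicator (cball (0::complex) (2 / real n)) p)"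
      proof (rule integral_mono_AE)
        show "integrable lborel (\<lambda>p. 2 * M * \<bar>C\<bar> * (real n)\<^sup>2 / ln (real n / 2) * indicator (cball (0::complex) (2 / real n)) p)"
          by (intro integrable_mult_right integrable_real_indicator emeasure_lborel_cball_finite) auto
        show "AE p in lborel. norm (E n p) \<le> 2 * M * \<bar>C\<bar> * (real n)\<^sup>2 / ln (real n / 2) * indicator (cball 0 (2 / real n)) p"
          by (rule AE_I'[of "{0}"]) (use Eb in auto)
      qed (use Ei in auto)
      also have "\<dots> = 2 * M * \<bar>C\<bar> * (real n)\<^sup>2 / ln (real n / 2) * measure lborel (cball (0::complex) (2 / real n))" by simp
      also have "\<dots> \<le> 2 * M * \<bar>C\<bar> * (real n)\<^sup>2 / ln (real n / 2) * (4 * (2 / real n)\<^sup>2)"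
      proof (intro mult_left_mono)
        show "measure lborel (cball (0::complex) (2 / real n)) \<le> 4 * (2 / real n)\<^sup>2"
          unfolding measure_def using emeasure_cball_complex[of "2 / real n"] by (intro enn2real_leI) auto
      qed (use M ln in auto)
      also have "\<dots> = 32 * M * \<bar>C\<bar> / ln (real n / 2)" using n0 by (simp add: field_simps power2_eq_square)
      finally show "norm (integral\<^sup>L lborel (\<lambda>p. \<psi> n p * g p)) \<le> 32 * M * \<bar>C\<bar> / ln (real n / 2)" .
    qed
    have "filterlim (\<lambda>n. ln (real n / 2)) at_top sequentially"
      by (intro filterlim_compose[OF ln_at_top] filterlim_compose[OF _ filterlim_real_sequentially])
         (use filterlim_tendsto_pos_mult_at_top[OF tendsto_const[of "1/2::real"] _ filterlim_ident] in simp)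
    then show "(\<lambda>n. 32 * M * \<bar>C\<bar> / ln (real n / 2)) \<longlonglongrightarrow> 0"
      by (intro real_tendsto_divide_at_top[OF tendsto_const])
  qed
  show ?thesis using LIMSEQ_unique[OF lim1 lim2] by (simp add: g_def[abs_def])
qed

section \<open>Integration on the surface\<close>

context complex_surface
begin

lemma coord_inv_measurable:
  assumes "\<phi> \<in> coords \<A>"
  shows "chart_inv \<phi> \<in> borel_measurable (restrict_space borel (snd \<phi> ` fst \<phi>))"
  by (rule borel_measurable_continuous_on_restrict[OF coord_inv_continuous[OF assms]])

lemma coord_image_borel:
  assumes "\<phi> \<in> coords \<A>" "B \<in> sets borel"
  shows "snd \<phi> ` (fst \<phi> \<inter> B) \<in> sets borel"
proof -
  let ?R = "snd \<phi> ` fst \<phi>"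
  have R: "?R \<in> sets borel" using coord_open_range[OF assms(1)] by simp
  have "chart_inv \<phi> -` B \<inter> space (restrict_space borel ?R) \<in> sets (restrict_space borel ?R)"
    by (rule measurable_sets[OF coord_inv_measurable[OF assms(1)] assms(2)])
  then have "chart_inv \<phi> -` B \<inter> ?R \<in> sets borel"
    using R by (simp add: sets_restrict_space_iff space_restrict_space)
  then show ?thesis unfolding coord_image_eq[OF assms(1)] by (simp add: Int_commute)
qed

lemma d1_sum:
  assumes "open W" "finite I" "\<And>i. i \<in> I \<Longrightarrow> smooth_form1 \<A> W (\<eta> i)" "\<phi> \<in> coords \<A>" "x \<in> fst \<phi>" "x \<in> W"
  shows "d1 (\<lambda>\<phi> x. \<Sum>i\<in>I. \<eta> i \<phi> x) \<phi> x = (\<Sum>i\<in>I. d1 (\<eta> i) \<phi> x)"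
  using assms(2,3)
proof (induction I)
  case empty
  have "d1 (\<lambda>\<phi> x. 0) \<phi> x = 0" by (simp add: d1_def)
  then show ?case by simp
next
  case (insert i I)
  have s: "smooth_form1 \<A> W (\<lambda>\<phi> x. \<Sum>i\<in>I. \<eta> i \<phi> x)"
    by (rule smooth_form1_sum[OF assms(1)]) (use insert.prems in auto)
  show ?case
    using insert d1_add[OF assms(1) insert.prems[of i] s assms(4-6)] by simp
qed

end

context cech_surface
begin

section \<open>The auxiliary measure and integrals in arbitrary charts\<close>

definition piece :: "nat \<Rightarrow> 'a set" where "piece i = V i - (\<Union>j<i. V j)"

lemma piece_subset: "piece i \<subseteq> V i" by (auto simp: piece_def)

lemma piece_idx: "i < n \<Longrightarrow> x \<in> piece i \<longleftrightarrow> idx x = i"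
proof
  assume i: "i < n" "x \<in> piece i"
  then have "idx x \<le> i" unfolding idx_def by (intro Least_le) (auto simp: piece_def)
  moreover have "\<not> idx x < i" using i(2) idx(2)[of x] by (auto simp: piece_def)
  ultimately show "idx x = i" by simp
next
  assume i: "i < n" "idx x = i"
  have "x \<notin> V j" if "j < i" for j
  proof
    assume "x \<in> V j"
    then have "idx x \<le> j" unfolding idx_def using that i(1) by (intro Least_le) auto
    then show False using that i(2) by simp
  qed
  then show "x \<in> piece i" using idx(2)[of x] i by (auto simp: piece_def)
qed

lemma piece_borel: "i < n \<Longrightarrow> piece i \<in> sets borel"
  unfolding piece_def using V_open by (intro sets.Diff borel_open open_UN) auto

lemma D_borel: "D \<in> sets borel" using closed_D by simp

text \<open>Made total so that it is measurable on the whole plane; the default carries no weight,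
  because the density in \<open>lam\<close> is supported in the chart image.\<close>

definition cpos :: "nat \<Rightarrow> complex \<Rightarrow> 'a" where
  "cpos i p = (if p \<in> snd (chart K i) ` V i then chart_inv (chart K i) p else undefined)"

text \<open>Lebesgue measure of the coordinates $z_i$ on the pieces that \<open>integral_form2\<close> uses. It is not a
  canonical measure, but it turns 2-forms into functions, so that the convergence theorems apply.\<close>

definition lam :: "'a measure" where
  "lam = distr (density (count_space {..<n} \<Otimes>\<^sub>M lborel) (\<lambda>ip. indicator (snd (chart K (fst ip)) ` piece (fst ip)) (snd ip)))
     borel (\<lambda>ip. cpos (fst ip) (snd ip))"

lemma sets_lam [simp, measurable_cong]: "sets lam = sets borel" by (simp add: lam_def)
lemma space_lam [simp]: "space lam = UNIV" by (simp add: lam_def)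

lemma chart_piece_borel: "i < n \<Longrightarrow> B \<in> sets borel \<Longrightarrow> snd (chart K i) ` (piece i \<inter> B) \<in> sets borel"
  using coord_image_borel[OF chart_coords, of i "piece i \<inter> B"] piece_borel[of i] piece_subset[of i]
  by (simp add: cover_dom_def Int_absorb1 Int_assoc[symmetric])

lemma cpos_measurable: "i < n \<Longrightarrow> cpos i \<in> borel_measurable lborel"
proof -
  assume i: "i < n"
  let ?R = "snd (chart K i) ` V i"
  have R: "?R \<in> sets borel" using coord_open_range[OF chart_coords[OF i]] by (simp add: cover_dom_def)
  have c: "chart_inv (chart K i) \<in> borel_measurable (restrict_space borel ?R)"
    using coord_inv_measurable[OF chart_coords[OF i]] by (simp add: cover_dom_def)
  have "(\<lambda>p. if p \<in> ?R then chart_inv (chart K i) p else undefined) \<in> borel_measurable borel"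
    using R c by (subst measurable_If_restrict_space_iff) (simp_all add: Collect_mem_eq)
  then show ?thesis by (simp add: cpos_def[abs_def])
qed

lemma nn_integral_lam:
  assumes f: "f \<in> borel_measurable borel"
  shows "(\<integral>\<^sup>+x. f x \<partial>lam) = (\<Sum>i<n. \<integral>\<^sup>+p. indicator (snd (chart K i) ` piece i) p * f (cpos i p) \<partial>lborel)"
proof -
  let ?P = "count_space {..<n} \<Otimes>\<^sub>M (lborel :: complex measure)"
  let ?w = "\<lambda>ip. indicator (snd (chart K (fst ip)) ` piece (fst ip)) (snd ip) :: ennreal"
  let ?c = "\<lambda>ip. cpos (fst ip) (snd ip)"
  have pb: "snd (chart K i) ` piece i \<in> sets borel" if "i < n" for i
    using chart_piece_borel[OF that, of UNIV] by simp
  have w: "?w \<in> borel_measurable ?P"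
    by (rule measurable_pair_measure_countable1) (use pb in auto)
  have c: "?c \<in> borel_measurable ?P"
    by (rule measurable_pair_measure_countable1) (use cpos_measurable in auto)
  have fc: "(\<lambda>ip. f (?c ip)) \<in> borel_measurable ?P" using measurable_compose[OF c f] .
  have wf: "(\<lambda>ip. ?w ip * f (?c ip)) \<in> borel_measurable ?P" using w fc by measurable
  have "(\<integral>\<^sup>+x. f x \<partial>lam) = (\<integral>\<^sup>+ip. f (?c ip) \<partial>density ?P ?w)"
    unfolding lam_def using c f by (subst nn_integral_distr) auto
  also have "\<dots> = (\<integral>\<^sup>+ip. ?w ip * f (?c ip) \<partial>?P)"
    by (rule nn_integral_density[OF w fc])
  also have "\<dots> = (\<integral>\<^sup>+i. \<integral>\<^sup>+p. ?w (i, p) * f (?c (i, p)) \<partial>lborel \<partial>count_space {..<n})"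
    by (rule lborel.nn_integral_fst[OF wf, symmetric])
  finally show ?thesis by (simp add: nn_integral_count_space_finite)
qed

text \<open>The density with which \<open>lam\<close> becomes Lebesgue measure of the coordinate
  \<phi> (\<open>density_lam\<close>): on the i-th piece it is the squared modulus of
  d\<phi>/dz_i.\<close>

definition jsq :: "'a coord \<Rightarrow> 'a \<Rightarrow> real" where
  "jsq \<phi> x = indicator (fst \<phi>) x * (cmod (jac \<phi> (chart K (idx x)) x))\<^sup>2"

lemma jsq_nonneg: "jsq \<phi> x \<ge> 0" by (simp add: jsq_def)

text \<open>For functions that may jump from one piece to the next: such a function is a finite sum
  of continuous functions cut off by indicators, with at most one nonzero term at each
  point.\<close>

lemma piecewise_measurable:
  fixes F :: "'a \<Rightarrow> 'b::{real_normed_vector, second_countable_topology}"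
  assumes "\<And>i. i < n \<Longrightarrow> S i \<in> sets borel" "\<And>i. i < n \<Longrightarrow> S i \<subseteq> piece i" "\<And>i. i < n \<Longrightarrow> continuous_on (S i) (f i)"
    and "\<And>i x. i < n \<Longrightarrow> x \<in> S i \<Longrightarrow> F x = f i x" "\<And>x. x \<notin> (\<Union>i<n. S i) \<Longrightarrow> F x = 0"
  shows "F \<in> borel_measurable borel"
proof -
  have S: "i = idx x" if "i < n" "x \<in> S i" for i x
    using assms(2)[OF that(1)] that piece_idx by auto
  have "F x = (\<Sum>i<n. indicator (S i) x *\<^sub>R f i x)" for x
  proof (cases "x \<in> S (idx x)")
    case True
    have "(\<Sum>i<n. indicator (S i) x *\<^sub>R f i x) = (\<Sum>i\<in>{idx x}. indicator (S i) x *\<^sub>R f i x)"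
      using S idx(1)[of x] by (intro sum.mono_neutral_right) (auto simp: indicator_def)
    then show ?thesis using True assms(4)[OF idx(1) True] by simp
  next
    case False
    then have "x \<notin> S i" if "i < n" for i using assms(2)[OF that] piece_idx[OF that, of x] by auto
    then show ?thesis using assms(5)[of x] by simp
  qed
  moreover have "(\<lambda>x. \<Sum>i<n. indicator (S i) x *\<^sub>R f i x) \<in> borel_measurable borel"
    using assms(1,3) by (intro borel_measurable_sum borel_measurable_continuous_on_indicator) auto
  ultimately show ?thesis by presburger
qed

lemma jsq_measurable: "\<phi> \<in> coords \<A> \<Longrightarrow> jsq \<phi> \<in> borel_measurable borel"
proof (rule piecewise_measurable[where S = "\<lambda>i. piece i \<inter> fst \<phi>" and f = "\<lambda>i x. (cmod (jac \<phi> (chart K i) x))\<^sup>2"])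
  assume \<phi>: "\<phi> \<in> coords \<A>"
  show "piece i \<inter> fst \<phi> \<in> sets borel" if "i < n" for i
    using piece_borel[OF that] coord_open[OF \<phi>] by auto
  show "continuous_on (piece i \<inter> fst \<phi>) (\<lambda>x. (cmod (jac \<phi> (chart K i) x))\<^sup>2)" if i: "i < n" for i
  proof -
    have o: "open (fst \<phi> \<inter> fst (chart K i))" using coord_open[OF \<phi>] coord_open[OF chart_coords[OF i]] by auto
    have "continuous_on (fst \<phi> \<inter> fst (chart K i)) (jac \<phi> (chart K i))"
      by (rule smooth_fun_continuous[OF holo_fun_smooth[OF o holo_fun_jac[OF \<phi> chart_coords[OF i]]] o])
    then have "continuous_on (piece i \<inter> fst \<phi>) (jac \<phi> (chart K i))"
      by (rule continuous_on_subset) (use piece_subset[of i] in \<open>auto simp: cover_dom_def\<close>)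
    then show ?thesis by (intro continuous_intros)
  qed
  show "jsq \<phi> x = 0" if "x \<notin> (\<Union>i<n. piece i \<inter> fst \<phi>)" for x
    using that idx[of x] piece_idx[of "idx x" x] by (auto simp: jsq_def indicator_def)
qed (auto simp: jsq_def piece_idx)

text \<open>On each piece this is the holomorphic change of variables from z_i to \<phi>. As \<phi>
  is injective, the images of the pieces are disjoint and their areas add up. Later integrals can
  thus be computed in any coordinate.\<close>

lemma density_lam:
  assumes \<phi>: "\<phi> \<in> coords \<A>"
  shows "density lam (\<lambda>x. ennreal (jsq \<phi> x)) = distr (restrict_space lborel (snd \<phi> ` fst \<phi>)) borel (chart_inv \<phi>)"
proof (rule measure_eqI)
  let ?R = "snd \<phi> ` fst \<phi>"
  note J = jsq_measurable[OF \<phi>]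
  have R: "?R \<in> sets borel" using coord_open_range[OF \<phi>] by simp
  have ci: "chart_inv \<phi> \<in> borel_measurable (restrict_space lborel ?R)"
    using coord_inv_measurable[OF \<phi>] by (simp add: measurable_cong_sets[OF sets_restrict_space_cong[OF sets_lborel] refl])
  show "sets (density lam (\<lambda>x. ennreal (jsq \<phi> x))) = sets (distr (restrict_space lborel ?R) borel (chart_inv \<phi>))" by simp
  fix B assume "B \<in> sets (density lam (\<lambda>x. ennreal (jsq \<phi> x)))"
  then have B: "B \<in> sets borel" by simp
  define A where "A i = snd (chart K i) ` (piece i \<inter> (fst \<phi> \<inter> B))" for i
  have A: "A i \<in> sets borel" if "i < n" for i
    unfolding A_def using B coord_open[OF \<phi>] by (intro chart_piece_borel that) auto
  let ?B = "\<lambda>i. snd \<phi> ` (fst \<phi> \<inter> (piece i \<inter> B))"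
  have Bi: "?B i \<in> sets borel" if "i < n" for i
    using B piece_borel[OF that] by (intro coord_image_borel \<phi>) auto
  have "emeasure (density lam (\<lambda>x. ennreal (jsq \<phi> x))) B = (\<integral>\<^sup>+x. ennreal (jsq \<phi> x) * indicator B x \<partial>lam)"
    using B J by (intro emeasure_density) auto
  also have "\<dots> = (\<Sum>i<n. \<integral>\<^sup>+p. indicator (snd (chart K i) ` piece i) p * (ennreal (jsq \<phi> (cpos i p)) * indicator B (cpos i p)) \<partial>lborel)"
    by (intro nn_integral_lam borel_measurable_times_ennreal measurable_compose[OF J measurable_ennreal] borel_measurable_indicator B)
  also have "\<dots> = (\<Sum>i<n. emeasure lborel (?B i))"
  proof (rule sum.cong[OF refl])
    fix i assume "i \<in> {..<n}"
    then have i: "i < n" by simp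
    let ?\<psi> = "chart K i" and ?h = "snd \<phi> \<circ> chart_inv (chart K i)"
    note \<psi> = chart_coords[OF i]
    have V: "fst ?\<psi> = V i" by (simp add: cover_dom_def)
    have pt: "cpos i p = x \<and> idx x = i \<and> x \<in> V i" if "p = snd ?\<psi> x" "x \<in> piece i" for p x
      using that piece_subset[of i] piece_idx[OF i, of x] coord_inv[OF \<psi>, of x] by (auto simp: cpos_def V)
    have hA: "?h ` A i = ?B i"
      using piece_subset[of i] coord_inv[OF \<psi>] unfolding A_def image_image o_def V[symmetric]
      by (force simp: image_iff)
    have "(\<integral>\<^sup>+p. indicator (snd ?\<psi> ` piece i) p * (ennreal (jsq \<phi> (cpos i p)) * indicator B (cpos i p)) \<partial>lborel)
       = (\<integral>\<^sup>+p. ennreal ((cmod (deriv ?h p))\<^sup>2 * indicator (A i) p) \<partial>lborel)"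
    proof (rule nn_integral_cong)
      fix p :: complex
      show "indicator (snd ?\<psi> ` piece i) p * (ennreal (jsq \<phi> (cpos i p)) * indicator B (cpos i p)) = ennreal ((cmod (deriv ?h p))\<^sup>2 * indicator (A i) p)"
      proof (cases "p \<in> snd ?\<psi> ` piece i")
        case True
        then obtain x where x: "p = snd ?\<psi> x" "x \<in> piece i" by auto
        note P = pt[OF x]
        have inj: "p \<in> A i \<longleftrightarrow> x \<in> fst \<phi> \<inter> B"
        proof
          assume "p \<in> A i"
          then obtain y where y: "p = snd ?\<psi> y" "y \<in> piece i" "y \<in> fst \<phi> \<inter> B" by (auto simp: A_def)
          then show "x \<in> fst \<phi> \<inter> B" using pt[OF y(1,2)] P by simp
        qed (use x in \<open>auto simp: A_def\<close>)
        have "jac \<phi> ?\<psi> x = deriv ?h p" by (simp add: jac_def in_coord_def x(1))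
        then show ?thesis using True P inj by (auto simp: jsq_def indicator_def)
      next
        case False
        then have "p \<notin> A i" by (auto simp: A_def)
        then show ?thesis using False by simp
      qed
    qed
    also have "\<dots> = emeasure lborel (?h ` A i)"
    proof (rule emeasure_holomorphic_image[symmetric])
      show "open (snd ?\<psi> ` (fst ?\<psi> \<inter> fst \<phi>))" by (rule coord_open_image[OF \<psi> coord_open[OF \<phi>]])
      show "?h holomorphic_on snd ?\<psi> ` (fst ?\<psi> \<inter> fst \<phi>)" by (rule transition_holomorphic[OF \<psi> \<phi>])
      show "A i \<in> sets borel" by (rule A[OF i])
      show "A i \<subseteq> snd ?\<psi> ` (fst ?\<psi> \<inter> fst \<phi>)" using piece_subset[of i] by (auto simp: A_def V)
      show "?h ` A i \<in> sets borel" unfolding hA by (rule Bi[OF i])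
      show "inj_on ?h (A i)"
      proof (rule inj_onI)
        fix p q assume pq: "p \<in> A i" "q \<in> A i" "?h p = ?h q"
        then obtain x y where xy: "p = snd ?\<psi> x" "x \<in> piece i" "x \<in> fst \<phi>" "q = snd ?\<psi> y" "y \<in> piece i" "y \<in> fst \<phi>"
          by (auto simp: A_def)
        have "x \<in> fst ?\<psi>" "y \<in> fst ?\<psi>" using xy piece_subset[of i] by (auto simp: V)
        then have "snd \<phi> x = snd \<phi> y" using pq(3) coord_inv[OF \<psi>] by (simp add: xy)
        then have "x = y" using inj_onD[OF coord_inj[OF \<phi>]] xy by blast
        then show "p = q" using xy by simp
      qed
    qed
    finally show "(\<integral>\<^sup>+p. indicator (snd ?\<psi> ` piece i) p * (ennreal (jsq \<phi> (cpos i p)) * indicator B (cpos i p)) \<partial>lborel) = emeasure lborel (?B i)"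
      unfolding hA .
  qed
  also have "\<dots> = emeasure lborel (\<Union>i<n. ?B i)"
  proof (rule sum_emeasure)
    show "?B ` {..<n} \<subseteq> sets lborel" using Bi by auto
    show "disjoint_family_on ?B {..<n}"
      unfolding disjoint_family_on_def
    proof (intro ballI impI)
      fix i j assume ij: "i \<in> {..<n}" "j \<in> {..<n}" "i \<noteq> j"
      show "?B i \<inter> ?B j = {}"
      proof (rule ccontr)
        assume "?B i \<inter> ?B j \<noteq> {}"
        then obtain x y where xy: "snd \<phi> x = snd \<phi> y" "x \<in> fst \<phi>" "y \<in> fst \<phi>" "x \<in> piece i" "y \<in> piece j" by auto
        then have "x = y" using inj_onD[OF coord_inj[OF \<phi>]] by blast
        then show False using xy ij piece_idx by auto
      qed
    qed
  qed simp
  also have "(\<Union>i<n. ?B i) = snd \<phi> ` (fst \<phi> \<inter> B)"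
  proof
    show "snd \<phi> ` (fst \<phi> \<inter> B) \<subseteq> (\<Union>i<n. ?B i)"
    proof
      fix q assume "q \<in> snd \<phi> ` (fst \<phi> \<inter> B)"
      then obtain x where x: "q = snd \<phi> x" "x \<in> fst \<phi>" "x \<in> B" by auto
      then have "q \<in> ?B (idx x)" using piece_idx[OF idx(1), of x x] by auto
      then show "q \<in> (\<Union>i<n. ?B i)" using idx(1)[of x] by auto
    qed
  qed auto
  also have "emeasure lborel (snd \<phi> ` (fst \<phi> \<inter> B)) = emeasure (distr (restrict_space lborel ?R) borel (chart_inv \<phi>)) B"
    unfolding coord_image_eq[OF \<phi>]
    using B R ci by (simp add: emeasure_distr emeasure_restrict_space space_restrict_space Int_commute)
  finally show "emeasure (density lam (\<lambda>x. ennreal (jsq \<phi> x))) B = emeasure (distr (restrict_space lborel ?R) borel (chart_inv \<phi>)) B" .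
qed

text \<open>The density of a 2-form against \<open>lam\<close>, up to the factor -2i in dz \<and>
  dzbar = -2i dx dy. Forms on U carry no meaningful value on D, where 0 is taken.\<close>

definition form_fun :: "'a form2 \<Rightarrow> 'a \<Rightarrow> complex" where
  "form_fun \<omega> x = (if x \<in> D then 0 else \<omega> (chart K (idx x)) x)"

lemma form_fun_chart:
  assumes "smooth_form2 \<A> (UNIV - D) \<omega>" "\<phi> \<in> coords \<A>" "x \<in> fst \<phi>" "x \<notin> D"
  shows "form_fun \<omega> x = jsq \<phi> x *\<^sub>R \<omega> \<phi> x"
  using smooth_form2_change[OF assms(1,2) chart_coords[OF idx(1)], of x x] assms idx[of x]
  by (simp add: form_fun_def jsq_def cover_dom_def scaleR_conv_of_real)

lemma form_continuous:
  assumes "smooth_form2 \<A> W \<omega>" "\<phi> \<in> coords \<A>" "open W"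
  shows "continuous_on (fst \<phi> \<inter> W) (\<omega> \<phi>)"
  using smooth_fun_continuous[OF smooth_form2_smooth[OF assms(1,2)]] coord_open[OF assms(2)] assms(3) by auto

lemma form_fun_measurable [measurable]:
  assumes "smooth_form2 \<A> (UNIV - D) \<omega>"
  shows "form_fun \<omega> \<in> borel_measurable borel"
proof (rule piecewise_measurable[where S = "\<lambda>i. piece i - D" and f = "\<lambda>i. \<omega> (chart K i)"])
  show "piece i - D \<in> sets borel" if "i < n" for i using piece_borel[OF that] D_borel by auto
  show "continuous_on (piece i - D) (\<omega> (chart K i))" if "i < n" for i
    by (rule continuous_on_subset[OF form_continuous[OF assms chart_coords[OF that] open_U]])
       (use piece_subset[of i] in \<open>auto simp: cover_dom_def\<close>)
  show "form_fun \<omega> x = 0" if "x \<notin> (\<Union>i<n. piece i - D)" for x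
    using that idx[of x] piece_idx[of "idx x" x] by (auto simp: form_fun_def)
qed (auto simp: form_fun_def piece_idx)

lemma form_fun_integral_chart:
  assumes \<omega>: "smooth_form2 \<A> (UNIV - D) \<omega>" and \<phi>: "\<phi> \<in> coords \<A>" and W: "W \<in> sets borel" "W \<subseteq> fst \<phi>"
  shows "integrable lam (\<lambda>x. indicator W x *\<^sub>R form_fun \<omega> x) \<longleftrightarrow>
      integrable lborel (\<lambda>p. indicator (snd \<phi> ` (W - D)) p *\<^sub>R in_coord \<phi> (\<omega> \<phi>) p)" (is ?I)
    and "integral\<^sup>L lam (\<lambda>x. indicator W x *\<^sub>R form_fun \<omega> x) =
      integral\<^sup>L lborel (\<lambda>p. indicator (snd \<phi> ` (W - D)) p *\<^sub>R in_coord \<phi> (\<omega> \<phi>) p)" (is ?E)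
    and "(\<lambda>p. indicator (snd \<phi> ` (W - D)) p *\<^sub>R in_coord \<phi> (\<omega> \<phi>) p) \<in> borel_measurable borel" (is ?M)
proof -
  let ?R = "snd \<phi> ` fst \<phi>"
  have R: "?R \<in> sets borel" using coord_open_range[OF \<phi>] by simp
  have WD: "W - D \<in> sets borel" using W(1) D_borel by auto
  define f where "f x = indicator (W - D) x *\<^sub>R \<omega> \<phi> x" for x
  have f: "f \<in> borel_measurable borel"
    unfolding f_def[abs_def]
    by (rule borel_measurable_continuous_on_indicator[OF WD continuous_on_subset[OF form_continuous[OF \<omega> \<phi> open_U]]])
       (use W(2) in auto)
  have 1: "(\<lambda>x. indicator W x *\<^sub>R form_fun \<omega> x) = (\<lambda>x. jsq \<phi> x *\<^sub>R f x)"
  proof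
    fix x show "indicator W x *\<^sub>R form_fun \<omega> x = jsq \<phi> x *\<^sub>R f x"
      using form_fun_chart[OF \<omega> \<phi>, of x] W(2) by (cases "x \<in> D") (auto simp: f_def indicator_def form_fun_def)
  qed
  have 2: "(\<lambda>p. indicator ?R p *\<^sub>R f (chart_inv \<phi> p)) = (\<lambda>p. indicator (snd \<phi> ` (W - D)) p *\<^sub>R in_coord \<phi> (\<omega> \<phi>) p)"
  proof
    fix p
    have "p \<in> snd \<phi> ` (W - D) \<longleftrightarrow> p \<in> ?R \<and> chart_inv \<phi> p \<in> W - D"
      using coord_image_eq[OF \<phi>, of "W - D"] W(2) by (auto simp: Int_absorb1 set_eq_iff)
    then show "indicator ?R p *\<^sub>R f (chart_inv \<phi> p) = indicator (snd \<phi> ` (W - D)) p *\<^sub>R in_coord \<phi> (\<omega> \<phi>) p"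
      by (auto simp: f_def in_coord_def indicator_def)
  qed
  have ci: "chart_inv \<phi> \<in> borel_measurable (restrict_space lborel ?R)"
    using coord_inv_measurable[OF \<phi>] by (simp add: measurable_cong_sets[OF sets_restrict_space_cong[OF sets_lborel] refl])
  have Rs: "?R \<inter> space lborel \<in> sets lborel" using R by simp
  have J: "jsq \<phi> \<in> borel_measurable lam" "f \<in> borel_measurable lam" using jsq_measurable[OF \<phi>] f by (simp_all cong: measurable_cong_sets)
  have "integrable lam (\<lambda>x. jsq \<phi> x *\<^sub>R f x) \<longleftrightarrow> integrable (density lam (\<lambda>x. ennreal (jsq \<phi> x))) f"
    by (rule integrable_density[symmetric]) (use J jsq_nonneg in auto)
  also have "\<dots> \<longleftrightarrow> integrable (restrict_space lborel ?R) (\<lambda>p. f (chart_inv \<phi> p))"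
    unfolding density_lam[OF \<phi>] by (rule integrable_distr_eq[OF ci f])
  also have "\<dots> \<longleftrightarrow> integrable lborel (\<lambda>p. indicator ?R p *\<^sub>R f (chart_inv \<phi> p))"
    by (rule integrable_restrict_space[OF Rs])
  finally show ?I unfolding 1 2 .
  have "integral\<^sup>L lam (\<lambda>x. jsq \<phi> x *\<^sub>R f x) = integral\<^sup>L (density lam (\<lambda>x. ennreal (jsq \<phi> x))) f"
    by (rule integral_density[symmetric]) (use J jsq_nonneg in auto)
  also have "\<dots> = integral\<^sup>L (restrict_space lborel ?R) (\<lambda>p. f (chart_inv \<phi> p))"
    unfolding density_lam[OF \<phi>] by (rule integral_distr[OF ci f])
  also have "\<dots> = integral\<^sup>L lborel (\<lambda>p. indicator ?R p *\<^sub>R f (chart_inv \<phi> p))"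
    by (rule integral_restrict_space[OF Rs])
  finally show ?E unfolding 1 2 .
  have "(\<lambda>p. f (chart_inv \<phi> p)) \<in> borel_measurable (restrict_space lborel ?R)" by (rule measurable_compose[OF ci f])
  then have "(\<lambda>p. indicator ?R p *\<^sub>R f (chart_inv \<phi> p)) \<in> borel_measurable lborel"
    by (rule iffD1[OF borel_measurable_restrict_space_iff[OF Rs]])
  then show ?M unfolding 2 by simp
qed

lemma integral_form2_lam:
  assumes \<omega>: "smooth_form2 \<A> (UNIV - D) \<omega>" and A: "A \<in> sets borel" "A \<inter> D = {}"
    and int: "integrable lam (\<lambda>x. indicator A x *\<^sub>R form_fun \<omega> x)"
  shows "integral_form2 K \<omega> A = - 2 * \<i> * integral\<^sup>L lam (\<lambda>x. indicator A x *\<^sub>R form_fun \<omega> x)"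
proof -
  have W: "A \<inter> piece i \<in> sets borel" "A \<inter> piece i \<subseteq> fst (chart K i)" "A \<inter> piece i - D = A \<inter> piece i" if "i < n" for i
    using A piece_borel[OF that] piece_subset[of i] by (auto simp: cover_dom_def)
  have ii: "integrable lam (\<lambda>x. indicator (A \<inter> piece i) x *\<^sub>R form_fun \<omega> x)" if i: "i < n" for i
  proof -
    have "integrable lam (\<lambda>x. indicator (piece i) x *\<^sub>R (indicator A x *\<^sub>R form_fun \<omega> x))"
      by (rule integrable_mult_indicator[OF _ int]) (use piece_borel[OF i] in simp)
    then show ?thesis by (simp add: indicator_inter_arith mult.commute)
  qed
  have e: "indicator A x *\<^sub>R form_fun \<omega> x = (\<Sum>i<n. indicator (A \<inter> piece i) x *\<^sub>R form_fun \<omega> x)" for x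
  proof -
    have "(\<Sum>i<n. indicator (A \<inter> piece i) x *\<^sub>R form_fun \<omega> x) = (\<Sum>i\<in>{idx x}. indicator (A \<inter> piece i) x *\<^sub>R form_fun \<omega> x)"
      using piece_idx idx(1)[of x] by (intro sum.mono_neutral_right) (auto simp: indicator_def)
    then show ?thesis using piece_idx[OF idx(1), of x x] by (simp add: indicator_def)
  qed
  have "integral\<^sup>L lam (\<lambda>x. indicator A x *\<^sub>R form_fun \<omega> x) = (\<Sum>i<n. integral\<^sup>L lam (\<lambda>x. indicator (A \<inter> piece i) x *\<^sub>R form_fun \<omega> x))"
    unfolding e by (rule Bochner_Integration.integral_sum) (use ii in auto)
  also have "\<dots> = (\<Sum>i<n. set_lebesgue_integral lborel (coordinate K i ` (A \<inter> piece i)) (in_coord (chart K i) (\<omega> (chart K i))))"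
  proof (rule sum.cong[OF refl])
    fix i assume "i \<in> {..<n}"
    then have i: "i < n" by simp
    show "integral\<^sup>L lam (\<lambda>x. indicator (A \<inter> piece i) x *\<^sub>R form_fun \<omega> x) = set_lebesgue_integral lborel (coordinate K i ` (A \<inter> piece i)) (in_coord (chart K i) (\<omega> (chart K i)))"
      unfolding form_fun_integral_chart(2)[OF \<omega> chart_coords[OF i] W(1,2)[OF i]] set_lebesgue_integral_def W(3)[OF i] coordinate_def ..
  qed
  finally show ?thesis
    unfolding integral_form2_def piece_def[symmetric] by (simp add: sum_distrib_left)
qed

section \<open>Absolute integrability near smooth points and near punctures\<close>

lemma integrable_form_local:
  assumes \<omega>: "smooth_form2 \<A> (UNIV - D) \<omega>"
    and loc: "\<And>x. \<exists>N. open N \<and> x \<in> N \<and> integrable lam (\<lambda>x. indicator N x *\<^sub>R form_fun \<omega> x)"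
  shows "integrable lam (form_fun \<omega>)"
proof -
  obtain N where N: "\<And>x. open (N x)" "\<And>x. x \<in> N x" "\<And>x. integrable lam (\<lambda>y. indicator (N x) y *\<^sub>R form_fun \<omega> y)"
    using loc by metis
  \<comment> \<open>Compactness of the surface: finitely many of the neighbourhoods suffice, and the
    sum of the local norms is an integrable majorant.\<close>
  obtain F where F: "finite F" "UNIV \<subseteq> (\<Union>x\<in>F. N x)"
    by (rule compactE_image[OF compact_UNIV, of UNIV N]) (use N(1,2) in auto)
  show ?thesis
  proof (rule Bochner_Integration.integrable_bound)
    show "integrable lam (\<lambda>y. \<Sum>x\<in>F. norm (indicator (N x) y *\<^sub>R form_fun \<omega> y))"
      by (intro Bochner_Integration.integrable_sum integrable_norm N(3))
    show "form_fun \<omega> \<in> borel_measurable lam" using form_fun_measurable[OF \<omega>] by (simp cong: measurable_cong_sets)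
    show "AE y in lam. norm (form_fun \<omega> y) \<le> norm (\<Sum>x\<in>F. norm (indicator (N x) y *\<^sub>R form_fun \<omega> y))"
    proof (rule AE_I2)
      fix y
      obtain x where x: "x \<in> F" "y \<in> N x" using F(2) by auto
      have "norm (indicator (N x) y *\<^sub>R form_fun \<omega> y) \<le> (\<Sum>x\<in>F. norm (indicator (N x) y *\<^sub>R form_fun \<omega> y))"
        using F(1) x(1) by (intro member_le_sum) auto
      then show "norm (form_fun \<omega> y) \<le> norm (\<Sum>x\<in>F. norm (indicator (N x) y *\<^sub>R form_fun \<omega> y))" using x(2) by simp
    qed
  qed
qed

text \<open>\<open>W\<close> may contain points of D, which serves forms that extend smoothly across
  a puncture; for other forms it is taken to be U.\<close>

lemma integrable_near_smooth:
  assumes \<omega>: "smooth_form2 \<A> (UNIV - D) \<omega>" and W: "open W" "x \<in> W" "smooth_form2 \<A> W \<omega>"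
  shows "\<exists>N. open N \<and> x \<in> N \<and> integrable lam (\<lambda>x. indicator N x *\<^sub>R form_fun \<omega> x)"
proof -
  obtain \<phi> where \<phi>: "\<phi> \<in> coords \<A>" "x \<in> fst \<phi>" by (rule coords_cover)
  have "open (snd \<phi> ` (fst \<phi> \<inter> W))" by (rule coord_open_image[OF \<phi>(1) W(1)])
  then obtain b where b: "b > 0" "cball (snd \<phi> x) b \<subseteq> snd \<phi> ` (fst \<phi> \<inter> W)"
    using \<phi> W(2) open_contains_cball by blast
  define N where "N = {y \<in> fst \<phi>. snd \<phi> y \<in> ball (snd \<phi> x) b}"
  have N: "open N" unfolding N_def by (rule coord_open_preimage[OF \<phi>(1)]) auto
  have Nb: "N \<in> sets borel" "N \<subseteq> fst \<phi>" using N by (auto simp: N_def)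
  have "continuous_on (snd \<phi> ` (fst \<phi> \<inter> W)) (in_coord \<phi> (\<omega> \<phi>))"
    unfolding in_coord_def
    by (rule continuous_on_compose[OF continuous_on_subset[OF coord_inv_continuous[OF \<phi>(1)]] continuous_on_subset[OF form_continuous[OF W(3) \<phi>(1) W(1)]]])
       (use \<phi>(1) in auto)
  then have "integrable lborel (\<lambda>p. indicator (cball (snd \<phi> x) b) p *\<^sub>R in_coord \<phi> (\<omega> \<phi>) p)"
    by (intro borel_integrable_compact continuous_on_subset[OF _ b(2)]) auto
  moreover have "snd \<phi> ` (N - D) \<in> sets lborel"
    using coord_image_borel[OF \<phi>(1), of "N - D"] Nb D_borel by (simp add: Int_absorb1 Diff_subset_conv le_supI2 subset_iff)
  ultimately have i: "integrable lborel (\<lambda>p. indicator (snd \<phi> ` (N - D)) p *\<^sub>R (indicator (cball (snd \<phi> x) b) p *\<^sub>R in_coord \<phi> (\<omega> \<phi>) p))"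
    by (rule integrable_mult_indicator[rotated])
  have e: "indicator (snd \<phi> ` (N - D)) p *\<^sub>R (indicator (cball (snd \<phi> x) b) p *\<^sub>R in_coord \<phi> (\<omega> \<phi>) p)
      = indicator (snd \<phi> ` (N - D)) p *\<^sub>R in_coord \<phi> (\<omega> \<phi>) p" for p
    by (auto simp: indicator_def N_def)
  have "integrable lam (\<lambda>x. indicator N x *\<^sub>R form_fun \<omega> x)"
    unfolding form_fun_integral_chart(1)[OF \<omega> \<phi>(1) Nb] using i unfolding e .
  then show ?thesis using N b(1) \<phi>(2) by (intro exI[of _ N]) (auto simp: N_def)
qed

lemma integrable_near_cusp:
  assumes \<omega>: "smooth_form2 \<A> (UNIV - D) \<omega>" and \<phi>: "\<phi> \<in> coords \<A>" "p \<in> fst \<phi>" "snd \<phi> p = 0" "fst \<phi> \<inter> D = {p}"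
    and r: "0 < r" "r \<le> exp (- 1)"
    and bd: "\<And>x. x \<in> fst \<phi> \<Longrightarrow> x \<noteq> p \<Longrightarrow> norm (snd \<phi> x) < r \<Longrightarrow> norm (\<omega> \<phi> x) \<le> C * cusp_majorant (snd \<phi> x)"
  shows "\<exists>N. open N \<and> p \<in> N \<and> integrable lam (\<lambda>x. indicator N x *\<^sub>R form_fun \<omega> x)"
proof -
  define N where "N = {y \<in> fst \<phi>. snd \<phi> y \<in> ball 0 r}"
  have N: "open N" unfolding N_def by (rule coord_open_preimage[OF \<phi>(1)]) auto
  have Nb: "N \<in> sets borel" "N \<subseteq> fst \<phi>" using N by (auto simp: N_def)
  have "integrable lborel (\<lambda>q. indicator (snd \<phi> ` (N - D)) q *\<^sub>R in_coord \<phi> (\<omega> \<phi>) q)"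
  proof (rule Bochner_Integration.integrable_bound)
    show "integrable lborel (\<lambda>q. C * (indicator cusp_disc q *\<^sub>R cusp_majorant q))"
      by (intro integrable_mult_right cusp_majorant_integrable)
    show "(\<lambda>q. indicator (snd \<phi> ` (N - D)) q *\<^sub>R in_coord \<phi> (\<omega> \<phi>) q) \<in> borel_measurable lborel"
      using form_fun_integral_chart(3)[OF \<omega> \<phi>(1) Nb] by simp
    show "AE q in lborel. norm (indicator (snd \<phi> ` (N - D)) q *\<^sub>R in_coord \<phi> (\<omega> \<phi>) q) \<le> norm (C * (indicator cusp_disc q *\<^sub>R cusp_majorant q))"
    proof (rule AE_I2)
      fix q
      show "norm (indicator (snd \<phi> ` (N - D)) q *\<^sub>R in_coord \<phi> (\<omega> \<phi>) q) \<le> norm (C * (indicator cusp_disc q *\<^sub>R cusp_majorant q))"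
      proof (cases "q \<in> snd \<phi> ` (N - D)")
        case True
        then obtain x where x: "q = snd \<phi> x" "x \<in> N" "x \<notin> D" by auto
        have xf: "x \<in> fst \<phi>" "norm (snd \<phi> x) < r" using x(2) by (auto simp: N_def)
        have xp: "x \<noteq> p" using x(3) \<phi>(4) by auto
        have "snd \<phi> x \<noteq> 0" using inj_onD[OF coord_inj[OF \<phi>(1)], of x p] xp xf \<phi>(2,3) by auto
        then have "q \<in> cusp_disc" using xf r by (simp add: cusp_disc_def x(1))
        moreover have "norm (in_coord \<phi> (\<omega> \<phi>) q) \<le> C * cusp_majorant q"
          using bd[OF xf(1) xp xf(2)] \<phi>(1) xf(1) by (simp add: x(1))
        ultimately show ?thesis using True by (simp add: abs_le_iff) 
      qed simp
    qed
  qed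
  then have "integrable lam (\<lambda>x. indicator N x *\<^sub>R form_fun \<omega> x)"
    unfolding form_fun_integral_chart(1)[OF \<omega> \<phi>(1) Nb] .
  then show ?thesis using N r(1) \<phi>(2,3) by (intro exI[of _ N]) (auto simp: N_def)
qed

section \<open>Stokes' theorem on the surface\<close>

lemma smooth_form1_coeff_C1:
  assumes "smooth_form1 \<A> W \<xi>" "\<phi> \<in> coords \<A>" "open W" "f = (\<lambda>x. fst (\<xi> \<phi> x)) \<or> f = (\<lambda>x. snd (\<xi> \<phi> x))"
  shows "\<And>q. q \<in> snd \<phi> ` (fst \<phi> \<inter> W) \<Longrightarrow> in_coord \<phi> f differentiable (at q)"
    and "continuous_on (snd \<phi> ` (fst \<phi> \<inter> W)) (\<lambda>q. frechet_derivative (in_coord \<phi> f) (at q) v)"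
proof -
  have "smooth_fun \<A> (fst \<phi> \<inter> W) f" using smooth_form1_fst_snd[OF assms(1-3)] assms(4) by auto
  then have "cont_diff_on (Suc 0) (snd \<phi> ` (fst \<phi> \<inter> (fst \<phi> \<inter> W))) (in_coord \<phi> f)"
    using assms(2) unfolding smooth_fun_def by blast
  then show "\<And>q. q \<in> snd \<phi> ` (fst \<phi> \<inter> W) \<Longrightarrow> in_coord \<phi> f differentiable (at q)"
    and "continuous_on (snd \<phi> ` (fst \<phi> \<inter> W)) (\<lambda>q. frechet_derivative (in_coord \<phi> f) (at q) v)"
    unfolding Int_left_absorb cont_diff_on.simps by blast+
qed

text \<open>The coefficients, extended by 0, are C^1 on the plane without the origin: it is covered
  by the image of the chart minus D and the complement of the compact support, because a puncture of
  the chart can only sit at the origin. Then \<open>cusp_stokes\<close> applies.\<close>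

lemma chart_stokes:
  assumes \<xi>: "smooth_form1 \<A> (UNIV - D) \<xi>" and \<phi>: "\<phi> \<in> coords \<A>" and C: "compact C" "C \<subseteq> fst \<phi>"
    and supp: "\<And>\<psi> x. \<psi> \<in> coords \<A> \<Longrightarrow> x \<in> fst \<psi> \<Longrightarrow> x \<notin> C \<Longrightarrow> x \<notin> D \<Longrightarrow> \<xi> \<psi> x = 0"
    and origin: "\<And>p. p \<in> fst \<phi> \<Longrightarrow> p \<in> D \<Longrightarrow> snd \<phi> p = 0"
    and bd: "\<delta> > 0" "\<And>x. x \<in> fst \<phi> \<Longrightarrow> x \<notin> D \<Longrightarrow> snd \<phi> x \<noteq> 0 \<Longrightarrow> norm (snd \<phi> x) < \<delta> \<Longrightarrow>
        norm (fst (\<xi> \<phi> x)) \<le> B / (norm (snd \<phi> x) * neglog (snd \<phi> x)) \<and>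
        norm (snd (\<xi> \<phi> x)) \<le> B / (norm (snd \<phi> x) * neglog (snd \<phi> x))"
    and int: "integrable lam (form_fun (d1 \<xi>))"
  shows "integral\<^sup>L lam (form_fun (d1 \<xi>)) = 0"
proof -
  let ?O1 = "snd \<phi> ` (fst \<phi> \<inter> (UNIV - D))" and ?O2 = "- (snd \<phi> ` C)"
  have O1: "open ?O1" by (rule coord_open_image[OF \<phi> open_U])
  have Cc: "compact (snd \<phi> ` C)"
    by (rule compact_continuous_image[OF continuous_on_subset[OF coord_continuous[OF \<phi>] C(2)] C(1)])
  then have O2: "open ?O2" using compact_imp_closed by auto
  have O12: "q \<in> ?O1 \<or> q \<in> ?O2" if "q \<noteq> 0" for q
    using that C(2) origin by auto
  define fa where "fa x = fst (\<xi> \<phi> x)" for x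
  define fb where "fb x = snd (\<xi> \<phi> x)" for x
  define ext where "ext f q = (if q \<in> ?O1 then in_coord \<phi> f q else 0)" for f :: "'a \<Rightarrow> complex" and q
  have f0: "f x = 0" if "f = fa \<or> f = fb" "x \<in> fst \<phi>" "x \<notin> D" "x \<notin> C" for f x
    using that supp[OF \<phi> that(2,4,3)] by (auto simp: fa_def fb_def)
  have e0: "ext f q = 0" if "f = fa \<or> f = fb" "q \<in> ?O2" for f q
  proof (cases "q \<in> ?O1")
    case True
    then obtain x where x: "q = snd \<phi> x" "x \<in> fst \<phi>" "x \<notin> D" by blast
    then have "x \<notin> C" using that(2) by blast
    then show ?thesis using f0[OF that(1) x(2,3)] x \<phi> by (simp add: ext_def)
  qed (simp add: ext_def)
  have D1: "frechet_derivative (ext f) (at q) = frechet_derivative (in_coord \<phi> f) (at q)" if "q \<in> ?O1" for f q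
    by (rule frechet_derivative_cong_open[OF O1 that]) (simp add: ext_def)
  have D2: "frechet_derivative (ext f) (at q) = (\<lambda>v. 0)" if "f = fa \<or> f = fb" "q \<in> ?O2" for f q
  proof -
    have "frechet_derivative (ext f) (at q) = frechet_derivative (\<lambda>q. 0) (at q)"
      by (rule frechet_derivative_cong_open[OF O2 that(2)]) (rule e0[OF that(1)])
    then show ?thesis by simp
  qed
  have C1: "in_coord \<phi> f differentiable (at q)" if "f = fa \<or> f = fb" "q \<in> ?O1" for f q
    using smooth_form1_coeff_C1(1)[OF \<xi> \<phi> open_U _ that(2)] that(1) by (auto simp: fa_def[abs_def] fb_def[abs_def])
  have C2: "continuous_on ?O1 (\<lambda>q. frechet_derivative (in_coord \<phi> f) (at q) v)" if "f = fa \<or> f = fb" for f v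
    using smooth_form1_coeff_C1(2)[OF \<xi> \<phi> open_U, of f] that by (auto simp: fa_def[abs_def] fb_def[abs_def])
  have diff: "ext f differentiable (at q)" if f: "f = fa \<or> f = fb" and q: "q \<noteq> 0" for f q
  proof (cases "q \<in> ?O1")
    case True
    show ?thesis using differentiable_cong_open[OF O1 True, of "ext f" "in_coord \<phi> f"] C1[OF f True] by (simp add: ext_def)
  next
    case False
    then have "q \<in> ?O2" using O12[OF q] by auto
    then show ?thesis using differentiable_cong_open[OF O2, of q "ext f" "\<lambda>q. 0"] e0[OF f] by simp
  qed
  have cont: "continuous_on (- {0}) (\<lambda>q. frechet_derivative (ext f) (at q) v)" if f: "f = fa \<or> f = fb" for f v
  proof -
    have "continuous_on ?O1 (\<lambda>q. frechet_derivative (ext f) (at q) v)"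
      by (rule continuous_on_eq[OF C2[OF f]]) (simp add: D1)
    moreover have "continuous_on ?O2 (\<lambda>q. frechet_derivative (ext f) (at q) v)"
      by (rule continuous_on_eq[OF continuous_on_const]) (simp add: D2[OF f])
    ultimately have "continuous_on (?O1 \<union> ?O2) (\<lambda>q. frechet_derivative (ext f) (at q) v)"
      by (rule continuous_on_open_Un[OF O1 O2])
    then show ?thesis by (rule continuous_on_subset) (use O12 in auto)
  qed
  obtain R where R: "\<And>q. q \<in> snd \<phi> ` C \<Longrightarrow> norm q \<le> R" using Cc compact_imp_bounded bounded_iff by metis
  have supp': "ext f q = 0" if "f = fa \<or> f = fb" "norm q > R" for f q
    by (rule e0[OF that(1)]) (use R[of q] that(2) in fastforce)
  \<comment> \<open>Inside radius exp(-1) the denominator is positive, so the bound passes to |B|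
    and holds also where the extension is 0.\<close>
  define \<delta>' where "\<delta>' = min \<delta> (exp (- 1))"
  have \<delta>': "\<delta>' > 0" using bd(1) by (simp add: \<delta>'_def)
  have bd': "norm (ext f q) \<le> \<bar>B\<bar> / (norm q * neglog q)" if f: "f = fa \<or> f = fb" and q: "q \<noteq> 0" "norm q < \<delta>'" for f q
  proof (cases "q \<in> ?O1")
    case True
    have L: "neglog q > 1" using q by (intro neglog_ge1) (simp add: cusp_disc_def \<delta>'_def)
    obtain x where x: "q = snd \<phi> x" "x \<in> fst \<phi>" "x \<notin> D" using True by auto
    have "norm (f x) \<le> B / (norm q * neglog q)"
      using bd(2)[OF x(2,3)] q f by (auto simp: x(1)[symmetric] \<delta>'_def fa_def fb_def)
    also have "\<dots> \<le> \<bar>B\<bar> / (norm q * neglog q)" using L by (intro divide_right_mono) auto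
    finally show ?thesis using True x \<phi> by (simp add: ext_def)
  next
    case False
    have "neglog q > 1" using q by (intro neglog_ge1) (simp add: cusp_disc_def \<delta>'_def)
    then show ?thesis using False by (simp add: ext_def)
  qed
  define g where "g q = wirt (frechet_derivative (ext fb) (at q)) - wirt_bar (frechet_derivative (ext fa) (at q))" for q
  define G where "G q = indicator (snd \<phi> ` (fst \<phi> - D)) q *\<^sub>R in_coord \<phi> (d1 \<xi> \<phi>) q" for q
  have o1: "snd \<phi> ` (fst \<phi> - D) = ?O1" by auto
  have gG: "g q = G q" if "q \<noteq> 0" for q
  proof (cases "q \<in> ?O1")
    case True
    then obtain x where x: "q = snd \<phi> x" "x \<in> fst \<phi>" "x \<notin> D" by auto
    have "g q = pd_z \<phi> fb x - pd_zbar \<phi> fa x"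
      unfolding g_def D1[OF True] pd_z_wirt pd_zbar_wirt by (simp add: x)
    also have "\<dots> = d1 \<xi> \<phi> x" by (simp add: d1_def fa_def[abs_def] fb_def[abs_def])
    finally show ?thesis using True x \<phi> by (simp add: G_def o1)
  next
    case False
    then have "q \<in> ?O2" using O12[OF that] by auto
    then have "g q = 0" by (simp add: g_def D2 wirt_def wirt_bar_def)
    then show ?thesis using False by (simp add: G_def o1)
  qed
  have \<omega>: "smooth_form2 \<A> (UNIV - D) (d1 \<xi>)" by (rule smooth_form2_d1[OF open_U \<xi>])
  have fb: "fst \<phi> \<in> sets borel" using coord_open[OF \<phi>] by simp
  \<comment> \<open>Off the chart \<xi> vanishes on a whole neighbourhood, the complement of its
    support in U, so d\<xi> vanishes as well.\<close>
  have outside: "indicator (fst \<phi>) x *\<^sub>R form_fun (d1 \<xi>) x = form_fun (d1 \<xi>) x" for x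
  proof (cases "x \<in> fst \<phi> \<or> x \<in> D")
    case False
    let ?\<psi> = "chart K (idx x)" and ?W = "UNIV - D - C"
    have W: "open ?W" using open_U compact_imp_closed[OF C(1)] by auto
    have xW: "x \<in> ?W" "x \<in> fst ?\<psi>" using False C(2) idx(2)[of x] by (auto simp: cover_dom_def)
    have "d1 \<xi> ?\<psi> x = d1 (\<lambda>\<phi> x. 0) ?\<psi> x"
      by (rule d1_cong[OF W _ chart_coords[OF idx(1)] xW(2,1)]) (use supp in auto)
    also have "\<dots> = 0" by (simp add: d1_def)
    finally show ?thesis using False by (simp add: form_fun_def)
  qed (auto simp: form_fun_def)
  have Gi: "integrable lborel G"
    unfolding G_def[abs_def] using form_fun_integral_chart(1)[OF \<omega> \<phi> fb] int by (simp add: outside)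
  have "q \<in> {0}" if "G q \<noteq> g q" for q using gG[of q] that by (cases "q = 0") auto
  then have AE: "AE q in lborel. G q = g q" by (intro AE_I'[of "{0}"]) auto
  have gm: "g \<in> borel_measurable lborel"
  proof -
    have "(\<lambda>q. if q = 0 then g 0 else G q) \<in> borel_measurable borel"
      using borel_measurable_integrable[OF Gi] by measurable
    moreover have "(\<lambda>q. if q = 0 then g 0 else G q) = g" using gG by auto
    ultimately show ?thesis by simp
  qed
  have gi: "integrable lborel g" by (rule integrable_cong_AE_imp[OF Gi gm]) (use AE in auto)
  have "integral\<^sup>L lborel g = 0"
    unfolding g_def[abs_def]
    by (rule cusp_stokes[OF diff diff cont cont supp' supp' \<delta>' bd' bd']) (use gi in \<open>auto simp: g_def[abs_def]\<close>)
  moreover have "integral\<^sup>L lborel G = integral\<^sup>L lborel g"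
    by (rule integral_cong_AE[OF borel_measurable_integrable[OF Gi] gm AE])
  moreover have "integral\<^sup>L lam (form_fun (d1 \<xi>)) = integral\<^sup>L lborel G"
    using form_fun_integral_chart(2)[OF \<omega> \<phi> fb] by (simp add: outside G_def[abs_def])
  ultimately show ?thesis by simp
qed

text \<open>At this rate a circle of radius \<epsilon> contributes O(1 / |log \<epsilon>|). The
  coordinate at each puncture is existential, so that the one in which the metric is good can be
  used.\<close>

definition cusp_growth :: "'a form1 \<Rightarrow> bool" where
  "cusp_growth \<xi> \<longleftrightarrow> (\<forall>p\<in>D. \<exists>\<phi>\<in>coords \<A>. p \<in> fst \<phi> \<and> snd \<phi> p = 0 \<and> fst \<phi> \<inter> D = {p} \<and>
     (\<exists>\<delta>>0. \<exists>B. \<forall>x\<in>fst \<phi>. x \<noteq> p \<longrightarrow> norm (snd \<phi> x) < \<delta> \<longrightarrow>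
        norm (fst (\<xi> \<phi> x)) \<le> B / (norm (snd \<phi> x) * neglog (snd \<phi> x)) \<and>
        norm (snd (\<xi> \<phi> x)) \<le> B / (norm (snd \<phi> x) * neglog (snd \<phi> x))))"

lemma coord_zero: "\<phi> \<in> coords \<A> \<Longrightarrow> p \<in> fst \<phi> \<Longrightarrow> snd \<phi> p = 0 \<Longrightarrow> x \<in> fst \<phi> \<Longrightarrow> x \<noteq> p \<Longrightarrow> snd \<phi> x \<noteq> 0"
  using inj_onD[OF coord_inj, of \<phi> x p] by auto

lemma bounded_near:
  fixes f :: "'a \<Rightarrow> 'b::real_normed_vector"
  assumes "continuous_on W f" "open W" "\<phi> \<in> coords \<A>" "p \<in> fst \<phi>" "p \<in> W" "snd \<phi> p = 0"
  obtains r M where "r > 0" "M \<ge> 0" "\<And>x. x \<in> fst \<phi> \<Longrightarrow> norm (snd \<phi> x) < r \<Longrightarrow> x \<in> W \<and> norm (f x) \<le> M"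
proof -
  have "open (snd \<phi> ` (fst \<phi> \<inter> W))" by (rule coord_open_image[OF assms(3,2)])
  moreover have "0 \<in> snd \<phi> ` (fst \<phi> \<inter> W)" using assms(4-6) by force
  ultimately obtain r where r: "r > 0" "cball 0 r \<subseteq> snd \<phi> ` (fst \<phi> \<inter> W)" using open_contains_cball by blast
  then have r': "cball 0 r \<subseteq> snd \<phi> ` fst \<phi>" by auto
  let ?C = "chart_inv \<phi> ` cball 0 r"
  note C = coord_cball_compact[OF assms(3) r']
  have CW: "?C \<subseteq> W" using r(2) assms(3) by (force simp: subset_iff)
  have "compact (f ` ?C)" by (rule compact_continuous_image[OF continuous_on_subset[OF assms(1) CW] C(1)])
  then obtain M where M: "\<And>y. y \<in> f ` ?C \<Longrightarrow> norm y \<le> M" using compact_imp_bounded bounded_iff by metis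
  show ?thesis
  proof (rule that[of r "\<bar>M\<bar>"])
    fix x assume "x \<in> fst \<phi>" "norm (snd \<phi> x) < r"
    then have "x \<in> ?C" unfolding C(3) by simp
    then show "x \<in> W \<and> norm (f x) \<le> \<bar>M\<bar>" using CW M[of "f x"] by fastforce
  qed (use r in auto)
qed

text \<open>Bounded coefficients qualify because |z| neglog z \<le> 1 in the cusp disc; so one
  Stokes theorem serves smooth forms as well as forms singular at D.\<close>

lemma smooth_cusp_growth:
  assumes \<xi>: "smooth_form1 \<A> UNIV \<xi>"
    and "\<And>p. p \<in> D \<Longrightarrow> \<exists>\<phi>\<in>coords \<A>. p \<in> fst \<phi> \<and> snd \<phi> p = 0 \<and> fst \<phi> \<inter> D = {p}"
  shows "cusp_growth \<xi>"
  unfolding cusp_growth_def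
proof
  fix p assume "p \<in> D"
  then obtain \<phi> where \<phi>: "\<phi> \<in> coords \<A>" "p \<in> fst \<phi>" "snd \<phi> p = 0" "fst \<phi> \<inter> D = {p}" using assms(2) by blast
  have c: "continuous_on (fst \<phi>) (\<lambda>x. \<xi> \<phi> x)"
    using smooth_fun_continuous[OF smooth_form1_smooth[OF \<xi> \<phi>(1)]] coord_open[OF \<phi>(1)] by simp
  obtain r M where r: "r > 0" "M \<ge> 0" "\<And>x. x \<in> fst \<phi> \<Longrightarrow> norm (snd \<phi> x) < r \<Longrightarrow> x \<in> fst \<phi> \<and> norm (\<xi> \<phi> x) \<le> M"
    by (rule bounded_near[OF c coord_open[OF \<phi>(1)] \<phi>(1,2,2,3)]) (rule that, assumption+)
  have "norm (fst (\<xi> \<phi> x)) \<le> M / (norm (snd \<phi> x) * neglog (snd \<phi> x)) \<and> norm (snd (\<xi> \<phi> x)) \<le> M / (norm (snd \<phi> x) * neglog (snd \<phi> x))"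
    if x: "x \<in> fst \<phi>" "x \<noteq> p" "norm (snd \<phi> x) < min r (exp (- 1))" for x
  proof -
    have nz: "snd \<phi> x \<noteq> 0" by (rule coord_zero[OF \<phi>(1-3) x(1,2)])
    then have cd: "snd \<phi> x \<in> cusp_disc" using x(3) by (simp add: cusp_disc_def)
    have pos: "norm (snd \<phi> x) * neglog (snd \<phi> x) > 0" using nz neglog_ge1[OF cd] by simp
    have "norm (\<xi> \<phi> x) \<le> M" using r(3) x by simp
    moreover have "M \<le> M / (norm (snd \<phi> x) * neglog (snd \<phi> x))"
      using norm_neglog_le1[OF cd] pos r(2) by (simp add: pos_le_divide_eq mult_left_le)
    ultimately show ?thesis
      using norm_fst_le[of "fst (\<xi> \<phi> x)" "snd (\<xi> \<phi> x)"] norm_snd_le[of "snd (\<xi> \<phi> x)" "fst (\<xi> \<phi> x)"] by simp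
  qed
  note b = this
  show "\<exists>\<phi>\<in>coords \<A>. p \<in> fst \<phi> \<and> snd \<phi> p = 0 \<and> fst \<phi> \<inter> D = {p} \<and>
     (\<exists>\<delta>>0. \<exists>B. \<forall>x\<in>fst \<phi>. x \<noteq> p \<longrightarrow> norm (snd \<phi> x) < \<delta> \<longrightarrow>
        norm (fst (\<xi> \<phi> x)) \<le> B / (norm (snd \<phi> x) * neglog (snd \<phi> x)) \<and>
        norm (snd (\<xi> \<phi> x)) \<le> B / (norm (snd \<phi> x) * neglog (snd \<phi> x)))"
    proof (rule bexI[OF _ \<phi>(1)], intro conjI \<phi>(2-4), rule exI[of _ "min r (exp (- 1))"], rule conjI, goal_cases)
    case 1
    show ?case using r(1) by simp
  next
    case 2
    show ?case by (rule exI[of _ M], intro ballI impI, rule b)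
  qed
qed

lemma smooth_fun_bounded:
  fixes f :: "'a \<Rightarrow> 'b::real_normed_vector"
  assumes "smooth_fun \<A> UNIV f"
  obtains M where "M > 0" "\<And>x. norm (f x) \<le> M"
proof -
  have "compact (f ` UNIV)"
    by (rule compact_continuous_image[OF smooth_fun_continuous[OF assms open_UNIV] compact_UNIV])
  then obtain M where "M > 0" "\<And>y. y \<in> range f \<Longrightarrow> norm y \<le> M" using compact_imp_bounded bounded_pos by metis
  then show ?thesis using that by blast
qed

lemma integrable_mult_smooth:
  fixes f :: "'a \<Rightarrow> real" and g :: "'a \<Rightarrow> complex"
  assumes f: "smooth_fun \<A> UNIV f" and g: "integrable lam g"
  shows "integrable lam (\<lambda>x. f x *\<^sub>R g x)"
proof -
  obtain M where M: "M > 0" "\<And>x. norm (f x) \<le> M" by (rule smooth_fun_bounded[OF f]) (rule that, assumption+)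
  have fm: "f \<in> borel_measurable borel"
    by (rule borel_measurable_continuous_onI[OF smooth_fun_continuous[OF f open_UNIV]])
  show ?thesis
  proof (rule Bochner_Integration.integrable_bound)
    show "integrable lam (\<lambda>x. M *\<^sub>R g x)" by (rule integrable_scaleR_right) (rule g)
    have "f \<in> borel_measurable lam" using fm by (simp cong: measurable_cong_sets)
    then show "(\<lambda>x. f x *\<^sub>R g x) \<in> borel_measurable lam"
      using borel_measurable_integrable[OF g] by (intro borel_measurable_scaleR)
    show "AE x in lam. norm (f x *\<^sub>R g x) \<le> norm (M *\<^sub>R g x)"
    proof (rule AE_I2)
      fix x
      have "\<bar>f x\<bar> * norm (g x) \<le> M * norm (g x)" using M(2)[of x] by (intro mult_right_mono) auto
      then show "norm (f x *\<^sub>R g x) \<le> norm (M *\<^sub>R g x)" using M(1) by simp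
    qed
  qed
qed

text \<open>Localise by a partition of unity subordinate to one centred chart per puncture and the
  sets V_i - D. Cutting off creates the terms d\<kappa>_j \<and> \<xi>, and the growth condition is
  used a second time for their integrability: 1 / (|z| neglog z) lies below the majorant.\<close>

lemma stokes_surface:
  assumes \<xi>: "smooth_form1 \<A> (UNIV - D) \<xi>" and growth: "cusp_growth \<xi>"
    and int: "integrable lam (form_fun (d1 \<xi>))"
  shows "integral\<^sup>L lam (form_fun (d1 \<xi>)) = 0"
proof -
  define good where "good p \<phi> \<longleftrightarrow> \<phi> \<in> coords \<A> \<and> p \<in> fst \<phi> \<and> snd \<phi> p = 0 \<and> fst \<phi> \<inter> D = {p} \<and>
     (\<exists>\<delta>>0. \<exists>B. \<forall>x\<in>fst \<phi>. x \<noteq> p \<longrightarrow> norm (snd \<phi> x) < \<delta> \<longrightarrow>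
        norm (fst (\<xi> \<phi> x)) \<le> B / (norm (snd \<phi> x) * neglog (snd \<phi> x)) \<and>
        norm (snd (\<xi> \<phi> x)) \<le> B / (norm (snd \<phi> x) * neglog (snd \<phi> x)))" for p \<phi>
  have "\<exists>\<phi>. good p \<phi>" if "p \<in> D" for p
    using growth[unfolded cusp_growth_def, rule_format, OF that] unfolding good_def Bex_def .
  then obtain \<Phi> where \<Phi>: "\<And>p. p \<in> D \<Longrightarrow> good p (\<Phi> p)" using bchoice[of D good] by blast
  obtain e where e: "bij_betw e {..<card D} D"
    using finite_D ex_bij_betw_nat_finite[of D] by (auto simp: atLeast0LessThan)
  define m where "m = card D"
  \<comment> \<open>Indices below m stand for the punctures, the following n for the members of the
    cover with D removed.\<close>
  define W where "W j = (if j < m then fst (\<Phi> (e j)) else V (j - m) - D)" for j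
  define ch where "ch j = (if j < m then \<Phi> (e j) else chart K (j - m))" for j
  have eD: "e j \<in> D" if "j < m" for j using e that by (auto simp: m_def bij_betw_def)
  have ch: "ch j \<in> coords \<A>" "W j \<subseteq> fst (ch j)" if "j < m + n" for j
    using \<Phi>[OF eD] chart_coords[of "j - m"] that by (auto simp: ch_def W_def good_def cover_dom_def)
  have Wo: "open (W j)" if "j < m + n" for j
      proof (cases "j < m")
    case True
    then show ?thesis using coord_open[OF ch(1)[OF that]] by (simp add: W_def ch_def)
  next
    case False
    then show ?thesis using VD_open[of "j - m"] that by (simp add: W_def)
  qed
  have Wc: "(\<Union>j<m+n. W j) = UNIV"
  proof -
    have "\<exists>j<m+n. x \<in> W j" for x
    proof (cases "x \<in> D")
      case True
      have "x \<in> e ` {..<m}" using e True by (simp add: m_def bij_betw_def)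
      then obtain j where "j < m" "e j = x" by blast
      then show ?thesis using \<Phi>[OF True] by (intro exI[of _ j]) (auto simp: W_def good_def)
    next
      case False
      then show ?thesis using idx[of x] by (intro exI[of _ "m + idx x"]) (auto simp: W_def)
    qed
    then show ?thesis by blast
  qed
  obtain \<kappa> :: "nat \<Rightarrow> 'a \<Rightarrow> real" and C where
    \<kappa>: "\<And>j. smooth_fun \<A> UNIV (\<kappa> j)" "\<And>x. (\<Sum>j<m+n. \<kappa> j x) = 1"
    and C: "\<And>j. j < m+n \<Longrightarrow> compact (C j)" "\<And>j. j < m+n \<Longrightarrow> C j \<subseteq> W j" "\<And>j x. j < m+n \<Longrightarrow> x \<notin> C j \<Longrightarrow> \<kappa> j x = 0"
    by (rule partition_of_unity[where V = W and n = "m+n"]) (rule Wo, assumption, rule Wc, rule that, assumption+)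
  have \<kappa>U: "smooth_fun \<A> (UNIV - D) (\<kappa> j)" for j by (rule smooth_fun_subset[OF \<kappa>(1)]) auto
  define \<xi>' where "\<xi>' j \<phi> x = \<kappa> j x *\<^sub>R \<xi> \<phi> x" for j \<phi> x
  have \<xi>': "smooth_form1 \<A> (UNIV - D) (\<xi>' j)" for j
    unfolding \<xi>'_def[abs_def] by (rule smooth_form1_scaleR[OF open_U \<kappa>U \<xi>])
  let ?k = "\<lambda>j x. complex_of_real (\<kappa> j x)"
  have d\<xi>': "d1 (\<xi>' j) \<phi> x = wedge (d0 (?k j) \<phi> x) (\<xi> \<phi> x) + of_real (\<kappa> j x) * d1 \<xi> \<phi> x"
    if "\<phi> \<in> coords \<A>" "x \<in> fst \<phi>" "x \<notin> D" for j \<phi> x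
    unfolding \<xi>'_def[abs_def] by (rule d1_scaleR[OF open_U \<kappa>U \<xi> that(1,2)]) (use that in auto)
  \<comment> \<open>This is d\<kappa>_j \<and> \<xi>, written as a combination of forms already
    known to be smooth, from which its transformation law follows.\<close>
  define wf where "wf j \<phi> x = d1 (\<xi>' j) \<phi> x + (- of_real (\<kappa> j x)) * d1 \<xi> \<phi> x" for j \<phi> x
  have wf: "wf j \<phi> x = wedge (d0 (?k j) \<phi> x) (\<xi> \<phi> x)" if "\<phi> \<in> coords \<A>" "x \<in> fst \<phi>" "x \<notin> D" for j \<phi> x
    using d\<xi>'[OF that] by (simp add: wf_def)
  have wfs: "smooth_form2 \<A> (UNIV - D) (wf j)" for j
    unfolding wf_def[abs_def]
    by (intro smooth_form2_add smooth_form2_mult smooth_fun_minus smooth_fun_of_real open_U smooth_form2_d1 \<xi>' \<xi> \<kappa>U)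
  have wfi: "integrable lam (form_fun (wf j))" for j
  proof (rule integrable_form_local[OF wfs])
    fix x
    show "\<exists>N. open N \<and> x \<in> N \<and> integrable lam (\<lambda>y. indicator N y *\<^sub>R form_fun (wf j) y)"
    proof (cases "x \<in> D")
      case False
      then show ?thesis by (intro integrable_near_smooth[OF wfs open_U _ wfs]) auto
    next
      case True
      let ?\<phi> = "\<Phi> x"
      have \<phi>: "?\<phi> \<in> coords \<A>" "x \<in> fst ?\<phi>" "snd ?\<phi> x = 0" "fst ?\<phi> \<inter> D = {x}" using \<Phi>[OF True] by (auto simp: good_def)
      obtain \<delta> B where B: "\<delta> > 0" "\<And>y. y \<in> fst ?\<phi> \<Longrightarrow> y \<noteq> x \<Longrightarrow> norm (snd ?\<phi> y) < \<delta> \<Longrightarrow>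
        norm (fst (\<xi> ?\<phi> y)) \<le> B / (norm (snd ?\<phi> y) * neglog (snd ?\<phi> y)) \<and>
        norm (snd (\<xi> ?\<phi> y)) \<le> B / (norm (snd ?\<phi> y) * neglog (snd ?\<phi> y))"
        using \<Phi>[OF True] unfolding good_def by blast
      have "smooth_form1 \<A> UNIV (d0 (?k j))" by (rule smooth_form1_d0[OF open_UNIV smooth_fun_of_real[OF open_UNIV \<kappa>(1)]])
      then have c: "continuous_on (fst ?\<phi>) (d0 (?k j) ?\<phi>)"
        using smooth_fun_continuous[OF smooth_form1_smooth[OF _ \<phi>(1)]] coord_open[OF \<phi>(1)] by fastforce
      obtain r M where r: "r > 0" "M \<ge> 0" "\<And>y. y \<in> fst ?\<phi> \<Longrightarrow> norm (snd ?\<phi> y) < r \<Longrightarrow> y \<in> fst ?\<phi> \<and> norm (d0 (?k j) ?\<phi> y) \<le> M"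
        by (rule bounded_near[OF c coord_open[OF \<phi>(1)] \<phi>(1,2,2,3)]) (rule that, assumption+)
      show ?thesis
      proof (rule integrable_near_cusp[OF wfs \<phi>, where r = "min (min r \<delta>) (exp (- 1))" and C = "2 * M * \<bar>B\<bar>"])
        fix y assume y: "y \<in> fst ?\<phi>" "y \<noteq> x" "norm (snd ?\<phi> y) < min (min r \<delta>) (exp (- 1))"
        let ?z = "snd ?\<phi> y" and ?d = "d0 (?k j) ?\<phi> y" and ?x = "\<xi> ?\<phi> y"
        have nz: "?z \<noteq> 0" by (rule coord_zero[OF \<phi>(1-3) y(1,2)])
        then have cd: "?z \<in> cusp_disc" using y(3) by (simp add: cusp_disc_def)
        have L: "neglog ?z > 1" by (rule neglog_ge1[OF cd])
        have z: "norm ?z > 0" using nz by simp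
        have yD: "y \<notin> D" using \<phi>(4) y by auto
        have M: "norm (fst ?d) \<le> M" "norm (snd ?d) \<le> M"
          using r(3)[OF y(1)] y(3) norm_fst_le[of "fst ?d" "snd ?d"] norm_snd_le[of "snd ?d" "fst ?d"] by auto
        have P0: "norm ?z * neglog ?z > 0" using z L by simp
        have P: "1 / (norm ?z * neglog ?z) \<le> cusp_majorant ?z"
        proof -
          have "(norm ?z * neglog ?z) * (norm ?z * neglog ?z) \<le> (norm ?z * neglog ?z) * 1"
            using norm_neglog_le1[OF cd] P0 by (intro mult_left_mono) auto
          then have "1 / (norm ?z * neglog ?z) \<le> 1 / ((norm ?z)\<^sup>2 * (neglog ?z)\<^sup>2)"
            using P0 mult_pos_pos[OF mult_pos_pos[OF P0 P0] P0]
            by (intro divide_left_mono) (simp_all add: power2_eq_square algebra_simps)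
          then show ?thesis using cusp_majorant_ge(4)[OF cd] by linarith
        qed
        have "B / (norm ?z * neglog ?z) \<le> \<bar>B\<bar> * cusp_majorant ?z"
        proof -
          have "B / (norm ?z * neglog ?z) \<le> \<bar>B\<bar> * (1 / (norm ?z * neglog ?z))"
            using P0 by (simp add: divide_right_mono)
          also have "\<dots> \<le> \<bar>B\<bar> * cusp_majorant ?z" using P by (intro mult_left_mono) auto
          finally show ?thesis .
        qed
        then have X: "norm (fst ?x) \<le> \<bar>B\<bar> * cusp_majorant ?z" "norm (snd ?x) \<le> \<bar>B\<bar> * cusp_majorant ?z"
          using B(2)[OF y(1,2)] y(3) by auto
        have "norm (wf j ?\<phi> y) \<le> norm (fst ?d) * norm (snd ?x) + norm (snd ?d) * norm (fst ?x)"
          unfolding wf[OF \<phi>(1) y(1) yD] wedge_def norm_mult[symmetric] by (rule norm_triangle_ineq4)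
        also have "\<dots> \<le> M * (\<bar>B\<bar> * cusp_majorant ?z) + M * (\<bar>B\<bar> * cusp_majorant ?z)"
          using M X r(2) by (intro add_mono mult_mono) auto
        finally show "norm (wf j ?\<phi> y) \<le> 2 * M * \<bar>B\<bar> * cusp_majorant ?z" by (simp add: algebra_simps)
      qed (use r B in auto)
    qed
  qed
  have ff: "form_fun (d1 (\<xi>' j)) x = form_fun (wf j) x + \<kappa> j x *\<^sub>R form_fun (d1 \<xi>) x" for j x
    by (simp add: form_fun_def wf_def scaleR_conv_of_real)
  have i: "integrable lam (form_fun (d1 (\<xi>' j)))" for j
    unfolding ff[abs_def] by (intro Bochner_Integration.integrable_add wfi integrable_mult_smooth \<kappa>(1) int)
  have z: "integral\<^sup>L lam (form_fun (d1 (\<xi>' j))) = 0" if j: "j < m + n" for j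
  proof -
    have supp: "\<xi>' j \<psi> x = 0" if "x \<notin> C j" for \<psi> x using C(3)[OF j that] by (simp add: \<xi>'_def)
    have Cj: "C j \<subseteq> fst (ch j)" using C(2)[OF j] ch(2)[OF j] by auto
    show ?thesis
    proof (cases "j < m")
      case True
      let ?p = "e j"
      have P: "good ?p (ch j)" using \<Phi>[OF eD[OF True]] True by (simp add: ch_def)
      then have \<phi>: "ch j \<in> coords \<A>" "?p \<in> fst (ch j)" "snd (ch j) ?p = 0" "fst (ch j) \<inter> D = {?p}" by (auto simp: good_def)
      obtain \<delta> B where B: "\<delta> > 0" "\<And>y. y \<in> fst (ch j) \<Longrightarrow> y \<noteq> ?p \<Longrightarrow> norm (snd (ch j) y) < \<delta> \<Longrightarrow>
        norm (fst (\<xi> (ch j) y)) \<le> B / (norm (snd (ch j) y) * neglog (snd (ch j) y)) \<and>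
        norm (snd (\<xi> (ch j) y)) \<le> B / (norm (snd (ch j) y) * neglog (snd (ch j) y))"
        using P unfolding good_def by blast
      obtain M where M: "M > 0" "\<And>x. norm (\<kappa> j x) \<le> M" by (rule smooth_fun_bounded[OF \<kappa>(1)]) (rule that, assumption+)
      show ?thesis
      proof (rule chart_stokes[OF \<xi>' \<phi>(1) C(1)[OF j] Cj _ _ B(1) _ i, where B = "M * B"])
        show "\<xi>' j \<psi> x = 0" if "x \<notin> C j" for \<psi> x by (rule supp[OF that])
        show "snd (ch j) p = 0" if "p \<in> fst (ch j)" "p \<in> D" for p
        proof -
          have "p = ?p" using that \<phi>(4) by blast
          then show ?thesis using \<phi>(3) by simp
        qed
        fix x assume x: "x \<in> fst (ch j)" "x \<notin> D" "snd (ch j) x \<noteq> 0" "norm (snd (ch j) x) < \<delta>"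
        have "x \<noteq> ?p" using x(2) \<phi>(4) by auto
        note b = B(2)[OF x(1) this x(4)]
        let ?Q = "norm (snd (ch j) x) * neglog (snd (ch j) x)"
        have mm: "norm (\<kappa> j x *\<^sub>R w) \<le> M * B / ?Q" if "norm w \<le> B / ?Q" for w :: complex
        proof -
          have "norm (\<kappa> j x *\<^sub>R w) \<le> M * (B / ?Q)"
            unfolding norm_scaleR using M that by (intro mult_mono) (auto simp: real_norm_def[symmetric] simp del: real_norm_def)
          then show ?thesis by simp
        qed
        show "norm (fst (\<xi>' j (ch j) x)) \<le> M * B / ?Q \<and> norm (snd (\<xi>' j (ch j) x)) \<le> M * B / ?Q"
          using mm b by (simp add: \<xi>'_def)
      qed
    next
      case False
      define i where "i = j - m"
      have i': "i < n" "ch j = chart K i" "C j \<subseteq> V i - D" using False j C(2)[OF j] by (auto simp: i_def ch_def W_def)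
      \<comment> \<open>Here the support avoids D, so the cut-off form is bounded, and a bounded
        form meets the growth condition at the origin of the coordinate.\<close>
      have cont: "continuous_on (C j) (\<xi>' j (ch j))"
      proof (rule continuous_on_subset)
        have o: "open (fst (ch j) \<inter> (UNIV - D))" using coord_open[OF ch(1)[OF j]] open_U by auto
        show "continuous_on (fst (ch j) \<inter> (UNIV - D)) (\<xi>' j (ch j))"
          by (rule smooth_fun_continuous[OF smooth_form1_smooth[OF \<xi>' ch(1)[OF j]] o])
        show "C j \<subseteq> fst (ch j) \<inter> (UNIV - D)" using i'(3) Cj by auto
      qed
      have "compact (\<xi>' j (ch j) ` C j)" by (rule compact_continuous_image[OF cont C(1)[OF j]])
      then obtain M where M: "M > 0" "\<And>y. y \<in> \<xi>' j (ch j) ` C j \<Longrightarrow> norm y \<le> M" using compact_imp_bounded bounded_pos by metis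
      have M': "norm (\<xi>' j (ch j) x) \<le> M" for x using M supp[of x "ch j"] by (cases "x \<in> C j") auto
      show ?thesis
      proof (rule chart_stokes[OF \<xi>' ch(1)[OF j] C(1)[OF j] Cj _ _ _ _ i, where \<delta> = "exp (- 1)" and B = M])
        show "\<xi>' j \<psi> x = 0" if "x \<notin> C j" for \<psi> x by (rule supp[OF that])
        show "snd (ch j) p = 0" if "p \<in> fst (ch j)" "p \<in> D" for p
          using coordinate_D[OF i'(1), of p] that by (simp add: i'(2) cover_dom_def coordinate_def)
        fix x assume x: "x \<in> fst (ch j)" "x \<notin> D" "snd (ch j) x \<noteq> 0" "norm (snd (ch j) x) < exp (- 1)"
        let ?z = "snd (ch j) x"
        have cd: "?z \<in> cusp_disc" using x by (simp add: cusp_disc_def)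
        have pos: "norm ?z * neglog ?z > 0" using x(3) neglog_ge1[OF cd] by simp
        have "M \<le> M / (norm ?z * neglog ?z)"
          using norm_neglog_le1[OF cd] pos M(1) by (simp add: pos_le_divide_eq mult_left_le)
        then show "norm (fst (\<xi>' j (ch j) x)) \<le> M / (norm ?z * neglog ?z) \<and> norm (snd (\<xi>' j (ch j) x)) \<le> M / (norm ?z * neglog ?z)"
          using M'[of x] norm_fst_le[of "fst (\<xi>' j (ch j) x)" "snd (\<xi>' j (ch j) x)"]
            norm_snd_le[of "snd (\<xi>' j (ch j) x)" "fst (\<xi>' j (ch j) x)"] by simp
      qed simp
    qed
  qed
  have "form_fun (d1 \<xi>) x = (\<Sum>j<m+n. form_fun (d1 (\<xi>' j)) x)" for x
  proof (cases "x \<in> D")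
    case False
    let ?\<psi> = "chart K (idx x)"
    have \<psi>: "?\<psi> \<in> coords \<A>" "x \<in> fst ?\<psi>" using chart_coords[OF idx(1)] idx(2)[of x] by (auto simp: cover_dom_def)
    have xU: "x \<in> UNIV - D" using False by auto
    have "d1 \<xi> ?\<psi> x = d1 (\<lambda>\<phi> x. \<Sum>j<m+n. \<xi>' j \<phi> x) ?\<psi> x"
    proof (rule d1_cong[OF open_U _ \<psi> xU])
      fix \<phi> y
      show "\<xi> \<phi> y = (\<Sum>j<m+n. \<xi>' j \<phi> y)" by (simp add: \<xi>'_def scaleR_left.sum[symmetric] \<kappa>(2))
    qed
    also have "\<dots> = (\<Sum>j<m+n. d1 (\<xi>' j) ?\<psi> x)" by (rule d1_sum[OF open_U _ \<xi>' \<psi> xU]) simp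
    finally show ?thesis using False by (simp add: form_fun_def)
  qed (simp add: form_fun_def)
  then have "integral\<^sup>L lam (form_fun (d1 \<xi>)) = integral\<^sup>L lam (\<lambda>x. \<Sum>j<m+n. form_fun (d1 (\<xi>' j)) x)" by presburger
  also have "\<dots> = (\<Sum>j<m+n. integral\<^sup>L lam (form_fun (d1 (\<xi>' j))))" by (rule Bochner_Integration.integral_sum) (rule i)
  also have "\<dots> = 0" using z by simp
  finally show ?thesis .
qed

subsection \<open>Growth at the punctures\<close>

text \<open>The quotient of two coordinates centred at p has a removable singularity at p, with the
  nonzero derivative of the transition map as its value. It compares the frame of the cover with
  that of the coordinate in which the metric is good.\<close>

lemma coord_quotient:
  assumes \<phi>: "\<phi> \<in> coords \<A>" "p \<in> fst \<phi>" "snd \<phi> p = 0" and \<psi>: "\<psi> \<in> coords \<A>" "p \<in> fst \<psi>" "snd \<psi> p = 0"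
  obtains G where "holo_fun \<A> (fst \<phi> \<inter> fst \<psi>) G" "\<And>x. x \<in> fst \<phi> \<inter> fst \<psi> \<Longrightarrow> G x \<noteq> 0"
    "\<And>x. x \<in> fst \<phi> \<inter> fst \<psi> \<Longrightarrow> snd \<psi> x = G x * snd \<phi> x"
proof -
  let ?W = "fst \<phi> \<inter> fst \<psi>"
  let ?S = "snd \<phi> ` ?W"
  let ?h = "snd \<psi> \<circ> chart_inv \<phi>"
  define g where "g z = (if z = 0 then deriv ?h 0 else (?h z - ?h 0) / (z - 0))" for z
  have W: "open ?W" using coord_open \<phi>(1) \<psi>(1) by blast
  have S: "open ?S" "0 \<in> ?S"
    using coord_open_image[OF \<phi>(1) coord_open[OF \<psi>(1)]] \<phi>(2,3) \<psi>(2) by force+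
  have g: "g holomorphic_on ?S"
    using pole_lemma_open[OF transition_holomorphic[OF \<phi>(1) \<psi>(1)] S(1), of 0] by (simp add: g_def[abs_def])
  have h0: "?h 0 = 0" using coord_inv[OF \<phi>(1,2)] \<phi>(3) \<psi>(3) by simp
  have dh: "deriv ?h 0 \<noteq> 0"
    using jac_nonzero[OF \<psi>(1) \<phi>(1) \<psi>(2) \<phi>(2)] \<phi>(3) by (simp add: jac_def in_coord_def)
  show ?thesis
  proof (rule that[of "\<lambda>x. g (snd \<phi> x)"])
    show "holo_fun \<A> ?W (\<lambda>x. g (snd \<phi> x))"
      unfolding holo_fun_def
    proof
      fix \<kappa> assume \<kappa>: "\<kappa> \<in> coords \<A>"
      have "g \<circ> (snd \<phi> \<circ> chart_inv \<kappa>) holomorphic_on (snd \<kappa> ` (fst \<kappa> \<inter> ?W))"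
      proof (rule holomorphic_on_compose_gen[OF _ g])
        show "(snd \<phi> \<circ> chart_inv \<kappa>) holomorphic_on (snd \<kappa> ` (fst \<kappa> \<inter> ?W))"
          by (rule holomorphic_on_subset[OF transition_holomorphic[OF \<kappa> \<phi>(1)]]) auto
        show "(snd \<phi> \<circ> chart_inv \<kappa>) ` snd \<kappa> ` (fst \<kappa> \<inter> ?W) \<subseteq> ?S" using \<kappa> by auto
      qed
      then show "in_coord \<kappa> (\<lambda>x. g (snd \<phi> x)) holomorphic_on (snd \<kappa> ` (fst \<kappa> \<inter> ?W))"
        by (simp add: in_coord_def o_def)
    qed
    fix x assume x: "x \<in> ?W"
    show "g (snd \<phi> x) \<noteq> 0"
    proof (cases "x = p")
      case True
      then show ?thesis using \<phi>(3) dh by (simp add: g_def)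
    next
      case False
      then have "snd \<phi> x \<noteq> 0" "snd \<psi> x \<noteq> 0" using coord_zero[OF \<phi>] coord_zero[OF \<psi>] x by auto
      then show ?thesis using h0 x \<phi>(1) by (simp add: g_def)
    qed
    show "snd \<psi> x = g (snd \<phi> x) * snd \<phi> x"
    proof (cases "x = p")
      case True
      then show ?thesis using \<phi>(3) \<psi>(3) by simp
    next
      case False
      then have "snd \<phi> x \<noteq> 0" using coord_zero[OF \<phi>] x by auto
      then show ?thesis using h0 x \<phi>(1) by (simp add: g_def)
    qed
  qed
qed

text \<open>Replaces the double logarithm log neglog by a square root, which the majorant can
  absorb.\<close>

lemma ln_le_sqrt: "1 \<le> (x::real) \<Longrightarrow> ln x \<le> 2 * sqrt x"
proof -
  assume x: "1 \<le> x"
  have "ln x = 2 * ln (sqrt x)" using x by (simp add: ln_sqrt)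
  then show ?thesis using ln_le_minus_one[of "sqrt x"] x by simp
qed

text \<open>Goodness bounds log ||z d/dz|| in some coordinate z centred at p. Near p the frame of
  the cover is k z d/dz with k holomorphic and nonvanishing, so r_i differs from log ||z d/dz||^2 by
  the smooth harmonic function log |k|^2, and the bounds carry over after shrinking the
  disc.\<close>

lemma good_growth:
  assumes \<rho>: "good_conformal_metric \<A> D \<rho>" and p: "p \<in> D" and i: "i < n" "p \<in> V i"
  obtains \<phi> r C where "\<phi> \<in> coords \<A>" "p \<in> fst \<phi>" "snd \<phi> p = 0" "fst \<phi> \<inter> D = {p}" "0 < r" "r \<le> exp (- 1)" "0 \<le> C"
    "\<And>x. x \<in> fst \<phi> \<Longrightarrow> norm (snd \<phi> x) < r \<Longrightarrow> x \<in> V i"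
    "\<And>x. x \<in> fst \<phi> \<Longrightarrow> x \<noteq> p \<Longrightarrow> norm (snd \<phi> x) < r \<Longrightarrow> \<bar>log_frame D K \<rho> i x\<bar> \<le> C * sqrt (neglog (snd \<phi> x))"
    "\<And>x. x \<in> fst \<phi> \<Longrightarrow> x \<noteq> p \<Longrightarrow> norm (snd \<phi> x) < r \<Longrightarrow>
      norm (pd_z \<phi> (\<lambda>y. complex_of_real (log_frame D K \<rho> i y)) x) \<le> C / (norm (snd \<phi> x) * neglog (snd \<phi> x))"
    "\<And>x. x \<in> fst \<phi> \<Longrightarrow> x \<noteq> p \<Longrightarrow> norm (snd \<phi> x) < r \<Longrightarrow>
      norm (c1_form \<rho> \<phi> x) \<le> C * (1 / ((norm (snd \<phi> x))\<^sup>2 * (neglog (snd \<phi> x))\<^sup>2))"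
    "\<And>x. x \<in> fst \<phi> \<Longrightarrow> x \<noteq> p \<Longrightarrow> norm (snd \<phi> x) < r \<Longrightarrow>
      \<bar>\<rho> \<phi> x\<bar> \<le> C * (1 / ((norm (snd \<phi> x))\<^sup>2 * (neglog (snd \<phi> x))\<^sup>2))"
proof -
  have \<rho>c: "conformal_metric \<A> (UNIV - D) \<rho>" using \<rho> by (simp add: good_conformal_metric_def)
  obtain \<phi> r \<alpha> C0 where \<phi>: "\<phi> \<in> coords \<A>" "p \<in> fst \<phi>" "snd \<phi> p = 0" "fst \<phi> \<inter> D = {p}"
    and r: "0 < r" "r < 1"
    and G: "(let N = {x \<in> fst \<phi>. cmod (snd \<phi> x) < r}; z = snd \<phi>;
             lognorm = (\<lambda>x. complex_of_real (ln (sqrt (norm_sq \<rho> \<phi> z x))))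
         in continuous_on N \<alpha> \<and> smooth_fun \<A> (N - {p}) \<alpha> \<and>
            (\<forall>x\<in>N - {p}.
               ln (\<rho> \<phi> x) = - ln ((cmod (z x))\<^sup>2 * (ln (cmod (z x)))\<^sup>2) + \<alpha> x) \<and>
            (\<forall>x\<in>N - {p}.
               (cmod (pd_z \<phi> (complex_of_real \<circ> \<alpha>) x))\<^sup>2
                 \<le> C0 / ((cmod (z x))\<^sup>2 * (ln (cmod (z x))) ^ 4)) \<and>
            poincare_growth1 \<phi> (N - {p}) (del lognorm) \<and>
            poincare_growth2 \<phi> (N - {p}) (d1 (del lognorm)) \<and>
            poincare_growth2 \<phi> (N - {p}) (dbar_del lognorm))"
    using bspec[OF conjunct2[OF \<rho>[unfolded good_conformal_metric_def]] p] by (elim bexE exE conjE) (rule that)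
  define N where "N = {x \<in> fst \<phi>. cmod (snd \<phi> x) < r}"
  define ln' where "ln' x = complex_of_real (ln (sqrt (norm_sq \<rho> \<phi> (snd \<phi>) x)))" for x
  have \<alpha>c: "continuous_on N \<alpha>"
    and \<alpha>: "\<And>x. x \<in> N \<Longrightarrow> x \<noteq> p \<Longrightarrow> ln (\<rho> \<phi> x) = - ln ((cmod (snd \<phi> x))\<^sup>2 * (ln (cmod (snd \<phi> x)))\<^sup>2) + \<alpha> x"
    and g1: "poincare_growth1 \<phi> (N - {p}) (del ln')" and g2: "poincare_growth2 \<phi> (N - {p}) (dbar_del ln')"
    using G unfolding N_def ln'_def[abs_def] Let_def by blast+
  obtain C1 where C1: "\<And>x. x \<in> N \<Longrightarrow> x \<noteq> p \<Longrightarrow> cmod (pd_z \<phi> ln' x) \<le> C1 / (cmod (snd \<phi> x) * \<bar>ln (cmod (snd \<phi> x))\<bar>)"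
    using g1 unfolding poincare_growth1_def del_def fst_conv by blast
  obtain C2 where C2: "\<And>x. x \<in> N \<Longrightarrow> x \<noteq> p \<Longrightarrow> cmod (dbar_del ln' \<phi> x) \<le> C2 / ((cmod (snd \<phi> x))\<^sup>2 * (ln (cmod (snd \<phi> x)))\<^sup>2)"
    using g2 unfolding poincare_growth2_def by blast
  have No: "open N"
  proof -
    have "open {x \<in> fst \<phi>. snd \<phi> x \<in> ball 0 r}" by (rule coord_open_preimage[OF \<phi>(1)]) auto
    then show ?thesis by (simp add: N_def)
  qed
  have pN: "p \<in> N" using \<phi> r by (simp add: N_def)
  let ?\<psi> = "chart K i" and ?lf = "log_frame D K \<rho> i"
  note \<psi> = chart_coords[OF i(1)]
  have p\<psi>: "p \<in> fst ?\<psi>" "snd ?\<psi> p = 0" using i(2) coordinate_D[OF i p] by (simp_all add: cover_dom_def coordinate_def)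
  obtain Q where Q: "holo_fun \<A> (fst \<phi> \<inter> fst ?\<psi>) Q" "\<And>x. x \<in> fst \<phi> \<inter> fst ?\<psi> \<Longrightarrow> Q x \<noteq> 0"
    "\<And>x. x \<in> fst \<phi> \<inter> fst ?\<psi> \<Longrightarrow> snd ?\<psi> x = Q x * snd \<phi> x"
    by (rule coord_quotient[OF \<phi>(1-3) \<psi> p\<psi>]) (rule that, assumption+)
  let ?W = "fst \<phi> \<inter> fst ?\<psi>"
  \<comment> \<open>With z_i = Q z the frame s_i = z_i d/dz_i equals Q z (dz/dz_i) d/dz, that is k z
    d/dz.\<close>
  define k where "k x = jac \<phi> ?\<psi> x * Q x" for x
  have W: "open ?W" using coord_open \<phi>(1) \<psi> by blast
  have kh: "holo_fun \<A> ?W k" unfolding k_def[abs_def] by (intro holo_fun_mult holo_fun_jac \<phi>(1) \<psi> Q(1))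
  have k0: "k x \<noteq> 0" if "x \<in> ?W" for x using Q(2)[OF that] jac_nonzero[OF \<phi>(1) \<psi>, of x] that by (simp add: k_def)
  define u where "u x = ln ((cmod (k x))\<^sup>2)" for x
  have us: "smooth_fun \<A> ?W u" unfolding u_def[abs_def] by (rule smooth_fun_ln_holo[OF W kh]) (rule k0)
  have u0: "dbar_del (\<lambda>x. complex_of_real (u x)) \<phi> x = 0" if "x \<in> ?W" for x
    unfolding u_def by (rule dbar_del_ln_holo[OF W kh _ \<phi>(1) _ that]) (use that k0 in auto)
  have us': "smooth_fun \<A> ?W (\<lambda>x. complex_of_real (u x))" by (rule smooth_fun_of_real[OF W us])
  have du: "continuous_on ?W (pd_z \<phi> (\<lambda>x. complex_of_real (u x)))"
    using smooth_fun_continuous[OF smooth_fun_pd_z[OF us' \<phi>(1) W]] W by (simp add: Int_commute Int_left_commute)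
  obtain r1 Ma where r1: "r1 > 0" "Ma \<ge> 0" "\<And>x. x \<in> fst \<phi> \<Longrightarrow> norm (snd \<phi> x) < r1 \<Longrightarrow> x \<in> N \<and> norm (\<alpha> x) \<le> Ma"
    by (rule bounded_near[OF \<alpha>c No \<phi>(1,2) pN \<phi>(3)]) (rule that, assumption+)
  have pW: "p \<in> ?W" using \<phi>(2) p\<psi>(1) by auto
  obtain r2 Mu where r2: "r2 > 0" "Mu \<ge> 0" "\<And>x. x \<in> fst \<phi> \<Longrightarrow> norm (snd \<phi> x) < r2 \<Longrightarrow> x \<in> ?W \<and> norm (u x) \<le> Mu"
    by (rule bounded_near[OF smooth_fun_continuous[OF us W] W \<phi>(1,2) pW \<phi>(3)]) (rule that, assumption+)
  obtain r3 Md where r3: "r3 > 0" "Md \<ge> 0"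
    "\<And>x. x \<in> fst \<phi> \<Longrightarrow> norm (snd \<phi> x) < r3 \<Longrightarrow> x \<in> ?W \<and> norm (pd_z \<phi> (\<lambda>x. complex_of_real (u x)) x) \<le> Md"
    by (rule bounded_near[OF du W \<phi>(1,2) pW \<phi>(3)]) (rule that, assumption+)
  define s where "s = min (min r1 r2) (min r3 (exp (- 1)))"
  have s: "0 < s" "s \<le> exp (- 1)" using r1 r2 r3 by (auto simp: s_def)
  \<comment> \<open>One constant for all four estimates: Ma + Mu + 4 for the logarithm, 2 |C1| + Md
    for its derivative, 2 |C2| for c_1 and exp Ma for the density.\<close>
  define C where "C = Ma + Mu + 4 + 2 * \<bar>C1\<bar> + Md + 2 * \<bar>C2\<bar> + exp Ma"
  have VD: "V i \<inter> D \<noteq> {}" using i(2) p by auto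
  have lf: "?lf y = ln (norm_sq \<rho> \<phi> (snd \<phi>) y) + u y" and pos: "norm_sq \<rho> \<phi> (snd \<phi>) y > 0" if y: "y \<in> ?W - D" for y
  proof -
    have nz: "snd \<phi> y \<noteq> 0" using coord_zero[OF \<phi>(1-3)] p y by blast
    have ry: "\<rho> \<phi> y > 0" using \<rho>c \<phi>(1) y unfolding conformal_metric_def by blast
    have ch: "\<rho> ?\<psi> y = \<rho> \<phi> y * (cmod (jac \<phi> ?\<psi> y))\<^sup>2"
      using \<rho>c \<phi>(1) \<psi> y unfolding conformal_metric_def by blast
    show 1: "norm_sq \<rho> \<phi> (snd \<phi>) y > 0" using nz ry by (simp add: norm_sq_def)
    have "norm_sq \<rho> ?\<psi> (frame_coeff D K i) y = norm_sq \<rho> \<phi> (snd \<phi>) y * (cmod (k y))\<^sup>2"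
      using VD Q(3)[of y] y by (simp add: norm_sq_def frame_coeff_def coordinate_def ch k_def norm_mult power_mult_distrib)
    moreover have "(cmod (k y))\<^sup>2 > 0" using k0[of y] y by simp
    ultimately show "?lf y = ln (norm_sq \<rho> \<phi> (snd \<phi>) y) + u y"
      using 1 by (simp add: log_frame_def u_def ln_mult)
  qed
  have lf': "complex_of_real (?lf y) = 2 * ln' y + complex_of_real (u y)" if y: "y \<in> ?W - D" for y
    using lf[OF y] pos[OF y] by (simp add: ln'_def ln_sqrt)
  have Wo: "open (?W - D)" using W closed_D by auto
  have lfs: "smooth_fun \<A> (?W - D) (\<lambda>y. complex_of_real (?lf y))"
    by (rule smooth_fun_subset[OF smooth_fun_of_real[OF VD_open[OF i(1)] log_frame_smooth[OF conformal_frame_log[OF \<rho>c] i(1)]]])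
       (auto simp: cover_dom_def)
  have us'': "smooth_fun \<A> (?W - D) (\<lambda>y. complex_of_real (u y))" by (rule smooth_fun_subset[OF us']) auto
  have lns: "smooth_fun \<A> (?W - D) ln'"
  proof -
    have "smooth_fun \<A> (?W - D) (\<lambda>y. (1/2) * (complex_of_real (?lf y) - complex_of_real (u y)))"
      by (intro smooth_fun_mult smooth_fun_const smooth_fun_diff Wo lfs us'')
    moreover have "smooth_fun \<A> (?W - D) (\<lambda>y. (1/2) * (complex_of_real (?lf y) - complex_of_real (u y))) \<longleftrightarrow> smooth_fun \<A> (?W - D) ln'"
      by (rule smooth_fun_cong[OF Wo]) (simp add: lf')
    ultimately show ?thesis by blast
  qed
  have lns2: "smooth_fun \<A> (?W - D) (\<lambda>y. 2 * ln' y)" by (intro smooth_fun_mult smooth_fun_const Wo lns)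
  have near: "x \<in> N" "norm (\<alpha> x) \<le> Ma" "x \<in> ?W - D" "norm (u x) \<le> Mu"
      "norm (pd_z \<phi> (\<lambda>x. complex_of_real (u x)) x) \<le> Md" "snd \<phi> x \<in> cusp_disc"
    if x: "x \<in> fst \<phi>" "x \<noteq> p" "norm (snd \<phi> x) < s" for x
    using r1(3)[OF x(1)] r2(3)[OF x(1)] r3(3)[OF x(1)] x \<phi>(4) coord_zero[OF \<phi>(1-3) x(1,2)]
    by (auto simp: s_def cusp_disc_def)
  have nl: "\<bar>ln (cmod z)\<bar> = neglog z" if "z \<in> cusp_disc" for z using neglog_ge1[OF that] by (simp add: neglog_def)
  have nl2: "(ln (cmod z))\<^sup>2 = (neglog z)\<^sup>2" for z by (simp add: neglog_def)
  show ?thesis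
  proof (rule that[OF \<phi> s, of C])
    show "0 \<le> C" using r1 r2 r3 by (simp add: C_def)
    show "x \<in> V i" if "x \<in> fst \<phi>" "norm (snd \<phi> x) < s" for x
      using r2(3)[OF that(1)] that(2) by (simp add: s_def cover_dom_def)
  next
    fix x assume x: "x \<in> fst \<phi>" "x \<noteq> p" "norm (snd \<phi> x) < s"
    note nx = near[OF x]
    let ?z = "snd \<phi> x"
    have L: "neglog ?z > 1" by (rule neglog_ge1[OF nx(6)])
    have z: "norm ?z > 0" using nx(6) by (simp add: cusp_disc_def)
    have A: "ln (\<rho> \<phi> x) = - ln ((norm ?z)\<^sup>2 * (neglog ?z)\<^sup>2) + \<alpha> x" using \<alpha>[OF nx(1) x(2)] unfolding nl2 .
    have rx: "\<rho> \<phi> x > 0" using pos[OF nx(3)] by (simp add: norm_sq_def zero_less_mult_iff)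
    have P0: "(norm ?z)\<^sup>2 * (neglog ?z)\<^sup>2 > 0" using z L by simp
    \<comment> \<open>The factor |z|^2 of the frame cancels the one in the denominator of \<rho>;
      only the double logarithm and \<alpha> are left.\<close>
    have "ln (norm_sq \<rho> \<phi> (snd \<phi>) x) = \<alpha> x - 2 * ln (neglog ?z)"
      using A rx z L by (simp add: norm_sq_def ln_mult ln_realpow)
    then have "\<bar>?lf x\<bar> \<le> Ma + Mu + 2 * ln (neglog ?z)"
      using lf[OF nx(3)] nx(2,4) ln_gt_zero[OF L] by simp
    also have "\<dots> \<le> (Ma + Mu) * 1 + 4 * sqrt (neglog ?z)" using ln_le_sqrt[of "neglog ?z"] L by simp
    also have "\<dots> \<le> (Ma + Mu) * sqrt (neglog ?z) + 4 * sqrt (neglog ?z)"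
      using r1(2) r2(2) L by (intro add_mono mult_left_mono) auto
    also have "\<dots> \<le> C * sqrt (neglog ?z)"
      unfolding distrib_right[symmetric] using L r3(2) by (intro mult_right_mono) (auto simp: C_def)
    finally show "\<bar>?lf x\<bar> \<le> C * sqrt (neglog ?z)" .
    have "pd_z \<phi> (\<lambda>y. complex_of_real (?lf y)) x = pd_z \<phi> (\<lambda>y. 2 * ln' y + complex_of_real (u y)) x"
      by (rule pd_z_cong[OF Wo lf' \<phi>(1) x(1) nx(3)])
    also have "\<dots> = pd_z \<phi> (\<lambda>y. 2 * ln' y) x + pd_z \<phi> (\<lambda>y. complex_of_real (u y)) x"
      by (rule pd_z_add[OF lns2 us'' \<phi>(1) x(1) nx(3)])
    also have "pd_z \<phi> (\<lambda>y. 2 * ln' y) x = 2 * pd_z \<phi> ln' x"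
      by (rule pd_z_cmult[OF lns \<phi>(1) x(1) nx(3)])
    finally have "norm (pd_z \<phi> (\<lambda>y. complex_of_real (?lf y)) x) \<le> 2 * norm (pd_z \<phi> ln' x) + Md"
      using nx(5) norm_triangle_ineq[of "2 * pd_z \<phi> ln' x" "pd_z \<phi> (\<lambda>y. complex_of_real (u y)) x"] by (simp add: norm_mult)
    also have "\<dots> \<le> 2 * (\<bar>C1\<bar> / (norm ?z * neglog ?z)) + Md / (norm ?z * neglog ?z)"
    proof (intro add_mono mult_left_mono)
      have "norm (pd_z \<phi> ln' x) \<le> C1 / (norm ?z * neglog ?z)" using C1[OF nx(1) x(2)] unfolding nl[OF nx(6)] .
      also have "\<dots> \<le> \<bar>C1\<bar> / (norm ?z * neglog ?z)" using L by (intro divide_right_mono) auto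
      finally show "norm (pd_z \<phi> ln' x) \<le> \<bar>C1\<bar> / (norm ?z * neglog ?z)" .
      show "Md \<le> Md / (norm ?z * neglog ?z)"
        using norm_neglog_le1[OF nx(6)] z L r3(2) by (simp add: pos_le_divide_eq mult_left_le)
    qed simp
    also have "\<dots> = (2 * \<bar>C1\<bar> + Md) / (norm ?z * neglog ?z)" by (simp add: add_divide_distrib)
    also have "\<dots> \<le> C / (norm ?z * neglog ?z)"
      using L r1(2) r2(2) by (intro divide_right_mono) (auto simp: C_def)
    finally show "norm (pd_z \<phi> (\<lambda>y. complex_of_real (?lf y)) x) \<le> C / (norm ?z * neglog ?z)" .
    have xV: "x \<in> V i" using nx(3) by (simp add: cover_dom_def)
    have xD: "x \<notin> D" using nx(3) by simp
    have "c1_form \<rho> \<phi> x = dbar_del (\<lambda>y. complex_of_real (?lf y)) \<phi> x"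
      by (rule c1_frame[OF \<rho>c i(1) \<phi>(1) x(1) xV xD, symmetric])
    also have "\<dots> = dbar_del (\<lambda>y. 2 * ln' y + complex_of_real (u y)) \<phi> x"
      by (rule dbar_del_cong[OF Wo lf' \<phi>(1) x(1) nx(3)])
    also have "\<dots> = dbar_del (\<lambda>y. 2 * ln' y) \<phi> x + dbar_del (\<lambda>y. complex_of_real (u y)) \<phi> x"
      by (rule dbar_del_add[OF Wo lns2 us'' \<phi>(1) x(1) nx(3)])
    also have "dbar_del (\<lambda>y. 2 * ln' y) \<phi> x = 2 * dbar_del ln' \<phi> x"
      by (rule dbar_del_cmult[OF Wo lns \<phi>(1) x(1) nx(3)])
    also have "dbar_del (\<lambda>y. complex_of_real (u y)) \<phi> x = 0" using u0 nx(3) by blast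
    finally have "norm (c1_form \<rho> \<phi> x) = 2 * norm (dbar_del ln' \<phi> x)" by (simp add: norm_mult)
    also have "\<dots> \<le> 2 * (C2 / ((norm ?z)\<^sup>2 * (neglog ?z)\<^sup>2))"
      using C2[OF nx(1) x(2)] unfolding nl2 by simp
    also have "\<dots> = 2 * C2 * (1 / ((norm ?z)\<^sup>2 * (neglog ?z)\<^sup>2))" by simp
    also have "\<dots> \<le> C * (1 / ((norm ?z)\<^sup>2 * (neglog ?z)\<^sup>2))"
    proof (rule mult_right_mono)
      show "2 * C2 \<le> C"
        unfolding C_def using r1(2) r2(2) r3(2) abs_ge_zero[of C1] abs_ge_self[of C2] exp_ge_zero[of Ma] by linarith
    qed simp
    finally show "norm (c1_form \<rho> \<phi> x) \<le> C * (1 / ((norm ?z)\<^sup>2 * (neglog ?z)\<^sup>2))" .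
    have "\<rho> \<phi> x = exp (ln (\<rho> \<phi> x))" using rx by simp
    also have "\<dots> = exp (\<alpha> x) * (1 / ((norm ?z)\<^sup>2 * (neglog ?z)\<^sup>2))"
      unfolding A exp_add exp_minus using P0 by (simp add: field_simps)
    also have "\<dots> \<le> C * (1 / ((norm ?z)\<^sup>2 * (neglog ?z)\<^sup>2))"
    proof (intro mult_right_mono)
      have "exp (\<alpha> x) \<le> exp Ma" using nx(2) by simp
      then show "exp (\<alpha> x) \<le> C"
        unfolding C_def using r1(2) r2(2) r3(2) abs_ge_zero[of C1] abs_ge_zero[of C2] by linarith
    qed simp
    finally show "\<bar>\<rho> \<phi> x\<bar> \<le> C * (1 / ((norm ?z)\<^sup>2 * (neglog ?z)\<^sup>2))" using rx by simp
  qed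
qed

lemma form2_bounded_near:
  assumes "smooth_form2 \<A> W \<omega>" "open W" "\<phi> \<in> coords \<A>" "p \<in> fst \<phi>" "p \<in> W" "snd \<phi> p = 0"
  obtains r M where "r > 0" "M \<ge> 0" "\<And>x. x \<in> fst \<phi> \<Longrightarrow> norm (snd \<phi> x) < r \<Longrightarrow> x \<in> W \<and> norm (\<omega> \<phi> x) \<le> M"
proof -
  have o: "open (fst \<phi> \<inter> W)" using coord_open[OF assms(3)] assms(2) by blast
  obtain r M where r: "r > 0" "M \<ge> 0" "\<And>x. x \<in> fst \<phi> \<Longrightarrow> norm (snd \<phi> x) < r \<Longrightarrow> x \<in> fst \<phi> \<inter> W \<and> norm (\<omega> \<phi> x) \<le> M"
    by (rule bounded_near[OF form_continuous[OF assms(1,3,2)] o assms(3,4) _ assms(6)])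
       (use assms(4,5) in blast, rule that, assumption+)
  show ?thesis by (rule that[OF r(1,2)]) (use r(3) in blast)
qed

lemma form1_bounded_near:
  assumes "smooth_form1 \<A> W \<omega>" "open W" "\<phi> \<in> coords \<A>" "p \<in> fst \<phi>" "p \<in> W" "snd \<phi> p = 0"
  obtains r M where "r > 0" "M \<ge> 0" "\<And>x. x \<in> fst \<phi> \<Longrightarrow> norm (snd \<phi> x) < r \<Longrightarrow> x \<in> W \<and> norm (\<omega> \<phi> x) \<le> M"
proof -
  have o: "open (fst \<phi> \<inter> W)" using coord_open[OF assms(3)] assms(2) by blast
  obtain r M where r: "r > 0" "M \<ge> 0" "\<And>x. x \<in> fst \<phi> \<Longrightarrow> norm (snd \<phi> x) < r \<Longrightarrow> x \<in> fst \<phi> \<inter> W \<and> norm (\<omega> \<phi> x) \<le> M"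
    by (rule bounded_near[OF smooth_fun_continuous[OF smooth_form1_smooth[OF assms(1,3)] o] o assms(3,4) _ assms(6)])
       (use assms(4,5) in blast, rule that, assumption+)
  show ?thesis by (rule that[OF r(1,2)]) (use r(3) in blast)
qed

text \<open>For the second bound, log w \<le> w - 1 at w = |z|^(-1/2) gives neglog z |z|^(1/2) \<le>
  2, and squaring yields the constant 4. It admits the product of r_i with a smooth 1-form to
  Stokes' theorem.\<close>

lemma cusp_disc_growth:
  assumes "z \<in> cusp_disc"
  shows "0 \<le> B \<Longrightarrow> B \<le> B / (norm z * neglog z)" and "sqrt (neglog z) \<le> 4 / (norm z * neglog z)"
proof -
  have L: "neglog z > 1" by (rule neglog_ge1[OF assms])
  have z: "norm z > 0" using assms by (simp add: cusp_disc_def)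
  show "B \<le> B / (norm z * neglog z)" if "0 \<le> B"
    using norm_neglog_le1[OF assms] z L that by (simp add: pos_le_divide_eq mult_left_le)
  let ?w = "sqrt (norm z)"
  have w: "?w > 0" using z by simp
  have "ln (1 / ?w) \<le> 1 / ?w - 1" using w by (intro ln_le_minus_one) simp
  moreover have "ln (1 / ?w) = neglog z / 2" using z by (simp add: ln_div ln_sqrt neglog_def)
  ultimately have "neglog z \<le> 2 / ?w" by simp
  then have "neglog z * ?w \<le> 2" using w by (simp add: pos_le_divide_eq)
  then have "(neglog z * ?w)\<^sup>2 \<le> 2\<^sup>2" using L w by (intro power_mono) auto
  then have 1: "neglog z * (norm z * neglog z) \<le> 4" using z by (simp add: power_mult_distrib power2_eq_square algebra_simps)
  have "sqrt (neglog z) \<le> neglog z" using L real_sqrt_le_mono[of "neglog z" "(neglog z)\<^sup>2"] by (simp add: power2_eq_square)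
  then have "sqrt (neglog z) * (norm z * neglog z) \<le> neglog z * (norm z * neglog z)"
    using L by (intro mult_right_mono) auto
  then have "sqrt (neglog z) * (norm z * neglog z) \<le> 4" using 1 by linarith
  then show "sqrt (neglog z) \<le> 4 / (norm z * neglog z)" using z L by (simp add: pos_le_divide_eq)
qed

section \<open>Integrability of the forms in the construction\<close>

lemma chart_centered:
  assumes "p \<in> D"
  shows "\<exists>\<phi>\<in>coords \<A>. p \<in> fst \<phi> \<and> snd \<phi> p = 0 \<and> fst \<phi> \<inter> D = {p}"
proof -
  obtain i where i: "i < n" "p \<in> V i" by (rule V_cover)
  have "fst (chart K i) \<inter> D = {p}"
    unfolding cover_dom_def[symmetric] using V_D_unique[OF i assms] i(2) assms by blast
  then show ?thesis
    using chart_coords[OF i(1)] i(2) coordinate_D[OF i assms]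
    by (intro bexI[of _ "chart K i"]) (auto simp: cover_dom_def coordinate_def)
qed

lemma integrable_smooth_form2:
  assumes "smooth_form2 \<A> UNIV \<omega>"
  shows "integrable lam (form_fun \<omega>)"
proof -
  have U: "smooth_form2 \<A> (UNIV - D) \<omega>" by (rule smooth_form2_subset[OF assms]) auto
  show ?thesis by (rule integrable_form_local[OF U]) (rule integrable_near_smooth[OF U open_UNIV UNIV_I assms])
qed

text \<open>This is why different choices of h and \<eta> lead to the same limit.\<close>

lemma integral_exact_smooth:
  assumes "smooth_form1 \<A> UNIV \<xi>"
  shows "integrable lam (form_fun (d1 \<xi>))" "integral\<^sup>L lam (form_fun (d1 \<xi>)) = 0"
proof -
  show i: "integrable lam (form_fun (d1 \<xi>))" by (rule integrable_smooth_form2[OF smooth_form2_d1[OF open_UNIV assms]])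
  show "integral\<^sup>L lam (form_fun (d1 \<xi>)) = 0"
    by (rule stokes_surface[OF smooth_form1_subset[OF assms] smooth_cusp_growth[OF assms chart_centered] i]) auto
qed

text \<open>A bound is required only at the punctures, each in a coordinate of its own; elsewhere
  smoothness gives local integrability.\<close>

lemma integrable_cusp:
  assumes \<omega>: "smooth_form2 \<A> (UNIV - D) \<omega>"
    and cusp: "\<And>p. p \<in> D \<Longrightarrow> \<exists>\<phi> r C. \<phi> \<in> coords \<A> \<and> p \<in> fst \<phi> \<and> snd \<phi> p = 0 \<and> fst \<phi> \<inter> D = {p} \<and> 0 < r \<and> r \<le> exp (- 1) \<and>
      (\<forall>x\<in>fst \<phi>. x \<noteq> p \<longrightarrow> norm (snd \<phi> x) < r \<longrightarrow> norm (\<omega> \<phi> x) \<le> C * cusp_majorant (snd \<phi> x))"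
  shows "integrable lam (form_fun \<omega>)"
proof (rule integrable_form_local[OF \<omega>])
  fix x
  show "\<exists>N. open N \<and> x \<in> N \<and> integrable lam (\<lambda>y. indicator N y *\<^sub>R form_fun \<omega> y)"
  proof (cases "x \<in> D")
    case False
    then show ?thesis by (intro integrable_near_smooth[OF \<omega> open_U _ \<omega>]) auto
  next
    case True
    from cusp[OF this] show ?thesis by (elim exE conjE) (rule integrable_near_cusp[OF \<omega>], blast+)
  qed
qed

lemma good_conformal: "good_conformal_metric \<A> D \<rho> \<Longrightarrow> conformal_metric \<A> (UNIV - D) \<rho>"
  by (simp add: good_conformal_metric_def)

lemma integrable_c1:
  assumes \<rho>: "good_conformal_metric \<A> D \<rho>"
  shows "integrable lam (form_fun (c1_form \<rho>))"
proof (rule integrable_cusp[OF c1_form_smooth[OF good_conformal[OF \<rho>]]])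
  fix p assume p: "p \<in> D"
  obtain i where i: "i < n" "p \<in> V i" by (rule V_cover)
  show "\<exists>\<phi> r C. \<phi> \<in> coords \<A> \<and> p \<in> fst \<phi> \<and> snd \<phi> p = 0 \<and> fst \<phi> \<inter> D = {p} \<and> 0 < r \<and> r \<le> exp (- 1) \<and>
      (\<forall>x\<in>fst \<phi>. x \<noteq> p \<longrightarrow> norm (snd \<phi> x) < r \<longrightarrow> norm (c1_form \<rho> \<phi> x) \<le> C * cusp_majorant (snd \<phi> x))"
  proof (rule good_growth[OF \<rho> p i], goal_cases)
    case (1 \<phi> r C)
    have "norm (c1_form \<rho> \<phi> x) \<le> C * cusp_majorant (snd \<phi> x)" if x: "x \<in> fst \<phi>" "x \<noteq> p" "norm (snd \<phi> x) < r" for x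
    proof -
      have "snd \<phi> x \<in> cusp_disc" using coord_zero[OF 1(1-3) x(1,2)] x(3) 1(6) by (simp add: cusp_disc_def)
      then have "C * (1 / ((norm (snd \<phi> x))\<^sup>2 * (neglog (snd \<phi> x))\<^sup>2)) \<le> C * cusp_majorant (snd \<phi> x)"
        using 1(7) by (intro mult_left_mono cusp_majorant_ge(4))
      then show ?thesis using 1(11)[OF x] by linarith
    qed
    then show ?case using 1(1-6) by blast
  qed
qed

lemma kahler_smooth:
  assumes "conformal_metric \<A> (UNIV - D) \<rho>"
  shows "smooth_form2 \<A> (UNIV - D) (kahler_form \<rho>)"
  unfolding smooth_form2_def
proof (intro conjI ballI)
  fix \<phi> \<psi> x assume a: "\<phi> \<in> coords \<A>" "\<psi> \<in> coords \<A>" "x \<in> fst \<phi> \<inter> fst \<psi> \<inter> (UNIV - D)"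
  have "\<rho> \<psi> x = \<rho> \<phi> x * (cmod (jac \<phi> \<psi> x))\<^sup>2" using assms a unfolding conformal_metric_def by blast
  then show "kahler_form \<rho> \<psi> x = kahler_form \<rho> \<phi> x * of_real ((cmod (jac \<phi> \<psi> x))\<^sup>2)" by (simp add: kahler_form_def)
next
  fix \<phi> assume a: "\<phi> \<in> coords \<A>"
  have o: "open (fst \<phi> \<inter> (UNIV - D))" using coord_open[OF a] open_U by blast
  have "smooth_fun \<A> (fst \<phi> \<inter> (UNIV - D)) (\<rho> \<phi>)" using assms a unfolding conformal_metric_def by blast
  then have "smooth_fun \<A> (fst \<phi> \<inter> (UNIV - D)) (\<lambda>x. (\<i> / 2) * of_real (\<rho> \<phi> x))"
    by (intro smooth_fun_mult smooth_fun_const smooth_fun_of_real o)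
  then show "smooth_fun \<A> (fst \<phi> \<inter> (UNIV - D)) (kahler_form \<rho> \<phi>)" by (simp add: kahler_form_def[abs_def])
qed

lemma integrable_kahler:
  assumes \<rho>: "good_conformal_metric \<A> D \<rho>"
  shows "integrable lam (form_fun (kahler_form \<rho>))"
proof (rule integrable_cusp[OF kahler_smooth[OF good_conformal[OF \<rho>]]])
  fix p assume p: "p \<in> D"
  obtain i where i: "i < n" "p \<in> V i" by (rule V_cover)
  show "\<exists>\<phi> r C. \<phi> \<in> coords \<A> \<and> p \<in> fst \<phi> \<and> snd \<phi> p = 0 \<and> fst \<phi> \<inter> D = {p} \<and> 0 < r \<and> r \<le> exp (- 1) \<and>
      (\<forall>x\<in>fst \<phi>. x \<noteq> p \<longrightarrow> norm (snd \<phi> x) < r \<longrightarrow> norm (kahler_form \<rho> \<phi> x) \<le> C * cusp_majorant (snd \<phi> x))"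
  proof (rule good_growth[OF \<rho> p i], goal_cases)
    case (1 \<phi> r C)
    have "norm (kahler_form \<rho> \<phi> x) \<le> C * cusp_majorant (snd \<phi> x)" if x: "x \<in> fst \<phi>" "x \<noteq> p" "norm (snd \<phi> x) < r" for x
    proof -
      have "snd \<phi> x \<in> cusp_disc" using coord_zero[OF 1(1-3) x(1,2)] x(3) 1(6) by (simp add: cusp_disc_def)
      then have "C * (1 / ((norm (snd \<phi> x))\<^sup>2 * (neglog (snd \<phi> x))\<^sup>2)) \<le> C * cusp_majorant (snd \<phi> x)"
        using 1(7) by (intro mult_left_mono cusp_majorant_ge(4))
      moreover have "norm (kahler_form \<rho> \<phi> x) \<le> \<bar>\<rho> \<phi> x\<bar>" by (simp add: kahler_form_def norm_mult)
      ultimately show ?thesis using 1(12)[OF x] by linarith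
    qed
    then show ?case using 1(1-6) by blast
  qed
qed

text \<open>omega^0 is the worst term: r_i is bounded by a multiple of neglog^(1/2) and c_1 has
  Poincare growth, and the product of the two rates is exactly the majorant. The correction
  d\<eta>_i is smooth across D.\<close>

lemma integrable_descent:
  assumes \<rho>: "good_conformal_metric \<A> D \<rho>" and d: "descent \<A> D K \<rho> h \<eta> \<omega>"
  shows "integrable lam (form_fun \<omega>)"
proof (rule integrable_cusp[OF descentD(6)[OF d]])
  note \<rho>c = good_conformal[OF \<rho>]
  fix p assume p: "p \<in> D"
  obtain i where i: "i < n" "p \<in> V i" by (rule V_cover)
  have ds: "smooth_form2 \<A> (V i) (d1 (\<eta> i))" by (rule smooth_form2_d1[OF V_open[OF i(1)] descentD(3)[OF d i(1)]])
  show "\<exists>\<phi> r C. \<phi> \<in> coords \<A> \<and> p \<in> fst \<phi> \<and> snd \<phi> p = 0 \<and> fst \<phi> \<inter> D = {p} \<and> 0 < r \<and> r \<le> exp (- 1) \<and>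
      (\<forall>x\<in>fst \<phi>. x \<noteq> p \<longrightarrow> norm (snd \<phi> x) < r \<longrightarrow> norm (\<omega> \<phi> x) \<le> C * cusp_majorant (snd \<phi> x))"
  proof (rule good_growth[OF \<rho> p i], goal_cases)
    case (1 \<phi> r C)
    obtain r' M where r': "r' > 0" "M \<ge> 0" "\<And>x. x \<in> fst \<phi> \<Longrightarrow> norm (snd \<phi> x) < r' \<Longrightarrow> x \<in> V i \<and> norm (d1 (\<eta> i) \<phi> x) \<le> M"
      by (rule form2_bounded_near[OF ds V_open[OF i(1)] 1(1,2) i(2) 1(3)]) (rule that, assumption+)
    have "norm (\<omega> \<phi> x) \<le> (C * C + M) * cusp_majorant (snd \<phi> x)"
      if x: "x \<in> fst \<phi>" "x \<noteq> p" "norm (snd \<phi> x) < min r r'" for x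
    proof -
      let ?z = "snd \<phi> x"
      have xr: "norm ?z < r" "norm ?z < r'" using x(3) by auto
      have cd: "?z \<in> cusp_disc" using coord_zero[OF 1(1-3) x(1,2)] xr(1) 1(6) by (simp add: cusp_disc_def)
      have xV: "x \<in> V i" by (rule 1(8)[OF x(1) xr(1)])
      have xD: "x \<notin> D" using 1(4) x by blast
      have "omega0 D K \<rho> i \<phi> x = of_real (log_frame D K \<rho> i x / 2) * c1_form \<rho> \<phi> x"
        using c1_frame[OF \<rho>c i(1) 1(1) x(1) xV xD] by (simp add: omega0_def o_def)
      then have "norm (omega0 D K \<rho> i \<phi> x) = \<bar>log_frame D K \<rho> i x / 2\<bar> * norm (c1_form \<rho> \<phi> x)"
        by (simp only: norm_mult norm_of_real)
      also have "\<dots> \<le> (C * sqrt (neglog ?z)) * (C * (1 / ((norm ?z)\<^sup>2 * (neglog ?z)\<^sup>2)))"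
        using 1(7) 1(9)[OF x(1,2) xr(1)] 1(11)[OF x(1,2) xr(1)] neglog_ge1[OF cd] by (intro mult_mono) auto
      also have "\<dots> = (C * C) * (sqrt (neglog ?z) / ((norm ?z)\<^sup>2 * (neglog ?z)\<^sup>2))" by simp
      also have "\<dots> = (C * C) * cusp_majorant ?z" unfolding cusp_majorant_ge(3)[OF cd] ..
      finally have 2: "norm (omega0 D K \<rho> i \<phi> x) \<le> (C * C) * cusp_majorant ?z" .
      have "M * 1 \<le> M * cusp_majorant ?z" using r'(2) cusp_majorant_ge(1)[OF cd] by (intro mult_left_mono)
      then have "norm (d1 (\<eta> i) \<phi> x) \<le> M * cusp_majorant ?z" using r'(3)[OF x(1) xr(2)] by linarith
      moreover have "norm (\<omega> \<phi> x) \<le> norm (omega0 D K \<rho> i \<phi> x) + norm (d1 (\<eta> i) \<phi> x)"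
        unfolding descentD(7)[OF d i(1) 1(1) x(1) xV xD] by (rule norm_triangle_ineq)
      ultimately show ?thesis using 2 by (simp add: distrib_right)
    qed
    then show ?case
      using 1(1-6) r'(1) by (intro exI[of _ \<phi>] exI[of _ "min r r'"] exI[of _ "C * C + M"] conjI ballI impI) simp_all
  qed
qed

text \<open>omega^0 has real factors, and for an imaginary form a dz + b dzbar, where a is minus the
  conjugate of b, the coefficient of the differential is twice the real part of b_z. Hence the limit
  that defines the cup norm is real.\<close>

lemma descent_real:
  assumes \<rho>: "frame_log \<rho>" and d: "descent \<A> D K \<rho> h \<eta> \<omega>"
  shows "Im (form_fun \<omega> x) = 0"
proof (cases "x \<in> D")
  case False
  let ?i = "idx x" and ?\<phi> = "chart K (idx x)"
  note i = idx[of x] and \<phi> = chart_coords[OF idx(1)[of x]]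
  have x: "x \<in> fst ?\<phi>" "x \<in> V ?i - D" using i False by (auto simp: cover_dom_def)
  have s: "smooth_fun \<A> (V ?i) (\<lambda>y. snd (\<eta> ?i ?\<phi> y))"
    using smooth_form1_fst_snd(2)[OF descentD(3)[OF d i(1)] \<phi> V_open[OF i(1)]] by (simp add: cover_dom_def)
  have "pd_zbar ?\<phi> (\<lambda>y. fst (\<eta> ?i ?\<phi> y)) x = pd_zbar ?\<phi> (\<lambda>y. - cnj (snd (\<eta> ?i ?\<phi> y))) x"
    by (rule pd_zbar_cong[OF V_open[OF i(1)] _ \<phi> x(1) i(2)])
       (use descentD(4)[OF d i(1)] \<phi> in \<open>auto simp: imaginary_form1_def cover_dom_def\<close>)
  also have "\<dots> = - cnj (pd_z ?\<phi> (\<lambda>y. snd (\<eta> ?i ?\<phi> y)) x)"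
    using pd_zbar_minus[OF smooth_fun_cnj[OF V_open[OF i(1)] s] \<phi> x(1) i(2)] pd_zbar_cnj[OF s \<phi> x(1) i(2)] by simp
  finally have "Im (d1 (\<eta> ?i) ?\<phi> x) = 0" by (simp add: d1_def)
  moreover have "Im (dbar_del (\<lambda>y. complex_of_real (log_frame D K \<rho> ?i y)) ?\<phi> x) = 0"
    by (rule dbar_del_real[OF VD_open[OF i(1)] log_frame_smooth[OF \<rho> i(1)] \<phi> x])
  moreover have "\<omega> ?\<phi> x = omega0 D K \<rho> ?i ?\<phi> x + d1 (\<eta> ?i) ?\<phi> x"
    using descentD(7)[OF d i(1) \<phi> x(1) i(2)] False by simp
  ultimately show ?thesis using False by (simp add: form_fun_def omega0_def o_def)
qed (simp add: form_fun_def)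

section \<open>The limit over X_eps and the value of the cup norm\<close>

lemma X_eps_borel: "X_eps D K \<epsilon> \<in> sets borel"
proof -
  have "open {x. \<exists>i<n. V i \<inter> D \<noteq> {} \<and> x \<in> V i \<and> cmod (coordinate K i x) < \<epsilon>}"
  proof -
    have "open {x \<in> fst (chart K i). snd (chart K i) x \<in> ball 0 \<epsilon>}" if "i < n" for i
      by (rule coord_open_preimage[OF chart_coords[OF that]]) auto
    then have "open (\<Union>i\<in>{i. i < n \<and> V i \<inter> D \<noteq> {}}. {x \<in> fst (chart K i). snd (chart K i) x \<in> ball 0 \<epsilon>})" by auto
    moreover have "(\<Union>i\<in>{i. i < n \<and> V i \<inter> D \<noteq> {}}. {x \<in> fst (chart K i). snd (chart K i) x \<in> ball 0 \<epsilon>}) =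
        {x. \<exists>i<n. V i \<inter> D \<noteq> {} \<and> x \<in> V i \<and> cmod (coordinate K i x) < \<epsilon>}"
      by (auto simp: cover_dom_def coordinate_def)
    ultimately show ?thesis by simp
  qed
  then show ?thesis unfolding X_eps_def by (intro sets.Diff borel_open open_UNIV)
qed

lemma X_eps_D: "\<epsilon> > 0 \<Longrightarrow> X_eps D K \<epsilon> \<inter> D = {}"
proof -
  assume \<epsilon>: "\<epsilon> > 0"
  have "x \<notin> X_eps D K \<epsilon>" if x: "x \<in> D" for x
  proof -
    obtain i where i: "i < n" "x \<in> V i" by (rule V_cover)
    have "\<exists>i<n. V i \<inter> D \<noteq> {} \<and> x \<in> V i \<and> cmod (coordinate K i x) < \<epsilon>"
      using i x coordinate_D[OF i x] \<epsilon> by (intro exI[of _ i] conjI) auto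
    then show ?thesis by (simp add: X_eps_def)
  qed
  then show ?thesis by blast
qed

text \<open>Finitely many charts of the cover contain the point, and the coordinate of each one that
  meets D is nonzero there.\<close>

lemma X_eps_eventually:
  assumes "x \<notin> D"
  shows "eventually (\<lambda>\<epsilon>. x \<in> X_eps D K \<epsilon>) (at_right 0)"
proof -
  let ?I = "{i. i < n \<and> V i \<inter> D \<noteq> {} \<and> x \<in> V i}"
  have "eventually (\<lambda>\<epsilon>. \<epsilon> \<le> cmod (coordinate K i x)) (at_right 0)" if "i \<in> ?I" for i
    using coordinate_nonzero[of i x] that assms
    by (intro eventually_at_right_less[of 0, THEN eventually_mono] order_less_imp_le eventually_at_rightI[of 0 "cmod (coordinate K i x)"]) auto
  then have "eventually (\<lambda>\<epsilon>. \<forall>i\<in>?I. \<epsilon> \<le> cmod (coordinate K i x)) (at_right 0)"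
    by (intro eventually_ball_finite) auto
  then show ?thesis
  proof eventually_elim
    case (elim \<epsilon>)
    have False if "i < n" "V i \<inter> D \<noteq> {}" "x \<in> V i" "cmod (coordinate K i x) < \<epsilon>" for i
      using bspec[OF elim, of i] that by simp
    then show ?case unfolding X_eps_def by blast
  qed
qed

text \<open>Dominated convergence along sequences \<epsilon> \<rightarrow> 0. The constant is i / (2
  pi) times the -2i of dz \<and> dzbar, that is 1 / pi.\<close>

lemma integral_form2_limit:
  assumes \<omega>: "smooth_form2 \<A> (UNIV - D) \<omega>" and int: "integrable lam (form_fun \<omega>)"
  shows "((\<lambda>\<epsilon>. \<i> / (2 * pi) * integral_form2 K \<omega> (X_eps D K \<epsilon>)) \<longlongrightarrow> integral\<^sup>L lam (form_fun \<omega>) / pi) (at_right 0)"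
proof -
  have ii: "integrable lam (\<lambda>x. indicator (X_eps D K \<epsilon>) x *\<^sub>R form_fun \<omega> x)" for \<epsilon>
    by (rule integrable_mult_indicator[OF _ int]) (simp add: X_eps_borel)
  have "((\<lambda>\<epsilon>. integral\<^sup>L lam (\<lambda>x. indicator (X_eps D K \<epsilon>) x *\<^sub>R form_fun \<omega> x)) \<longlongrightarrow> integral\<^sup>L lam (form_fun \<omega>)) (at_right 0)"
  proof (rule tendsto_at_right_sequentially[of 0 1])
    fix S :: "nat \<Rightarrow> real"
    assume S: "\<And>k. 0 < S k" "S \<longlonglongrightarrow> 0"
    have Sf: "filterlim S (at_right 0) sequentially"
      unfolding filterlim_at using S(2) less_imp_neq[OF S(1)] S(1) by (auto intro!: always_eventually)
    show "(\<lambda>k. integral\<^sup>L lam (\<lambda>x. indicator (X_eps D K (S k)) x *\<^sub>R form_fun \<omega> x)) \<longlonglongrightarrow> integral\<^sup>L lam (form_fun \<omega>)"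
    proof (rule integral_dominated_convergence[where w = "\<lambda>x. norm (form_fun \<omega> x)"])
      show "AE x in lam. (\<lambda>k. indicator (X_eps D K (S k)) x *\<^sub>R form_fun \<omega> x) \<longlonglongrightarrow> form_fun \<omega> x"
      proof (rule AE_I2)
        fix x
        show "(\<lambda>k. indicator (X_eps D K (S k)) x *\<^sub>R form_fun \<omega> x) \<longlonglongrightarrow> form_fun \<omega> x"
        proof (cases "x \<in> D")
          case False
          have "eventually (\<lambda>k. x \<in> X_eps D K (S k)) sequentially"
            using eventually_compose_filterlim[OF X_eps_eventually[OF False] Sf] .
          then have "eventually (\<lambda>k. indicator (X_eps D K (S k)) x *\<^sub>R form_fun \<omega> x = form_fun \<omega> x) sequentially"
            by eventually_elim simp
          then show ?thesis by (rule tendsto_eventually)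
        qed (simp add: form_fun_def)
      qed
      show "AE x in lam. norm (indicator (X_eps D K (S k)) x *\<^sub>R form_fun \<omega> x) \<le> norm (form_fun \<omega> x)" for k
        by (rule AE_I2) (simp add: indicator_def)
    qed (use int ii in \<open>auto intro: borel_measurable_integrable integrable_norm\<close>)
  qed simp
  then have lim: "((\<lambda>\<epsilon>. \<i> / (2 * pi) * (- 2 * \<i> * integral\<^sup>L lam (\<lambda>x. indicator (X_eps D K \<epsilon>) x *\<^sub>R form_fun \<omega> x)))
      \<longlongrightarrow> \<i> / (2 * pi) * (- 2 * \<i> * integral\<^sup>L lam (form_fun \<omega>))) (at_right 0)"
    by (intro tendsto_mult tendsto_const)
  have c: "\<i> / (2 * pi) * (- 2 * \<i> * w) = w / pi" for w by simp
  have ev: "eventually (\<lambda>\<epsilon>. \<i> / (2 * pi) * (- 2 * \<i> * integral\<^sup>L lam (\<lambda>x. indicator (X_eps D K \<epsilon>) x *\<^sub>R form_fun \<omega> x)) =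
      \<i> / (2 * pi) * integral_form2 K \<omega> (X_eps D K \<epsilon>)) (at_right 0)"
    using eventually_at_right_less[of "0::real"]
  proof eventually_elim
    case (elim \<epsilon>)
    show ?case unfolding integral_form2_lam[OF \<omega> X_eps_borel X_eps_D[OF elim] ii] ..
  qed
  show ?thesis using Lim_transform_eventually[OF lim ev] unfolding c .
qed

text \<open>The definite description is met because any two descents of one metric differ by the
  differential of a 1-form smooth on the whole surface, whose integral vanishes; the given descent
  provides the value.\<close>

lemma log_cup_norm_eq:
  assumes \<rho>: "frame_log \<rho>" and d: "descent \<A> D K \<rho> h \<eta> \<omega>" and int: "integrable lam (form_fun \<omega>)"
  shows "log_cup_norm \<A> D K \<rho> = Re (integral\<^sup>L lam (form_fun \<omega>)) / pi"
  unfolding log_cup_norm_def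
proof (rule the_equality)
  let ?I = "integral\<^sup>L lam (form_fun \<omega>)"
  have "Im ?I = integral\<^sup>L lam (\<lambda>x. Im (form_fun \<omega> x))" using int by (simp add: integral_Im)
  then have "Im ?I = 0" using descent_real[OF \<rho> d] by simp
  then have I: "?I = of_real (Re ?I)" by (simp add: complex_eq_iff)
  have "?I / pi = of_real (Re ?I / pi)" by (subst I) simp
  then have "((\<lambda>\<epsilon>. \<i> / (2 * pi) * integral_form2 K \<omega> (X_eps D K \<epsilon>)) \<longlongrightarrow> complex_of_real (Re ?I / pi)) (at_right 0)"
    using integral_form2_limit[OF descentD(6)[OF d] int] by simp
  then show "\<exists>h \<eta> \<omega>. descent \<A> D K \<rho> h \<eta> \<omega> \<and>
        ((\<lambda>\<epsilon>. \<i> / (2 * pi) * integral_form2 K \<omega> (X_eps D K \<epsilon>)) \<longlongrightarrow> complex_of_real (Re ?I / pi)) (at_right 0)"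
    using d by blast
  fix v
  assume "\<exists>h \<eta> \<omega>. descent \<A> D K \<rho> h \<eta> \<omega> \<and>
        ((\<lambda>\<epsilon>. \<i> / (2 * pi) * integral_form2 K \<omega> (X_eps D K \<epsilon>)) \<longlongrightarrow> complex_of_real v) (at_right 0)"
  then obtain h' \<eta>' \<omega>' where d': "descent \<A> D K \<rho> h' \<eta>' \<omega>'"
    and l: "((\<lambda>\<epsilon>. \<i> / (2 * pi) * integral_form2 K \<omega>' (X_eps D K \<epsilon>)) \<longlongrightarrow> complex_of_real v) (at_right 0)" by blast
  obtain \<xi> where \<xi>: "smooth_form1 \<A> UNIV \<xi>"
    "\<And>\<phi> x. \<phi> \<in> coords \<A> \<Longrightarrow> x \<in> fst \<phi> \<Longrightarrow> x \<notin> D \<Longrightarrow> \<omega>' \<phi> x = \<omega> \<phi> x + d1 \<xi> \<phi> x"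
    by (rule descent_unique_mod_exact[OF d d']) (rule that, assumption+)
  have e: "form_fun \<omega>' = (\<lambda>x. form_fun \<omega> x + form_fun (d1 \<xi>) x)"
  proof
    fix x
    show "form_fun \<omega>' x = form_fun \<omega> x + form_fun (d1 \<xi>) x"
      using \<xi>(2)[OF chart_coords[OF idx(1)], of x x] idx(2)[of x] by (auto simp: form_fun_def cover_dom_def)
  qed
  note x = integral_exact_smooth[OF \<xi>(1)]
  have i': "integrable lam (form_fun \<omega>')" unfolding e by (rule Bochner_Integration.integrable_add[OF int x(1)])
  have "integral\<^sup>L lam (form_fun \<omega>') = ?I" unfolding e using x int by (simp add: Bochner_Integration.integral_add)
  then have "complex_of_real v = ?I / pi"
    using tendsto_unique[OF _ l integral_form2_limit[OF descentD(6)[OF d'] i']] by simp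
  also have "\<dots> = of_real (Re ?I / pi)" by (subst I) simp
  finally show "v = Re ?I / pi" by (simp only: of_real_eq_iff)
qed

lemma area_eq:
  assumes \<rho>: "conformal_metric \<A> (UNIV - D) \<rho>" and int: "integrable lam (form_fun (kahler_form \<rho>))"
  shows "area D K \<rho> = integral\<^sup>L lam (\<lambda>x. if x \<in> D then 0 else \<rho> (chart K (idx x)) x)"
proof -
  let ?P = "\<lambda>x. if x \<in> D then 0 else \<rho> (chart K (idx x)) x"
  have e: "indicator (UNIV - D) x *\<^sub>R form_fun (kahler_form \<rho>) x = form_fun (kahler_form \<rho>) x" for x
    by (simp add: form_fun_def)
  have f: "form_fun (kahler_form \<rho>) x = (\<i> / 2) * complex_of_real (?P x)" for x
    by (simp add: form_fun_def kahler_form_def)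
  have "integral_form2 K (kahler_form \<rho>) (UNIV - D) = - 2 * \<i> * integral\<^sup>L lam (form_fun (kahler_form \<rho>))"
    using integral_form2_lam[OF kahler_smooth[OF \<rho>] _ Diff_disjoint[of D UNIV, unfolded Int_commute[of D]]] D_borel int by (simp add: e)
  also have "integral\<^sup>L lam (form_fun (kahler_form \<rho>)) = (\<i> / 2) * complex_of_real (integral\<^sup>L lam ?P)"
    unfolding f[abs_def] by simp
  finally show ?thesis by (simp add: area_def)
qed

end

section \<open>The first variation\<close>

lemma cont_diff_on_exp:
  fixes f :: "complex \<Rightarrow> real"
  assumes "open S" "cont_diff_on k S f"
  shows "cont_diff_on k S (\<lambda>p. exp (f p))"
  using assms(2)
proof (induction k)
  case 0
  then show ?case by (simp add: continuous_on_exp)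
next
  case (Suc k)
  show ?case
  proof (rule cont_diff_on_SucI[OF assms(1)])
    fix p assume "p \<in> S"
    then show "((\<lambda>p. exp (f p)) has_derivative (\<lambda>v. exp (f p) * frechet_derivative f (at p) v)) (at p)"
      using DERIV_compose_FDERIV[OF DERIV_exp cont_diff_on_SucE[OF Suc.prems]] by (simp add: mult.commute)
  next
    fix v
    show "cont_diff_on k S (\<lambda>p. exp (f p) * frechet_derivative f (at p) v)"
      using Suc cont_diff_on_SucD[OF Suc.prems] by (intro cont_diff_on_mult assms(1)) auto
  qed
qed

section \<open>Differentiating the area\<close>

lemma exp_quadratic_bound:
  fixes y :: real
  assumes "\<bar>y\<bar> \<le> 1"
  shows "\<bar>exp y - 1 - y\<bar> \<le> y\<^sup>2"
proof -
  have "exp y \<le> 1 + y + y\<^sup>2"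
  proof (cases "0 \<le> y")
    case True
    then show ?thesis using exp_bound assms by simp
  next
    case False
    define u where "u = - y"
    have u: "0 \<le> u" "u \<le> 1" using False assms by (simp_all add: u_def)
    have e: "1 + u + u\<^sup>2 / 2 \<le> exp u" by (rule exp_lower_Taylor_quadratic[OF u(1)])
    have q: "0 \<le> 1 - u + u\<^sup>2" using u by simp
    \<comment> \<open>The claim is now exp(-u) \<le> 1 - u + u^2. The product of the right side with
      the quadratic lower bound of exp u is at least 1, since its linear term cancels and the other
      coefficients are nonnegative.\<close>
    have "1 + u ^ 3 / 2 + u\<^sup>2 / 2 + u ^ 4 / 2 = (1 - u + u\<^sup>2) * (1 + u + u\<^sup>2 / 2)"
      by (simp add: power2_eq_square power3_eq_cube power4_eq_xxxx field_simps)
    moreover have "1 \<le> 1 + u ^ 3 / 2 + u\<^sup>2 / 2 + u ^ 4 / 2" using u by simp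
    moreover have "(1 - u + u\<^sup>2) * (1 + u + u\<^sup>2 / 2) \<le> (1 - u + u\<^sup>2) * exp u" using e q by (intro mult_left_mono)
    ultimately have "1 \<le> (1 - u + u\<^sup>2) * exp u" by linarith
    then have "exp (- u) \<le> 1 - u + u\<^sup>2" by (simp add: exp_minus inverse_eq_divide pos_divide_le_eq)
    then show ?thesis by (simp add: u_def)
  qed
  then show ?thesis using exp_ge_add_one_self[of y] zero_le_power2[of y] by linarith
qed

text \<open>A uniform quadratic remainder gives the derivative directly, in place of a limit of
  difference quotients under the integral sign.\<close>

lemma quadratic_has_derivative:
  fixes f :: "real \<Rightarrow> real"
  assumes "d > 0" "\<And>h. \<bar>h\<bar> < d \<Longrightarrow> \<bar>f h - f 0 - h * D\<bar> \<le> C * h\<^sup>2"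
  shows "(f has_real_derivative D) (at 0)"
  unfolding DERIV_def
proof (rule LIM_zero_cancel, rule tendsto_0_le[where K = C])
  show "((\<lambda>h::real. h) \<longlongrightarrow> 0) (at 0)" by simp
  show "eventually (\<lambda>h. norm ((f (0 + h) - f 0) / h - D) \<le> norm h * C) (at 0)"
    unfolding eventually_at
  proof (intro exI[of _ d] conjI ballI impI assms(1))
    fix h :: real assume h: "h \<noteq> 0 \<and> dist h 0 < d"
    have "\<bar>(f h - f 0) / h - D\<bar> * \<bar>h\<bar> = \<bar>f h - f 0 - h * D\<bar>"
      using h by (simp add: abs_mult[symmetric] field_simps)
    also have "\<dots> \<le> C * h\<^sup>2" using h by (intro assms(2)) auto
    also have "\<dots> = (\<bar>h\<bar> * C) * \<bar>h\<bar>" by (simp add: power2_eq_square abs_mult_self_eq)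
    finally have "\<bar>(f h - f 0) / h - D\<bar> * \<bar>h\<bar> \<le> (\<bar>h\<bar> * C) * \<bar>h\<bar>" .
    then show "norm ((f (0 + h) - f 0) / h - D) \<le> norm h * C" using h by (simp add: mult.commute)
  qed
qed

text \<open>As \<sigma> is bounded by M, the remainder exp(h \<sigma>) - 1 - h \<sigma> is at most
  M^2 h^2 for |h| < 1/M, uniformly on the space, so integration against P leaves a quadratic
  error.\<close>

lemma exp_integral_has_derivative:
  fixes \<sigma> P :: "'a \<Rightarrow> real"
  assumes \<sigma>: "\<sigma> \<in> borel_measurable m" "M > 0" "\<And>x. \<bar>\<sigma> x\<bar> \<le> M" and P: "integrable m P"
  shows "((\<lambda>t. integral\<^sup>L m (\<lambda>x. exp (t * \<sigma> x) * P x)) has_real_derivative integral\<^sup>L m (\<lambda>x. \<sigma> x * P x)) (at 0)"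
proof (rule quadratic_has_derivative[where d = "1 / M" and C = "M\<^sup>2 * integral\<^sup>L m (\<lambda>x. \<bar>P x\<bar>)"])
  show "1 / M > 0" using \<sigma>(2) by simp
  have Pm: "P \<in> borel_measurable m" by (rule borel_measurable_integrable[OF P])
  have bd: "integrable m (\<lambda>x. g x * P x)" if "g \<in> borel_measurable m" "\<And>x. \<bar>g x\<bar> \<le> B" for g :: "'a \<Rightarrow> real" and B
  proof (rule Bochner_Integration.integrable_bound)
    show "integrable m (\<lambda>x. B * P x)" using P by simp
    show "(\<lambda>x. g x * P x) \<in> borel_measurable m" using that(1) Pm by measurable
    have "\<bar>g x * P x\<bar> \<le> \<bar>B * P x\<bar>" for x
    proof -
      have "\<bar>g x\<bar> \<le> \<bar>B\<bar>" using that(2)[of x] by linarith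
      then show ?thesis by (simp add: abs_mult mult_right_mono)
    qed
    then show "AE x in m. norm (g x * P x) \<le> norm (B * P x)" by simp
  qed
  have i\<sigma>: "integrable m (\<lambda>x. \<sigma> x * P x)" by (rule bd[OF \<sigma>(1,3)])
  fix h :: real assume h: "\<bar>h\<bar> < 1 / M"
  have hs: "\<bar>h * \<sigma> x\<bar> \<le> 1" for x
  proof -
    have "\<bar>h\<bar> * \<bar>\<sigma> x\<bar> \<le> (1 / M) * M" using h \<sigma> by (intro mult_mono) auto
    then show ?thesis using \<sigma>(2) by (simp add: abs_mult)
  qed
  have ie: "integrable m (\<lambda>x. exp (h * \<sigma> x) * P x)"
  proof (rule bd[where B = "exp 1"])
    show "(\<lambda>x. exp (h * \<sigma> x)) \<in> borel_measurable m" using \<sigma>(1) by measurable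
    show "\<bar>exp (h * \<sigma> x)\<bar> \<le> exp 1" for x using hs[of x] by simp
  qed
  have "integral\<^sup>L m (\<lambda>x. exp (h * \<sigma> x) * P x) - integral\<^sup>L m (\<lambda>x. exp (0 * \<sigma> x) * P x) - h * integral\<^sup>L m (\<lambda>x. \<sigma> x * P x)
      = integral\<^sup>L m (\<lambda>x. exp (h * \<sigma> x) * P x - P x - h * (\<sigma> x * P x))"
    using ie P i\<sigma> by (simp add: Bochner_Integration.integral_diff)
  also have "\<bar>\<dots>\<bar> \<le> integral\<^sup>L m (\<lambda>x. (M\<^sup>2 * h\<^sup>2) * \<bar>P x\<bar>)"
  proof (rule integral_abs_bound[THEN order_trans], rule integral_mono)
    show "integrable m (\<lambda>x. \<bar>exp (h * \<sigma> x) * P x - P x - h * (\<sigma> x * P x)\<bar>)"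
      using ie P i\<sigma> by (intro integrable_abs Bochner_Integration.integrable_diff integrable_mult_right)
    show "integrable m (\<lambda>x. (M\<^sup>2 * h\<^sup>2) * \<bar>P x\<bar>)" using P by simp
    fix x
    have "\<bar>exp (h * \<sigma> x) - 1 - h * \<sigma> x\<bar> \<le> (h * \<sigma> x)\<^sup>2" by (rule exp_quadratic_bound[OF hs])
    also have "\<dots> \<le> M\<^sup>2 * h\<^sup>2"
    proof -
      have "\<bar>\<sigma> x\<bar>\<^sup>2 \<le> M\<^sup>2" using \<sigma>(3) by (intro power_mono) auto
      then show ?thesis
        using mult_left_mono[of "(\<sigma> x)\<^sup>2" "M\<^sup>2" "h\<^sup>2"] by (simp add: power_mult_distrib mult.commute)
    qed
    finally have "\<bar>exp (h * \<sigma> x) - 1 - h * \<sigma> x\<bar> * \<bar>P x\<bar> \<le> (M\<^sup>2 * h\<^sup>2) * \<bar>P x\<bar>" by (intro mult_right_mono) auto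
    moreover have "exp (h * \<sigma> x) * P x - P x - h * (\<sigma> x * P x) = (exp (h * \<sigma> x) - 1 - h * \<sigma> x) * P x"
      by (simp add: algebra_simps)
    ultimately show "\<bar>exp (h * \<sigma> x) * P x - P x - h * (\<sigma> x * P x)\<bar> \<le> (M\<^sup>2 * h\<^sup>2) * \<bar>P x\<bar>"
      by (simp only: abs_mult)
  qed
  finally show "\<bar>integral\<^sup>L m (\<lambda>x. exp (h * \<sigma> x) * P x) - integral\<^sup>L m (\<lambda>x. exp (0 * \<sigma> x) * P x) - h * integral\<^sup>L m (\<lambda>x. \<sigma> x * P x)\<bar>
      \<le> M\<^sup>2 * integral\<^sup>L m (\<lambda>x. \<bar>P x\<bar>) * h\<^sup>2" by (simp add: algebra_simps)
qed

context complex_surface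
begin

lemma smooth_fun_exp:
  fixes f :: "'a \<Rightarrow> real"
  assumes "open W" "smooth_fun \<A> W f"
  shows "smooth_fun \<A> W (\<lambda>x. exp (f x))"
  unfolding smooth_fun_def in_coord_def o_def
proof (intro ballI allI)
  fix \<phi> k assume \<phi>: "\<phi> \<in> coords \<A>"
  show "cont_diff_on k (snd \<phi> ` (fst \<phi> \<inter> W)) (\<lambda>x. exp (f (chart_inv \<phi> x)))"
    by (rule cont_diff_on_exp[OF coord_open_image[OF \<phi> assms(1)]])
       (use assms(2) \<phi> in \<open>auto simp: smooth_fun_def in_coord_def o_def\<close>)
qed

lemma conformal_metric_conf_change:
  assumes "conformal_metric \<A> U \<rho>" "open U" "smooth_fun \<A> UNIV \<tau>"
  shows "conformal_metric \<A> U (conf_change \<tau> \<rho>)"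
proof -
  have "smooth_fun \<A> (fst \<phi> \<inter> U) (conf_change \<tau> \<rho> \<phi>)" if \<phi>: "\<phi> \<in> coords \<A>" for \<phi>
  proof -
    have o: "open (fst \<phi> \<inter> U)" using coord_open[OF \<phi>] assms(2) by blast
    have r: "smooth_fun \<A> (fst \<phi> \<inter> U) (\<rho> \<phi>)" using assms(1) \<phi> unfolding conformal_metric_def by blast
    have t: "smooth_fun \<A> (fst \<phi> \<inter> U) \<tau>" by (rule smooth_fun_subset[OF assms(3)]) auto
    show ?thesis unfolding conf_change_def[abs_def] by (intro smooth_fun_mult smooth_fun_exp o r t)
  qed
  moreover have "conf_change \<tau> \<rho> \<phi> x > 0" if "\<phi> \<in> coords \<A>" "x \<in> fst \<phi> \<inter> U" for \<phi> x
  proof -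
    have "\<rho> \<phi> x > 0" using assms(1) that unfolding conformal_metric_def by blast
    then show ?thesis by (simp add: conf_change_def)
  qed
  moreover have "conf_change \<tau> \<rho> \<psi> x = conf_change \<tau> \<rho> \<phi> x * (cmod (jac \<phi> \<psi> x))\<^sup>2"
    if "\<phi> \<in> coords \<A>" "\<psi> \<in> coords \<A>" "x \<in> fst \<phi> \<inter> fst \<psi> \<inter> U" for \<phi> \<psi> x
  proof -
    have r: "\<rho> \<psi> x = \<rho> \<phi> x * (cmod (jac \<phi> \<psi> x))\<^sup>2" using assms(1) that unfolding conformal_metric_def by blast
    show ?thesis unfolding conf_change_def r by (rule mult.assoc[symmetric])
  qed
  ultimately show ?thesis unfolding conformal_metric_def by (intro conjI ballI)
qed

end

context cech_surface
begin

text \<open>The terms of d\<xi> are \<sigma> c_1 of Poincare growth, r_i dbar del \<sigma> of size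
  neglog^(1/2), and a bounded one, all below the majorant. In \<xi> the term \<sigma> d^c r_i is O(1
  / (|z| neglog z)) by the growth of del log ||s_i||, and the other terms satisfy the same bound, so
  Stokes' theorem applies.\<close>

lemma variation_exact_form:
  assumes \<rho>: "good_conformal_metric \<A> D \<rho>" and \<sigma>: "smooth_fun \<A> UNIV \<sigma>" and \<xi>: "smooth_form1 \<A> (UNIV - D) \<xi>"
    and loc: "\<And>i. i < n \<Longrightarrow> \<exists>\<zeta>. smooth_form1 \<A> (V i) \<zeta> \<and> (\<forall>\<phi>\<in>coords \<A>. \<forall>x\<in>fst \<phi> \<inter> V i - D.
        \<xi> \<phi> x = (1/4) *\<^sub>R theta \<sigma> (log_frame D K \<rho> i) \<phi> x - \<zeta> \<phi> x)"
  shows "integrable lam (form_fun (d1 \<xi>))" and "integral\<^sup>L lam (form_fun (d1 \<xi>)) = 0"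
proof -
  note \<rho>c = good_conformal[OF \<rho>]
  have \<sigma>W: "smooth_fun \<A> W \<sigma>" for W by (rule smooth_fun_subset[OF \<sigma>]) auto
  obtain S where S: "S > 0" "\<And>x. norm (\<sigma> x) \<le> S" by (rule smooth_fun_bounded[OF \<sigma>]) (rule that, assumption+)
  have near: "\<exists>\<phi> r B. \<phi> \<in> coords \<A> \<and> p \<in> fst \<phi> \<and> snd \<phi> p = 0 \<and> fst \<phi> \<inter> D = {p} \<and> 0 < r \<and> r \<le> exp (- 1) \<and>
      (\<forall>x\<in>fst \<phi>. x \<noteq> p \<longrightarrow> norm (snd \<phi> x) < r \<longrightarrow> norm (d1 \<xi> \<phi> x) \<le> B * cusp_majorant (snd \<phi> x) \<and>
        norm (\<xi> \<phi> x) \<le> B / (norm (snd \<phi> x) * neglog (snd \<phi> x)))" if p: "p \<in> D" for p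
  proof -
    obtain i where i: "i < n" "p \<in> V i" by (rule V_cover)
    let ?lf = "log_frame D K \<rho> i"
    note Vo = V_open[OF i(1)] and Wo = VD_open[OF i(1)]
    note lfs = log_frame_smooth[OF conformal_frame_log[OF \<rho>c] i(1)]
    obtain \<zeta> where \<zeta>: "smooth_form1 \<A> (V i) \<zeta>"
      "\<And>\<phi> x. \<phi> \<in> coords \<A> \<Longrightarrow> x \<in> fst \<phi> \<inter> V i - D \<Longrightarrow> \<xi> \<phi> x = (1/4) *\<^sub>R theta \<sigma> ?lf \<phi> x - \<zeta> \<phi> x"
      using loc[OF i(1)] by blast
    have \<zeta>D: "smooth_form1 \<A> (V i - D) \<zeta>" by (rule smooth_form1_subset[OF \<zeta>(1)]) auto
    have ths: "smooth_form1 \<A> (V i - D) (theta \<sigma> ?lf)" by (rule smooth_form1_theta[OF Wo \<sigma>W lfs])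
    have ths': "smooth_form1 \<A> (V i - D) (\<lambda>\<phi> x. (1/4) *\<^sub>R theta \<sigma> ?lf \<phi> x)"
      by (rule smooth_form1_scaleR[OF Wo smooth_fun_const ths])
    have cs: "smooth_fun \<A> UNIV (\<lambda>y. complex_of_real (\<sigma> y))" by (rule smooth_fun_of_real[OF open_UNIV \<sigma>])
    show ?thesis
    proof (rule good_growth[OF \<rho> p i], goal_cases)
      case (1 \<phi> r C)
      note \<phi> = 1(1)
      obtain r1 M1 where r1: "r1 > 0" "M1 \<ge> 0"
        "\<And>x. x \<in> fst \<phi> \<Longrightarrow> norm (snd \<phi> x) < r1 \<Longrightarrow> x \<in> UNIV \<and> norm (dbar_del (\<lambda>y. complex_of_real (\<sigma> y)) \<phi> x) \<le> M1"
        by (rule form2_bounded_near[OF smooth_form2_dbar_del[OF open_UNIV cs] open_UNIV 1(1,2) UNIV_I 1(3)]) (rule that, assumption+)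
      obtain r2 M2 where r2: "r2 > 0" "M2 \<ge> 0" "\<And>x. x \<in> fst \<phi> \<Longrightarrow> norm (snd \<phi> x) < r2 \<Longrightarrow> x \<in> V i \<and> norm (d1 \<zeta> \<phi> x) \<le> M2"
        by (rule form2_bounded_near[OF smooth_form2_d1[OF Vo \<zeta>(1)] Vo 1(1,2) i(2) 1(3)]) (rule that, assumption+)
      obtain r3 M3 where r3: "r3 > 0" "M3 \<ge> 0"
        "\<And>x. x \<in> fst \<phi> \<Longrightarrow> norm (snd \<phi> x) < r3 \<Longrightarrow> x \<in> UNIV \<and> norm (dc (\<lambda>y. complex_of_real (\<sigma> y)) \<phi> x) \<le> M3"
        by (rule form1_bounded_near[OF smooth_form1_dc[OF open_UNIV cs] open_UNIV 1(1,2) UNIV_I 1(3)]) (rule that, assumption+)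
      obtain r4 M4 where r4: "r4 > 0" "M4 \<ge> 0" "\<And>x. x \<in> fst \<phi> \<Longrightarrow> norm (snd \<phi> x) < r4 \<Longrightarrow> x \<in> V i \<and> norm (\<zeta> \<phi> x) \<le> M4"
        by (rule form1_bounded_near[OF \<zeta>(1) Vo 1(1,2) i(2) 1(3)]) (rule that, assumption+)
      define s where "s = min r (min (min r1 r2) (min r3 r4))"
      \<comment> \<open>\<open>B1\<close> collects the bounds for d\<xi> and \<open>B2\<close> those
        for \<xi>; in the latter, 2 counts the two components of d^c r_i and 4 comes from
        \<open>cusp_disc_growth\<close>.\<close>
      define B1 where "B1 = S * C + C * M1 + M2"
      define B2 where "B2 = S * (2 * C) + 4 * C * M3 + M4"
      have B: "B1 \<ge> 0" "B2 \<ge> 0" using S 1(7) r1(2) r2(2) r3(2) r4(2) by (simp_all add: B1_def B2_def)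
      have "norm (d1 \<xi> \<phi> x) \<le> (B1 + B2) * cusp_majorant (snd \<phi> x) \<and>
        norm (\<xi> \<phi> x) \<le> (B1 + B2) / (norm (snd \<phi> x) * neglog (snd \<phi> x))"
        if x: "x \<in> fst \<phi>" "x \<noteq> p" "norm (snd \<phi> x) < s" for x
      proof -
        let ?z = "snd \<phi> x"
        have xs: "norm ?z < r" "norm ?z < r1" "norm ?z < r2" "norm ?z < r3" "norm ?z < r4" using x(3) by (auto simp: s_def)
        have cd: "?z \<in> cusp_disc" using coord_zero[OF 1(1-3) x(1,2)] xs(1) 1(6) by (simp add: cusp_disc_def)
        have L: "neglog ?z > 1" by (rule neglog_ge1[OF cd])
        have xV: "x \<in> V i" by (rule 1(8)[OF x(1) xs(1)])
        have xD: "x \<notin> D" using 1(4) x by blast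
        have xW: "x \<in> V i - D" using xV xD by simp
        note lf = 1(9)[OF x(1,2) xs(1)] and plf = 1(10)[OF x(1,2) xs(1)]
        have sl: "\<bar>?lf x\<bar> \<le> C * cusp_majorant ?z"
          using lf mult_left_mono[OF cusp_majorant_ge(2)[OF cd] 1(7)] by linarith
        have c1: "norm (c1_form \<rho> \<phi> x) \<le> C * cusp_majorant ?z"
          using 1(11)[OF x(1,2) xs(1)] mult_left_mono[OF cusp_majorant_ge(4)[OF cd] 1(7)] by linarith
        have m1: "M2 \<le> M2 * cusp_majorant ?z" using mult_left_mono[OF cusp_majorant_ge(1)[OF cd] r2(2)] by simp
        have mn: "cusp_majorant ?z \<ge> 0" by (rule cusp_majorant_nonneg[OF cd])
        have "d1 \<xi> \<phi> x = d1 (\<lambda>\<phi> x. (1/4) *\<^sub>R theta \<sigma> ?lf \<phi> x - \<zeta> \<phi> x) \<phi> x"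
          by (rule d1_cong[OF Wo _ \<phi> x(1) xW]) (rule \<zeta>(2), auto)
        also have "\<dots> = d1 (\<lambda>\<phi> x. (1/4) *\<^sub>R theta \<sigma> ?lf \<phi> x) \<phi> x - d1 \<zeta> \<phi> x"
          by (rule d1_diff[OF Wo ths' \<zeta>D \<phi> x(1) xW])
        also have "d1 (\<lambda>\<phi> x. (1/4) *\<^sub>R theta \<sigma> ?lf \<phi> x) \<phi> x = of_real (1/4) * d1 (theta \<sigma> ?lf) \<phi> x"
          by (rule d1_cmult[OF Wo ths \<phi> x(1) xW])
        also have "d1 (theta \<sigma> ?lf) \<phi> x = 2 * (of_real (\<sigma> x) * dbar_del (\<lambda>y. complex_of_real (?lf y)) \<phi> x
            - of_real (?lf x) * dbar_del (\<lambda>y. complex_of_real (\<sigma> y)) \<phi> x)"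
          by (rule d1_theta[OF Wo \<sigma>W lfs \<phi> x(1) xW])
        also have "dbar_del (\<lambda>y. complex_of_real (?lf y)) \<phi> x = c1_form \<rho> \<phi> x"
          by (rule c1_frame[OF \<rho>c i(1) \<phi> x(1) xV xD])
        finally have e: "d1 \<xi> \<phi> x = (1/2) * (of_real (\<sigma> x) * c1_form \<rho> \<phi> x
            - of_real (?lf x) * dbar_del (\<lambda>y. complex_of_real (\<sigma> y)) \<phi> x) - d1 \<zeta> \<phi> x" by simp
        have "norm (d1 \<xi> \<phi> x) \<le> (1/2) * norm (of_real (\<sigma> x) * c1_form \<rho> \<phi> x
            - of_real (?lf x) * dbar_del (\<lambda>y. complex_of_real (\<sigma> y)) \<phi> x) + norm (d1 \<zeta> \<phi> x)"
          unfolding e by (rule order_trans[OF norm_triangle_ineq4]) (simp add: norm_mult)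
        also have "\<dots> \<le> norm (of_real (\<sigma> x) * c1_form \<rho> \<phi> x
            - of_real (?lf x) * dbar_del (\<lambda>y. complex_of_real (\<sigma> y)) \<phi> x) + norm (d1 \<zeta> \<phi> x)" by simp
        also have "\<dots> \<le> \<bar>\<sigma> x\<bar> * norm (c1_form \<rho> \<phi> x) + \<bar>?lf x\<bar> * norm (dbar_del (\<lambda>y. complex_of_real (\<sigma> y)) \<phi> x) + norm (d1 \<zeta> \<phi> x)"
          by (rule add_right_mono, rule order_trans[OF norm_triangle_ineq4]) (simp add: norm_mult)
        also have "\<dots> \<le> S * (C * cusp_majorant ?z) + (C * cusp_majorant ?z) * M1 + M2 * cusp_majorant ?z"
        proof (intro add_mono mult_mono)
          show "\<bar>\<sigma> x\<bar> \<le> S" using S(2)[of x] by simp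
          show "norm (dbar_del (\<lambda>y. complex_of_real (\<sigma> y)) \<phi> x) \<le> M1" using r1(3)[OF x(1) xs(2)] by simp
          show "norm (d1 \<zeta> \<phi> x) \<le> M2 * cusp_majorant ?z" using r2(3)[OF x(1) xs(3)] m1 by linarith
        qed (use S(1) c1 sl mn 1(7) in simp_all)
        also have "\<dots> = B1 * cusp_majorant ?z" by (simp add: B1_def algebra_simps)
        also have "\<dots> \<le> (B1 + B2) * cusp_majorant ?z" using mn B by (intro mult_right_mono) auto
        finally have 1: "norm (d1 \<xi> \<phi> x) \<le> (B1 + B2) * cusp_majorant ?z" .
        let ?Q = "norm ?z * neglog ?z"
        have Q: "?Q > 0" using cd L by (simp add: cusp_disc_def)
        have zb: "pd_zbar \<phi> (\<lambda>y. complex_of_real (?lf y)) x = cnj (pd_z \<phi> (\<lambda>y. complex_of_real (?lf y)) x)"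
          by (rule pd_zbar_real[OF Wo lfs \<phi> x(1) xW])
        have dlf: "norm (dc (\<lambda>y. complex_of_real (?lf y)) \<phi> x) \<le> 2 * C / ?Q"
        proof -
          have "norm (dc (\<lambda>y. complex_of_real (?lf y)) \<phi> x) \<le> 2 * norm (pd_z \<phi> (\<lambda>y. complex_of_real (?lf y)) x)"
            unfolding dc_def zb by (rule order_trans[OF norm_Pair_le]) simp
          then show ?thesis using plf by simp
        qed
        have lf': "\<bar>?lf x\<bar> \<le> C * (4 / ?Q)"
          using lf mult_left_mono[OF cusp_disc_growth(2)[OF cd] \<open>0 \<le> C\<close>] by linarith
        have "norm (\<xi> \<phi> x) \<le> norm (theta \<sigma> ?lf \<phi> x) + norm (\<zeta> \<phi> x)"
        proof -
          have "norm ((1/4) *\<^sub>R theta \<sigma> ?lf \<phi> x - \<zeta> \<phi> x) \<le> norm ((1/4) *\<^sub>R theta \<sigma> ?lf \<phi> x) + norm (\<zeta> \<phi> x)"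
            by (rule norm_triangle_ineq4)
          also have "\<dots> \<le> norm (theta \<sigma> ?lf \<phi> x) + norm (\<zeta> \<phi> x)" by simp
          finally show ?thesis using \<zeta>(2)[OF \<phi>, of x] x(1) xW by simp
        qed
        also have "norm (theta \<sigma> ?lf \<phi> x) \<le> \<bar>\<sigma> x\<bar> * norm (dc (\<lambda>y. complex_of_real (?lf y)) \<phi> x)
            + \<bar>?lf x\<bar> * norm (dc (\<lambda>y. complex_of_real (\<sigma> y)) \<phi> x)"
          unfolding theta_def by (rule order_trans[OF norm_triangle_ineq4]) simp
        also have "\<dots> \<le> S * (2 * C / ?Q) + C * (4 / ?Q) * M3"
        proof (intro add_mono mult_mono dlf lf')
          show "\<bar>\<sigma> x\<bar> \<le> S" using S(2)[of x] by simp
          show "norm (dc (\<lambda>y. complex_of_real (\<sigma> y)) \<phi> x) \<le> M3" using r3(3)[OF x(1) xs(4)] by simp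
        qed (use S(1) Q \<open>0 \<le> C\<close> in auto)
        also have "norm (\<zeta> \<phi> x) \<le> M4 / ?Q"
          using r4(3)[OF x(1) xs(5)] cusp_disc_growth(1)[OF cd r4(2)] by linarith
        also have "S * (2 * C / ?Q) + C * (4 / ?Q) * M3 + M4 / ?Q = B2 / ?Q"
          by (simp add: B2_def add_divide_distrib)
        also have "\<dots> \<le> (B1 + B2) / ?Q" using Q B by (intro divide_right_mono) auto
        finally show ?thesis using 1 by simp
      qed
      then show ?case
        using 1(1-6) r1(1) r2(1) r3(1) r4(1)
        by (intro exI[of _ \<phi>] exI[of _ s] exI[of _ "B1 + B2"] conjI ballI impI) (simp_all add: s_def)
    qed
  qed
  show i: "integrable lam (form_fun (d1 \<xi>))"
  proof (rule integrable_cusp[OF smooth_form2_d1[OF open_U \<xi>]])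
    fix p assume "p \<in> D"
    from near[OF this] show "\<exists>\<phi> r C. \<phi> \<in> coords \<A> \<and> p \<in> fst \<phi> \<and> snd \<phi> p = 0 \<and> fst \<phi> \<inter> D = {p} \<and> 0 < r \<and> r \<le> exp (- 1) \<and>
      (\<forall>x\<in>fst \<phi>. x \<noteq> p \<longrightarrow> norm (snd \<phi> x) < r \<longrightarrow> norm (d1 \<xi> \<phi> x) \<le> C * cusp_majorant (snd \<phi> x))"
      by meson
  qed
  have "cusp_growth \<xi>"
    unfolding cusp_growth_def
  proof
    fix p assume "p \<in> D"
    from near[OF this] obtain \<phi> r B where \<phi>: "\<phi> \<in> coords \<A>" "p \<in> fst \<phi>" "snd \<phi> p = 0" "fst \<phi> \<inter> D = {p}" "0 < r"
      and b: "\<And>x. x \<in> fst \<phi> \<Longrightarrow> x \<noteq> p \<Longrightarrow> norm (snd \<phi> x) < r \<Longrightarrow> norm (\<xi> \<phi> x) \<le> B / (norm (snd \<phi> x) * neglog (snd \<phi> x))"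
      by meson
    have b': "norm (fst (\<xi> \<phi> x)) \<le> B / (norm (snd \<phi> x) * neglog (snd \<phi> x)) \<and>
        norm (snd (\<xi> \<phi> x)) \<le> B / (norm (snd \<phi> x) * neglog (snd \<phi> x))"
      if "x \<in> fst \<phi>" "x \<noteq> p" "norm (snd \<phi> x) < r" for x
      using b[OF that] norm_fst_le[of "fst (\<xi> \<phi> x)" "snd (\<xi> \<phi> x)"] norm_snd_le[of "snd (\<xi> \<phi> x)" "fst (\<xi> \<phi> x)"] by simp
    show "\<exists>\<phi>\<in>coords \<A>. p \<in> fst \<phi> \<and> snd \<phi> p = 0 \<and> fst \<phi> \<inter> D = {p} \<and>
     (\<exists>\<delta>>0. \<exists>B. \<forall>x\<in>fst \<phi>. x \<noteq> p \<longrightarrow> norm (snd \<phi> x) < \<delta> \<longrightarrow>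
        norm (fst (\<xi> \<phi> x)) \<le> B / (norm (snd \<phi> x) * neglog (snd \<phi> x)) \<and>
        norm (snd (\<xi> \<phi> x)) \<le> B / (norm (snd \<phi> x) * neglog (snd \<phi> x)))"
    proof (rule bexI[OF _ \<phi>(1)], intro conjI \<phi>(2-4), rule exI[of _ r], rule conjI[OF \<phi>(5)], rule exI[of _ B], intro ballI impI, goal_cases)
      case (1 x)
      then show ?case by (rule b')
    qed
  qed
  then show "integral\<^sup>L lam (form_fun (d1 \<xi>)) = 0" by (rule stokes_surface[OF \<xi> _ i])
qed

section \<open>The fundamental lemma and the criterion\<close>

lemma nonempty_open_not_null:
  assumes W: "open W" "x \<in> W"
  shows "W \<notin> null_sets lam"
proof
  assume N: "W \<in> null_sets lam"
  obtain \<phi> where \<phi>: "\<phi> \<in> coords \<A>" "x \<in> fst \<phi>" by (rule coords_cover)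
  let ?R = "snd \<phi> ` fst \<phi>"
  have Wb: "W \<in> sets borel" using W(1) by simp
  have R: "?R \<in> sets borel" using coord_open_range[OF \<phi>(1)] by simp
  have ci: "chart_inv \<phi> \<in> borel_measurable (restrict_space lborel ?R)"
    using coord_inv_measurable[OF \<phi>(1)] by (simp add: measurable_cong_sets[OF sets_restrict_space_cong[OF sets_lborel] refl])
  \<comment> \<open>A null set of \<open>lam\<close> stays null for the density that turns
    \<open>lam\<close> into Lebesgue measure of a chart, and there nonempty open sets have positive
    measure.\<close>
  have "emeasure (density lam (\<lambda>x. ennreal (jsq \<phi> x))) W = 0"
  proof -
    have "emeasure (density lam (\<lambda>x. ennreal (jsq \<phi> x))) W = (\<integral>\<^sup>+x. ennreal (jsq \<phi> x) * indicator W x \<partial>lam)"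
      using jsq_measurable[OF \<phi>(1)] Wb by (intro emeasure_density) (simp_all cong: measurable_cong_sets)
    also have "\<dots> = 0" by (rule nn_integral_null_set[OF N])
    finally show ?thesis .
  qed
  then have "emeasure (distr (restrict_space lborel ?R) borel (chart_inv \<phi>)) W = 0"
    unfolding density_lam[OF \<phi>(1)] .
  then have "emeasure (restrict_space lborel ?R) (chart_inv \<phi> -` W \<inter> ?R) = 0"
    using ci Wb by (simp add: emeasure_distr space_restrict_space)
  then have "emeasure lborel (chart_inv \<phi> -` W \<inter> ?R) = 0"
    using R by (subst (asm) emeasure_restrict_space) auto
  moreover have e: "chart_inv \<phi> -` W \<inter> ?R = snd \<phi> ` (fst \<phi> \<inter> W)"
    unfolding coord_image_eq[OF \<phi>(1)] by (simp add: Int_commute)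
  moreover have o: "open (snd \<phi> ` (fst \<phi> \<inter> W))" by (rule coord_open_image[OF \<phi>(1) W(1)])
  ultimately have "snd \<phi> ` (fst \<phi> \<inter> W) \<in> null_sets lborel" by (simp add: null_sets_def)
  then have "negligible (snd \<phi> ` (fst \<phi> \<inter> W))"
    unfolding negligible_iff_null_sets by (rule null_sets_completionI)
  moreover have "snd \<phi> ` (fst \<phi> \<inter> W) \<noteq> {}" using W(2) \<phi>(2) by blast
  ultimately show False using open_not_negligible[OF o] by blast
qed

text \<open>If Re g were nonzero at a point, a bump supported where it keeps its sign would produce
  a nonnegative function with integral 0 that is positive on an open set. That set lies in one chart
  off D, where \<open>form_fun\<close> is the coefficient of g times the positive factor
  \<open>jsq\<close>.\<close>

lemma fundamental_lemma:
  assumes g: "smooth_form2 \<A> (UNIV - D) g" and int: "integrable lam (form_fun g)"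
    and zero: "\<And>\<sigma>::'a \<Rightarrow> real. smooth_fun \<A> UNIV \<sigma> \<Longrightarrow> integral\<^sup>L lam (\<lambda>x. \<sigma> x * Re (form_fun g x)) = 0"
    and \<phi>: "\<phi> \<in> coords \<A>" and x: "x \<in> fst \<phi>" "x \<notin> D"
  shows "Re (g \<phi> x) = 0"
proof (rule ccontr)
  assume nz: "Re (g \<phi> x) \<noteq> 0"
  define s where "s = sgn (Re (g \<phi> x))"
  have o: "open (fst \<phi> \<inter> (UNIV - D))" using coord_open[OF \<phi>] open_U by blast
  define W where "W = (fst \<phi> \<inter> (UNIV - D)) \<inter> (\<lambda>y. s * Re (g \<phi> y)) -` {0<..}"
  have Wo: "open W"
    unfolding W_def
    by (rule continuous_open_preimage[OF _ o open_greaterThan])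
       (intro continuous_intros form_continuous[OF g \<phi> open_U])
  have xW: "x \<in> W" using x nz by (simp add: W_def s_def sgn_mult_self_eq[symmetric] flip: abs_sgn) (simp add: sgn_if)
  obtain \<kappa> :: "'a \<Rightarrow> real" and N C where \<kappa>: "smooth_fun \<A> UNIV \<kappa>" "\<And>y. 0 \<le> \<kappa> y" and N: "open N" "x \<in> N" "\<And>y. y \<in> N \<Longrightarrow> \<kappa> y = 1"
    and C: "C \<subseteq> W" "\<And>y. y \<notin> C \<Longrightarrow> \<kappa> y = 0"
    by (rule bump_at_exists[OF Wo xW]) (rule that, assumption+)
  define f where "f y = s * (\<kappa> y * Re (form_fun g y))" for y
  have G: "Re (form_fun g y) = jsq \<phi> y * Re (g \<phi> y)" if "y \<in> W" for y
    using form_fun_chart[OF g \<phi>, of y] that by (simp add: W_def)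
  have fW: "f y = \<kappa> y * (jsq \<phi> y * (s * Re (g \<phi> y)))" if "y \<in> W" for y
    unfolding f_def G[OF that] by simp
  have pos: "f y \<ge> 0" for y
  proof (cases "y \<in> C")
    case True
    then have "y \<in> W" using C(1) by blast
    then show ?thesis unfolding fW[OF \<open>y \<in> W\<close>] using \<kappa>(2)[of y] jsq_nonneg[of \<phi> y] by (simp add: W_def)
  next
    case False
    then show ?thesis by (simp add: f_def C(2))
  qed
  have "integrable lam (\<lambda>y. Re (\<kappa> y *\<^sub>R form_fun g y))" by (intro integrable_Re integrable_mult_smooth \<kappa>(1) int)
  then have fi: "integrable lam f" unfolding f_def[abs_def] by (intro integrable_mult_right) simp
  have "integral\<^sup>L lam f = 0" using zero[OF \<kappa>(1)] by (simp add: f_def[abs_def])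
  then have ae: "AE y in lam. f y = 0" using integral_nonneg_eq_0_iff_AE[OF fi AE_I2[of lam "\<lambda>y. 0 \<le> f y"]] pos by simp
  have ne: "f y \<noteq> 0" if y: "y \<in> N \<inter> W" for y
  proof -
    have yW: "y \<in> W" using y by blast
    then have "y \<in> fst \<phi>" "s * Re (g \<phi> y) \<noteq> 0" by (auto simp: W_def)
    moreover have "jsq \<phi> y \<noteq> 0"
      using jac_nonzero[OF \<phi> chart_coords[OF idx(1)], of y y] idx(2)[of y] \<open>y \<in> fst \<phi>\<close> by (simp add: jsq_def cover_dom_def)
    ultimately show ?thesis unfolding fW[OF yW] using N(3)[of y] y by simp
  qed
  have NW: "open (N \<inter> W)" "x \<in> N \<inter> W" using N(1,2) Wo xW by auto
  have "AE y in lam. y \<notin> N \<inter> W" using ae by eventually_elim (use ne in blast)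
  then have "N \<inter> W \<in> null_sets lam" using NW(1) by (subst AE_iff_null_sets) auto
  then show False using nonempty_open_not_null[OF NW] by blast
qed

text \<open>The coefficient of \<open>g\<close> is 2c + \<rho>, since -2i times i/2 is 1. The cup
  norm contributes the coefficient of t in its polynomial, divided by pi, the exact term having
  integral 0; the 2 in front of c weighs this 1 / pi against the 1 / (2 pi) of the area.\<close>

lemma S_has_derivative:
  assumes \<rho>: "good_conformal_metric \<A> D \<rho>" and \<sigma>: "smooth_fun \<A> UNIV (\<sigma> :: 'a \<Rightarrow> real)"
  defines "g \<equiv> \<lambda>\<phi> x. 2 * c1_form \<rho> \<phi> x + (- 2 * \<i>) * kahler_form \<rho> \<phi> x"
  shows "((\<lambda>t. S_functional \<A> D K (conf_change (\<lambda>x. t * \<sigma> x) \<rho>)) has_real_derivative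
      integral\<^sup>L lam (\<lambda>x. \<sigma> x * Re (form_fun g x)) / (2 * pi)) (at 0)"
proof -
  note \<rho>c = good_conformal[OF \<rho>]
  obtain S where S: "S > 0" "\<And>x. norm (\<sigma> x) \<le> S" by (rule smooth_fun_bounded[OF \<sigma>]) (rule that, assumption+)
  obtain h \<eta> \<omega> where d: "descent \<A> D K \<rho> h \<eta> \<omega>" using descent_exists[OF conformal_frame_log[OF \<rho>c]] by blast
  obtain \<xi> where \<xi>: "smooth_form1 \<A> (UNIV - D) \<xi>"
    "\<And>i. i < n \<Longrightarrow> \<exists>\<zeta>. smooth_form1 \<A> (V i) \<zeta> \<and> (\<forall>\<phi>\<in>coords \<A>. \<forall>x\<in>fst \<phi> \<inter> V i - D.
        \<xi> \<phi> x = (1/4) *\<^sub>R theta \<sigma> (log_frame D K \<rho> i) \<phi> x - \<zeta> \<phi> x)"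
    "\<And>t. \<exists>\<eta>'. descent \<A> D K (conf_change (\<lambda>x. t * \<sigma> x) \<rho>) h \<eta>'
        (\<lambda>\<phi> x. \<omega> \<phi> x + (of_real (t * \<sigma> x) * c1_form \<rho> \<phi> x
           + (of_real (t\<^sup>2 / 2 * \<sigma> x) * dbar_del (\<lambda>y. complex_of_real (\<sigma> y)) \<phi> x + of_real (- t) * d1 \<xi> \<phi> x)))"
    by (rule descent_variation[OF \<rho>c d \<sigma>]) (rule that, assumption+)
  have X: "integrable lam (form_fun (d1 \<xi>))" "integral\<^sup>L lam (form_fun (d1 \<xi>)) = 0"
    by (rule variation_exact_form[OF \<rho> \<sigma> \<xi>(1)], rule \<xi>(2), assumption)+
  note Im\<omega> = integrable_descent[OF \<rho> d]
  note c1i = integrable_c1[OF \<rho>] and ki = integrable_kahler[OF \<rho>]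
  have \<sigma>c: "smooth_fun \<A> UNIV (\<lambda>y. complex_of_real (\<sigma> y))" by (rule smooth_fun_of_real[OF open_UNIV \<sigma>])
  note ddi = integrable_smooth_form2[OF smooth_form2_dbar_del[OF open_UNIV \<sigma>c]]
  let ?A = "\<lambda>x. \<sigma> x *\<^sub>R form_fun (c1_form \<rho>) x"
  let ?B = "\<lambda>x. \<sigma> x *\<^sub>R form_fun (dbar_del (\<lambda>y. complex_of_real (\<sigma> y))) x"
  note Ai = integrable_mult_smooth[OF \<sigma> c1i] and Bi = integrable_mult_smooth[OF \<sigma> ddi]
  define P where "P x = (if x \<in> D then 0 else \<rho> (chart K (idx x)) x)" for x
  have kP: "form_fun (kahler_form \<rho>) x = (\<i> / 2) * complex_of_real (P x)" for x
    by (simp add: form_fun_def kahler_form_def P_def)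
  have "integrable lam (\<lambda>x. Re ((- 2 * \<i>) * form_fun (kahler_form \<rho>) x))"
    by (intro integrable_Re integrable_mult_right ki)
  then have Pi: "integrable lam P" by (simp add: kP)
  have \<sigma>m: "\<sigma> \<in> borel_measurable lam"
    using borel_measurable_continuous_onI[OF smooth_fun_continuous[OF \<sigma> open_UNIV]] by (simp cong: measurable_cong_sets)
  have lcn: "log_cup_norm \<A> D K (conf_change (\<lambda>x. t * \<sigma> x) \<rho>)
      = (Re (integral\<^sup>L lam (form_fun \<omega>)) + t * Re (integral\<^sup>L lam ?A) + t\<^sup>2 / 2 * Re (integral\<^sup>L lam ?B)) / pi" for t
  proof -
    have ts: "smooth_fun \<A> UNIV (\<lambda>x. t * \<sigma> x)" by (rule smooth_fun_mult[OF open_UNIV smooth_fun_const \<sigma>])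
    define \<omega>' where "\<omega>' \<phi> x = \<omega> \<phi> x + (of_real (t * \<sigma> x) * c1_form \<rho> \<phi> x
           + (of_real (t\<^sup>2 / 2 * \<sigma> x) * dbar_del (\<lambda>y. complex_of_real (\<sigma> y)) \<phi> x + of_real (- t) * d1 \<xi> \<phi> x))" for \<phi> x
    obtain \<eta>' where d': "descent \<A> D K (conf_change (\<lambda>x. t * \<sigma> x) \<rho>) h \<eta>' \<omega>'"
      using \<xi>(3)[of t] unfolding \<omega>'_def[abs_def] by blast
    have e: "form_fun \<omega>' x = form_fun \<omega> x + (t *\<^sub>R ?A x + ((t\<^sup>2 / 2) *\<^sub>R ?B x + (- t) *\<^sub>R form_fun (d1 \<xi>) x))" for x
      by (simp add: form_fun_def \<omega>'_def scaleR_conv_of_real)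
    note parts = integrable_scaleR_right[of t, OF Ai] integrable_scaleR_right[of "t\<^sup>2 / 2", OF Bi] integrable_scaleR_right[of "- t", OF X(1)]
    have i3: "integrable lam (\<lambda>x. (t\<^sup>2 / 2) *\<^sub>R ?B x + (- t) *\<^sub>R form_fun (d1 \<xi>) x)"
      by (rule Bochner_Integration.integrable_add[OF parts(2,3)])
    have i2: "integrable lam (\<lambda>x. t *\<^sub>R ?A x + ((t\<^sup>2 / 2) *\<^sub>R ?B x + (- t) *\<^sub>R form_fun (d1 \<xi>) x))"
      by (rule Bochner_Integration.integrable_add[OF parts(1) i3])
    have i1: "integrable lam (form_fun \<omega>')"
      unfolding e[abs_def] by (rule Bochner_Integration.integrable_add[OF Im\<omega> i2])
    have "integral\<^sup>L lam (form_fun \<omega>') = integral\<^sup>L lam (form_fun \<omega>) + (integral\<^sup>L lam (\<lambda>x. t *\<^sub>R ?A x)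
        + (integral\<^sup>L lam (\<lambda>x. (t\<^sup>2 / 2) *\<^sub>R ?B x) + integral\<^sup>L lam (\<lambda>x. (- t) *\<^sub>R form_fun (d1 \<xi>) x)))"
      unfolding e[abs_def] Bochner_Integration.integral_add[OF Im\<omega> i2] Bochner_Integration.integral_add[OF parts(1) i3]
        Bochner_Integration.integral_add[OF parts(2,3)] ..
    also have "\<dots> = integral\<^sup>L lam (form_fun \<omega>) + (t *\<^sub>R integral\<^sup>L lam ?A + ((t\<^sup>2 / 2) *\<^sub>R integral\<^sup>L lam ?B + (- t) *\<^sub>R 0))"
      unfolding integral_scaleR_right X(2) ..
    finally have "Re (integral\<^sup>L lam (form_fun \<omega>')) = Re (integral\<^sup>L lam (form_fun \<omega>)) + t * Re (integral\<^sup>L lam ?A) + t\<^sup>2 / 2 * Re (integral\<^sup>L lam ?B)"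
      by simp
    then show ?thesis using log_cup_norm_eq[OF frame_log_conf_change[OF \<rho>c ts] d' i1] by simp
  qed
  have ar: "area D K (conf_change (\<lambda>x. t * \<sigma> x) \<rho>) = integral\<^sup>L lam (\<lambda>x. exp (t * \<sigma> x) * P x)" for t
  proof -
    have ts: "smooth_fun \<A> UNIV (\<lambda>x. t * \<sigma> x)" by (rule smooth_fun_mult[OF open_UNIV smooth_fun_const \<sigma>])
    note et = smooth_fun_exp[OF open_UNIV ts]
    have f: "form_fun (kahler_form (conf_change (\<lambda>x. t * \<sigma> x) \<rho>)) x = exp (t * \<sigma> x) *\<^sub>R form_fun (kahler_form \<rho>) x" for x
      by (simp add: form_fun_def kahler_form_def conf_change_def scaleR_conv_of_real)
    have i: "integrable lam (form_fun (kahler_form (conf_change (\<lambda>x. t * \<sigma> x) \<rho>)))"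
      unfolding f[abs_def] by (rule integrable_mult_smooth[OF et ki])
    have p: "(if x \<in> D then 0 else conf_change (\<lambda>x. t * \<sigma> x) \<rho> (chart K (idx x)) x) = exp (t * \<sigma> x) * P x" for x
      by (simp add: P_def conf_change_def)
    show ?thesis using area_eq[OF conformal_metric_conf_change[OF \<rho>c open_U ts] i] unfolding p .
  qed
  have S_eq: "(\<lambda>t. S_functional \<A> D K (conf_change (\<lambda>x. t * \<sigma> x) \<rho>)) =
      (\<lambda>t. (Re (integral\<^sup>L lam (form_fun \<omega>)) + t * Re (integral\<^sup>L lam ?A) + t\<^sup>2 / 2 * Re (integral\<^sup>L lam ?B)) / pi
        + 1 / (2 * pi) * integral\<^sup>L lam (\<lambda>x. exp (t * \<sigma> x) * P x))"
    by (intro ext) (simp only: S_functional_def lcn ar)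
  have \<sigma>P: "integrable lam (\<lambda>x. \<sigma> x * P x)"
  proof (rule Bochner_Integration.integrable_bound)
    show "integrable lam (\<lambda>x. S * P x)" using Pi by simp
    show "(\<lambda>x. \<sigma> x * P x) \<in> borel_measurable lam" using \<sigma>m borel_measurable_integrable[OF Pi] by (rule borel_measurable_times)
    have "\<bar>\<sigma> x * P x\<bar> \<le> \<bar>S * P x\<bar>" for x
      unfolding abs_mult using S(1) S(2)[of x] by (intro mult_right_mono) auto
    then show "AE x in lam. norm (\<sigma> x * P x) \<le> norm (S * P x)" by simp
  qed
  have gf: "\<sigma> x * Re (form_fun g x) = 2 * Re (?A x) + \<sigma> x * P x" for x
    by (simp add: form_fun_def g_def kahler_form_def P_def algebra_simps)
  have RA: "integrable lam (\<lambda>x. 2 * Re (?A x))" by (intro integrable_mult_right integrable_Re Ai)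
  have "integral\<^sup>L lam (\<lambda>x. \<sigma> x * Re (form_fun g x)) = integral\<^sup>L lam (\<lambda>x. 2 * Re (?A x)) + integral\<^sup>L lam (\<lambda>x. \<sigma> x * P x)"
    unfolding gf by (rule Bochner_Integration.integral_add[OF RA \<sigma>P])
  also have "integral\<^sup>L lam (\<lambda>x. 2 * Re (?A x)) = 2 * Re (integral\<^sup>L lam ?A)"
    by (simp only: integral_mult_right_zero integral_Re[OF Ai])
  finally have D: "integral\<^sup>L lam (\<lambda>x. \<sigma> x * Re (form_fun g x)) / (2 * pi) =
      (Re (integral\<^sup>L lam ?A)) / pi + 1 / (2 * pi) * integral\<^sup>L lam (\<lambda>x. \<sigma> x * P x)"
    by (simp add: add_divide_distrib)
  have Fd: "((\<lambda>t. integral\<^sup>L lam (\<lambda>x. exp (t * \<sigma> x) * P x)) has_real_derivative integral\<^sup>L lam (\<lambda>x. \<sigma> x * P x)) (at 0)"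
    by (rule exp_integral_has_derivative[OF \<sigma>m S(1) _ Pi]) (use S(2) in simp)
  have "((\<lambda>t. (a + t * b + t\<^sup>2 / 2 * c) / pi) has_real_derivative b / pi) (at 0)" for a b c :: real
    by (auto intro!: derivative_eq_intros)
  from DERIV_add[OF this DERIV_cmult[OF Fd]] show ?thesis unfolding S_eq D .
qed

text \<open>Vanishing of g is the Liouville equation. The fundamental lemma controls only the real
  part, which suffices because c_1 and i omega_\<rho> both have real coefficients.\<close>

lemma critical_iff:
  assumes \<rho>: "good_conformal_metric \<A> D \<rho>"
  shows "(\<forall>\<phi>\<in>coords \<A>. \<forall>x\<in>fst \<phi> - D. c1_form \<rho> \<phi> x = \<i> * kahler_form \<rho> \<phi> x) \<longleftrightarrow>
         (\<forall>\<sigma>::'a \<Rightarrow> real. smooth_fun \<A> UNIV \<sigma> \<longrightarrow>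
            ((\<lambda>t::real. S_functional \<A> D K (conf_change (\<lambda>x. t * \<sigma> x) \<rho>)) has_real_derivative 0) (at 0))"
proof
  define g where "g \<phi> x = 2 * c1_form \<rho> \<phi> x + (- 2 * \<i>) * kahler_form \<rho> \<phi> x" for \<phi> x
  note \<rho>c = good_conformal[OF \<rho>]
  have S: "((\<lambda>t. S_functional \<A> D K (conf_change (\<lambda>x. t * \<sigma> x) \<rho>)) has_real_derivative
      integral\<^sup>L lam (\<lambda>x. \<sigma> x * Re (form_fun g x)) / (2 * pi)) (at 0)" if "smooth_fun \<A> UNIV \<sigma>" for \<sigma> :: "'a \<Rightarrow> real"
    using S_has_derivative[OF \<rho> that] unfolding g_def[abs_def] .
  {
    assume L: "\<forall>\<phi>\<in>coords \<A>. \<forall>x\<in>fst \<phi> - D. c1_form \<rho> \<phi> x = \<i> * kahler_form \<rho> \<phi> x"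
    have "form_fun g x = 0" for x
    proof (cases "x \<in> D")
      case False
      then have "x \<in> fst (chart K (idx x)) - D" using idx(2)[of x] by (simp add: cover_dom_def)
      then have "c1_form \<rho> (chart K (idx x)) x = \<i> * kahler_form \<rho> (chart K (idx x)) x"
        using L chart_coords[OF idx(1)[of x]] by blast
      then show ?thesis by (simp add: form_fun_def g_def)
    qed (simp add: form_fun_def)
    then show "\<forall>\<sigma>::'a \<Rightarrow> real. smooth_fun \<A> UNIV \<sigma> \<longrightarrow>
            ((\<lambda>t::real. S_functional \<A> D K (conf_change (\<lambda>x. t * \<sigma> x) \<rho>)) has_real_derivative 0) (at 0)"
      using S by simp
  next
    assume R: "\<forall>\<sigma>::'a \<Rightarrow> real. smooth_fun \<A> UNIV \<sigma> \<longrightarrow>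
            ((\<lambda>t::real. S_functional \<A> D K (conf_change (\<lambda>x. t * \<sigma> x) \<rho>)) has_real_derivative 0) (at 0)"
    have z: "integral\<^sup>L lam (\<lambda>x. \<sigma> x * Re (form_fun g x)) = 0" if \<sigma>: "smooth_fun \<A> UNIV \<sigma>" for \<sigma> :: "'a \<Rightarrow> real"
      using DERIV_unique[OF S[OF \<sigma>] R[rule_format, OF \<sigma>]] by simp
    have gs: "smooth_form2 \<A> (UNIV - D) g"
      unfolding g_def[abs_def]
      by (intro smooth_form2_add smooth_form2_mult smooth_fun_const open_U c1_form_smooth kahler_smooth \<rho>c)
    have e: "form_fun g x = 2 * form_fun (c1_form \<rho>) x + (- 2 * \<i>) * form_fun (kahler_form \<rho>) x" for x
      by (simp add: form_fun_def g_def)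
    have gi: "integrable lam (form_fun g)"
      unfolding e[abs_def]
      by (intro Bochner_Integration.integrable_add integrable_mult_right integrable_c1[OF \<rho>] integrable_kahler[OF \<rho>])
    show "\<forall>\<phi>\<in>coords \<A>. \<forall>x\<in>fst \<phi> - D. c1_form \<rho> \<phi> x = \<i> * kahler_form \<rho> \<phi> x"
    proof (intro ballI)
      fix \<phi> x assume \<phi>: "\<phi> \<in> coords \<A>" and x: "x \<in> fst \<phi> - D"
      have x': "x \<in> fst \<phi>" "x \<notin> D" using x by auto
      have 0: "Re (g \<phi> x) = 0" by (rule fundamental_lemma[OF gs gi z \<phi> x'])
      obtain i where i: "i < n" "x \<in> V i" by (rule V_cover)
      have xV: "x \<in> V i - D" using i x' by simp
      have "Im (c1_form \<rho> \<phi> x) = 0"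
        unfolding c1_frame[OF \<rho>c i(1) \<phi> x'(1) i(2) x'(2), symmetric]
        by (rule dbar_del_real[OF VD_open[OF i(1)] log_frame_smooth[OF conformal_frame_log[OF \<rho>c] i(1)] \<phi> x'(1) xV])
      then show "c1_form \<rho> \<phi> x = \<i> * kahler_form \<rho> \<phi> x"
        using 0 by (simp add: g_def kahler_form_def complex_eq_iff)
    qed
  }
qed

end

theorem theorem6p1:
  fixes \<A> :: "('a::t2_space) coord set" and D :: "'a set"
    and \<rho> :: "'a conf_metric" and K :: "'a cech_choice"
  assumes "compact_riemann_surface \<A>"
    and "finite D"
    and "hyperbolic_surface \<A> (UNIV - D)"
    and "good_conformal_metric \<A> D \<rho>"
    and "cup_square_choice \<A> D K"
  shows "(\<forall>\<phi>\<in>coords \<A>. \<forall>x\<in>fst \<phi> - D. c1_form \<rho> \<phi> x = \<i> * kahler_form \<rho> \<phi> x) \<longleftrightarrow>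
         (\<forall>\<sigma>::'a \<Rightarrow> real. smooth_fun \<A> UNIV \<sigma> \<longrightarrow>
            ((\<lambda>t::real. S_functional \<A> D K (conf_change (\<lambda>x. t * \<sigma> x) \<rho>))
               has_real_derivative 0) (at 0))"
proof -
  interpret cech_surface \<A> D K
    by unfold_locales (use assms in auto)
  show ?thesis by (rule critical_iff[OF assms(4)])
qed

end
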